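(* Let $R$ be a Krull domain with quotient field $K$ and $A$ a flat $R$-algebra with a retraction $\Phi : A \to R$ such that (1) $\mathrm{Ker}\,\Phi$ is a finitely generated ideal of $A$; (2) $A \otimes_R K = K^{[1]}$; (3) $A \otimes_R k(P)$ is an integral domain for each height one prime ideal $P$ of $R$. Then there exists an invertible ideal $I$ of $R$ such that $A \cong \mathrm{Sym}_R(I)$ as $R$-algebras.
   Context: All rings are commutative with unity. For a ring $R$ and an $R$-algebra $A$, $A = R^{[n]}$ means that $A$ is isomorphic, as an $R$-algebra, to a polynomial ring in $n$ variables over $R$. For a prime ideal $P$ of $R$, $k(P) = R_P/PR_P$ denotes the residue field. A retraction $\Phi: A \to R$ is an $R$-algebra homomorphism from $A$ to $R$ (so its restriction to $R$ is the identity). $\mathrm{Sym}_R(I)$ denotes the symmetric algebra of the $R$-module $I$. *)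

theory Defs
  imports "HOL-Algebra.Algebra" "HOL-Library.Extended_Nat"
begin

section \<open>Modules and algebras\<close>

text \<open>
  Algebras over \<open>R\<close> are the commutative ones of the library locale \<^locale>\<open>algebra\<close>; the structure
  map \<open>R \<rightarrow> A\<close> is \<open>r \<mapsto> r \<odot> \<one>\<close>.
\<close>

definition algebra_via :: "('b, 'm) ring_scheme \<Rightarrow> ('r \<Rightarrow> 'b) \<Rightarrow> ('r, 'b) module" where
  "algebra_via B f =
     \<lparr>carrier = carrier B, monoid.mult = (\<lambda>x y. x \<otimes>\<^bsub>B\<^esub> y), monoid.one = \<one>\<^bsub>B\<^esub>,
      ring.zero = \<zero>\<^bsub>B\<^esub>, ring.add = (\<lambda>x y. x \<oplus>\<^bsub>B\<^esub> y), smult = (\<lambda>r x. f r \<otimes>\<^bsub>B\<^esub> x)\<rparr>"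

definition self_algebra :: "('r, 'm) ring_scheme \<Rightarrow> ('r, 'r) module" where
  "self_algebra R = algebra_via R (\<lambda>r. r)"

text \<open>The multiplicative fields of the following record are irrelevant: only its additive
  group and its scalar multiplication are used.\<close>

definition ideal_module :: "('r, 'm) ring_scheme \<Rightarrow> 'r set \<Rightarrow> ('r, 'r) module" where
  "ideal_module R I = (self_algebra R)\<lparr>carrier := I\<rparr>"

definition module_hom ::
  "('r, 'k) ring_scheme \<Rightarrow> ('r, 'm, 'p) module_scheme \<Rightarrow> ('r, 'n, 'q) module_scheme \<Rightarrow> ('m \<Rightarrow> 'n) set"
  where
  "module_hom R M N =
     {f. f \<in> carrier M \<rightarrow> carrier N \<and>
         (\<forall>x\<in>carrier M. \<forall>y\<in>carrier M. f (x \<oplus>\<^bsub>M\<^esub> y) = f x \<oplus>\<^bsub>N\<^esub> f y) \<and>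
         (\<forall>r\<in>carrier R. \<forall>x\<in>carrier M. f (r \<odot>\<^bsub>M\<^esub> x) = r \<odot>\<^bsub>N\<^esub> f x)}"

definition algebra_hom ::
  "('r, 'k) ring_scheme \<Rightarrow> ('r, 'a, 'p) module_scheme \<Rightarrow> ('r, 'b, 'q) module_scheme \<Rightarrow> ('a \<Rightarrow> 'b) set"
  where
  "algebra_hom R A B =
     {f \<in> ring_hom A B. \<forall>r\<in>carrier R. \<forall>x\<in>carrier A. f (r \<odot>\<^bsub>A\<^esub> x) = r \<odot>\<^bsub>B\<^esub> f x}"

definition algebra_isomorphic ::
  "('r, 'k) ring_scheme \<Rightarrow> ('r, 'a, 'p) module_scheme \<Rightarrow> ('r, 'b, 'q) module_scheme \<Rightarrow> bool"
  where
  "algebra_isomorphic R A B \<longleftrightarrow>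
     (\<exists>f\<in>algebra_hom R A B. bij_betw f (carrier A) (carrier B))"

definition retraction ::
  "('r, 'k) ring_scheme \<Rightarrow> ('r, 'a, 'p) module_scheme \<Rightarrow> ('a \<Rightarrow> 'r) \<Rightarrow> bool" where
  "retraction R A \<Phi> \<longleftrightarrow> \<Phi> \<in> algebra_hom R A (self_algebra R)"

definition finitely_generated_ideal :: "('a, 'p) ring_scheme \<Rightarrow> 'a set \<Rightarrow> bool" where
  "finitely_generated_ideal A J \<longleftrightarrow> (\<exists>S. finite S \<and> S \<subseteq> carrier A \<and> J = Idl\<^bsub>A\<^esub> S)"


section \<open>Tensor products\<close>

text \<open>
  \<open>M \<otimes>\<^sub>R N\<close> is the free abelian group on \<open>M \<times> N\<close> modulo the subgroup generated by the usual
  relations. If \<open>M\<close> and \<open>N\<close> are algebras, the free abelian group carries the product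
  \<open>(m, n) (m', n') = (m m', n n')\<close>, the relations form an ideal, and the quotient is the
  tensor product of algebras. If \<open>M\<close> and \<open>N\<close> are mere modules, only the additive
  group of the quotient is meaningful.
\<close>

definition free_pairs ::
  "('r, 'm, 'p) module_scheme \<Rightarrow> ('r, 'n, 'q) module_scheme \<Rightarrow> ('m \<times> 'n \<Rightarrow>\<^sub>0 int) ring" where
  "free_pairs M N =
     \<lparr>carrier = carrier (free_Abelian_group (carrier M \<times> carrier N)),
      monoid.mult = (\<lambda>c d. frag_extend (\<lambda>(m, n). frag_extend
         (\<lambda>(m', n'). frag_of (m \<otimes>\<^bsub>M\<^esub> m', n \<otimes>\<^bsub>N\<^esub> n')) d) c),
      monoid.one = frag_of (\<one>\<^bsub>M\<^esub>, \<one>\<^bsub>N\<^esub>), ring.zero = 0, ring.add = (+)\<rparr>"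

definition tensor_relations ::
  "('r, 'k) ring_scheme \<Rightarrow> ('r, 'm, 'p) module_scheme \<Rightarrow> ('r, 'n, 'q) module_scheme
    \<Rightarrow> ('m \<times> 'n \<Rightarrow>\<^sub>0 int) set" where
  "tensor_relations R M N = generate (free_Abelian_group (carrier M \<times> carrier N))
     ({frag_of (m \<oplus>\<^bsub>M\<^esub> m', n) - frag_of (m, n) - frag_of (m', n) | m m' n.
         m \<in> carrier M \<and> m' \<in> carrier M \<and> n \<in> carrier N} \<union>
      {frag_of (m, n \<oplus>\<^bsub>N\<^esub> n') - frag_of (m, n) - frag_of (m, n') | m n n'.
         m \<in> carrier M \<and> n \<in> carrier N \<and> n' \<in> carrier N} \<union>
      {frag_of (r \<odot>\<^bsub>M\<^esub> m, n) - frag_of (m, r \<odot>\<^bsub>N\<^esub> n) | r m n.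
         r \<in> carrier R \<and> m \<in> carrier M \<and> n \<in> carrier N})"

definition tensor ::
  "('r, 'k) ring_scheme \<Rightarrow> ('r, 'm, 'p) module_scheme \<Rightarrow> ('r, 'n, 'q) module_scheme
    \<Rightarrow> ('m \<times> 'n \<Rightarrow>\<^sub>0 int) set ring" where
  "tensor R M N = free_pairs M N Quot tensor_relations R M N"

definition pure_tensor ::
  "('r, 'k) ring_scheme \<Rightarrow> ('r, 'm, 'p) module_scheme \<Rightarrow> ('r, 'n, 'q) module_scheme
    \<Rightarrow> 'm \<Rightarrow> 'n \<Rightarrow> ('m \<times> 'n \<Rightarrow>\<^sub>0 int) set" where
  "pure_tensor R M N m n = tensor_relations R M N +>\<^bsub>free_pairs M N\<^esub> frag_of (m, n)"

text \<open>For an \<open>R\<close>-algebra \<open>B\<close> that is itself a ring of scalars: \<open>A \<otimes>\<^sub>R B\<close> as a \<open>B\<close>-algebra.\<close>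

definition base_change ::
  "('r, 'k) ring_scheme \<Rightarrow> ('r, 'a, 'p) module_scheme \<Rightarrow> ('r, 'b, 'q) module_scheme
    \<Rightarrow> ('b, ('a \<times> 'b \<Rightarrow>\<^sub>0 int) set) module" where
  "base_change R A B = algebra_via (tensor R A B) (\<lambda>b. pure_tensor R A B \<one>\<^bsub>A\<^esub> b)"

text \<open>The map \<open>f \<otimes> id : M \<otimes>\<^sub>R A \<rightarrow> N \<otimes>\<^sub>R A\<close>. As for \<^const>\<open>rcoset_mult\<close>, the union ranges over
  representatives and its members all coincide.\<close>

definition tensor_map ::
  "('r, 'k) ring_scheme \<Rightarrow> ('r, 'm, 'p) module_scheme \<Rightarrow> ('r, 'n, 'q) module_scheme
    \<Rightarrow> ('r, 'a, 's) module_scheme \<Rightarrow> ('m \<Rightarrow> 'n)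
    \<Rightarrow> ('m \<times> 'a \<Rightarrow>\<^sub>0 int) set \<Rightarrow> ('n \<times> 'a \<Rightarrow>\<^sub>0 int) set" where
  "tensor_map R M N A f U =
     (\<Union>c\<in>U. tensor_relations R N A +>\<^bsub>free_pairs N A\<^esub>
               frag_extend (\<lambda>(m, a). frag_of (f m, a)) c)"

text \<open>
  Flatness: tensoring preserves injectivity. A definition in HOL can only quantify over the modules
  on one fixed type. The type \<open>(nat \<Rightarrow> 'r) set\<close> carries a copy of every quotient of \<open>R\<^sup>n\<close> (as a set
  of cosets), hence of every finitely generated \<open>R\<close>-module. Nothing is lost: that an element of
  \<open>M \<otimes> A\<close> vanishes in \<open>N \<otimes> A\<close> already happens over finitely generated submodules of \<open>M\<close> and \<open>N\<close>.
\<close>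

definition flat_module :: "('r, 'k) ring_scheme \<Rightarrow> ('r, 'a, 'p) module_scheme \<Rightarrow> bool" where
  "flat_module R A \<longleftrightarrow> module R A \<and>
     (\<forall>(M :: ('r, (nat \<Rightarrow> 'r) set) module) (N :: ('r, (nat \<Rightarrow> 'r) set) module) f.
        module R M \<and> module R N \<and> f \<in> module_hom R M N \<and> inj_on f (carrier M) \<longrightarrow>
        inj_on (tensor_map R M N A f) (carrier (tensor R M A)))"


section \<open>Localization\<close>

definition fract_rel :: "('r, 'k) ring_scheme \<Rightarrow> 'r set \<Rightarrow> (('r \<times> 'r) \<times> ('r \<times> 'r)) set" where
  "fract_rel R S =
     {((a, s), (b, t)). a \<in> carrier R \<and> b \<in> carrier R \<and> s \<in> S \<and> t \<in> S \<and>
        (\<exists>u\<in>S. u \<otimes>\<^bsub>R\<^esub> (a \<otimes>\<^bsub>R\<^esub> t) = u \<otimes>\<^bsub>R\<^esub> (b \<otimes>\<^bsub>R\<^esub> s))}"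

definition fract :: "('r, 'k) ring_scheme \<Rightarrow> 'r set \<Rightarrow> 'r \<Rightarrow> 'r \<Rightarrow> ('r \<times> 'r) set" where
  "fract R S a s = fract_rel R S `` {(a, s)}"

definition localization :: "('r, 'k) ring_scheme \<Rightarrow> 'r set \<Rightarrow> ('r, ('r \<times> 'r) set) module" where
  "localization R S =
     \<lparr>carrier = (carrier R \<times> S) // fract_rel R S,
      monoid.mult = (\<lambda>U V. \<Union>(a, s)\<in>U. \<Union>(b, t)\<in>V. fract R S (a \<otimes>\<^bsub>R\<^esub> b) (s \<otimes>\<^bsub>R\<^esub> t)),
      monoid.one = fract R S \<one>\<^bsub>R\<^esub> \<one>\<^bsub>R\<^esub>,
      ring.zero = fract R S \<zero>\<^bsub>R\<^esub> \<one>\<^bsub>R\<^esub>,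
      ring.add = (\<lambda>U V. \<Union>(a, s)\<in>U. \<Union>(b, t)\<in>V.
               fract R S ((a \<otimes>\<^bsub>R\<^esub> t) \<oplus>\<^bsub>R\<^esub> (b \<otimes>\<^bsub>R\<^esub> s)) (s \<otimes>\<^bsub>R\<^esub> t)),
      smult = (\<lambda>r U. \<Union>(a, s)\<in>U. fract R S (r \<otimes>\<^bsub>R\<^esub> a) s)\<rparr>"

definition quotient_field :: "('r, 'k) ring_scheme \<Rightarrow> ('r, ('r \<times> 'r) set) module" where
  "quotient_field R = localization R (carrier R - {\<zero>\<^bsub>R\<^esub>})"

definition to_quotient_field :: "('r, 'k) ring_scheme \<Rightarrow> 'r \<Rightarrow> ('r \<times> 'r) set" where
  "to_quotient_field R r = fract R (carrier R - {\<zero>\<^bsub>R\<^esub>}) r \<one>\<^bsub>R\<^esub>"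

definition localization_at :: "('r, 'k) ring_scheme \<Rightarrow> 'r set \<Rightarrow> ('r, ('r \<times> 'r) set) module" where
  "localization_at R P = localization R (carrier R - P)"

definition extended_prime :: "('r, 'k) ring_scheme \<Rightarrow> 'r set \<Rightarrow> ('r \<times> 'r) set set" where
  "extended_prime R P = Idl\<^bsub>localization_at R P\<^esub> ((\<lambda>p. fract R (carrier R - P) p \<one>\<^bsub>R\<^esub>) ` P)"

definition residue_field ::
  "('r, 'k) ring_scheme \<Rightarrow> 'r set \<Rightarrow> ('r, ('r \<times> 'r) set set) module" where
  "residue_field R P =
     algebra_via (localization_at R P Quot extended_prime R P)
       (\<lambda>r. extended_prime R P +>\<^bsub>localization_at R P\<^esub> fract R (carrier R - P) r \<one>\<^bsub>R\<^esub>)"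


section \<open>Krull domains\<close>

definition height :: "('r, 'k) ring_scheme \<Rightarrow> 'r set \<Rightarrow> enat" where
  "height R P = Sup {enat n | n. \<exists>C :: nat \<Rightarrow> 'r set.
     (\<forall>i\<le>n. primeideal (C i) R) \<and> (\<forall>i<n. C i \<subset> C (Suc i)) \<and> C n = P}"

definition height_one_primes :: "('r, 'k) ring_scheme \<Rightarrow> 'r set set" where
  "height_one_primes R = {P. primeideal P R \<and> height R P = 1}"

definition discrete_valuation_ring :: "('r, 'k) ring_scheme \<Rightarrow> bool" where
  "discrete_valuation_ring V \<longleftrightarrow>
     principal_domain V \<and> (\<exists>!M. maximalideal M V) \<and> \<not> field V"

text \<open>The last condition says \<open>R = \<Inter> R\<^sub>P\<close> inside the quotient field, where \<open>R\<^sub>P\<close> is viewed as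
  the subring of all \<open>a / s\<close> with \<open>s \<notin> P\<close>. Fields count as Krull domains (empty intersection).\<close>

definition krull_domain :: "('r, 'k) ring_scheme \<Rightarrow> bool" where
  "krull_domain R \<longleftrightarrow> domain R \<and>
     (\<forall>P\<in>height_one_primes R. discrete_valuation_ring (localization_at R P)) \<and>
     (\<forall>x\<in>carrier R - {\<zero>\<^bsub>R\<^esub>}. finite {P \<in> height_one_primes R. x \<in> P}) \<and>
     to_quotient_field R ` carrier R =
       {x \<in> carrier (quotient_field R). \<forall>P\<in>height_one_primes R.
          \<exists>a\<in>carrier R. \<exists>s\<in>carrier R - P. x = fract R (carrier R - {\<zero>\<^bsub>R\<^esub>}) a s}"


section \<open>Invertible ideals\<close>

definition fractional_ideal :: "('r, 'k) ring_scheme \<Rightarrow> ('r \<times> 'r) set set \<Rightarrow> bool" where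
  "fractional_ideal R J \<longleftrightarrow> submodule J R (quotient_field R) \<and>
     (\<exists>d\<in>carrier R - {\<zero>\<^bsub>R\<^esub>}. \<forall>x\<in>J. d \<odot>\<^bsub>quotient_field R\<^esub> x \<in> to_quotient_field R ` carrier R)"

definition fractional_ideal_prod ::
  "('r, 'k) ring_scheme \<Rightarrow> ('r \<times> 'r) set set \<Rightarrow> ('r \<times> 'r) set set \<Rightarrow> ('r \<times> 'r) set set" where
  "fractional_ideal_prod R I J = generate (add_monoid (quotient_field R))
     {x \<otimes>\<^bsub>quotient_field R\<^esub> y | x y. x \<in> I \<and> y \<in> J}"

definition invertible_ideal :: "('r, 'k) ring_scheme \<Rightarrow> 'r set \<Rightarrow> bool" where
  "invertible_ideal R I \<longleftrightarrow> ideal I R \<and>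
     (\<exists>J. fractional_ideal R J \<and>
        fractional_ideal_prod R (to_quotient_field R ` I) J = to_quotient_field R ` carrier R)"


section \<open>Symmetric algebras\<close>

text \<open>The free associative algebra \<open>R\<langle>U\<rangle>\<close>: finitely supported functions on words over \<open>U\<close>,
  with the convolution product.\<close>

definition free_algebra :: "('r, 'k) ring_scheme \<Rightarrow> 'x set \<Rightarrow> ('x list \<Rightarrow> 'r) ring" where
  "free_algebra R U =
     \<lparr>carrier = {p. (\<forall>w. p w \<in> carrier R) \<and> finite {w. p w \<noteq> \<zero>\<^bsub>R\<^esub>} \<and>
                    (\<forall>w. p w \<noteq> \<zero>\<^bsub>R\<^esub> \<longrightarrow> set w \<subseteq> U)},
      monoid.mult = (\<lambda>p q w. \<Oplus>\<^bsub>R\<^esub>i\<in>{..length w}. p (take i w) \<otimes>\<^bsub>R\<^esub> q (drop i w)),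
      monoid.one = (\<lambda>w. if w = [] then \<one>\<^bsub>R\<^esub> else \<zero>\<^bsub>R\<^esub>),
      ring.zero = (\<lambda>w. \<zero>\<^bsub>R\<^esub>),
      ring.add = (\<lambda>p q w. p w \<oplus>\<^bsub>R\<^esub> q w)\<rparr>"

definition word :: "('r, 'k) ring_scheme \<Rightarrow> 'r \<Rightarrow> 'x list \<Rightarrow> ('x list \<Rightarrow> 'r)" where
  "word R r v = (\<lambda>w. if w = v then r else \<zero>\<^bsub>R\<^esub>)"

text \<open>The tensor algebra \<open>T\<^sub>R(M)\<close> is \<open>R\<langle>M\<rangle>\<close> modulo the relations which make \<open>M \<rightarrow> T\<^sub>R(M)\<close> linear.\<close>

definition tensor_algebra_relations ::
  "('r, 'k) ring_scheme \<Rightarrow> ('r, 'm, 'p) module_scheme \<Rightarrow> ('m list \<Rightarrow> 'r) set" where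
  "tensor_algebra_relations R M =
     (let F = free_algebra R (carrier M) in
      Idl\<^bsub>F\<^esub> ({word R \<one>\<^bsub>R\<^esub> [x \<oplus>\<^bsub>M\<^esub> y] \<ominus>\<^bsub>F\<^esub> (word R \<one>\<^bsub>R\<^esub> [x] \<oplus>\<^bsub>F\<^esub> word R \<one>\<^bsub>R\<^esub> [y]) | x y.
                x \<in> carrier M \<and> y \<in> carrier M} \<union>
              {word R \<one>\<^bsub>R\<^esub> [r \<odot>\<^bsub>M\<^esub> x] \<ominus>\<^bsub>F\<^esub> word R r [x] | r x.
                r \<in> carrier R \<and> x \<in> carrier M}))"

definition tensor_algebra ::
  "('r, 'k) ring_scheme \<Rightarrow> ('r, 'm, 'p) module_scheme \<Rightarrow> ('r, ('m list \<Rightarrow> 'r) set) module" where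
  "tensor_algebra R M =
     algebra_via (free_algebra R (carrier M) Quot tensor_algebra_relations R M)
       (\<lambda>r. tensor_algebra_relations R M +>\<^bsub>free_algebra R (carrier M)\<^esub> word R r [])"

definition tensor_algebra_incl ::
  "('r, 'k) ring_scheme \<Rightarrow> ('r, 'm, 'p) module_scheme \<Rightarrow> 'm \<Rightarrow> ('m list \<Rightarrow> 'r) set" where
  "tensor_algebra_incl R M x =
     tensor_algebra_relations R M +>\<^bsub>free_algebra R (carrier M)\<^esub> word R \<one>\<^bsub>R\<^esub> [x]"

definition commutator_ideal ::
  "('r, 'k) ring_scheme \<Rightarrow> ('r, 'm, 'p) module_scheme \<Rightarrow> ('m list \<Rightarrow> 'r) set set" where
  "commutator_ideal R M =
     (let T = tensor_algebra R M; \<iota> = tensor_algebra_incl R M in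
      Idl\<^bsub>T\<^esub> {(\<iota> x \<otimes>\<^bsub>T\<^esub> \<iota> y) \<ominus>\<^bsub>T\<^esub> (\<iota> y \<otimes>\<^bsub>T\<^esub> \<iota> x) | x y. x \<in> carrier M \<and> y \<in> carrier M})"

definition symmetric_algebra ::
  "('r, 'k) ring_scheme \<Rightarrow> ('r, 'm, 'p) module_scheme \<Rightarrow> ('r, ('m list \<Rightarrow> 'r) set set) module" where
  "symmetric_algebra R M =
     algebra_via (tensor_algebra R M Quot commutator_ideal R M)
       (\<lambda>r. commutator_ideal R M +>\<^bsub>tensor_algebra R M\<^esub> (r \<odot>\<^bsub>tensor_algebra R M\<^esub> \<one>\<^bsub>tensor_algebra R M\<^esub>))"

end

theory Submission
  imports Defs
begin

text \<open>
  Put \<open>K\<close> for the quotient field of \<open>R\<close>. As \<open>A\<close> is flat it is torsion-free, so \<open>A\<close> embeds into its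
  generic fibre \<open>A \<otimes> K = K[T]\<close>, and after a translation of \<open>T\<close> the retraction \<open>\<Phi>\<close> becomes
  \<open>f \<mapsto> f(0)\<close>. From now on \<open>A\<close> is a subring \<open>B\<close> of \<open>K[T]\<close> with \<open>f(0) \<in> R\<close> for all \<open>f \<in> B\<close>. Let \<open>L\<close> be the
  \<open>R\<close>-module of the linear coefficients of the elements of \<open>B\<close>. It is a finitely generated submodule
  of \<open>K\<close>, because a product of an element of \<open>A\<close> with one of the kernel of \<open>\<Phi>\<close> has linear coefficient
  \<open>f(0)\<close> times that of the second factor, so that ideal generators of the kernel give module
  generators of \<open>L\<close>. The claim is that \<open>B = R[L T]\<close> and that \<open>L\<close> is invertible; then
  \<open>B = \<Oplus> L\<^sup>n T\<^sup>n\<close> is the symmetric algebra of \<open>L\<close>, and \<open>L\<close> is isomorphic to an ideal.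

  First let \<open>P\<close> be a prime of height one. The local ring \<open>R\<^sub>P\<close> is a discrete valuation ring, with
  uniformizer \<open>\<pi>\<close> say, so \<open>L\<^sub>P = \<delta> R\<^sub>P\<close> for some \<open>\<delta> \<in> L\<close>. The third hypothesis says that \<open>\<pi>\<close> is a prime
  element of \<open>B\<^sub>P\<close>. Hence an element of \<open>B\<^sub>P\<close> that \<open>\<pi>\<close> does not divide can be
  cancelled (\<open>BV_cancel\<close>): if its product with some \<open>x \<in> K[T]\<close> is in \<open>B\<^sub>P\<close>, then so is \<open>x\<close>. Applied to
  an element \<open>\<delta> T u\<close> of \<open>B\<close> with \<open>u(0) = 1\<close>, this gives \<open>\<delta> T \<in> B\<^sub>P\<close> (\<open>BV_variable\<close>); applied to \<open>\<delta> T\<close>, it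
  allows one to divide by \<open>\<delta> T\<close> and shows that the coefficient of \<open>T\<^sup>n\<close> lies in \<open>\<delta>\<^sup>n R\<^sub>P\<close>
  (\<open>BV_coeff\<close>). Thus \<open>B\<^sub>P = R\<^sub>P[\<delta> T]\<close>.

  The passage from the primes of height one to \<open>R\<close> uses flatness twice, each time through
  \<open>flat_colon\<close>: if \<open>s\<^sub>j x \<in> r A\<close> for finitely many \<open>s\<^sub>j\<close>, then \<open>x\<close> lies in the extension to \<open>A\<close> of the colon
  ideal \<open>(r : s\<^sub>0, s\<^sub>1, ...)\<close> of \<open>R\<close>. Together with the finite character of \<open>R\<close> this gives \<open>B = \<Inter> B\<^sub>P\<close>
  (\<open>B_Int\<close>), hence \<open>L T \<subseteq> B\<close>. Applied to \<open>c\<^sub>0 T\<close> with \<open>c\<^sub>0 \<in> L\<close>, it then gives \<open>1 \<in> L M\<close> with \<open>M = (R : L)\<close>,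
  that is, \<open>L\<close> is invertible (\<open>one_in_LM\<close>). Finally the coefficients of \<open>T\<^sup>n\<close> in \<open>B\<close> are multiplied into
  \<open>R\<close> by \<open>M\<^sup>n\<close>, since this holds locally, so they lie in \<open>L\<^sup>n\<close> and \<open>B = R[L T]\<close> (\<open>B_generated\<close>).

  The last step is \<open>symmetric_algebra_iso\<close>. A relation \<open>\<Sum> x\<^sub>i y\<^sub>i = 1\<close> with \<open>x\<^sub>i \<in> L\<close> and \<open>y\<^sub>i \<in> M\<close> provides
  an explicit inverse \<open>c \<mapsto> \<Sum> x\<^sub>i \<cdot> (y\<^sub>i c)\<close> of the multiplication \<open>L \<otimes> L\<^sup>n \<rightarrow> L\<^sup>n\<^sup>+\<^sup>1\<close>, which is iterated
  to invert the map from the symmetric algebra to \<open>B\<close>.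
\<close>

section \<open>Localization\<close>

locale localized_ring = cring R for R :: "('r, 'm) ring_scheme" (structure) +
  fixes S :: "'r set"
  assumes denoms_closed: "S \<subseteq> carrier R"
    and denoms_one: "\<one> \<in> S"
    and denoms_mult: "\<And>s t. s \<in> S \<Longrightarrow> t \<in> S \<Longrightarrow> s \<otimes> t \<in> S"
begin

lemma denom_carrier [simp]: "s \<in> S \<Longrightarrow> s \<in> carrier R"
  using denoms_closed by blast

declare denoms_one [simp] denoms_mult [simp]

lemma fract_rel_iff:
  "((a, s), (b, t)) \<in> fract_rel R S \<longleftrightarrow> a \<in> carrier R \<and> b \<in> carrier R \<and> s \<in> S \<and> t \<in> S \<and>
        (\<exists>u\<in>S. u \<otimes> (a \<otimes> t) = u \<otimes> (b \<otimes> s))"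
  by (simp add: fract_rel_def)

lemma fract_rel_trans:
  assumes "((a, s), (b, t)) \<in> fract_rel R S" and "((b, t), (c, v)) \<in> fract_rel R S"
  shows "((a, s), (c, v)) \<in> fract_rel R S"
proof -
  from assms obtain u w where *: "a \<in> carrier R" "b \<in> carrier R" "c \<in> carrier R"
      "s \<in> S" "t \<in> S" "v \<in> S" "u \<in> S" "w \<in> S"
      and e1: "u \<otimes> (a \<otimes> t) = u \<otimes> (b \<otimes> s)" and e2: "w \<otimes> (b \<otimes> v) = w \<otimes> (c \<otimes> t)"
    by (auto simp: fract_rel_iff)

  have "(u \<otimes> w \<otimes> t) \<otimes> (a \<otimes> v) = w \<otimes> v \<otimes> (u \<otimes> (a \<otimes> t))"
    using * by (simp add: m_ac)
  also have "\<dots> = u \<otimes> s \<otimes> (w \<otimes> (b \<otimes> v))"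
    unfolding e1 using * by (simp add: m_ac)
  also have "\<dots> = (u \<otimes> w \<otimes> t) \<otimes> (c \<otimes> s)"
    unfolding e2 using * by (simp add: m_ac)
  finally show ?thesis
    using * by (auto simp: fract_rel_iff intro!: bexI[of _ "u \<otimes> w \<otimes> t"])
qed

lemma fract_rel_sym: "(x, y) \<in> fract_rel R S \<Longrightarrow> (y, x) \<in> fract_rel R S"
  by (cases x; cases y) (auto simp: fract_rel_iff intro: sym)

lemma fract_rel_refl: "a \<in> carrier R \<Longrightarrow> s \<in> S \<Longrightarrow> ((a, s), (a, s)) \<in> fract_rel R S"
  using denoms_one by (auto simp: fract_rel_iff)

lemma fract_eq_iff:
  assumes "a \<in> carrier R" "b \<in> carrier R" "s \<in> S" "t \<in> S"
  shows "fract R S a s = fract R S b t \<longleftrightarrow> (\<exists>u\<in>S. u \<otimes> (a \<otimes> t) = u \<otimes> (b \<otimes> s))"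
proof -
  have "fract R S a s = fract R S b t \<longleftrightarrow> ((a, s), (b, t)) \<in> fract_rel R S"
  proof
    assume "fract R S a s = fract R S b t"
    then show "((a, s), (b, t)) \<in> fract_rel R S"
      using fract_rel_refl[OF assms(2,4)] by (auto simp: fract_def)
  next
    assume h: "((a, s), (b, t)) \<in> fract_rel R S"
    have "((a, s), x) \<in> fract_rel R S \<longleftrightarrow> ((b, t), x) \<in> fract_rel R S" for x
      using fract_rel_trans[OF h, of "fst x" "snd x"]
        fract_rel_trans[OF fract_rel_sym[OF h], of "fst x" "snd x"] by auto
    then show "fract R S a s = fract R S b t"
      by (auto simp: fract_def)
  qed
  then show ?thesis using assms by (simp add: fract_rel_iff)
qed

lemma fract_eqI:
  assumes "a \<in> carrier R" "b \<in> carrier R" "s \<in> S" "t \<in> S" "a \<otimes> t = b \<otimes> s"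
  shows "fract R S a s = fract R S b t"
  using assms denoms_one by (auto simp: fract_eq_iff)

lemma mem_fractD:
  assumes "(b, t) \<in> fract R S a s"
  shows "b \<in> carrier R" "t \<in> S" "a \<in> carrier R" "s \<in> S" "fract R S b t = fract R S a s"
  using assms fract_eq_iff[of b a t s] by (auto simp: fract_def fract_rel_def dest: sym)

lemma fract_self: "a \<in> carrier R \<Longrightarrow> s \<in> S \<Longrightarrow> (a, s) \<in> fract R S a s"
  by (simp add: fract_def fract_rel_refl)

lemma fract_closed [simp]:
  "a \<in> carrier R \<Longrightarrow> s \<in> S \<Longrightarrow> fract R S a s \<in> carrier (localization R S)"
  by (auto simp: localization_def fract_def quotient_def)

lemma fract_cases:
  assumes "x \<in> carrier (localization R S)"
  obtains a s where "a \<in> carrier R" "s \<in> S" "x = fract R S a s"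
  using assms by (auto simp: localization_def fract_def quotient_def)

text \<open>An operation on classes that is given by a union over all representatives can be evaluated
  on any one of them.\<close>

lemma Union_fract:
  assumes "a \<in> carrier R" "s \<in> S"
    and "\<And>b t. (b, t) \<in> fract R S a s \<Longrightarrow> g b t = c"
  shows "(\<Union>(b, t)\<in>fract R S a s. g b t) = c"
  using assms(3) fract_self[OF assms(1,2)] by fastforce

lemma fract_mult:
  assumes "a \<in> carrier R" "b \<in> carrier R" "s \<in> S" "t \<in> S"
  shows "fract R S a s \<otimes>\<^bsub>localization R S\<^esub> fract R S b t = fract R S (a \<otimes> b) (s \<otimes> t)"
proof -
  have "fract R S (a' \<otimes> b') (s' \<otimes> t') = fract R S (a \<otimes> b) (s \<otimes> t)"
    if p: "(a', s') \<in> fract R S a s" "(b', t') \<in> fract R S b t" for a' s' b' t'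
  proof -
    note c = mem_fractD[OF p(1)] mem_fractD[OF p(2)]
    from c(5,10) obtain u w where u: "u \<in> S" "w \<in> S"
        "u \<otimes> (a' \<otimes> s) = u \<otimes> (a \<otimes> s')" "w \<otimes> (b' \<otimes> t) = w \<otimes> (b \<otimes> t')"
      using c assms by (auto simp: fract_eq_iff)
    have "u \<otimes> w \<otimes> (a' \<otimes> b' \<otimes> (s \<otimes> t)) = u \<otimes> (a' \<otimes> s) \<otimes> (w \<otimes> (b' \<otimes> t))"
      using c assms u(1,2) by (simp add: m_ac)
    also have "\<dots> = u \<otimes> w \<otimes> (a \<otimes> b \<otimes> (s' \<otimes> t'))"
      unfolding u using c assms u(1,2) by (simp add: m_ac)
    finally show ?thesis
      using u c assms by (auto simp: fract_eq_iff intro!: bexI[of _ "u \<otimes> w"])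
  qed
  then show ?thesis
    using assms by (simp add: localization_def) (intro Union_fract; simp)
qed

lemma fract_add:
  assumes "a \<in> carrier R" "b \<in> carrier R" "s \<in> S" "t \<in> S"
  shows "fract R S a s \<oplus>\<^bsub>localization R S\<^esub> fract R S b t
         = fract R S (a \<otimes> t \<oplus> b \<otimes> s) (s \<otimes> t)"
proof -
  have "fract R S (a' \<otimes> t' \<oplus> b' \<otimes> s') (s' \<otimes> t') = fract R S (a \<otimes> t \<oplus> b \<otimes> s) (s \<otimes> t)"
    if p: "(a', s') \<in> fract R S a s" "(b', t') \<in> fract R S b t" for a' s' b' t'
  proof -
    note c = mem_fractD[OF p(1)] mem_fractD[OF p(2)]
    from c(5,10) obtain u w where u: "u \<in> S" "w \<in> S"
        "u \<otimes> (a' \<otimes> s) = u \<otimes> (a \<otimes> s')" "w \<otimes> (b' \<otimes> t) = w \<otimes> (b \<otimes> t')"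
      using c assms by (auto simp: fract_eq_iff)
    have "u \<otimes> w \<otimes> ((a' \<otimes> t' \<oplus> b' \<otimes> s') \<otimes> (s \<otimes> t))
        = w \<otimes> t' \<otimes> t \<otimes> (u \<otimes> (a' \<otimes> s)) \<oplus> u \<otimes> s' \<otimes> s \<otimes> (w \<otimes> (b' \<otimes> t))"
      using c assms u(1,2) by (simp add: m_ac l_distr r_distr)
    also have "\<dots> = u \<otimes> w \<otimes> ((a \<otimes> t \<oplus> b \<otimes> s) \<otimes> (s' \<otimes> t'))"
      unfolding u using c assms u(1,2) by (simp add: m_ac l_distr r_distr)
    finally show ?thesis
      using u c assms by (auto simp: fract_eq_iff intro!: bexI[of _ "u \<otimes> w"])
  qed
  then show ?thesis
    using assms by (simp add: localization_def) (intro Union_fract; simp)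
qed

lemma fract_smult:
  assumes "r \<in> carrier R" "a \<in> carrier R" "s \<in> S"
  shows "r \<odot>\<^bsub>localization R S\<^esub> fract R S a s = fract R S (r \<otimes> a) s"
proof -
  have "fract R S (r \<otimes> a') s' = fract R S (r \<otimes> a) s"
    if p: "(a', s') \<in> fract R S a s" for a' s'
  proof -
    note c = mem_fractD[OF p]
    from c(5) obtain u where u: "u \<in> S" "u \<otimes> (a' \<otimes> s) = u \<otimes> (a \<otimes> s')"
      using c assms by (auto simp: fract_eq_iff)
    have "u \<otimes> (r \<otimes> a' \<otimes> s) = r \<otimes> (u \<otimes> (a' \<otimes> s))"
      using c assms u(1) by (simp add: m_ac)
    also have "\<dots> = u \<otimes> (r \<otimes> a \<otimes> s')"
      unfolding u using c assms u(1) by (simp add: m_ac)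
    finally show ?thesis
      using u c assms by (auto simp: fract_eq_iff)
  qed
  then show ?thesis
    using assms by (simp add: localization_def) (intro Union_fract; simp)
qed

lemma fract_one: "\<one>\<^bsub>localization R S\<^esub> = fract R S \<one> \<one>"
  and fract_zero: "\<zero>\<^bsub>localization R S\<^esub> = fract R S \<zero> \<one>"
  by (simp_all add: localization_def)

theorem localization_cring: "cring (localization R S)"
proof (intro cringI abelian_groupI comm_monoidI)
  fix x y z
  assume "x \<in> carrier (localization R S)" "y \<in> carrier (localization R S)"
     "z \<in> carrier (localization R S)"
  then obtain a s b t c v where *: "a \<in> carrier R" "b \<in> carrier R" "c \<in> carrier R" "s \<in> S" "t \<in> S"
      "v \<in> S" "x = fract R S a s" "y = fract R S b t" "z = fract R S c v"
    by (metis fract_cases)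
  show "x \<oplus>\<^bsub>localization R S\<^esub> y \<oplus>\<^bsub>localization R S\<^esub> z =
      x \<oplus>\<^bsub>localization R S\<^esub> (y \<oplus>\<^bsub>localization R S\<^esub> z)"
    "x \<otimes>\<^bsub>localization R S\<^esub> y \<otimes>\<^bsub>localization R S\<^esub> z =
      x \<otimes>\<^bsub>localization R S\<^esub> (y \<otimes>\<^bsub>localization R S\<^esub> z)"
    using * by (simp_all add: fract_add fract_mult l_distr r_distr m_ac a_ac)
  have "fract R S ((a \<otimes> t \<oplus> b \<otimes> s) \<otimes> c) (s \<otimes> t \<otimes> v)
      = fract R S (a \<otimes> c \<otimes> (t \<otimes> v) \<oplus> b \<otimes> c \<otimes> (s \<otimes> v)) (s \<otimes> v \<otimes> (t \<otimes> v))"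
    using *(1-6) by (intro fract_eqI) (auto simp: l_distr r_distr m_ac)
  then show "(x \<oplus>\<^bsub>localization R S\<^esub> y) \<otimes>\<^bsub>localization R S\<^esub> z =
      x \<otimes>\<^bsub>localization R S\<^esub> z \<oplus>\<^bsub>localization R S\<^esub> y \<otimes>\<^bsub>localization R S\<^esub> z"
    using * by (simp add: fract_add fract_mult)
next
  fix x assume "x \<in> carrier (localization R S)"
  then obtain a s where *: "a \<in> carrier R" "s \<in> S" "x = fract R S a s"
    by (metis fract_cases)
  have "fract R S (\<ominus> a \<otimes> s \<oplus> a \<otimes> s) (s \<otimes> s) = fract R S \<zero> \<one>"
    using * by (intro fract_eqI) (auto simp: l_minus l_neg)
  with * show "\<exists>y\<in>carrier (localization R S). y \<oplus>\<^bsub>localization R S\<^esub> x = \<zero>\<^bsub>localization R S\<^esub>"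
    by (intro bexI[of _ "fract R S (\<ominus> a) s"]) (auto simp: fract_add fract_zero)
qed (auto elim!: fract_cases simp: fract_add fract_mult fract_zero fract_one m_ac a_ac)

lemma fract_surj_hom: "(\<lambda>a. fract R S a \<one>) \<in> ring_hom R (localization R S)"
  by (rule ring_hom_memI) (auto simp: fract_add fract_mult fract_one)

text \<open>The universal property: a homomorphism that inverts the denominators extends to fractions.\<close>

lemma localization_lift:
  fixes C :: "('c, 'n) ring_scheme"
  assumes "cring C" and phi: "\<phi> \<in> ring_hom R C" and units: "\<And>s. s \<in> S \<Longrightarrow> \<phi> s \<in> Units C"
  obtains ext where "ext \<in> ring_hom (localization R S) C"
    "\<And>a s. a \<in> carrier R \<Longrightarrow> s \<in> S \<Longrightarrow> ext (fract R S a s) = \<phi> a \<otimes>\<^bsub>C\<^esub> inv\<^bsub>C\<^esub> \<phi> s"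
proof -
  interpret C: cring C by fact
  define ext where "ext x = (let p = SOME p. p \<in> x in \<phi> (fst p) \<otimes>\<^bsub>C\<^esub> inv\<^bsub>C\<^esub> \<phi> (snd p))" for x
  have cl [simp]: "\<phi> a \<in> carrier C" if "a \<in> carrier R" for a
    using phi that by (rule ring_hom_closed)
  have m [simp]: "\<phi> (a \<otimes> b) = \<phi> a \<otimes>\<^bsub>C\<^esub> \<phi> b" if "a \<in> carrier R" "b \<in> carrier R" for a b
    using phi that by (rule ring_hom_mult)
  have a [simp]: "\<phi> (a \<oplus> b) = \<phi> a \<oplus>\<^bsub>C\<^esub> \<phi> b" if "a \<in> carrier R" "b \<in> carrier R" for a b
    using phi that by (rule ring_hom_add)
  have one [simp]: "\<phi> \<one> = \<one>\<^bsub>C\<^esub>" using phi by (rule ring_hom_one)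
  note [simp] = units
  have key: "\<phi> a \<otimes>\<^bsub>C\<^esub> inv\<^bsub>C\<^esub> \<phi> s = \<phi> b \<otimes>\<^bsub>C\<^esub> inv\<^bsub>C\<^esub> \<phi> t"
    if *: "a \<in> carrier R" "b \<in> carrier R" "s \<in> S" "t \<in> S" "fract R S a s = fract R S b t" for a b s t
  proof -
    obtain u where u: "u \<in> S" "u \<otimes> (a \<otimes> t) = u \<otimes> (b \<otimes> s)"
      using * by (auto simp: fract_eq_iff)
    have "\<phi> (u \<otimes> (a \<otimes> t)) = \<phi> (u \<otimes> (b \<otimes> s))"
      by (simp only: u(2))
    then have e: "\<phi> a \<otimes>\<^bsub>C\<^esub> \<phi> t = \<phi> b \<otimes>\<^bsub>C\<^esub> \<phi> s"
      using *(1-4) u(1) by simp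
    have "\<phi> a \<otimes>\<^bsub>C\<^esub> inv\<^bsub>C\<^esub> \<phi> s = (\<phi> a \<otimes>\<^bsub>C\<^esub> \<phi> t) \<otimes>\<^bsub>C\<^esub> inv\<^bsub>C\<^esub> \<phi> t \<otimes>\<^bsub>C\<^esub> inv\<^bsub>C\<^esub> \<phi> s"
      using * by (simp add: C.m_assoc)
    also have "\<dots> = \<phi> b \<otimes>\<^bsub>C\<^esub> inv\<^bsub>C\<^esub> \<phi> t \<otimes>\<^bsub>C\<^esub> (\<phi> s \<otimes>\<^bsub>C\<^esub> inv\<^bsub>C\<^esub> \<phi> s)"
      unfolding e using * by (simp add: C.m_ac del: C.Units_r_inv)
    finally show ?thesis using * by simp
  qed
  have val: "ext (fract R S a s) = \<phi> a \<otimes>\<^bsub>C\<^esub> inv\<^bsub>C\<^esub> \<phi> s" if *: "a \<in> carrier R" "s \<in> S" for a s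
  proof -
    define p where "p = (SOME p. p \<in> fract R S a s)"
    have "(fst p, snd p) \<in> fract R S a s"
      unfolding p_def using someI[of "\<lambda>p. p \<in> fract R S a s", OF fract_self[OF *]] by simp
    from mem_fractD[OF this] show ?thesis
      unfolding ext_def Let_def p_def[symmetric] by (intro key) auto
  qed
  have "ext \<in> ring_hom (localization R S) C"
  proof (rule ring_hom_memI)
    fix x y assume "x \<in> carrier (localization R S)" "y \<in> carrier (localization R S)"
    then obtain a s b t where *: "a \<in> carrier R" "b \<in> carrier R" "s \<in> S" "t \<in> S"
        "x = fract R S a s" "y = fract R S b t"
      by (metis fract_cases)
    show "ext x \<in> carrier C" using * by (simp add: val)
    have i: "inv\<^bsub>C\<^esub> (\<phi> s \<otimes>\<^bsub>C\<^esub> \<phi> t) = inv\<^bsub>C\<^esub> \<phi> s \<otimes>\<^bsub>C\<^esub> inv\<^bsub>C\<^esub> \<phi> t"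
    proof (rule C.comm_inv_char)
      have "\<phi> s \<otimes>\<^bsub>C\<^esub> \<phi> t \<otimes>\<^bsub>C\<^esub> (inv\<^bsub>C\<^esub> \<phi> s \<otimes>\<^bsub>C\<^esub> inv\<^bsub>C\<^esub> \<phi> t)
        = (\<phi> s \<otimes>\<^bsub>C\<^esub> inv\<^bsub>C\<^esub> \<phi> s) \<otimes>\<^bsub>C\<^esub> (\<phi> t \<otimes>\<^bsub>C\<^esub> inv\<^bsub>C\<^esub> \<phi> t)"
        using * by (simp add: C.m_ac del: C.Units_r_inv)
      then show "\<phi> s \<otimes>\<^bsub>C\<^esub> \<phi> t \<otimes>\<^bsub>C\<^esub> (inv\<^bsub>C\<^esub> \<phi> s \<otimes>\<^bsub>C\<^esub> inv\<^bsub>C\<^esub> \<phi> t) = \<one>\<^bsub>C\<^esub>"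
        using * by simp
    qed (use * in auto)
    show "ext (x \<otimes>\<^bsub>localization R S\<^esub> y) = ext x \<otimes>\<^bsub>C\<^esub> ext y"
      using * by (simp add: val fract_mult i C.m_ac)
    have j: "\<phi> t \<otimes>\<^bsub>C\<^esub> (inv\<^bsub>C\<^esub> \<phi> s \<otimes>\<^bsub>C\<^esub> inv\<^bsub>C\<^esub> \<phi> t) = inv\<^bsub>C\<^esub> \<phi> s"
      using * C.m_lcomm[of "\<phi> t" "inv\<^bsub>C\<^esub> \<phi> s" "inv\<^bsub>C\<^esub> \<phi> t"] by simp
    have k: "\<phi> s \<otimes>\<^bsub>C\<^esub> (inv\<^bsub>C\<^esub> \<phi> s \<otimes>\<^bsub>C\<^esub> inv\<^bsub>C\<^esub> \<phi> t) = inv\<^bsub>C\<^esub> \<phi> t"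
      using * by (simp add: C.m_assoc[symmetric])
    show "ext (x \<oplus>\<^bsub>localization R S\<^esub> y) = ext x \<oplus>\<^bsub>C\<^esub> ext y"
      using * by (simp add: val fract_add i C.l_distr C.m_assoc j k)
  next
    show "ext \<one>\<^bsub>localization R S\<^esub> = \<one>\<^bsub>C\<^esub>"
      by (simp add: val fract_one)
  qed
  with val show thesis by (rule that[rotated])
qed

end

context "domain"
begin

lemma nonzero_localized: "localized_ring R (carrier R - {\<zero>})"
  by unfold_locales (auto simp: integral_iff)

lemma quotient_field_eq_iff:
  assumes "a \<in> carrier R" "b \<in> carrier R" "s \<in> carrier R - {\<zero>}" "t \<in> carrier R - {\<zero>}"
  shows "fract R (carrier R - {\<zero>}) a s = fract R (carrier R - {\<zero>}) b t \<longleftrightarrow> a \<otimes> t = b \<otimes> s"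
proof -
  interpret Q: localized_ring R "carrier R - {\<zero>}" by (rule nonzero_localized)
  show ?thesis
    using assms m_lcancel[of _ "a \<otimes> t" "b \<otimes> s"] by (auto simp: Q.fract_eq_iff)
qed

theorem quotient_field_is_field: "field (quotient_field R)"
proof -
  interpret Q: localized_ring R "carrier R - {\<zero>}" by (rule nonzero_localized)
  interpret K: cring "quotient_field R"
    unfolding quotient_field_def by (rule Q.localization_cring)
  show ?thesis
  proof (rule K.cring_fieldI2)
    show "\<zero>\<^bsub>quotient_field R\<^esub> \<noteq> \<one>\<^bsub>quotient_field R\<^esub>"
      unfolding quotient_field_def Q.fract_zero Q.fract_one
      by (subst quotient_field_eq_iff) auto
  next
    fix x assume x: "x \<in> carrier (quotient_field R)" "x \<noteq> \<zero>\<^bsub>quotient_field R\<^esub>"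
    then obtain a s where *: "a \<in> carrier R" "s \<in> carrier R - {\<zero>}"
        "x = fract R (carrier R - {\<zero>}) a s"
      unfolding quotient_field_def by (metis Q.fract_cases)
    have a: "a \<noteq> \<zero>"
      using x(2) * unfolding quotient_field_def Q.fract_zero
      by (auto simp: quotient_field_eq_iff)
    have "x \<otimes>\<^bsub>quotient_field R\<^esub> fract R (carrier R - {\<zero>}) s a = \<one>\<^bsub>quotient_field R\<^esub>"
      using * a unfolding quotient_field_def
      by (simp add: Q.fract_mult Q.fract_one quotient_field_eq_iff integral_iff m_comm)
    moreover have "fract R (carrier R - {\<zero>}) s a \<in> carrier (quotient_field R)"
      using * a unfolding quotient_field_def by (intro Q.fract_closed) auto
    ultimately show "\<exists>y\<in>carrier (quotient_field R).
        x \<otimes>\<^bsub>quotient_field R\<^esub> y = \<one>\<^bsub>quotient_field R\<^esub>"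
      by blast
  qed
qed

lemma to_quotient_field_hom: "to_quotient_field R \<in> ring_hom R (quotient_field R)"
proof -
  interpret Q: localized_ring R "carrier R - {\<zero>}" by (rule nonzero_localized)
  show ?thesis
    using Q.fract_surj_hom unfolding quotient_field_def to_quotient_field_def[abs_def] .
qed

lemma to_quotient_field_inj: "inj_on (to_quotient_field R) (carrier R)"
  by (rule inj_onI) (simp add: to_quotient_field_def quotient_field_eq_iff)

lemma fract_eq_quotient:
  assumes "a \<in> carrier R" "s \<in> carrier R - {\<zero>}"
  shows "fract R (carrier R - {\<zero>}) a s
    = to_quotient_field R a \<otimes>\<^bsub>quotient_field R\<^esub> inv\<^bsub>quotient_field R\<^esub> to_quotient_field R s"
proof -
  interpret Q: localized_ring R "carrier R - {\<zero>}" by (rule nonzero_localized)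
  interpret K: field "quotient_field R" by (rule quotient_field_is_field)
  let ?x = "fract R (carrier R - {\<zero>})"
  have c: "?x a s \<in> carrier (quotient_field R)" "?x \<one> s \<in> carrier (quotient_field R)"
    "?x s \<one> \<in> carrier (quotient_field R)"
    using assms unfolding quotient_field_def by (auto intro!: Q.fract_closed)
  have "?x s \<one> \<otimes>\<^bsub>quotient_field R\<^esub> ?x \<one> s = \<one>\<^bsub>quotient_field R\<^esub>"
    using assms unfolding quotient_field_def
    by (simp add: Q.fract_mult Q.fract_one quotient_field_eq_iff)
  then have "inv\<^bsub>quotient_field R\<^esub> ?x s \<one> = ?x \<one> s"
    using c by (intro K.comm_inv_char)
  then show ?thesis
    using assms unfolding to_quotient_field_def
    by (simp add: quotient_field_def Q.fract_mult)
qed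

lemma quotient_field_cases:
  assumes "x \<in> carrier (quotient_field R)"
  obtains a s where "a \<in> carrier R" "s \<in> carrier R" "s \<noteq> \<zero>"
    "x = to_quotient_field R a \<otimes>\<^bsub>quotient_field R\<^esub> inv\<^bsub>quotient_field R\<^esub> to_quotient_field R s"
proof -
  interpret Q: localized_ring R "carrier R - {\<zero>}" by (rule nonzero_localized)
  from assms obtain a s where "a \<in> carrier R" "s \<in> carrier R - {\<zero>}"
      "x = fract R (carrier R - {\<zero>}) a s"
    unfolding quotient_field_def by (metis Q.fract_cases)
  then show thesis using that[of a s] by (simp add: fract_eq_quotient)
qed

lemma quotient_field_smult:
  assumes "r \<in> carrier R" "x \<in> carrier (quotient_field R)"
  shows "r \<odot>\<^bsub>quotient_field R\<^esub> x = to_quotient_field R r \<otimes>\<^bsub>quotient_field R\<^esub> x"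
proof -
  interpret Q: localized_ring R "carrier R - {\<zero>}" by (rule nonzero_localized)
  from assms obtain a s where "a \<in> carrier R" "s \<in> carrier R - {\<zero>}"
      "x = fract R (carrier R - {\<zero>}) a s"
    unfolding quotient_field_def by (metis Q.fract_cases)
  with assms show ?thesis
    unfolding quotient_field_def to_quotient_field_def by (simp add: Q.fract_smult Q.fract_mult)
qed

end

section \<open>Tensor products of algebras\<close>

locale module_pair =
  fixes R :: "('r, 'k) ring_scheme" (structure) and M :: "('r, 'm, 'p) module_scheme"
    and N :: "('r, 'n, 'q) module_scheme"
  assumes left_module: "module R M" and right_module: "module R N"
begin

abbreviation rels where "rels \<equiv> tensor_relations R M N"

lemma rel_intros:
  shows rel_zero: "0 \<in> rels"
    and rel_add_left: "\<lbrakk>m \<in> carrier M; m' \<in> carrier M; n \<in> carrier N\<rbrakk> \<Longrightarrow>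
      frag_of (m \<oplus>\<^bsub>M\<^esub> m', n) - frag_of (m, n) - frag_of (m', n) \<in> rels"
    and rel_add_right: "\<lbrakk>m \<in> carrier M; n \<in> carrier N; n' \<in> carrier N\<rbrakk> \<Longrightarrow>
      frag_of (m, n \<oplus>\<^bsub>N\<^esub> n') - frag_of (m, n) - frag_of (m, n') \<in> rels"
    and rel_balance: "\<lbrakk>r \<in> carrier R; m \<in> carrier M; n \<in> carrier N\<rbrakk> \<Longrightarrow>
      frag_of (r \<odot>\<^bsub>M\<^esub> m, n) - frag_of (m, r \<odot>\<^bsub>N\<^esub> n) \<in> rels"
proof -
  show "0 \<in> rels"
    using generate.one[of "free_Abelian_group (carrier M \<times> carrier N)"]
    unfolding tensor_relations_def one_free_Abelian_group .
qed (auto simp: tensor_relations_def intro!: generate.incl)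

text \<open>The relations form the subgroup generated by three families, so a property that holds for these
  families and is preserved by differences holds for all relations. The support condition is part
  of the conclusion because inverses in the free abelian group are negations only on its carrier.\<close>

lemma rel_induct [consumes 1, case_names zero add_left add_right balance diff]:
  assumes c: "c \<in> rels" and zero: "P 0"
    and add_left: "\<And>m m' n. \<lbrakk>m \<in> carrier M; m' \<in> carrier M; n \<in> carrier N\<rbrakk> \<Longrightarrow>
      P (frag_of (m \<oplus>\<^bsub>M\<^esub> m', n) - frag_of (m, n) - frag_of (m', n))"
    and add_right: "\<And>m n n'. \<lbrakk>m \<in> carrier M; n \<in> carrier N; n' \<in> carrier N\<rbrakk> \<Longrightarrow>
      P (frag_of (m, n \<oplus>\<^bsub>N\<^esub> n') - frag_of (m, n) - frag_of (m, n'))"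
    and balance: "\<And>r m n. \<lbrakk>r \<in> carrier R; m \<in> carrier M; n \<in> carrier N\<rbrakk> \<Longrightarrow>
      P (frag_of (r \<odot>\<^bsub>M\<^esub> m, n) - frag_of (m, r \<odot>\<^bsub>N\<^esub> n))"
    and diff: "\<And>c d. \<lbrakk>Poly_Mapping.keys c \<subseteq> carrier M \<times> carrier N;
       Poly_Mapping.keys d \<subseteq> carrier M \<times> carrier N; P c; P d\<rbrakk> \<Longrightarrow> P (c - d)"
  shows "Poly_Mapping.keys c \<subseteq> carrier M \<times> carrier N \<and> P c"
proof -
  interpret M: module R M by (rule left_module)
  interpret N: module R N by (rule right_module)
  define S where "S = carrier M \<times> carrier N"
  have kd: "Poly_Mapping.keys (a - b) \<subseteq> S"
    if "Poly_Mapping.keys a \<subseteq> S" "Poly_Mapping.keys b \<subseteq> S" for a b :: "'m \<times> 'n \<Rightarrow>\<^sub>0 int"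
    using keys_diff[of a b] that by blast
  have kf: "Poly_Mapping.keys (frag_of x :: _ \<Rightarrow>\<^sub>0 int) \<subseteq> S \<longleftrightarrow> x \<in> S" for x
    by (auto simp: keys_frag_of)
  have mem: "(a, b) \<in> S \<longleftrightarrow> a \<in> carrier M \<and> b \<in> carrier N" for a b
    by (simp add: S_def)
  have gen: "Poly_Mapping.keys h \<subseteq> S \<and> P h"
    if "h \<in> {frag_of (m \<oplus>\<^bsub>M\<^esub> m', n) - frag_of (m, n) - frag_of (m', n) | m m' n.
         m \<in> carrier M \<and> m' \<in> carrier M \<and> n \<in> carrier N} \<union>
      {frag_of (m, n \<oplus>\<^bsub>N\<^esub> n') - frag_of (m, n) - frag_of (m, n') | m n n'.
         m \<in> carrier M \<and> n \<in> carrier N \<and> n' \<in> carrier N} \<union>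
      {frag_of (r \<odot>\<^bsub>M\<^esub> m, n) - frag_of (m, r \<odot>\<^bsub>N\<^esub> n) | r m n.
         r \<in> carrier R \<and> m \<in> carrier M \<and> n \<in> carrier N}" for h
    using that
    by (elim UnE CollectE exE conjE; simp add: kd kf mem add_left add_right balance)
  have "Poly_Mapping.keys c \<subseteq> S \<and> P c"
    using c unfolding tensor_relations_def S_def[symmetric]
  proof (induction rule: generate.induct)
    case one
    then show ?case using zero by simp
  next
    case (incl h)
    then show ?case by (rule gen)
  next
    case (inv h)
    from gen[OF inv] show ?case
      using diff[of 0 h] zero by (simp add: S_def)
  next
    case (eng h1 h2)
    then have k: "Poly_Mapping.keys h1 \<subseteq> S" "Poly_Mapping.keys h2 \<subseteq> S" "P h1" "P h2"
      by auto
    note diff' = diff[folded S_def]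
    have z: "Poly_Mapping.keys (0 :: 'm \<times> 'n \<Rightarrow>\<^sub>0 int) \<subseteq> S" by simp
    have "Poly_Mapping.keys (h1 - (0 - h2)) \<subseteq> S" "P (h1 - (0 - h2))"
      by (intro kd diff' zero z k)+
    then show ?case by simp
  qed
  then show ?thesis by (simp add: S_def)
qed

lemma rel_keys: "c \<in> rels \<Longrightarrow> Poly_Mapping.keys c \<subseteq> carrier M \<times> carrier N"
  using rel_induct[of c "\<lambda>_. True"] by simp

lemma rel_subgroup: "subgroup rels (free_Abelian_group (carrier M \<times> carrier N))"
  unfolding tensor_relations_def
proof (rule group.generate_is_subgroup[OF group_free_Abelian_group], rule subsetI)
  fix h
  assume "h \<in> {frag_of (m \<oplus>\<^bsub>M\<^esub> m', n) - frag_of (m, n) - frag_of (m', n) | m m' n.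
         m \<in> carrier M \<and> m' \<in> carrier M \<and> n \<in> carrier N} \<union>
      {frag_of (m, n \<oplus>\<^bsub>N\<^esub> n') - frag_of (m, n) - frag_of (m, n') | m n n'.
         m \<in> carrier M \<and> n \<in> carrier N \<and> n' \<in> carrier N} \<union>
      {frag_of (r \<odot>\<^bsub>M\<^esub> m, n) - frag_of (m, r \<odot>\<^bsub>N\<^esub> n) | r m n.
         r \<in> carrier R \<and> m \<in> carrier M \<and> n \<in> carrier N}"
  then have "h \<in> rels" unfolding tensor_relations_def by (rule generate.incl)
  then show "h \<in> carrier (free_Abelian_group (carrier M \<times> carrier N))"
    using rel_keys by simp
qed

lemma rel_add: "c \<in> rels \<Longrightarrow> d \<in> rels \<Longrightarrow> c + d \<in> rels"
  using subgroup.m_closed[OF rel_subgroup] by simp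

lemma rel_uminus: "c \<in> rels \<Longrightarrow> - c \<in> rels"
  using subgroup.m_inv_closed[OF rel_subgroup] rel_keys by fastforce

lemma rel_diff: "c \<in> rels \<Longrightarrow> d \<in> rels \<Longrightarrow> c - d \<in> rels"
  using rel_add[OF _ rel_uminus] by fastforce

lemma coset_eq: "rels +>\<^bsub>free_pairs M N\<^esub> c = {h + c | h. h \<in> rels}"
  by (auto simp: a_r_coset_def r_coset_def free_pairs_def)

lemma coset_eq_iff:
  "rels +>\<^bsub>free_pairs M N\<^esub> c = rels +>\<^bsub>free_pairs M N\<^esub> d \<longleftrightarrow> c - d \<in> rels"
proof
  assume "rels +>\<^bsub>free_pairs M N\<^esub> c = rels +>\<^bsub>free_pairs M N\<^esub> d"
  moreover have "c \<in> rels +>\<^bsub>free_pairs M N\<^esub> c"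
    unfolding coset_eq using rel_zero by (auto intro!: exI[of _ 0])
  ultimately show "c - d \<in> rels" unfolding coset_eq by auto
next
  assume cd: "c - d \<in> rels"
  have "h + c = (h + (c - d)) + d" "h + d = (h - (c - d)) + c" for h by simp_all
  then show "rels +>\<^bsub>free_pairs M N\<^esub> c = rels +>\<^bsub>free_pairs M N\<^esub> d"
    unfolding coset_eq using rel_add[OF _ cd] rel_diff[OF _ cd] by blast
qed

lemma rel_zero_left: "n \<in> carrier N \<Longrightarrow> frag_of (\<zero>\<^bsub>M\<^esub>, n) \<in> rels"
proof -
  interpret M: module R M by (rule left_module)
  assume "n \<in> carrier N"
  then have "- (frag_of (\<zero>\<^bsub>M\<^esub>, n)) \<in> rels"
    using rel_add_left[of "\<zero>\<^bsub>M\<^esub>" "\<zero>\<^bsub>M\<^esub>" n] by simp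
  then show ?thesis using rel_uminus by fastforce
qed

text \<open>A lower bound for the tensor product: a map into an abelian group which is bilinear and
  balanced modulo a subgroup \<open>H\<close> sends every pure tensor that vanishes into \<open>H\<close>. Working modulo
  \<open>H\<close> saves forming the quotient by \<open>H\<close>, and lets the map depend on choices of representatives.\<close>

lemma pure_tensor_zero_detect:
  fixes G :: "('g, 'h) ring_scheme"
  assumes G: "abelian_group G" and H: "subgroup H (add_monoid G)"
    and closed: "\<And>m n. m \<in> carrier M \<Longrightarrow> n \<in> carrier N \<Longrightarrow> \<beta> m n \<in> carrier G"
    and left: "\<And>m m' n. \<lbrakk>m \<in> carrier M; m' \<in> carrier M; n \<in> carrier N\<rbrakk> \<Longrightarrow>
      \<beta> (m \<oplus>\<^bsub>M\<^esub> m') n \<ominus>\<^bsub>G\<^esub> \<beta> m n \<ominus>\<^bsub>G\<^esub> \<beta> m' n \<in> H"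
    and right: "\<And>m n n'. \<lbrakk>m \<in> carrier M; n \<in> carrier N; n' \<in> carrier N\<rbrakk> \<Longrightarrow>
      \<beta> m (n \<oplus>\<^bsub>N\<^esub> n') \<ominus>\<^bsub>G\<^esub> \<beta> m n \<ominus>\<^bsub>G\<^esub> \<beta> m n' \<in> H"
    and balance: "\<And>r m n. \<lbrakk>r \<in> carrier R; m \<in> carrier M; n \<in> carrier N\<rbrakk> \<Longrightarrow>
      \<beta> (r \<odot>\<^bsub>M\<^esub> m) n \<ominus>\<^bsub>G\<^esub> \<beta> m (r \<odot>\<^bsub>N\<^esub> n) \<in> H"
    and mn: "m \<in> carrier M" "n \<in> carrier N" "frag_of (m, n) \<in> rels"
  shows "\<beta> m n \<in> H"
proof -
  interpret M: module R M by (rule left_module)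
  interpret N: module R N by (rule right_module)
  interpret G: abelian_group G by fact
  define S where "S = carrier M \<times> carrier N"
  obtain h where h: "h \<in> hom (free_Abelian_group S) (add_monoid G)"
      and hf: "\<And>x. x \<in> S \<Longrightarrow> h (frag_of x) = (\<lambda>(m, n). \<beta> m n) x"
    using comm_group.free_Abelian_group_universal[OF G.a_comm_group, of "\<lambda>(m, n). \<beta> m n" S] closed
    by (auto simp: S_def image_subset_iff)
  interpret h: group_hom "free_Abelian_group S" "add_monoid G" h
    by (rule group_hom.intro) (auto simp: group_hom_axioms_def h G.a_group)
  have hc: "h c \<in> carrier G" if "Poly_Mapping.keys c \<subseteq> S" for c
    using h.hom_closed[of c] that by simp
  have hd: "h (c - d) = h c \<ominus>\<^bsub>G\<^esub> h d"
    if "Poly_Mapping.keys c \<subseteq> S" "Poly_Mapping.keys d \<subseteq> S" for c d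
  proof -
    have "h (c + - d) = h c \<oplus>\<^bsub>G\<^esub> h (- d)"
      using h.hom_mult[of c "- d"] that by simp
    moreover have "h (- d) = \<ominus>\<^bsub>G\<^esub> h d"
      using h.hom_inv[of d] that by (simp add: a_inv_def)
    ultimately show ?thesis by (simp add: a_minus_def)
  qed
  have kd: "Poly_Mapping.keys (a - b) \<subseteq> S"
    if "Poly_Mapping.keys a \<subseteq> S" "Poly_Mapping.keys b \<subseteq> S" for a b :: "'m \<times> 'n \<Rightarrow>\<^sub>0 int"
    using keys_diff[of a b] that by blast
  have "h c \<in> H" if "c \<in> rels" for c
  proof -
    have "Poly_Mapping.keys c \<subseteq> carrier M \<times> carrier N \<and> h c \<in> H"
      using that
    proof (induction rule: rel_induct)
      case zero
      then show ?case using h.hom_one subgroup.one_closed[OF H] by simp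
    next
      case (diff c d)
      then have "h c \<oplus>\<^bsub>G\<^esub> (\<ominus>\<^bsub>G\<^esub> h d) \<in> H"
        using subgroup.m_closed[OF H] subgroup.m_inv_closed[OF H] by (simp add: a_inv_def)
      then show ?case using diff by (simp add: hd S_def a_minus_def)
    qed (use left right balance in \<open>auto simp: hd hf S_def keys_frag_of kd[unfolded S_def]\<close>)
    then show ?thesis ..
  qed
  from this[OF mn(3)] show ?thesis using hf[of "(m, n)"] mn by (simp add: S_def)
qed

end

locale algebra_pair =
  fixes R :: "('r, 'k) ring_scheme" (structure) and M :: "('r, 'm, 'p) module_scheme"
    and N :: "('r, 'n, 'q) module_scheme"
  assumes left_algebra: "algebra R M" and right_algebra: "algebra R N"

sublocale algebra_pair \<subseteq> module_pair
  by (intro module_pair.intro algebra.module left_algebra right_algebra)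

context algebra_pair
begin

abbreviation F where "F \<equiv> free_pairs M N"

lemma carrier_F: "c \<in> carrier F \<longleftrightarrow> Poly_Mapping.keys c \<subseteq> carrier M \<times> carrier N"
  by (simp add: free_pairs_def)

lemma F_add: "c \<oplus>\<^bsub>F\<^esub> d = c + d" and F_zero: "\<zero>\<^bsub>F\<^esub> = 0"
  and F_one: "\<one>\<^bsub>F\<^esub> = frag_of (\<one>\<^bsub>M\<^esub>, \<one>\<^bsub>N\<^esub>)"
  by (simp_all add: free_pairs_def)

lemma F_mult_of: "frag_of (m, n) \<otimes>\<^bsub>F\<^esub> frag_of (m', n') = frag_of (m \<otimes>\<^bsub>M\<^esub> m', n \<otimes>\<^bsub>N\<^esub> n')"
  by (simp add: free_pairs_def)

lemma F_mult_diff_left: "(c - c') \<otimes>\<^bsub>F\<^esub> d = c \<otimes>\<^bsub>F\<^esub> d - c' \<otimes>\<^bsub>F\<^esub> d"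
  by (simp add: free_pairs_def frag_extend_diff)

lemma F_mult_diff_right: "c \<otimes>\<^bsub>F\<^esub> (d - d') = c \<otimes>\<^bsub>F\<^esub> d - c \<otimes>\<^bsub>F\<^esub> d'"
  by (induction c rule: frag_induction[OF subset_UNIV])
    (auto simp: free_pairs_def frag_extend_diff)

lemma F_mult_zero: "0 \<otimes>\<^bsub>F\<^esub> d = 0" "c \<otimes>\<^bsub>F\<^esub> 0 = 0"
  using F_mult_diff_left[of 0 0 d] F_mult_diff_right[of c 0 0] by simp_all

lemma F_closed_diff: "c \<in> carrier F \<Longrightarrow> d \<in> carrier F \<Longrightarrow> c - d \<in> carrier F"
  unfolding carrier_F using keys_diff[of c d] by blast

lemma F_closed_of: "frag_of (m, n) \<in> carrier F \<longleftrightarrow> m \<in> carrier M \<and> n \<in> carrier N"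
  unfolding carrier_F by (simp add: keys_frag_of)

text \<open>Since multiplication in \<open>F\<close> is additive in each factor, the ring laws of \<open>F\<close> follow by this
  induction from those for single pairs.\<close>

lemma F_induct [consumes 1, case_names zero of diff]:
  assumes "c \<in> carrier F" and "P 0"
    and "\<And>m n. m \<in> carrier M \<Longrightarrow> n \<in> carrier N \<Longrightarrow> P (frag_of (m, n))"
    and "\<And>c d. \<lbrakk>c \<in> carrier F; d \<in> carrier F; P c; P d\<rbrakk> \<Longrightarrow> P (c - d)"
  shows "P c"
  using assms(1)[unfolded carrier_F]
  by (rule free_Abelian_group_induct) (use assms in \<open>auto simp: carrier_F\<close>)

lemma F_closed_mult:
  assumes "c \<in> carrier F" "d \<in> carrier F" shows "c \<otimes>\<^bsub>F\<^esub> d \<in> carrier F"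
proof -
  interpret M: algebra R M by (rule left_algebra)
  interpret N: algebra R N by (rule right_algebra)
  have z: "0 \<in> carrier F" by (simp add: carrier_F)
  show ?thesis using assms(1)
  proof (induction rule: F_induct)
    case (of m n)
    show ?case using assms(2)
      by (induction rule: F_induct)
        (auto simp: F_mult_of F_closed_of of F_mult_diff_right F_mult_zero F_closed_diff z)
  qed (auto simp: F_mult_zero F_mult_diff_left F_closed_diff z)
qed

lemma F_add_diff: "c + d = c - (0 - d)" for c d :: "'m \<times> 'n \<Rightarrow>\<^sub>0 int"
  by simp

theorem free_pairs_cring: "cring F"
proof -
  interpret M: algebra R M by (rule left_algebra)
  interpret N: algebra R N by (rule right_algebra)
  have z: "0 \<in> carrier F" by (simp add: carrier_F)
  have comm: "c \<otimes>\<^bsub>F\<^esub> d = d \<otimes>\<^bsub>F\<^esub> c" if "c \<in> carrier F" "d \<in> carrier F" for c d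
    using that(1)
  proof (induction rule: F_induct)
    case (of m n)
    show ?case using that(2)
      by (induction rule: F_induct)
        (auto simp: F_mult_of of F_mult_diff_right F_mult_diff_left F_mult_zero M.m_comm N.m_comm)
  qed (auto simp: F_mult_zero F_mult_diff_left F_mult_diff_right)
  have assoc: "c \<otimes>\<^bsub>F\<^esub> d \<otimes>\<^bsub>F\<^esub> e = c \<otimes>\<^bsub>F\<^esub> (d \<otimes>\<^bsub>F\<^esub> e)"
    if "c \<in> carrier F" "d \<in> carrier F" "e \<in> carrier F" for c d e
    using that(1)
  proof (induction rule: F_induct)
    case 1: (of m n)
    show ?case using that(2)
    proof (induction rule: F_induct)
      case 2: (of m' n')
      show ?case using that(3)
        by (induction rule: F_induct)
          (auto simp: F_mult_of 1 2 F_mult_diff_right F_mult_zero M.m_assoc N.m_assoc)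
    qed (auto simp: F_mult_zero F_mult_diff_left F_mult_diff_right)
  qed (auto simp: F_mult_zero F_mult_diff_left F_mult_diff_right)
  have one: "\<one>\<^bsub>F\<^esub> \<otimes>\<^bsub>F\<^esub> c = c" if "c \<in> carrier F" for c
    using that by (induction rule: F_induct)
      (auto simp: F_one F_mult_of F_mult_zero F_mult_diff_right)
  have distr: "(c + c') \<otimes>\<^bsub>F\<^esub> d = c \<otimes>\<^bsub>F\<^esub> d + c' \<otimes>\<^bsub>F\<^esub> d" for c c' d
    unfolding F_add_diff F_mult_diff_left F_mult_zero ..
  have neg: "- c \<in> carrier F" if "c \<in> carrier F" for c
    using F_closed_diff[OF z that] by simp
  have add: "c + d \<in> carrier F" if "c \<in> carrier F" "d \<in> carrier F" for c d
    using F_closed_diff[OF that(1) neg[OF that(2)]] by simp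
  have "abelian_group F"
    by (rule abelian_groupI) (auto simp: F_add F_zero z add ac_simps intro!: bexI[OF _ neg])
  moreover have "Group.comm_monoid F"
  proof (rule comm_monoidI)
    show "\<one>\<^bsub>F\<^esub> \<in> carrier F" by (simp add: F_one F_closed_of)
  qed (fact F_closed_mult assoc one comm)+
  ultimately show ?thesis
    by (rule cringI) (simp add: F_add distr)
qed

theorem rel_ideal: "ideal rels F"
proof -
  interpret M: algebra R M by (rule left_algebra)
  interpret N: algebra R N by (rule right_algebra)
  interpret F: cring F by (rule free_pairs_cring)
  have sub: "subgroup rels (add_monoid F)"
  proof -
    have "add_monoid F = free_Abelian_group (carrier M \<times> carrier N)"
      by (simp add: free_pairs_def free_Abelian_group_def)
    then show ?thesis using rel_subgroup by simp
  qed
  have l: "c \<otimes>\<^bsub>F\<^esub> d \<in> rels" if "d \<in> rels" "c \<in> carrier F" for c d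
    using that(2)
  proof (induction rule: F_induct)
    case 1: (of m n)
    have "Poly_Mapping.keys d \<subseteq> carrier M \<times> carrier N \<and> frag_of (m, n) \<otimes>\<^bsub>F\<^esub> d \<in> rels"
      using that(1)
    proof (induction rule: rel_induct)
      case (add_left m1 m2 n1)
      then show ?case
        using 1 rel_add_left[of "m \<otimes>\<^bsub>M\<^esub> m1" "m \<otimes>\<^bsub>M\<^esub> m2" "n \<otimes>\<^bsub>N\<^esub> n1"]
        by (simp add: F_mult_diff_right F_mult_of M.r_distr)
    next
      case (add_right m1 n1 n2)
      then show ?case
        using 1 rel_add_right[of "m \<otimes>\<^bsub>M\<^esub> m1" "n \<otimes>\<^bsub>N\<^esub> n1" "n \<otimes>\<^bsub>N\<^esub> n2"]
        by (simp add: F_mult_diff_right F_mult_of N.r_distr)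
    next
      case (balance r m1 n1)
      have "m \<otimes>\<^bsub>M\<^esub> (r \<odot>\<^bsub>M\<^esub> m1) = r \<odot>\<^bsub>M\<^esub> (m \<otimes>\<^bsub>M\<^esub> m1)" "n \<otimes>\<^bsub>N\<^esub> (r \<odot>\<^bsub>N\<^esub> n1) = r \<odot>\<^bsub>N\<^esub> (n \<otimes>\<^bsub>N\<^esub> n1)"
        using 1 balance M.smult_assoc2[of r m1 m] N.smult_assoc2[of r n1 n]
          M.m_comm[of m "r \<odot>\<^bsub>M\<^esub> m1"] M.m_comm[of m m1] N.m_comm[of n "r \<odot>\<^bsub>N\<^esub> n1"] N.m_comm[of n n1]
        by simp_all
      with 1 balance show ?case
        using rel_balance[of r "m \<otimes>\<^bsub>M\<^esub> m1" "n \<otimes>\<^bsub>N\<^esub> n1"]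
        by (simp add: F_mult_diff_right F_mult_of)
    qed (auto simp: F_mult_zero F_mult_diff_right rel_zero rel_diff)
    then show ?case ..
  qed (auto simp: F_mult_zero F_mult_diff_left rel_zero rel_diff)
  have c: "d \<in> carrier F" if "d \<in> rels" for d
    using rel_keys[OF that] by (simp add: carrier_F)
  show ?thesis
  proof (rule idealI)
    fix d c assume "d \<in> rels" "c \<in> carrier F"
    then show "c \<otimes>\<^bsub>F\<^esub> d \<in> rels" "d \<otimes>\<^bsub>F\<^esub> c \<in> rels"
      using l[of d c] by (simp_all only: F.m_comm[OF c])
  qed (rule F.ring_axioms sub)+
qed

abbreviation T where "T \<equiv> tensor R M N"
abbreviation pure where "pure \<equiv> pure_tensor R M N"

lemma tensor_cring: "cring T"
  unfolding tensor_def by (rule ideal.quotient_is_cring[OF rel_ideal free_pairs_cring])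

lemma proj_hom: "(+>\<^bsub>F\<^esub>) rels \<in> ring_hom F T"
  unfolding tensor_def by (rule ideal.rcos_ring_hom[OF rel_ideal])

lemma pure_closed: "m \<in> carrier M \<Longrightarrow> n \<in> carrier N \<Longrightarrow> pure m n \<in> carrier T"
  unfolding pure_tensor_def by (rule ring_hom_closed[OF proj_hom]) (simp add: F_closed_of)

lemma pure_mult:
  assumes "m \<in> carrier M" "n \<in> carrier N" "m' \<in> carrier M" "n' \<in> carrier N"
  shows "pure m n \<otimes>\<^bsub>T\<^esub> pure m' n' = pure (m \<otimes>\<^bsub>M\<^esub> m') (n \<otimes>\<^bsub>N\<^esub> n')"
  using ring_hom_mult[OF proj_hom, of "frag_of (m, n)" "frag_of (m', n')"] assms
  by (simp add: pure_tensor_def F_closed_of F_mult_of)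

lemma pure_one: "pure \<one>\<^bsub>M\<^esub> \<one>\<^bsub>N\<^esub> = \<one>\<^bsub>T\<^esub>"
  using ring_hom_one[OF proj_hom] by (simp add: pure_tensor_def F_one)

lemma tensor_zero: "\<zero>\<^bsub>T\<^esub> = rels +>\<^bsub>F\<^esub> 0"
  by (simp add: tensor_def FactRing_def coset_eq)

lemma pure_add_left:
  assumes "m \<in> carrier M" "m' \<in> carrier M" "n \<in> carrier N"
  shows "pure (m \<oplus>\<^bsub>M\<^esub> m') n = pure m n \<oplus>\<^bsub>T\<^esub> pure m' n"
  using ring_hom_add[OF proj_hom, of "frag_of (m, n)" "frag_of (m', n)"] assms
    coset_eq_iff[of "frag_of (m \<oplus>\<^bsub>M\<^esub> m', n)" "frag_of (m, n) + frag_of (m', n)"] rel_add_left[OF assms]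
  by (simp add: pure_tensor_def F_closed_of F_add diff_diff_eq)

lemma pure_add_right:
  assumes "m \<in> carrier M" "n \<in> carrier N" "n' \<in> carrier N"
  shows "pure m (n \<oplus>\<^bsub>N\<^esub> n') = pure m n \<oplus>\<^bsub>T\<^esub> pure m n'"
  using ring_hom_add[OF proj_hom, of "frag_of (m, n)" "frag_of (m, n')"] assms
    coset_eq_iff[of "frag_of (m, n \<oplus>\<^bsub>N\<^esub> n')" "frag_of (m, n) + frag_of (m, n')"] rel_add_right[OF assms]
  by (simp add: pure_tensor_def F_closed_of F_add diff_diff_eq)

lemma pure_balance:
  "\<lbrakk>r \<in> carrier R; m \<in> carrier M; n \<in> carrier N\<rbrakk> \<Longrightarrow> pure (r \<odot>\<^bsub>M\<^esub> m) n = pure m (r \<odot>\<^bsub>N\<^esub> n)"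
  by (simp add: pure_tensor_def coset_eq_iff rel_balance)

lemma pure_eq_zero_iff: "pure m n = \<zero>\<^bsub>T\<^esub> \<longleftrightarrow> frag_of (m, n) \<in> rels"
  unfolding pure_tensor_def tensor_zero coset_eq_iff by simp

lemma tensor_induct [consumes 1, case_names pure minus]:
  assumes "x \<in> carrier T"
    and pure: "\<And>m n. m \<in> carrier M \<Longrightarrow> n \<in> carrier N \<Longrightarrow> P (pure m n)"
    and minus: "\<And>x y. \<lbrakk>x \<in> carrier T; y \<in> carrier T; P x; P y\<rbrakk> \<Longrightarrow> P (x \<ominus>\<^bsub>T\<^esub> y)"
  shows "P x"
proof -
  interpret M: algebra R M by (rule left_algebra)
  interpret N: algebra R N by (rule right_algebra)
  interpret F: cring F by (rule free_pairs_cring)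
  interpret T: cring T by (rule tensor_cring)
  have ph: "ring_hom_cring F T ((+>\<^bsub>F\<^esub>) rels)"
    by (intro ring_hom_cring.intro ring_hom_cring_axioms.intro proj_hom free_pairs_cring tensor_cring)
  from assms(1) obtain c where c: "c \<in> carrier F" "x = rels +>\<^bsub>F\<^esub> c"
    by (auto simp: tensor_def FactRing_def A_RCOSETS_def')
  have "P (rels +>\<^bsub>F\<^esub> c)"
    using c(1)
  proof (induction rule: F_induct)
    case zero
    have "P (pure \<zero>\<^bsub>M\<^esub> \<zero>\<^bsub>N\<^esub>)" by (rule pure) auto
    moreover have "pure \<zero>\<^bsub>M\<^esub> \<zero>\<^bsub>N\<^esub> = rels +>\<^bsub>F\<^esub> 0"
      using rel_zero_left[of "\<zero>\<^bsub>N\<^esub>"] unfolding tensor_zero[symmetric] pure_eq_zero_iff by simp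
    ultimately show ?case by simp
  next
    case (diff c d)
    have "rels +>\<^bsub>F\<^esub> (c - d) = (rels +>\<^bsub>F\<^esub> c) \<ominus>\<^bsub>T\<^esub> (rels +>\<^bsub>F\<^esub> d)"
    proof -
      have "- d \<in> carrier F" "- d \<oplus>\<^bsub>F\<^esub> d = \<zero>\<^bsub>F\<^esub>"
        using diff(2) by (simp_all add: carrier_F F_add F_zero)
      then have "\<ominus>\<^bsub>F\<^esub> d = - d"
        using diff(2) by (intro F.minus_equality)
      then have "c - d = c \<oplus>\<^bsub>F\<^esub> \<ominus>\<^bsub>F\<^esub> d" by (simp add: F_add)
      then show ?thesis using diff(1,2) ring_hom_add[OF proj_hom, of c "\<ominus>\<^bsub>F\<^esub> d"]
          ring_hom_cring.hom_a_inv[OF ph diff(2)]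
        by (simp add: a_minus_def)
    qed
    then show ?case using minus[OF ring_hom_closed[OF proj_hom] ring_hom_closed[OF proj_hom], OF diff] by simp
  qed (use pure in \<open>simp add: pure_tensor_def\<close>)
  then show ?thesis using c by simp
qed

end

section \<open>Colon ideals in flat modules\<close>

text \<open>The class of \<open>v\<close> in \<open>(R / rR)\<^sup>k\<close>: all functions which agree with \<open>v\<close> modulo \<open>r\<close> at the
  indices below \<open>k\<close>; the values elsewhere are arbitrary.\<close>

definition vec_class :: "('r, 'k) ring_scheme \<Rightarrow> 'r \<Rightarrow> nat \<Rightarrow> (nat \<Rightarrow> 'r) \<Rightarrow> (nat \<Rightarrow> 'r) set" where
  "vec_class R r k v = {w. \<forall>i<k. w i \<in> PIdl\<^bsub>R\<^esub> r +>\<^bsub>R\<^esub> v i}"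

definition vec_rep :: "('r, 'k) ring_scheme \<Rightarrow> 'r \<Rightarrow> nat \<Rightarrow> (nat \<Rightarrow> 'r) set \<Rightarrow> (nat \<Rightarrow> 'r)" where
  "vec_rep R r k U = (SOME v. (\<forall>i. v i \<in> carrier R) \<and> U = vec_class R r k v)"

text \<open>The \<open>R\<close>-module \<open>(R / rR)\<^sup>k\<close>; the operations go through chosen representatives.\<close>

definition vec_quot :: "('r, 'k) ring_scheme \<Rightarrow> 'r \<Rightarrow> nat \<Rightarrow> ('r, (nat \<Rightarrow> 'r) set) module" where
  "vec_quot R r k =
     \<lparr>carrier = vec_class R r k ` {v. \<forall>i. v i \<in> carrier R}, monoid.mult = (\<lambda>U V. U), monoid.one = {},
      ring.zero = vec_class R r k (\<lambda>_. \<zero>\<^bsub>R\<^esub>),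
      ring.add = (\<lambda>U V. vec_class R r k (\<lambda>i. vec_rep R r k U i \<oplus>\<^bsub>R\<^esub> vec_rep R r k V i)),
      smult = (\<lambda>a U. vec_class R r k (\<lambda>i. a \<otimes>\<^bsub>R\<^esub> vec_rep R r k U i))\<rparr>"

context cring
begin

context
  fixes r :: 'a and k :: nat
  assumes r: "r \<in> carrier R"
begin

private abbreviation cl where "cl \<equiv> vec_class R r k"
private abbreviation N where "N \<equiv> vec_quot R r k"

private lemma J: "ideal (PIdl r) R"
  using r by (rule cgenideal_ideal)

lemma vec_class_eq_iff:
  assumes "\<forall>i. v i \<in> carrier R" "\<forall>i. w i \<in> carrier R"
  shows "cl v = cl w \<longleftrightarrow> (\<forall>i<k. v i \<ominus> w i \<in> PIdl r)"
proof -
  interpret J: ideal "PIdl r" R by (rule J)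
  have "cl v = cl w \<longleftrightarrow> (\<forall>i<k. PIdl r +> v i = PIdl r +> w i)"
  proof
    assume "cl v = cl w"
    moreover have "v \<in> cl v" using assms J.a_rcos_self by (auto simp: vec_class_def)
    ultimately have "\<forall>i<k. v i \<in> PIdl r +> w i" by (auto simp: vec_class_def)
    then show "\<forall>i<k. PIdl r +> v i = PIdl r +> w i"
      using assms J.a_repr_independence' by blast
  qed (auto simp: vec_class_def)
  then show ?thesis using assms by (simp add: quotient_eq_iff_same_a_r_cos[OF J])
qed

lemma vec_rep_class:
  assumes "\<forall>i. v i \<in> carrier R"
  shows "\<forall>i. vec_rep R r k (cl v) i \<in> carrier R" "cl (vec_rep R r k (cl v)) = cl v"
  using someI[of "\<lambda>w. (\<forall>i. w i \<in> carrier R) \<and> cl v = cl w" v] assms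
  unfolding vec_rep_def by auto

lemma vec_add:
  assumes "\<forall>i. v i \<in> carrier R" "\<forall>i. w i \<in> carrier R"
  shows "cl v \<oplus>\<^bsub>N\<^esub> cl w = cl (\<lambda>i. v i \<oplus> w i)"
proof -
  interpret J: ideal "PIdl r" R by (rule J)
  let ?v = "vec_rep R r k (cl v)" and ?w = "vec_rep R r k (cl w)"
  note rv = vec_rep_class[OF assms(1)] and rw = vec_rep_class[OF assms(2)]
  have e: "?v i \<ominus> v i \<in> PIdl r" "?w i \<ominus> w i \<in> PIdl r" if "i < k" for i
    using rv rw assms that by (auto simp: vec_class_eq_iff)
  have "cl (\<lambda>i. ?v i \<oplus> ?w i) = cl (\<lambda>i. v i \<oplus> w i)"
  proof (subst vec_class_eq_iff; (intro allI impI)?)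
    fix i assume i: "i < k"
    have c: "?v i \<in> carrier R" "?w i \<in> carrier R" "v i \<in> carrier R" "w i \<in> carrier R"
      using rv rw assms by auto
    then have "?v i \<oplus> ?w i \<ominus> (v i \<oplus> w i) = (?v i \<ominus> v i) \<oplus> (?w i \<ominus> w i)"
      by algebra
    then show "?v i \<oplus> ?w i \<ominus> (v i \<oplus> w i) \<in> PIdl r"
      using J.a_closed[OF e[OF i]] by simp
  qed (use rv rw assms in auto)
  then show ?thesis by (simp add: vec_quot_def)
qed

lemma vec_smult:
  assumes "a \<in> carrier R" "\<forall>i. v i \<in> carrier R"
  shows "a \<odot>\<^bsub>N\<^esub> cl v = cl (\<lambda>i. a \<otimes> v i)"
proof -
  interpret J: ideal "PIdl r" R by (rule J)
  let ?v = "vec_rep R r k (cl v)"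
  note rv = vec_rep_class[OF assms(2)]
  have e: "?v i \<ominus> v i \<in> PIdl r" if "i < k" for i
    using rv assms that by (auto simp: vec_class_eq_iff)
  have "cl (\<lambda>i. a \<otimes> ?v i) = cl (\<lambda>i. a \<otimes> v i)"
  proof (subst vec_class_eq_iff; (intro allI impI)?)
    fix i assume i: "i < k"
    have c: "?v i \<in> carrier R" "v i \<in> carrier R"
      using rv assms by auto
    then have "a \<otimes> ?v i \<ominus> a \<otimes> v i = a \<otimes> (?v i \<ominus> v i)"
      using assms(1) by algebra
    then show "a \<otimes> ?v i \<ominus> a \<otimes> v i \<in> PIdl r"
      using J.I_l_closed[OF e[OF i] assms(1)] by simp
  qed (use rv assms in auto)
  then show ?thesis by (simp add: vec_quot_def)
qed

lemma vec_carrier: "\<forall>i. v i \<in> carrier R \<Longrightarrow> cl v \<in> carrier N"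
  by (auto simp: vec_quot_def)

lemma vec_zero: "\<zero>\<^bsub>N\<^esub> = cl (\<lambda>_. \<zero>)"
  by (simp add: vec_quot_def)

lemma vec_cases:
  assumes "U \<in> carrier N" obtains v where "\<forall>i. v i \<in> carrier R" "U = cl v"
  using assms by (auto simp: vec_quot_def)

lemma vec_quot_module: "module R N"
proof (rule moduleI)
  show "cring R" by (rule is_cring)
  show "abelian_group N"
  proof (rule abelian_groupI)
    fix U assume "U \<in> carrier N"
    then obtain v where v: "\<forall>i. v i \<in> carrier R" "U = cl v" by (rule vec_cases)
    then have "cl (\<lambda>i. \<ominus> v i) \<oplus>\<^bsub>N\<^esub> U = \<zero>\<^bsub>N\<^esub>"
      by (simp add: vec_add vec_zero l_neg)
    then show "\<exists>V\<in>carrier N. V \<oplus>\<^bsub>N\<^esub> U = \<zero>\<^bsub>N\<^esub>"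
      using v vec_carrier[of "\<lambda>i. \<ominus> v i"] by auto
  qed (auto elim!: vec_cases simp: vec_add vec_zero vec_carrier a_ac)
qed (auto elim!: vec_cases simp: vec_add vec_smult vec_carrier l_distr r_distr m_assoc)

end

end

text \<open>
  The consequence of flatness that is used: if \<open>s\<^sub>0 x, ..., s\<^sub>k\<^sub>-\<^sub>1 x\<close> all lie in \<open>r A\<close>, then \<open>x\<close> lies
  in \<open>\<aa> A\<close>, where \<open>\<aa>\<close> is the colon ideal \<open>(r : s\<^sub>0, ..., s\<^sub>k\<^sub>-\<^sub>1)\<close> of \<open>R\<close>. Indeed \<open>R / \<aa>\<close> embeds into
  \<open>(R / rR)\<^sup>k\<close> as the submodule generated by the class of \<open>s\<close>, and tensoring with \<open>A\<close> preserves this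
  inclusion. The submodule \<open>\<aa> A\<close> is replaced by any subgroup \<open>H\<close> which contains it.
\<close>

theorem flat_colon:
  fixes R :: "('r, 'k) ring_scheme" (structure) and A :: "('r, 'a, 'p) module_scheme"
    and k :: nat
  assumes flat: "flat_module R A"
    and r: "r \<in> carrier R" and s: "\<And>j. s j \<in> carrier R" and x: "x \<in> carrier A"
    and sx: "\<And>j. j < k \<Longrightarrow> \<exists>y\<in>carrier A. s j \<odot>\<^bsub>A\<^esub> x = r \<odot>\<^bsub>A\<^esub> y"
    and H: "subgroup H (add_monoid A)"
    and colon: "\<And>a y. \<lbrakk>a \<in> carrier R; \<And>j. j < k \<Longrightarrow> \<exists>b\<in>carrier R. s j \<otimes> a = r \<otimes> b; y \<in> carrier A\<rbrakk>
      \<Longrightarrow> a \<odot>\<^bsub>A\<^esub> y \<in> H"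
  shows "x \<in> H"
proof -
  interpret A: module R A using flat by (simp add: flat_module_def)
  define N where "N = vec_quot R r k"
  let ?cl = "vec_class R r k"
  interpret N: module R N unfolding N_def using r by (rule A.vec_quot_module)
  note add = A.vec_add[OF r, of _ _ k, folded N_def] and smult = A.vec_smult[OF r, of _ _ k, folded N_def]
    and zero = A.vec_zero[OF r, of k, folded N_def] and cls = A.vec_carrier[OF r, of _ k, folded N_def]
    and eq = A.vec_class_eq_iff[OF r, of _ _ k]
  define M where "M = N\<lparr>carrier := {?cl (\<lambda>i. a \<otimes> s i) | a. a \<in> carrier R}\<rparr>"
  have Msub: "carrier M \<subseteq> carrier N"
    using s by (auto simp: M_def intro!: cls)
  have Msm: "submodule {?cl (\<lambda>i. a \<otimes> s i) | a. a \<in> carrier R} R N"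
  proof (rule N.submoduleI)
    show "{?cl (\<lambda>i. a \<otimes> s i) | a. a \<in> carrier R} \<subseteq> carrier N"
      using s by (auto intro!: cls)
    show "\<zero>\<^bsub>N\<^esub> \<in> {?cl (\<lambda>i. a \<otimes> s i) | a. a \<in> carrier R}"
      using s by (auto simp: zero intro!: exI[of _ "\<zero>"])
  next
    fix U assume "U \<in> {?cl (\<lambda>i. a \<otimes> s i) | a. a \<in> carrier R}"
    then obtain a where a: "a \<in> carrier R" "U = ?cl (\<lambda>i. a \<otimes> s i)" by auto
    have "?cl (\<lambda>i. \<ominus> a \<otimes> s i) \<oplus>\<^bsub>N\<^esub> U = \<zero>\<^bsub>N\<^esub>"
      using a s by (simp add: add zero A.R.l_minus A.R.l_neg)
    then have "\<ominus>\<^bsub>N\<^esub> U = ?cl (\<lambda>i. \<ominus> a \<otimes> s i)"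
      using a s by (intro N.minus_equality) (auto intro!: cls)
    then show "\<ominus>\<^bsub>N\<^esub> U \<in> {?cl (\<lambda>i. a \<otimes> s i) | a. a \<in> carrier R}"
      using a by (auto intro!: exI[of _ "\<ominus> a"])
  next
    fix U V assume "U \<in> {?cl (\<lambda>i. a \<otimes> s i) | a. a \<in> carrier R}"
      "V \<in> {?cl (\<lambda>i. a \<otimes> s i) | a. a \<in> carrier R}"
    then obtain a b where "a \<in> carrier R" "U = ?cl (\<lambda>i. a \<otimes> s i)"
       "b \<in> carrier R" "V = ?cl (\<lambda>i. b \<otimes> s i)" by auto
    then show "U \<oplus>\<^bsub>N\<^esub> V \<in> {?cl (\<lambda>i. a \<otimes> s i) | a. a \<in> carrier R}"
      using s by (auto simp: add A.l_distr intro!: exI[of _ "a \<oplus> b"])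
  next
    fix b U assume "b \<in> carrier R" "U \<in> {?cl (\<lambda>i. a \<otimes> s i) | a. a \<in> carrier R}"
    then obtain a where "a \<in> carrier R" "U = ?cl (\<lambda>i. a \<otimes> s i)" "b \<in> carrier R" by auto
    then show "b \<odot>\<^bsub>N\<^esub> U \<in> {?cl (\<lambda>i. a \<otimes> s i) | a. a \<in> carrier R}"
      using s by (auto simp: smult A.m_assoc intro!: exI[of _ "b \<otimes> a"])
  qed
  have Mmod: "module R M"
    unfolding M_def by (rule submodule.submodule_is_module[OF Msm N.module_axioms])
  interpret M: module R M by (rule Mmod)
  interpret MA: module_pair R M A by (intro module_pair.intro Mmod A.module_axioms)
  interpret NA: module_pair R N A by (intro module_pair.intro N.module_axioms A.module_axioms)
  have Mops: "(\<oplus>\<^bsub>M\<^esub>) = (\<oplus>\<^bsub>N\<^esub>)" "(\<odot>\<^bsub>M\<^esub>) = (\<odot>\<^bsub>N\<^esub>)"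
    by (simp_all add: M_def)
  have relMN: "c \<in> NA.rels" if "c \<in> MA.rels" for c
  proof -
    have "Poly_Mapping.keys c \<subseteq> carrier M \<times> carrier A \<and> c \<in> NA.rels"
      using that
      by (induction rule: MA.rel_induct)
        (auto simp: Mops subsetD[OF Msub] NA.rel_zero NA.rel_diff NA.rel_add_left NA.rel_add_right
          NA.rel_balance)
    then show ?thesis ..
  qed
  have map: "tensor_map R M N A (\<lambda>U. U) (MA.rels +>\<^bsub>free_pairs M A\<^esub> c) = NA.rels +>\<^bsub>free_pairs N A\<^esub> c" for c
  proof -
    have f: "(\<lambda>(m, a). frag_of (m, a)) = (frag_of :: (nat \<Rightarrow> 'r) set \<times> 'a \<Rightarrow> _)" by auto
    have "NA.rels +>\<^bsub>free_pairs N A\<^esub> c' = NA.rels +>\<^bsub>free_pairs N A\<^esub> c"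
      if "c' \<in> MA.rels +>\<^bsub>free_pairs M A\<^esub> c" for c'
      using that relMN by (auto simp: MA.coset_eq NA.coset_eq_iff)
    moreover have "c \<in> MA.rels +>\<^bsub>free_pairs M A\<^esub> c"
      using MA.rel_zero by (auto simp: MA.coset_eq intro!: exI[of _ 0])
    ultimately show ?thesis
      unfolding tensor_map_def f frag_expansion[symmetric] by blast
  qed
  let ?s = "?cl s"
  have sM: "?s \<in> carrier M"
    using s by (auto simp: M_def intro!: exI[of _ "\<one>"])
  \<comment> \<open>The coordinates of \<open>s\<close> are added one at a time; each one contributes \<open>e\<^sub>j \<otimes> s\<^sub>j x = r e\<^sub>j \<otimes> y\<close>.\<close>
  have part: "frag_of (?cl (\<lambda>i. if i < l then s i else \<zero>), x) \<in> NA.rels" if "l \<le> k" for l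
    using that
  proof (induction l)
    case 0
    then show ?case using NA.rel_zero_left[OF x] by (simp add: zero)
  next
    case (Suc l)
    let ?v = "\<lambda>i. if i < l then s i else \<zero>" and ?e = "\<lambda>i. if i = l then \<one> else \<zero>"
    let ?se = "\<lambda>i. s l \<otimes> ?e i"
    obtain y where y: "y \<in> carrier A" "s l \<odot>\<^bsub>A\<^esub> x = r \<odot>\<^bsub>A\<^esub> y"
      using sx[of l] Suc by auto
    have c: "?cl ?v \<in> carrier N" "?cl ?e \<in> carrier N" "?cl ?se \<in> carrier N"
      using s by (auto intro!: cls)
    have "(\<lambda>i. ?v i \<oplus> ?se i) = (\<lambda>i. if i < Suc l then s i else \<zero>)"
      using s by (auto simp: fun_eq_iff less_Suc_eq)
    then have sum: "?cl ?v \<oplus>\<^bsub>N\<^esub> ?cl ?se = ?cl (\<lambda>i. if i < Suc l then s i else \<zero>)"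
      using add[of ?v ?se] s by simp
    have 1: "frag_of (?cl ?v \<oplus>\<^bsub>N\<^esub> ?cl ?se, x) - frag_of (?cl ?v, x) - frag_of (?cl ?se, x) \<in> NA.rels"
      using c x by (intro NA.rel_add_left)
    have 2: "frag_of (?cl ?se, x) - frag_of (?cl ?e, r \<odot>\<^bsub>A\<^esub> y) \<in> NA.rels"
      using NA.rel_balance[of "s l" "?cl ?e" x] c x s y smult[of "s l" ?e] by simp
    have 3: "frag_of (?cl (\<lambda>i. r \<otimes> ?e i), y) - frag_of (?cl ?e, r \<odot>\<^bsub>A\<^esub> y) \<in> NA.rels"
      using NA.rel_balance[of r "?cl ?e" y] c y r smult[of r ?e] by simp
    have "?cl (\<lambda>i. r \<otimes> ?e i) = \<zero>\<^bsub>N\<^esub>"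
    proof -
      interpret J: ideal "PIdl r" R using r by (rule A.cgenideal_ideal)
      have "r \<otimes> ?e i \<ominus> \<zero> \<in> PIdl r" for i
        using r A.cgenideal_self[OF r] by (auto simp: a_minus_def)
      then show ?thesis using r by (subst zero, subst eq) auto
    qed
    then have 4: "frag_of (?cl (\<lambda>i. r \<otimes> ?e i), y) \<in> NA.rels"
      using NA.rel_zero_left[OF y(1)] by simp
    have 5: "frag_of (?cl ?v, x) \<in> NA.rels" using Suc by simp
    have 6: "frag_of (?cl ?e, r \<odot>\<^bsub>A\<^esub> y) \<in> NA.rels" using NA.rel_diff[OF 4 3] by simp
    have 7: "frag_of (?cl ?se, x) \<in> NA.rels" using NA.rel_add[OF 2 6] by simp
    have "frag_of (?cl ?v \<oplus>\<^bsub>N\<^esub> ?cl ?se, x) \<in> NA.rels"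
      using NA.rel_add[OF NA.rel_add[OF 1 5] 7] by simp
    then show ?case by (simp add: sum)
  qed
  have "frag_of (?s, x) \<in> NA.rels"
  proof -
    have "?cl (\<lambda>i. if i < k then s i else \<zero>) = ?s"
      by (simp add: vec_class_def cong: imp_cong)
    then show ?thesis using part[of k] by simp
  qed
  then have "NA.rels +>\<^bsub>free_pairs N A\<^esub> frag_of (?s, x) = NA.rels +>\<^bsub>free_pairs N A\<^esub> 0"
    by (simp add: NA.coset_eq_iff)
  then have map_eq: "tensor_map R M N A (\<lambda>U. U) (MA.rels +>\<^bsub>free_pairs M A\<^esub> frag_of (?s, x))
      = tensor_map R M N A (\<lambda>U. U) (MA.rels +>\<^bsub>free_pairs M A\<^esub> 0)"
    by (simp only: map)
  have map_inj: "inj_on (tensor_map R M N A (\<lambda>U. U)) (carrier (tensor R M A))"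
  proof -
    have "(\<lambda>U. U) \<in> module_hom R M N"
      using Msub by (auto simp: module_hom_def M_def)
    then show ?thesis
      using flat Mmod N.module_axioms unfolding flat_module_def by (auto intro: inj_on_id2)
  qed
  have coset_closed: "MA.rels +>\<^bsub>free_pairs M A\<^esub> c \<in> carrier (tensor R M A)"
    if "Poly_Mapping.keys c \<subseteq> carrier M \<times> carrier A" for c
    using that by (auto simp: tensor_def FactRing_def A_RCOSETS_def' free_pairs_def)
  have "MA.rels +>\<^bsub>free_pairs M A\<^esub> frag_of (?s, x) = MA.rels +>\<^bsub>free_pairs M A\<^esub> 0"
    by (rule inj_onD[OF map_inj map_eq]; rule coset_closed) (use sM x in \<open>simp_all add: keys_frag_of\<close>)
  then have rel: "frag_of (?s, x) \<in> MA.rels"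
    by (simp add: MA.coset_eq_iff)
  \<comment> \<open>\<open>M \<otimes> A\<close> maps to \<open>A / H\<close> by \<open>a s \<otimes> y \<mapsto> a y\<close>, where \<open>a\<close> is well defined modulo the colon ideal.\<close>
  define co where "co U = (SOME a. a \<in> carrier R \<and> U = ?cl (\<lambda>i. a \<otimes> s i))" for U
  have co: "co U \<in> carrier R" "U = ?cl (\<lambda>i. co U \<otimes> s i)" if "U \<in> carrier M" for U
  proof -
    have "\<exists>a. a \<in> carrier R \<and> U = ?cl (\<lambda>i. a \<otimes> s i)"
      using that by (auto simp: M_def)
    from someI_ex[OF this] show "co U \<in> carrier R" "U = ?cl (\<lambda>i. co U \<otimes> s i)"
      unfolding co_def by auto
  qed
  have coH: "a \<odot>\<^bsub>A\<^esub> y \<ominus>\<^bsub>A\<^esub> b \<odot>\<^bsub>A\<^esub> y \<in> H"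
    if ab: "a \<in> carrier R" "b \<in> carrier R" "y \<in> carrier A" "?cl (\<lambda>i. a \<otimes> s i) = ?cl (\<lambda>i. b \<otimes> s i)"
    for a b y
  proof -
    have d: "a \<otimes> s i \<ominus> b \<otimes> s i \<in> PIdl r" if "i < k" for i
      using ab s that by (subst (asm) eq) auto
    have "(a \<ominus> b) \<odot>\<^bsub>A\<^esub> y \<in> H"
    proof (rule colon)
      fix j assume "j < k"
      then obtain b' where b': "b' \<in> carrier R" "a \<otimes> s j \<ominus> b \<otimes> s j = b' \<otimes> r"
        using d[of j] by (auto simp: cgenideal_def)
      have "s j \<otimes> (a \<ominus> b) = a \<otimes> s j \<ominus> b \<otimes> s j"
        using ab s[of j] by algebra
      with b' show "\<exists>c\<in>carrier R. s j \<otimes> (a \<ominus> b) = r \<otimes> c"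
        using r A.R.m_comm[of r b'] \<open>s j \<otimes> (a \<ominus> b) = a \<otimes> s j \<ominus> b \<otimes> s j\<close>
        by (intro bexI[of _ b']) simp_all
    qed (use ab in auto)
    then show ?thesis
      using ab by (simp add: a_minus_def A.smult_l_distr A.smult_l_minus)
  qed
  have coW: "co W \<odot>\<^bsub>A\<^esub> y \<ominus>\<^bsub>A\<^esub> a \<odot>\<^bsub>A\<^esub> y \<in> H"
    if W: "W \<in> carrier M" "a \<in> carrier R" "y \<in> carrier A" "W = ?cl (\<lambda>i. a \<otimes> s i)" for W a y
    using co(1)[OF W(1)] W(2,3) trans[OF co(2)[OF W(1), symmetric] W(4)] by (rule coH)
  have "co ?s \<odot>\<^bsub>A\<^esub> x \<in> H"
  proof (rule MA.pure_tensor_zero_detect[OF A.abelian_group_axioms H _ _ _ _ sM x rel])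
    fix U y assume U: "U \<in> carrier M" "y \<in> carrier A"
    show "co U \<odot>\<^bsub>A\<^esub> y \<in> carrier A" using co(1) U by auto
    fix V assume V: "V \<in> carrier M"
    have "U \<oplus>\<^bsub>M\<^esub> V = ?cl (\<lambda>i. (co U \<oplus> co V) \<otimes> s i)"
    proof -
      have "U \<oplus>\<^bsub>M\<^esub> V = ?cl (\<lambda>i. co U \<otimes> s i) \<oplus>\<^bsub>N\<^esub> ?cl (\<lambda>i. co V \<otimes> s i)"
        using co(2)[OF U(1)] co(2)[OF V] by (simp add: M_def)
      then show ?thesis using co(1)[OF U(1)] co(1)[OF V] s by (simp add: add A.l_distr)
    qed
    then have "co (U \<oplus>\<^bsub>M\<^esub> V) \<odot>\<^bsub>A\<^esub> y \<ominus>\<^bsub>A\<^esub> (co U \<oplus> co V) \<odot>\<^bsub>A\<^esub> y \<in> H"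
      using U V co(1) M.M.a_closed[OF U(1) V] by (intro coW) auto
    then show "co (U \<oplus>\<^bsub>M\<^esub> V) \<odot>\<^bsub>A\<^esub> y \<ominus>\<^bsub>A\<^esub> co U \<odot>\<^bsub>A\<^esub> y \<ominus>\<^bsub>A\<^esub> co V \<odot>\<^bsub>A\<^esub> y \<in> H"
      using U V co(1) by (simp add: A.smult_l_distr a_minus_def A.M.minus_add A.M.a_ac)
  next
    fix U y y' assume U: "U \<in> carrier M" "y \<in> carrier A" "y' \<in> carrier A"
    have "co U \<odot>\<^bsub>A\<^esub> (y \<oplus>\<^bsub>A\<^esub> y') \<ominus>\<^bsub>A\<^esub> co U \<odot>\<^bsub>A\<^esub> y \<ominus>\<^bsub>A\<^esub> co U \<odot>\<^bsub>A\<^esub> y' = \<zero>\<^bsub>A\<^esub>"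
      using U co(1) by (simp add: A.smult_r_distr a_minus_def A.M.a_ac A.M.r_neg1 A.M.r_neg2 A.M.r_neg)
    then show "co U \<odot>\<^bsub>A\<^esub> (y \<oplus>\<^bsub>A\<^esub> y') \<ominus>\<^bsub>A\<^esub> co U \<odot>\<^bsub>A\<^esub> y \<ominus>\<^bsub>A\<^esub> co U \<odot>\<^bsub>A\<^esub> y' \<in> H"
      using subgroup.one_closed[OF H] by simp
  next
    fix b U y assume U: "b \<in> carrier R" "U \<in> carrier M" "y \<in> carrier A"
    have "b \<odot>\<^bsub>M\<^esub> U = ?cl (\<lambda>i. (b \<otimes> co U) \<otimes> s i)"
    proof -
      have "b \<odot>\<^bsub>M\<^esub> U = b \<odot>\<^bsub>N\<^esub> ?cl (\<lambda>i. co U \<otimes> s i)"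
        using co(2)[OF U(2)] by (simp add: M_def)
      then show ?thesis using co(1)[OF U(2)] s U by (simp add: smult A.m_assoc)
    qed
    then have "co (b \<odot>\<^bsub>M\<^esub> U) \<odot>\<^bsub>A\<^esub> y \<ominus>\<^bsub>A\<^esub> (b \<otimes> co U) \<odot>\<^bsub>A\<^esub> y \<in> H"
      using U co(1) M.smult_closed[OF U(1,2)] by (intro coW) auto
    moreover have "(b \<otimes> co U) \<odot>\<^bsub>A\<^esub> y = co U \<odot>\<^bsub>A\<^esub> (b \<odot>\<^bsub>A\<^esub> y)"
      using U co(1) by (simp add: A.smult_assoc1[symmetric] A.m_comm)
    ultimately show "co (b \<odot>\<^bsub>M\<^esub> U) \<odot>\<^bsub>A\<^esub> y \<ominus>\<^bsub>A\<^esub> co U \<odot>\<^bsub>A\<^esub> (b \<odot>\<^bsub>A\<^esub> y) \<in> H"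
      by simp
  qed
  moreover have "co ?s \<odot>\<^bsub>A\<^esub> x \<ominus>\<^bsub>A\<^esub> \<one> \<odot>\<^bsub>A\<^esub> x \<in> H"
    using x s by (intro coW sM) auto
  ultimately have "co ?s \<odot>\<^bsub>A\<^esub> x \<oplus>\<^bsub>A\<^esub> \<ominus>\<^bsub>A\<^esub> (co ?s \<odot>\<^bsub>A\<^esub> x \<ominus>\<^bsub>A\<^esub> x) \<in> H"
    using subgroup.m_closed[OF H] subgroup.m_inv_closed[OF H] x by (simp add: a_inv_def)
  moreover have "co ?s \<odot>\<^bsub>A\<^esub> x \<oplus>\<^bsub>A\<^esub> \<ominus>\<^bsub>A\<^esub> (co ?s \<odot>\<^bsub>A\<^esub> x \<ominus>\<^bsub>A\<^esub> x) = x"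
    using co(1)[OF sM] x by (simp add: a_minus_def A.M.minus_add A.M.a_ac A.M.r_neg1 A.M.r_neg2 A.M.r_neg)
  ultimately show ?thesis by simp
qed

section \<open>Symmetric algebras\<close>

text \<open>The universal property of a quotient ring. The induced map is read off from the image of a coset,
  which is a singleton.\<close>

lemma quotient_ring_lift:
  fixes R :: "('a, 'm) ring_scheme" and C :: "('c, 'n) ring_scheme"
  assumes "ring R" "ideal I R" "ring C" and f: "f \<in> ring_hom R C" and I: "\<And>x. x \<in> I \<Longrightarrow> f x = \<zero>\<^bsub>C\<^esub>"
  obtains g where "g \<in> ring_hom (R Quot I) C" "\<And>x. x \<in> carrier R \<Longrightarrow> g (I +>\<^bsub>R\<^esub> x) = f x"
proof -
  interpret R: ring R by fact
  interpret C: ring C by fact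
  interpret I: ideal I R by fact
  interpret Q: ring "R Quot I" by (rule I.quotient_is_ring)
  define g where "g U = the_elem (f ` U)" for U
  have gx: "g (I +>\<^bsub>R\<^esub> x) = f x" if x: "x \<in> carrier R" for x
  proof -
    have "f y = f x" if "y \<in> I +>\<^bsub>R\<^esub> x" for y
    proof -
      from that obtain h where h: "h \<in> I" "y = h \<oplus>\<^bsub>R\<^esub> x" by (auto simp: a_r_coset_def')
      then have "f y = f h \<oplus>\<^bsub>C\<^esub> f x" using ring_hom_add[OF f I.Icarr[OF h(1)] x] by simp
      then show ?thesis using I[OF h(1)] ring_hom_closed[OF f x] by simp
    qed
    moreover have "x \<in> I +>\<^bsub>R\<^esub> x" using x by (rule I.a_rcos_self)
    ultimately have "f ` (I +>\<^bsub>R\<^esub> x) = {f x}" by blast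
    then show ?thesis by (simp add: g_def)
  qed
  note p = I.rcos_ring_hom
  have "g \<in> ring_hom (R Quot I) C"
  proof (rule ring_hom_memI)
    fix U V assume "U \<in> carrier (R Quot I)" "V \<in> carrier (R Quot I)"
    then obtain x y where xy: "x \<in> carrier R" "U = I +>\<^bsub>R\<^esub> x" "y \<in> carrier R" "V = I +>\<^bsub>R\<^esub> y"
      by (auto simp: FactRing_def A_RCOSETS_def')
    show "g U \<in> carrier C" using xy gx ring_hom_closed[OF f] by simp
    show "g (U \<otimes>\<^bsub>R Quot I\<^esub> V) = g U \<otimes>\<^bsub>C\<^esub> g V"
      using xy by (simp add: ring_hom_mult[OF p xy(1,3), symmetric] gx ring_hom_mult[OF f])
    show "g (U \<oplus>\<^bsub>R Quot I\<^esub> V) = g U \<oplus>\<^bsub>C\<^esub> g V"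
      using xy by (simp add: ring_hom_add[OF p xy(1,3), symmetric] gx ring_hom_add[OF f])
  next
    show "g \<one>\<^bsub>R Quot I\<^esub> = \<one>\<^bsub>C\<^esub>"
      using gx[of "\<one>\<^bsub>R\<^esub>"] ring_hom_one[OF p] ring_hom_one[OF f] by simp
  qed
  then show thesis using gx by (rule that)
qed

lemma ring_hom_minus:
  assumes "ring R" "ring S" "h \<in> ring_hom R S" "x \<in> carrier R" "y \<in> carrier R"
  shows "h (x \<ominus>\<^bsub>R\<^esub> y) = h x \<ominus>\<^bsub>S\<^esub> h y"
proof -
  interpret h: ring_hom_ring R S h using assms(1-3) by (rule ring_hom_ringI2)
  show ?thesis using assms(4,5) by (simp add: a_minus_def)
qed

lemma algebra_via_simps [simp]:
  "carrier (algebra_via B f) = carrier B" "monoid.mult (algebra_via B f) = monoid.mult B"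
  "monoid.one (algebra_via B f) = monoid.one B" "ring.zero (algebra_via B f) = ring.zero B"
  "ring.add (algebra_via B f) = ring.add B"
  "smult (algebra_via B f) r x = f r \<otimes>\<^bsub>B\<^esub> x"
  by (simp_all add: algebra_via_def)

lemma ring_algebra_via: "ring B \<Longrightarrow> ring (algebra_via B f)"
proof -
  assume "ring B"
  then interpret B: ring B .
  show ?thesis
    by (intro ringI abelian_groupI monoidI)
      (auto simp: B.m_assoc B.l_distr B.r_distr B.a_ac intro: B.add.l_inv_ex)
qed

lemma ring_hom_algebra_via [simp]:
  fixes B :: "('b, 'm) ring_scheme" and C :: "('c, 'n) ring_scheme"
  shows "ring_hom C (algebra_via B f) = ring_hom C B"
    and "ring_hom (algebra_via B f) C = ring_hom B C"
  by (simp_all add: ring_hom_def)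

text \<open>The product of noncommutative polynomials: the coefficient at \<open>w\<close> is a sum over all ways of cutting
  \<open>w\<close> in two.\<close>

definition conv :: "('r, 'k) ring_scheme \<Rightarrow> ('x list \<Rightarrow> 'r) \<Rightarrow> ('x list \<Rightarrow> 'r) \<Rightarrow> 'x list \<Rightarrow> 'r" where
  "conv R p q w = (\<Oplus>\<^bsub>R\<^esub>i\<in>{..length w}. p (take i w) \<otimes>\<^bsub>R\<^esub> q (drop i w))"

context cring
begin

lemma conv_Nil: "p [] \<in> carrier R \<Longrightarrow> q [] \<in> carrier R \<Longrightarrow> conv R p q [] = p [] \<otimes> q []"
  by (simp add: conv_def)

text \<open>Splitting off the first letter turns the laws of the convolution product into inductions over
  words.\<close>

lemma conv_Cons:
  assumes "\<And>w. p w \<in> carrier R" "\<And>w. q w \<in> carrier R"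
  shows "conv R p q (x # w) = p [] \<otimes> q (x # w) \<oplus> conv R (\<lambda>w. p (x # w)) q w"
proof -
  have "conv R p q (x # w) = (\<Oplus>i\<in>{..length w}. p (x # take i w) \<otimes> q (drop i w)) \<oplus> p [] \<otimes> q (x # w)"
    using assms by (simp add: conv_def add.finprod_Suc2 del: add.finprod_Suc)
  then show ?thesis
    using assms by (simp add: conv_def a_comm)
qed

lemma conv_closed:
  assumes "\<And>w. p w \<in> carrier R" "\<And>w. q w \<in> carrier R"
  shows "conv R p q w \<in> carrier R"
  unfolding conv_def using assms by (intro finsum_closed) auto

lemma conv_zero_left:
  assumes "\<And>w. q w \<in> carrier R"
  shows "conv R (\<lambda>_. \<zero>) q w = \<zero>"
  by (induction w) (simp_all add: conv_Nil conv_Cons assms)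

lemma conv_add_left:
  assumes "\<And>w. p w \<in> carrier R" "\<And>w. p' w \<in> carrier R" "\<And>w. q w \<in> carrier R"
  shows "conv R (\<lambda>w. p w \<oplus> p' w) q w = conv R p q w \<oplus> conv R p' q w"
  using assms(1,2)
  by (induction w arbitrary: p p')
    (simp_all add: conv_Nil conv_Cons assms(3) l_distr conv_closed a_ac)

lemma conv_add_right:
  assumes "\<And>w. p w \<in> carrier R" "\<And>w. q' w \<in> carrier R" "\<And>w. q w \<in> carrier R"
  shows "conv R p (\<lambda>w. q w \<oplus> q' w) w = conv R p q w \<oplus> conv R p q' w"
  using assms(1)
  by (induction w arbitrary: p)
    (simp_all add: conv_Nil conv_Cons assms(2,3) r_distr conv_closed a_ac)

lemma conv_smult_left:
  assumes "\<And>w. p w \<in> carrier R" "\<And>w. q w \<in> carrier R" "r \<in> carrier R"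
  shows "conv R (\<lambda>w. r \<otimes> p w) q w = r \<otimes> conv R p q w"
  using assms(1)
  by (induction w arbitrary: p)
    (simp_all add: conv_Nil conv_Cons assms(2,3) r_distr conv_closed m_assoc)

lemma conv_assoc:
  assumes "\<And>w. p w \<in> carrier R" "\<And>w. q w \<in> carrier R" "\<And>w. s w \<in> carrier R"
  shows "conv R (conv R p q) s w = conv R p (conv R q s) w"
  using assms(1)
proof (induction w arbitrary: p)
  case Nil
  then show ?case using assms by (simp add: conv_Nil conv_closed m_assoc)
next
  case (Cons x w)
  have "conv R (\<lambda>w. conv R p q (x # w)) s w
      = conv R (\<lambda>w. p [] \<otimes> q (x # w) \<oplus> conv R (\<lambda>w. p (x # w)) q w) s w"
    using Cons assms by (simp add: conv_Cons)
  also have "\<dots> = p [] \<otimes> conv R (\<lambda>w. q (x # w)) s w \<oplus> conv R (\<lambda>w. p (x # w)) (conv R q s) w"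
    using Cons assms by (simp add: conv_add_left conv_smult_left conv_closed)
  finally show ?case
    using Cons.prems assms
    by (simp add: conv_Cons[of "conv R p q"] conv_Cons[of p "conv R q s"] conv_Cons[of q s]
        conv_closed conv_Nil r_distr m_assoc a_assoc)
qed

lemma word_closed: "r \<in> carrier R \<Longrightarrow> word R r v w \<in> carrier R"
  by (simp add: word_def)

lemma conv_scalar_left:
  assumes "\<And>w. q w \<in> carrier R" "r \<in> carrier R"
  shows "conv R (word R r []) q w = r \<otimes> q w"
proof (cases w)
  case Nil
  then show ?thesis using assms by (simp add: conv_Nil word_closed) (simp add: word_def)
next
  case (Cons x w')
  have "(\<lambda>w. word R r [] (x # w)) = (\<lambda>_. \<zero>)" by (simp add: word_def)
  then show ?thesis using Cons assms
    by (simp add: conv_Cons word_closed conv_zero_left) (simp add: word_def)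
qed

lemma conv_scalar_right:
  assumes "\<And>w. q w \<in> carrier R" "r \<in> carrier R"
  shows "conv R q (word R r []) w = r \<otimes> q w"
  using assms(1)
proof (induction w arbitrary: q)
  case Nil
  then show ?case using assms(2)
    by (simp add: conv_Nil word_closed m_comm) (simp add: word_def m_comm)
next
  case (Cons x w)
  then show ?case using assms(2)
    by (simp add: conv_Cons word_closed) (simp add: word_def)
qed

lemma conv_word:
  assumes "r \<in> carrier R" "s \<in> carrier R"
  shows "conv R (word R r v) (word R s u) = word R (r \<otimes> s) (v @ u)"
proof
  fix w
  show "conv R (word R r v) (word R s u) w = word R (r \<otimes> s) (v @ u) w"
  proof (induction v arbitrary: w)
    case Nil
    then show ?case using assms by (simp add: conv_scalar_left word_closed) (simp add: word_def)
  next
    case (Cons x v)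
    show ?case
    proof (cases w)
      case Nil
      then show ?thesis using assms by (simp add: conv_Nil word_closed) (simp add: word_def)
    next
      case (Cons y w')
      have "(\<lambda>w. word R r (x # v) (y # w)) = (if x = y then word R r v else (\<lambda>_. \<zero>))"
        by (auto simp: word_def)
      moreover have "word R r (x # v) [] = \<zero>" by (simp add: word_def)
      moreover have "word R (r \<otimes> s) ((x # v) @ u) (y # w') =
          (if x = y then word R (r \<otimes> s) (v @ u) w' else \<zero>)"
        by (auto simp: word_def)
      ultimately show ?thesis using assms Cons Cons.IH[of w']
        by (simp add: conv_Cons word_closed conv_zero_left conv_closed)
    qed
  qed
qed

abbreviation F where "F U \<equiv> free_algebra R U"

lemma F_simps:
  "p \<oplus>\<^bsub>F U\<^esub> q = (\<lambda>w. p w \<oplus> q w)" "p \<otimes>\<^bsub>F U\<^esub> q = conv R p q"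
  "\<one>\<^bsub>F U\<^esub> = word R \<one> []" "\<zero>\<^bsub>F U\<^esub> = (\<lambda>_. \<zero>)"
  by (auto simp: free_algebra_def conv_def word_def fun_eq_iff)

lemma F_carrier: "p \<in> carrier (F U) \<longleftrightarrow> (\<forall>w. p w \<in> carrier R) \<and> finite {w. p w \<noteq> \<zero>} \<and>
    (\<forall>w. p w \<noteq> \<zero> \<longrightarrow> set w \<subseteq> U)"
  by (simp add: free_algebra_def)

lemma F_closed_word: "r \<in> carrier R \<Longrightarrow> set v \<subseteq> U \<Longrightarrow> word R r v \<in> carrier (F U)"
  by (auto simp: F_carrier word_def)

lemma F_closed_conv:
  assumes "p \<in> carrier (F U)" "q \<in> carrier (F U)"
  shows "conv R p q \<in> carrier (F U)"
proof -
  have pq: "\<And>w. p w \<in> carrier R" "\<And>w. q w \<in> carrier R" using assms by (auto simp: F_carrier)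
  have supp: "\<exists>u v. w = u @ v \<and> p u \<noteq> \<zero> \<and> q v \<noteq> \<zero>" if w: "conv R p q w \<noteq> \<zero>" for w
  proof (rule ccontr)
    assume "\<nexists>u v. w = u @ v \<and> p u \<noteq> \<zero> \<and> q v \<noteq> \<zero>"
    then have "p (take i w) \<otimes> q (drop i w) = \<zero>" for i
      using pq by (metis append_take_drop_id l_null r_null)
    then have "conv R p q w = \<zero>" by (simp add: conv_def)
    with w show False by simp
  qed
  then have "{w. conv R p q w \<noteq> \<zero>} \<subseteq> (\<lambda>(u, v). u @ v) ` ({u. p u \<noteq> \<zero>} \<times> {v. q v \<noteq> \<zero>})"
    by force
  then have "finite {w. conv R p q w \<noteq> \<zero>}"
    using assms by (elim finite_subset) (auto simp: F_carrier)
  moreover have "set w \<subseteq> U" if "conv R p q w \<noteq> \<zero>" for w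
    using supp[OF that] assms by (force simp: F_carrier)
  ultimately show ?thesis using pq by (auto simp: F_carrier conv_closed)
qed

lemma free_algebra_ring: "ring (F U)"
proof (intro ringI abelian_groupI monoidI)
  fix p q assume p: "p \<in> carrier (F U)" and q: "q \<in> carrier (F U)"
  have "{w. p w \<oplus> q w \<noteq> \<zero>} \<subseteq> {w. p w \<noteq> \<zero>} \<union> {w. q w \<noteq> \<zero>}" by auto
  then have "finite {w. p w \<oplus> q w \<noteq> \<zero>}"
    using p q by (elim finite_subset) (auto simp: F_carrier)
  moreover have "set w \<subseteq> U" if "p w \<oplus> q w \<noteq> \<zero>" for w
    using that p q by (cases "p w = \<zero>") (auto simp: F_carrier)
  ultimately show "p \<oplus>\<^bsub>F U\<^esub> q \<in> carrier (F U)"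
    using p q unfolding F_simps by (simp add: F_carrier)
  show "p \<otimes>\<^bsub>F U\<^esub> q \<in> carrier (F U)" using p q by (simp add: F_simps F_closed_conv)
next
  fix p assume p: "p \<in> carrier (F U)"
  have "p w = \<zero>" if "\<ominus> p w = \<zero>" for w
    using that p by (metis F_carrier minus_minus minus_zero)
  then have "{w. \<ominus> p w \<noteq> \<zero>} = {w. p w \<noteq> \<zero>}" using p by (auto simp: F_carrier)
  then have "(\<lambda>w. \<ominus> p w) \<in> carrier (F U)" using p by (auto simp: F_carrier)
  then show "\<exists>q\<in>carrier (F U). q \<oplus>\<^bsub>F U\<^esub> p = \<zero>\<^bsub>F U\<^esub>"
    using p by (intro bexI[of _ "\<lambda>w. \<ominus> p w"]) (auto simp: F_simps F_carrier l_neg)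
qed (auto simp: F_simps F_carrier[of "\<lambda>_. \<zero>"] F_closed_word; simp add: F_carrier fun_eq_iff
   conv_assoc conv_add_left conv_add_right conv_scalar_left conv_scalar_right a_ac)+

lemma F_induct [consumes 1, case_names zero add]:
  assumes p: "p \<in> carrier (F U)" and zero: "P (\<lambda>_. \<zero>)"
    and add: "\<And>r v p. \<lbrakk>r \<in> carrier R; set v \<subseteq> U; p \<in> carrier (F U); P p\<rbrakk> \<Longrightarrow> P (\<lambda>w. word R r v w \<oplus> p w)"
  shows "P p"
  using p
proof (induction "card {w. p w \<noteq> \<zero>}" arbitrary: p)
  case 0
  then have "p = (\<lambda>_. \<zero>)" by (auto simp: F_carrier)
  then show ?case using zero by simp
next
  case (Suc n)
  then obtain v where v: "p v \<noteq> \<zero>" by (metis (mono_tags, lifting) card.empty empty_Collect_eq nat.distinct(1))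
  let ?p = "p(v := \<zero>)"
  have e: "{w. ?p w \<noteq> \<zero>} = {w. p w \<noteq> \<zero>} - {v}" by auto
  have c: "?p \<in> carrier (F U)" using Suc(3) unfolding F_carrier e by auto
  have "card {w. ?p w \<noteq> \<zero>} = n"
    unfolding e using Suc(2,3) v by (simp add: F_carrier)
  with Suc(1)[OF _ c] have "P ?p" by simp
  then have "P (\<lambda>w. word R (p v) v w \<oplus> ?p w)"
    using Suc(3) v c by (intro add[of "p v" v ?p]) (auto simp: F_carrier)
  moreover have "(\<lambda>w. word R (p v) v w \<oplus> ?p w) = p"
    using Suc(3) by (auto simp: word_def F_carrier)
  ultimately show ?case by simp
qed

end

definition eval_word :: "('c, 'n) monoid_scheme \<Rightarrow> ('x \<Rightarrow> 'c) \<Rightarrow> 'x list \<Rightarrow> 'c" where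
  "eval_word C j w = foldr (\<lambda>x c. j x \<otimes>\<^bsub>C\<^esub> c) w \<one>\<^bsub>C\<^esub>"

definition eval_free ::
  "('r, 'k) ring_scheme \<Rightarrow> ('r, 'c, 'n) module_scheme \<Rightarrow> ('x \<Rightarrow> 'c) \<Rightarrow> ('x list \<Rightarrow> 'r) \<Rightarrow> 'c" where
  "eval_free R C j p = (\<Oplus>\<^bsub>C\<^esub>w\<in>{w. p w \<noteq> \<zero>\<^bsub>R\<^esub>}. p w \<odot>\<^bsub>C\<^esub> eval_word C j w)"

context algebra
begin

context
  fixes U :: "'x set" and j
  assumes j: "\<And>x. x \<in> U \<Longrightarrow> j x \<in> carrier M"
begin

lemma eval_word_closed: "set w \<subseteq> U \<Longrightarrow> eval_word M j w \<in> carrier M"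
  by (induction w) (simp_all add: eval_word_def j)

lemma eval_word_append:
  "set v \<subseteq> U \<Longrightarrow> set w \<subseteq> U \<Longrightarrow> eval_word M j (v @ w) = eval_word M j v \<otimes>\<^bsub>M\<^esub> eval_word M j w"
  using eval_word_closed by (induction v) (simp_all add: eval_word_def j m_assoc)

lemma eval_free_superset:
  assumes p: "p \<in> carrier (free_algebra R U)" and W: "finite W" "{w. p w \<noteq> \<zero>\<^bsub>R\<^esub>} \<subseteq> W" "\<Union> (set ` W) \<subseteq> U"
  shows "eval_free R M j p = (\<Oplus>\<^bsub>M\<^esub>w\<in>W. p w \<odot>\<^bsub>M\<^esub> eval_word M j w)"
proof -
  have p': "p w \<in> carrier R" for w using p by (simp add: R.F_carrier)
  have c: "eval_word M j w \<in> carrier M" if "w \<in> W" for w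
    using that W(3) by (intro eval_word_closed) auto
  show ?thesis
    unfolding eval_free_def
    using W p' c by (intro M.add.finprod_mono_neutral_cong_left) auto
qed

lemma eval_free_add:
  assumes p: "p \<in> carrier (free_algebra R U)" and q: "q \<in> carrier (free_algebra R U)"
  shows "eval_free R M j (p \<oplus>\<^bsub>free_algebra R U\<^esub> q) = eval_free R M j p \<oplus>\<^bsub>M\<^esub> eval_free R M j q"
proof -
  interpret F: ring "free_algebra R U" by (rule R.free_algebra_ring)
  let ?W = "{w. p w \<noteq> \<zero>\<^bsub>R\<^esub>} \<union> {w. q w \<noteq> \<zero>\<^bsub>R\<^esub>}"
  have W: "finite ?W" "\<Union> (set ` ?W) \<subseteq> U" using p q by (auto simp: R.F_carrier)
  have pq: "p w \<in> carrier R" "q w \<in> carrier R" for w using p q by (auto simp: R.F_carrier)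
  have cw: "eval_word M j w \<in> carrier M" if "w \<in> ?W" for w
    using that W(2) by (intro eval_word_closed) auto
  have "eval_free R M j (p \<oplus>\<^bsub>free_algebra R U\<^esub> q)
      = (\<Oplus>\<^bsub>M\<^esub>w\<in>?W. (p \<oplus>\<^bsub>free_algebra R U\<^esub> q) w \<odot>\<^bsub>M\<^esub> eval_word M j w)"
    using F.a_closed[OF p q] W by (intro eval_free_superset) (auto simp: R.F_simps)
  also have "\<dots> = (\<Oplus>\<^bsub>M\<^esub>w\<in>?W. p w \<odot>\<^bsub>M\<^esub> eval_word M j w \<oplus>\<^bsub>M\<^esub> q w \<odot>\<^bsub>M\<^esub> eval_word M j w)"
    using pq cw by (intro M.add.finprod_cong') (auto simp: R.F_simps smult_l_distr)
  also have "\<dots> = (\<Oplus>\<^bsub>M\<^esub>w\<in>?W. p w \<odot>\<^bsub>M\<^esub> eval_word M j w) \<oplus>\<^bsub>M\<^esub> (\<Oplus>\<^bsub>M\<^esub>w\<in>?W. q w \<odot>\<^bsub>M\<^esub> eval_word M j w)"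
    using pq cw by (intro M.finsum_addf) auto
  also have "\<dots> = eval_free R M j p \<oplus>\<^bsub>M\<^esub> eval_free R M j q"
    using W p q by (simp add: eval_free_superset[of _ ?W])
  finally show ?thesis .
qed

lemma eval_free_word:
  assumes "r \<in> carrier R" "set v \<subseteq> U"
  shows "eval_free R M j (word R r v) = r \<odot>\<^bsub>M\<^esub> eval_word M j v"
proof -
  have "eval_free R M j (word R r v) = (\<Oplus>\<^bsub>M\<^esub>w\<in>{v}. word R r v w \<odot>\<^bsub>M\<^esub> eval_word M j w)"
    using assms by (intro eval_free_superset R.F_closed_word) (auto simp: word_def)
  also have "\<dots> = r \<odot>\<^bsub>M\<^esub> eval_word M j v"
    using assms by (simp add: eval_word_closed word_def)
  finally show ?thesis .
qed

lemma eval_free_closed: "p \<in> carrier (free_algebra R U) \<Longrightarrow> eval_free R M j p \<in> carrier M"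
  unfolding eval_free_def
  by (intro M.finsum_closed) (auto simp: R.F_carrier intro!: eval_word_closed)

theorem eval_free_hom: "eval_free R M j \<in> ring_hom (free_algebra R U) M"
proof (rule ring_hom_memI)
  interpret F: ring "free_algebra R U" by (rule R.free_algebra_ring)
  let ?F = "free_algebra R U"
  have sm: "a \<otimes>\<^bsub>M\<^esub> (r \<odot>\<^bsub>M\<^esub> b) = r \<odot>\<^bsub>M\<^esub> (a \<otimes>\<^bsub>M\<^esub> b)"
    if "r \<in> carrier R" "a \<in> carrier M" "b \<in> carrier M" for r a b
    using that smult_assoc2[of r b a] m_comm[of a "r \<odot>\<^bsub>M\<^esub> b"] m_comm[of b a] by simp
  have z: "eval_free R M j (\<lambda>_. \<zero>\<^bsub>R\<^esub>) = \<zero>\<^bsub>M\<^esub>" by (simp add: eval_free_def)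
  have zl: "(\<lambda>_. \<zero>\<^bsub>R\<^esub>) \<otimes>\<^bsub>?F\<^esub> q = (\<lambda>_. \<zero>\<^bsub>R\<^esub>)" "q \<otimes>\<^bsub>?F\<^esub> (\<lambda>_. \<zero>\<^bsub>R\<^esub>) = (\<lambda>_. \<zero>\<^bsub>R\<^esub>)" if "q \<in> carrier ?F" for q
    using F.l_null[OF that] F.r_null[OF that] by (simp_all add: R.F_simps(4))
  have "eval_free R M j (p \<otimes>\<^bsub>?F\<^esub> q) = eval_free R M j p \<otimes>\<^bsub>M\<^esub> eval_free R M j q"
    if p: "p \<in> carrier ?F" and q: "q \<in> carrier ?F" for p q
    using p
  proof (induction rule: R.F_induct)
    case zero
    then show ?case using q by (simp add: zl z eval_free_closed)
  next
    case (add r v p)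
    have w: "word R r v \<in> carrier ?F" using add by (intro R.F_closed_word)
    have "eval_free R M j (word R r v \<otimes>\<^bsub>?F\<^esub> q) = eval_free R M j (word R r v) \<otimes>\<^bsub>M\<^esub> eval_free R M j q"
      using q
    proof (induction rule: R.F_induct)
      case zero
      then show ?case using w by (simp add: zl z eval_free_closed)
    next
      case (add s u q)
      have w': "word R s u \<in> carrier ?F" using add by (intro R.F_closed_word)
      have "word R r v \<otimes>\<^bsub>?F\<^esub> word R s u = word R (r \<otimes>\<^bsub>R\<^esub> s) (v @ u)"
        using add(1) \<open>r \<in> carrier R\<close> by (simp add: R.F_simps R.conv_word)
      then have "eval_free R M j (word R r v \<otimes>\<^bsub>?F\<^esub> word R s u)
          = eval_free R M j (word R r v) \<otimes>\<^bsub>M\<^esub> eval_free R M j (word R s u)"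
        using add(1,2) \<open>r \<in> carrier R\<close> \<open>set v \<subseteq> U\<close> eval_word_closed
        by (simp add: eval_free_word eval_word_append smult_assoc1 smult_assoc2 sm)
          (simp add: smult_assoc1[symmetric] R.m_comm)
      with add w w' show ?case
        unfolding R.F_simps(1)[where U = U, symmetric]
        by (simp add: F.r_distr eval_free_add eval_free_closed r_distr)
    qed
    with add w q show ?case
      unfolding R.F_simps(1)[where U = U, symmetric]
      by (simp add: F.l_distr eval_free_add eval_free_closed l_distr)
  qed
  then show "eval_free R M j (p \<otimes>\<^bsub>?F\<^esub> q) = eval_free R M j p \<otimes>\<^bsub>M\<^esub> eval_free R M j q"
    if "p \<in> carrier ?F" "q \<in> carrier ?F" for p q using that .
qed (auto simp: eval_free_closed eval_free_add R.F_simps(3) eval_free_word eval_word_def)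

end

end

text \<open>The quotient map \<open>R\<langle>M\<rangle> \<rightarrow> Sym\<^sub>R(M)\<close>.\<close>

definition sym_proj ::
  "('r, 'k) ring_scheme \<Rightarrow> ('r, 'm, 'p) module_scheme \<Rightarrow> ('m list \<Rightarrow> 'r) \<Rightarrow> ('m list \<Rightarrow> 'r) set set" where
  "sym_proj R M p = commutator_ideal R M +>\<^bsub>tensor_algebra R M\<^esub>
     (tensor_algebra_relations R M +>\<^bsub>free_algebra R (carrier M)\<^esub> p)"

context module
begin

abbreviation FM where "FM \<equiv> free_algebra R (carrier M)"
abbreviation SM where "SM \<equiv> symmetric_algebra R M"

lemma word_closed_FM: "r \<in> carrier R \<Longrightarrow> set v \<subseteq> carrier M \<Longrightarrow> word R r v \<in> carrier FM"
  by (rule R.F_closed_word)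

lemma FM_ring: "ring FM" by (rule R.free_algebra_ring)

lemma linear_relations_closed:
  "{word R \<one> [x \<oplus>\<^bsub>M\<^esub> y] \<ominus>\<^bsub>FM\<^esub> (word R \<one> [x] \<oplus>\<^bsub>FM\<^esub> word R \<one> [y]) | x y.
      x \<in> carrier M \<and> y \<in> carrier M} \<union>
    {word R \<one> [r \<odot>\<^bsub>M\<^esub> x] \<ominus>\<^bsub>FM\<^esub> word R r [x] | r x. r \<in> carrier R \<and> x \<in> carrier M} \<subseteq> carrier FM"
proof -
  interpret F: ring FM by (rule FM_ring)
  show ?thesis by (auto intro!: F.minus_closed F.a_closed word_closed_FM)
qed

lemma tensor_relations_ideal: "ideal (tensor_algebra_relations R M) FM"
  unfolding tensor_algebra_relations_def Let_def
  by (intro ring.genideal_ideal[OF FM_ring] linear_relations_closed)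

lemma tensor_algebra_ring: "ring (tensor_algebra R M)"
  unfolding tensor_algebra_def by (intro ring_algebra_via ideal.quotient_is_ring tensor_relations_ideal)

lemma tensor_proj_hom:
  "(+>\<^bsub>FM\<^esub>) (tensor_algebra_relations R M) \<in> ring_hom FM (tensor_algebra R M)"
  unfolding tensor_algebra_def by (simp add: ideal.rcos_ring_hom[OF tensor_relations_ideal])

lemma tensor_incl_closed: "x \<in> carrier M \<Longrightarrow> tensor_algebra_incl R M x \<in> carrier (tensor_algebra R M)"
  unfolding tensor_algebra_incl_def
  by (rule ring_hom_closed[OF tensor_proj_hom]) (simp add: word_closed_FM)

lemma commutators_closed:
  "{(tensor_algebra_incl R M x \<otimes>\<^bsub>tensor_algebra R M\<^esub> tensor_algebra_incl R M y) \<ominus>\<^bsub>tensor_algebra R M\<^esub>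
     (tensor_algebra_incl R M y \<otimes>\<^bsub>tensor_algebra R M\<^esub> tensor_algebra_incl R M x) | x y.
     x \<in> carrier M \<and> y \<in> carrier M} \<subseteq> carrier (tensor_algebra R M)"
proof -
  interpret T: ring "tensor_algebra R M" by (rule tensor_algebra_ring)
  show ?thesis by (auto intro!: T.minus_closed T.m_closed tensor_incl_closed)
qed

lemma commutator_ideal_ideal: "ideal (commutator_ideal R M) (tensor_algebra R M)"
  unfolding commutator_ideal_def Let_def
  by (intro ring.genideal_ideal[OF tensor_algebra_ring] commutators_closed)

lemma symmetric_algebra_ring: "ring SM"
  unfolding symmetric_algebra_def
  by (intro ring_algebra_via ideal.quotient_is_ring commutator_ideal_ideal)

lemma sym_proj_hom: "sym_proj R M \<in> ring_hom FM SM"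
proof -
  have "(+>\<^bsub>tensor_algebra R M\<^esub>) (commutator_ideal R M) \<in> ring_hom (tensor_algebra R M) SM"
    unfolding symmetric_algebra_def by (simp add: ideal.rcos_ring_hom[OF commutator_ideal_ideal])
  from ring_hom_trans[OF tensor_proj_hom this] show ?thesis
    by (simp add: comp_def sym_proj_def[abs_def])
qed

lemma sym_proj_surj:
  assumes "z \<in> carrier SM" obtains p where "p \<in> carrier FM" "z = sym_proj R M p"
proof -
  from assms obtain t where t: "t \<in> carrier (tensor_algebra R M)"
      "z = commutator_ideal R M +>\<^bsub>tensor_algebra R M\<^esub> t"
    by (auto simp: symmetric_algebra_def FactRing_def A_RCOSETS_def')
  from t(1) obtain p where p: "p \<in> carrier FM" "t = tensor_algebra_relations R M +>\<^bsub>FM\<^esub> p"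
    by (auto simp: tensor_algebra_def FactRing_def A_RCOSETS_def')
  show thesis using that[of p] t p by (simp add: sym_proj_def)
qed

lemma sym_smult:
  assumes "r \<in> carrier R"
  shows "r \<odot>\<^bsub>SM\<^esub> z = sym_proj R M (word R r []) \<otimes>\<^bsub>SM\<^esub> z"
proof -
  have "r \<odot>\<^bsub>tensor_algebra R M\<^esub> \<one>\<^bsub>tensor_algebra R M\<^esub>
      = (tensor_algebra_relations R M +>\<^bsub>FM\<^esub> word R r []) \<otimes>\<^bsub>tensor_algebra R M\<^esub> \<one>\<^bsub>tensor_algebra R M\<^esub>"
    by (simp add: tensor_algebra_def)
  also have "\<dots> = tensor_algebra_relations R M +>\<^bsub>FM\<^esub> word R r []"
  proof -
    interpret T: ring "tensor_algebra R M" by (rule tensor_algebra_ring)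
    show ?thesis
      by (intro T.r_one ring_hom_closed[OF tensor_proj_hom] word_closed_FM) (auto simp: assms)
  qed
  finally show ?thesis
    by (simp add: symmetric_algebra_def sym_proj_def)
qed

lemma sym_proj_zero_rel:
  assumes "p \<in> tensor_algebra_relations R M"
  shows "sym_proj R M p = \<zero>\<^bsub>SM\<^esub>"
proof -
  have "tensor_algebra_relations R M +>\<^bsub>FM\<^esub> p = \<zero>\<^bsub>tensor_algebra R M\<^esub>"
    using abelian_group.a_coset_join2[OF ring.is_abelian_group[OF FM_ring]
        ideal.Icarr[OF tensor_relations_ideal assms]
        additive_subgroup.a_subgroup[OF ideal.axioms(1)[OF tensor_relations_ideal]] assms]
    by (simp add: tensor_algebra_def FactRing_def)
  then have "sym_proj R M p = sym_proj R M \<zero>\<^bsub>FM\<^esub>"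
    using ring_hom_zero[OF tensor_proj_hom FM_ring tensor_algebra_ring] by (simp add: sym_proj_def)
  then show ?thesis using ring_hom_zero[OF sym_proj_hom FM_ring symmetric_algebra_ring] by simp
qed

lemma sym_proj_eqI:
  assumes "p \<in> carrier FM" "q \<in> carrier FM" "p \<ominus>\<^bsub>FM\<^esub> q \<in> tensor_algebra_relations R M"
  shows "sym_proj R M p = sym_proj R M q"
proof -
  interpret F: ring FM by (rule FM_ring)
  interpret S: ring SM by (rule symmetric_algebra_ring)
  have "p = (p \<ominus>\<^bsub>FM\<^esub> q) \<oplus>\<^bsub>FM\<^esub> q"
    using assms by (simp add: F.minus_eq F.a_assoc F.l_neg)
  then have "sym_proj R M p = sym_proj R M (p \<ominus>\<^bsub>FM\<^esub> q) \<oplus>\<^bsub>SM\<^esub> sym_proj R M q"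
    using ring_hom_add[OF sym_proj_hom, of "p \<ominus>\<^bsub>FM\<^esub> q" q] assms by simp
  then show ?thesis
    using sym_proj_zero_rel[OF assms(3)] ring_hom_closed[OF sym_proj_hom assms(2)] by simp
qed

lemma sym_gen_add:
  assumes "x \<in> carrier M" "y \<in> carrier M"
  shows "sym_proj R M (word R \<one> [x \<oplus>\<^bsub>M\<^esub> y])
    = sym_proj R M (word R \<one> [x]) \<oplus>\<^bsub>SM\<^esub> sym_proj R M (word R \<one> [y])"
proof -
  interpret F: ring FM by (rule FM_ring)
  have c: "word R \<one> [x] \<in> carrier FM" "word R \<one> [y] \<in> carrier FM" "word R \<one> [x \<oplus>\<^bsub>M\<^esub> y] \<in> carrier FM"
    using assms by (auto intro!: word_closed_FM)
  have "word R \<one> [x \<oplus>\<^bsub>M\<^esub> y] \<ominus>\<^bsub>FM\<^esub> (word R \<one> [x] \<oplus>\<^bsub>FM\<^esub> word R \<one> [y]) \<in> tensor_algebra_relations R M"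
    unfolding tensor_algebra_relations_def Let_def
    using F.genideal_self[OF linear_relations_closed] assms by blast
  then have "sym_proj R M (word R \<one> [x \<oplus>\<^bsub>M\<^esub> y]) = sym_proj R M (word R \<one> [x] \<oplus>\<^bsub>FM\<^esub> word R \<one> [y])"
    using c by (intro sym_proj_eqI) auto
  then show ?thesis using ring_hom_add[OF sym_proj_hom c(1,2)] by simp
qed

lemma sym_gen_smult:
  assumes "r \<in> carrier R" "x \<in> carrier M"
  shows "sym_proj R M (word R \<one> [r \<odot>\<^bsub>M\<^esub> x]) = sym_proj R M (word R r [x])"
proof (rule sym_proj_eqI)
  interpret F: ring FM by (rule FM_ring)
  show "word R \<one> [r \<odot>\<^bsub>M\<^esub> x] \<ominus>\<^bsub>FM\<^esub> word R r [x] \<in> tensor_algebra_relations R M"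
    unfolding tensor_algebra_relations_def Let_def
    using F.genideal_self[OF linear_relations_closed] assms by blast
qed (use assms in \<open>auto intro!: word_closed_FM\<close>)

text \<open>The universal property. A linear map on \<open>M\<close> enters as the homomorphism \<open>f\<close> on the free algebra that
  it induces. Additivity and homogeneity say that \<open>f\<close> kills the linear relations, and the commutators
  are killed because \<open>C\<close> is commutative.\<close>

theorem symmetric_algebra_lift:
  fixes C :: "('e0, 'n0) ring_scheme"
  assumes C: "cring C" and f: "f \<in> ring_hom FM C"
    and add: "\<And>x y. \<lbrakk>x \<in> carrier M; y \<in> carrier M\<rbrakk> \<Longrightarrow>
      f (word R \<one> [x \<oplus>\<^bsub>M\<^esub> y]) = f (word R \<one> [x]) \<oplus>\<^bsub>C\<^esub> f (word R \<one> [y])"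
    and smult: "\<And>r x. \<lbrakk>r \<in> carrier R; x \<in> carrier M\<rbrakk> \<Longrightarrow>
      f (word R \<one> [r \<odot>\<^bsub>M\<^esub> x]) = f (word R r [x])"
  obtains g where "g \<in> ring_hom SM C" "\<And>p. p \<in> carrier FM \<Longrightarrow> g (sym_proj R M p) = f p"
proof -
  interpret C: cring C by fact
  interpret F: ring FM by (rule FM_ring)
  interpret T: ring "tensor_algebra R M" by (rule tensor_algebra_ring)
  have f': "ring_hom_ring FM C f"
    by (intro ring_hom_ringI2 FM_ring C.ring_axioms f)
  note fm = ring_hom_minus[OF FM_ring C.ring_axioms f]
  have "tensor_algebra_relations R M \<subseteq> a_kernel FM C f"
    unfolding tensor_algebra_relations_def Let_def
  proof (intro F.genideal_minimal ring_hom_ring.kernel_is_ideal[OF f'] Un_least subsetI)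
    fix p assume "p \<in> {word R \<one> [x \<oplus>\<^bsub>M\<^esub> y] \<ominus>\<^bsub>FM\<^esub> (word R \<one> [x] \<oplus>\<^bsub>FM\<^esub> word R \<one> [y]) | x y.
      x \<in> carrier M \<and> y \<in> carrier M}"
    then obtain x y where xy: "x \<in> carrier M" "y \<in> carrier M"
        "p = word R \<one> [x \<oplus>\<^bsub>M\<^esub> y] \<ominus>\<^bsub>FM\<^esub> (word R \<one> [x] \<oplus>\<^bsub>FM\<^esub> word R \<one> [y])" by blast
    have c: "word R \<one> [x] \<in> carrier FM" "word R \<one> [y] \<in> carrier FM" "word R \<one> [x \<oplus>\<^bsub>M\<^esub> y] \<in> carrier FM"
      using xy by (auto intro!: word_closed_FM)
    then have "f p = \<zero>\<^bsub>C\<^esub>"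
      using xy add[OF xy(1,2)] ring_hom_add[OF f c(1,2)] ring_hom_closed[OF f c(3)]
      by (simp add: fm C.minus_eq C.r_neg)
    then show "p \<in> a_kernel FM C f" using c xy by (simp add: a_kernel_def')
  next
    fix p assume "p \<in> {word R \<one> [r \<odot>\<^bsub>M\<^esub> x] \<ominus>\<^bsub>FM\<^esub> word R r [x] | r x. r \<in> carrier R \<and> x \<in> carrier M}"
    then obtain r x where rx: "r \<in> carrier R" "x \<in> carrier M"
        "p = word R \<one> [r \<odot>\<^bsub>M\<^esub> x] \<ominus>\<^bsub>FM\<^esub> word R r [x]" by blast
    have c: "word R \<one> [r \<odot>\<^bsub>M\<^esub> x] \<in> carrier FM" "word R r [x] \<in> carrier FM"
      using rx by (auto intro!: word_closed_FM)
    then have "f p = \<zero>\<^bsub>C\<^esub>"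
      using rx smult[OF rx(1,2)] ring_hom_closed[OF f c(2)] by (simp add: fm C.minus_eq C.r_neg)
    then show "p \<in> a_kernel FM C f" using c rx by (simp add: a_kernel_def')
  qed
  then have "f p = \<zero>\<^bsub>C\<^esub>" if "p \<in> tensor_algebra_relations R M" for p
    using that by (auto simp: a_kernel_def')
  then obtain h where h: "h \<in> ring_hom (FM Quot tensor_algebra_relations R M) C"
      and hp: "\<And>p. p \<in> carrier FM \<Longrightarrow> h (tensor_algebra_relations R M +>\<^bsub>FM\<^esub> p) = f p"
    using quotient_ring_lift[OF FM_ring tensor_relations_ideal C.ring_axioms f] by blast
  have h: "h \<in> ring_hom (tensor_algebra R M) C" using h by (simp add: tensor_algebra_def)
  have h': "ring_hom_ring (tensor_algebra R M) C h"
    by (intro ring_hom_ringI2 T.ring_axioms C.ring_axioms h)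
  have "commutator_ideal R M \<subseteq> a_kernel (tensor_algebra R M) C h"
    unfolding commutator_ideal_def Let_def
  proof (intro T.genideal_minimal ring_hom_ring.kernel_is_ideal[OF h'] subsetI)
    fix t assume "t \<in> {(tensor_algebra_incl R M x \<otimes>\<^bsub>tensor_algebra R M\<^esub> tensor_algebra_incl R M y)
       \<ominus>\<^bsub>tensor_algebra R M\<^esub>
     (tensor_algebra_incl R M y \<otimes>\<^bsub>tensor_algebra R M\<^esub> tensor_algebra_incl R M x) | x y.
     x \<in> carrier M \<and> y \<in> carrier M}"
    then obtain x y where xy: "x \<in> carrier M" "y \<in> carrier M"
      and t: "t = (tensor_algebra_incl R M x \<otimes>\<^bsub>tensor_algebra R M\<^esub> tensor_algebra_incl R M y)
       \<ominus>\<^bsub>tensor_algebra R M\<^esub>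
        (tensor_algebra_incl R M y \<otimes>\<^bsub>tensor_algebra R M\<^esub> tensor_algebra_incl R M x)"
      by blast
    note c = tensor_incl_closed[OF xy(1)] tensor_incl_closed[OF xy(2)]
    have "h t = \<zero>\<^bsub>C\<^esub>"
      using ring_hom_minus[OF T.ring_axioms C.ring_axioms h T.m_closed[OF c] T.m_closed[OF c(2,1)]]
        ring_hom_mult[OF h c] ring_hom_mult[OF h c(2,1)] ring_hom_closed[OF h c(1)] ring_hom_closed[OF h c(2)]
        C.m_comm[of "h (tensor_algebra_incl R M x)" "h (tensor_algebra_incl R M y)"]
      by (simp add: t C.minus_eq C.r_neg)
    then show "t \<in> a_kernel (tensor_algebra R M) C h" using c t by (simp add: a_kernel_def')
  qed
  then have "h p = \<zero>\<^bsub>C\<^esub>" if "p \<in> commutator_ideal R M" for p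
    using that by (auto simp: a_kernel_def')
  then obtain g where g: "g \<in> ring_hom (tensor_algebra R M Quot commutator_ideal R M) C"
      and gp: "\<And>t. t \<in> carrier (tensor_algebra R M) \<Longrightarrow>
        g (commutator_ideal R M +>\<^bsub>tensor_algebra R M\<^esub> t) = h t"
    using quotient_ring_lift[OF tensor_algebra_ring commutator_ideal_ideal C.ring_axioms h] by blast
  have "g \<in> ring_hom SM C" using g by (simp add: symmetric_algebra_def)
  moreover have "g (sym_proj R M p) = f p" if "p \<in> carrier FM" for p
    using that by (simp add: sym_proj_def gp hp ring_hom_closed[OF tensor_proj_hom])
  ultimately show thesis by (rule that)
qed

end

section \<open>Subalgebras of a polynomial ring over an intersection of valuation rings\<close>

lemma (in UP) carrier_up: "carrier P = up R"
  unfolding P_def UP_def by simp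

lemma (in UP) coeff_up: "g \<in> up R \<Longrightarrow> up_ring.coeff P g n = g n"
  unfolding P_def UP_def by simp

locale field_poly = UP + R?: field R

sublocale field_poly < UP_domain
  by intro_locales [1] (rule P_def)

context field_poly
begin

abbreviation cf where "cf \<equiv> up_ring.coeff P"
abbreviation mon where "mon \<equiv> up_ring.monom P"

lemma inv_nz:
  assumes "x \<in> carrier R" "x \<noteq> \<zero>"
  shows "inv x \<in> carrier R" "x \<otimes> inv x = \<one>" "inv x \<otimes> x = \<one>" "inv x \<noteq> \<zero>" "inv (inv x) = x"
proof -
  have u: "x \<in> Units R" using assms R.field_Units by auto
  then show c: "inv x \<in> carrier R" "x \<otimes> inv x = \<one>" "inv x \<otimes> x = \<one>" by auto
  show "inv x \<noteq> \<zero>" using c(2) assms by (metis R.r_null R.zero_not_one)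
  show "inv (inv x) = x" using u by (rule R.Units_inv_inv)
qed

lemma mult_nz:
  "x \<in> carrier R \<Longrightarrow> y \<in> carrier R \<Longrightarrow> x \<noteq> \<zero> \<Longrightarrow> y \<noteq> \<zero> \<Longrightarrow> x \<otimes> y \<noteq> \<zero>"
  using R.integral by blast

lemma inv_mult:
  assumes "x \<in> carrier R" "x \<noteq> \<zero>" "y \<in> carrier R" "y \<noteq> \<zero>"
  shows "inv (x \<otimes> y) = inv x \<otimes> inv y"
proof (rule R.comm_inv_char)
  note i = inv_nz[OF assms(1,2)] inv_nz[OF assms(3,4)]
  have "x \<otimes> y \<otimes> (inv x \<otimes> inv y) = (x \<otimes> inv x) \<otimes> (y \<otimes> inv y)"
    using assms i(1,6) by (simp only: R.m_ac R.m_closed)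
  then show "x \<otimes> y \<otimes> (inv x \<otimes> inv y) = \<one>" using i by simp
qed (use assms inv_nz in auto)

lemma cancel_inv:
  assumes "x \<in> carrier R" "x \<noteq> \<zero>" "y \<in> carrier R"
  shows "x \<otimes> (inv x \<otimes> y) = y" "inv x \<otimes> (x \<otimes> y) = y"
  using assms inv_nz[OF assms(1,2)] by (simp_all add: R.m_assoc[symmetric])

abbreviation T where "T \<equiv> mon \<one> 1"

lemma const_eq: "x \<in> carrier R \<Longrightarrow> mon x 0 = x \<odot>\<^bsub>P\<^esub> \<one>\<^bsub>P\<^esub>"
  using monom_mult_smult[of x \<one> 0] by (simp add: monom_one)

lemma coeff_T_mult:
  assumes "u \<in> carrier P"
  shows "cf (T \<otimes>\<^bsub>P\<^esub> u) 0 = \<zero>" "cf (T \<otimes>\<^bsub>P\<^esub> u) (Suc n) = cf u n"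
proof -
  show "cf (T \<otimes>\<^bsub>P\<^esub> u) 0 = \<zero>" using assms by simp
  show "cf (T \<otimes>\<^bsub>P\<^esub> u) (Suc n) = cf u n"
    using coeff_monom_mult[OF R.one_closed assms, of 1 n] assms by (simp del: coeff_mult)
qed

lemma shift_exists:
  assumes f: "f \<in> carrier P" "cf f 0 = \<zero>"
  obtains u where "u \<in> carrier P" "f = T \<otimes>\<^bsub>P\<^esub> u" "\<And>n. cf u n = cf f (Suc n)"
proof -
  note carr = carrier_up and cf = coeff_up
  define u where "u = (\<lambda>n. f (Suc n))"
  have f': "f \<in> up R" using f(1) carr by simp
  obtain m where m: "bound \<zero> m f" using R.bound_upD[OF f'] by blast
  have "bound \<zero> m u" unfolding u_def by (intro bound.intro bound.bound[OF m]) simp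
  then have u': "u \<in> up R" using mem_upD[OF f'] by (intro mem_upI exI[of _ m]) (simp_all add: u_def)
  then have u: "u \<in> carrier P" by (simp only: carr)
  have cu: "cf u n = cf f (Suc n)" for n
    by (simp only: cf[OF f'] cf[OF u']) (simp only: u_def)
  have "cf f n = cf (T \<otimes>\<^bsub>P\<^esub> u) n" for n
    by (cases n) (simp_all only: coeff_T_mult[OF u] f(2) cu)
  then have "f = T \<otimes>\<^bsub>P\<^esub> u" using f(1) u by (intro up_eqI) auto
  with u cu show thesis by (intro that)
qed

lemma coeff_1_mult:
  assumes "p \<in> carrier P" "q \<in> carrier P"
  shows "cf (p \<otimes>\<^bsub>P\<^esub> q) 1 = cf p 0 \<otimes> cf q 1 \<oplus> cf p 1 \<otimes> cf q 0"
proof -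
  have "{..1::nat} = {0, 1}" by auto
  then show ?thesis using assms by (simp add: R.a_comm)
qed

lemma mult_smult:
  assumes "a \<in> carrier R" "f \<in> carrier P" "g \<in> carrier P"
  shows "f \<otimes>\<^bsub>P\<^esub> (a \<odot>\<^bsub>P\<^esub> g) = a \<odot>\<^bsub>P\<^esub> (f \<otimes>\<^bsub>P\<^esub> g)"
  using assms UP_smult_assoc2[of a g f] UP_m_comm[of f "a \<odot>\<^bsub>P\<^esub> g"] UP_m_comm[of g f] by simp

lemma smult_cancel_inv:
  assumes "a \<in> carrier R" "a \<noteq> \<zero>" "f \<in> carrier P"
  shows "inv a \<odot>\<^bsub>P\<^esub> (a \<odot>\<^bsub>P\<^esub> f) = f" "a \<odot>\<^bsub>P\<^esub> (inv a \<odot>\<^bsub>P\<^esub> f) = f"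
  using assms inv_nz[OF assms(1,2)] by (simp_all add: UP_smult_assoc1[symmetric])

lemma smult_left_comm:
  assumes "a \<in> carrier R" "b \<in> carrier R" "f \<in> carrier P"
  shows "a \<odot>\<^bsub>P\<^esub> (b \<odot>\<^bsub>P\<^esub> f) = b \<odot>\<^bsub>P\<^esub> (a \<odot>\<^bsub>P\<^esub> f)"
  using assms by (simp add: UP_smult_assoc1[symmetric] R.m_comm)

definition lprod :: "'a list \<Rightarrow> 'a" where "lprod ys = foldr (\<otimes>) ys \<one>"

definition lsum :: "('a \<times> 'a) list \<Rightarrow> 'a" where "lsum ps = foldr (\<lambda>(x, y) c. x \<otimes> y \<oplus> c) ps \<zero>"

lemma lprod_closed: "set ys \<subseteq> carrier R \<Longrightarrow> lprod ys \<in> carrier R"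
  by (induction ys) (auto simp: lprod_def)

lemma lsum_closed: "set ps \<subseteq> carrier R \<times> carrier R \<Longrightarrow> lsum ps \<in> carrier R"
  by (induction ps) (auto simp: lsum_def)

lemma lsum_append:
  "set ps \<subseteq> carrier R \<times> carrier R \<Longrightarrow> set qs \<subseteq> carrier R \<times> carrier R \<Longrightarrow> lsum (ps @ qs) = lsum ps \<oplus> lsum qs"
proof (induction ps)
  case Nil
  then show ?case using lsum_closed[of qs] by (simp add: lsum_def)
next
  case (Cons p ps)
  then show ?case using lsum_closed[of ps] lsum_closed[of qs]
    by (cases p) (simp add: lsum_def R.a_assoc)
qed

lemma lsum_smult:
  "set ps \<subseteq> carrier R \<times> carrier R \<Longrightarrow> a \<in> carrier R \<Longrightarrow> lsum (map (\<lambda>(x, y). (x, a \<otimes> y)) ps) = a \<otimes> lsum ps"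
proof (induction ps)
  case (Cons p ps)
  then show ?case using lsum_closed[of ps]
    by (cases p) (simp add: lsum_def R.r_distr R.m_lcomm)
qed (simp add: lsum_def)

end

text \<open>
  The situation of the theorem inside \<open>K[T]\<close>, where \<open>R\<close> now denotes the field. The base ring \<open>R0\<close> is an
  intersection of discrete valuation rings \<open>V i\<close> with uniformizers \<open>\<pi> i\<close>; each \<open>V i\<close> is a ring of
  fractions of \<open>R0\<close>, and a nonzero element of \<open>R0\<close> is a unit in all but finitely many of them. That
  \<open>s \<in> R0\<close> is a unit of \<open>V i\<close> is written \<open>inv s \<in> V i\<close>. Of the algebra \<open>B\<close> it is assumed that it spans
  \<open>K[T]\<close>, that \<open>f \<mapsto> f(0)\<close> maps it to \<open>R0\<close>, that it satisfies the consequence of flatness for colon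
  ideals, that the linear coefficients of elements with \<open>f(0) = 0\<close> form a finitely generated module, and that
  \<open>\<pi> i\<close> is prime in the localization of \<open>B\<close> at \<open>i\<close>. Finite generation is stated by minimality among the
  sets \<open>H\<close> that are closed under linear combinations.
\<close>

locale krull_subalgebra = field_poly +
  fixes R0 :: "'a set" and I :: "'i set" and V :: "'i \<Rightarrow> 'a set" and \<pi> :: "'i \<Rightarrow> 'a"
    and B :: "(nat \<Rightarrow> 'a) set"
  assumes base_subring: "subring R0 R"
    and valuation_subring: "i \<in> I \<Longrightarrow> subring (V i) R"
    and base_Int: "R0 = {x \<in> carrier R. \<forall>i\<in>I. x \<in> V i}"
    and base_fraction: "x \<in> carrier R \<Longrightarrow> \<exists>s\<in>R0. s \<noteq> \<zero> \<and> s \<otimes> x \<in> R0"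
    and valuation_fraction: "\<lbrakk>i \<in> I; x \<in> V i\<rbrakk> \<Longrightarrow> \<exists>s\<in>R0. s \<noteq> \<zero> \<and> inv s \<in> V i \<and> s \<otimes> x \<in> R0"
    and uniformizer: "i \<in> I \<Longrightarrow> \<pi> i \<in> R0" "i \<in> I \<Longrightarrow> \<pi> i \<noteq> \<zero>" "i \<in> I \<Longrightarrow> inv (\<pi> i) \<notin> V i"
    and discrete: "\<lbrakk>i \<in> I; x \<in> carrier R; x \<noteq> \<zero>\<rbrakk> \<Longrightarrow> \<exists>n::nat. \<exists>u\<in>V i. u \<noteq> \<zero> \<and> inv u \<in> V i \<and>
      (x = u \<otimes> \<pi> i [^] n \<or> x \<otimes> \<pi> i [^] n = u)"
    and finite_character: "\<lbrakk>r \<in> R0; r \<noteq> \<zero>\<rbrakk> \<Longrightarrow> finite {i \<in> I. inv r \<notin> V i}"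
    and sub_subring: "subring B P"
    and sub_smult: "\<lbrakk>r \<in> R0; f \<in> B\<rbrakk> \<Longrightarrow> r \<odot>\<^bsub>P\<^esub> f \<in> B"
    and sub_const: "f \<in> B \<Longrightarrow> cf f 0 \<in> R0"
    and sub_denom: "f \<in> carrier P \<Longrightarrow> \<exists>r\<in>R0. r \<noteq> \<zero> \<and> r \<odot>\<^bsub>P\<^esub> f \<in> B"
    and sub_flat: "\<And>(k::nat) r s f H. \<lbrakk>r \<in> R0; r \<noteq> \<zero>; \<And>j. s j \<in> R0; f \<in> B;
       \<And>j. j < k \<Longrightarrow> \<exists>g\<in>B. s j \<odot>\<^bsub>P\<^esub> f = r \<odot>\<^bsub>P\<^esub> g; subgroup H (add_monoid P);
       \<And>a g. \<lbrakk>a \<in> R0; \<And>j. j < k \<Longrightarrow> \<exists>b\<in>R0. s j \<otimes> a = r \<otimes> b; g \<in> B\<rbrakk> \<Longrightarrow> a \<odot>\<^bsub>P\<^esub> g \<in> H\<rbrakk> \<Longrightarrow> f \<in> H"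
    and linear_fg: "\<exists>C. finite C \<and> C \<subseteq> {cf f 1 | f. f \<in> B \<and> cf f 0 = \<zero>} \<and>
       (\<forall>H. \<zero> \<in> H \<and> (\<forall>x\<in>H. \<forall>y\<in>H. x \<oplus> y \<in> H) \<and> (\<forall>r\<in>R0. \<forall>x\<in>H. r \<otimes> x \<in> H) \<and> C \<subseteq> H \<longrightarrow>
          {cf f 1 | f. f \<in> B \<and> cf f 0 = \<zero>} \<subseteq> H)"
    and prime_fibre: "\<lbrakk>i \<in> I; f \<in> B; g \<in> B; h \<in> B; s \<in> R0; s \<noteq> \<zero>; inv s \<in> V i;
       s \<odot>\<^bsub>P\<^esub> (f \<otimes>\<^bsub>P\<^esub> g) = \<pi> i \<odot>\<^bsub>P\<^esub> h\<rbrakk> \<Longrightarrow>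
       \<exists>t\<in>R0. t \<noteq> \<zero> \<and> inv t \<in> V i \<and> (\<exists>e\<in>B. t \<odot>\<^bsub>P\<^esub> f = \<pi> i \<odot>\<^bsub>P\<^esub> e \<or> t \<odot>\<^bsub>P\<^esub> g = \<pi> i \<odot>\<^bsub>P\<^esub> e)"
begin

text \<open>The slopes: linear coefficients of the elements of the kernel of \<open>f \<mapsto> f(0)\<close>.\<close>

definition L where "L = {cf f 1 | f. f \<in> B \<and> cf f 0 = \<zero>}"

lemma R0_carrier: "x \<in> R0 \<Longrightarrow> x \<in> carrier R"
  using base_Int by blast

lemma B_carrier: "f \<in> B \<Longrightarrow> f \<in> carrier P"
  using subringE(1)[OF sub_subring] by blast

lemma V_carrier: "i \<in> I \<Longrightarrow> x \<in> V i \<Longrightarrow> x \<in> carrier R"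
  using subringE(1)[OF valuation_subring] by blast

lemma R0_V: "i \<in> I \<Longrightarrow> x \<in> R0 \<Longrightarrow> x \<in> V i"
  using base_Int by blast

lemma L_carrier: "x \<in> L \<Longrightarrow> x \<in> carrier R"
  by (auto simp: L_def B_carrier)

lemma one_B: "\<one>\<^bsub>P\<^esub> \<in> B" and B_mult: "f \<in> B \<Longrightarrow> g \<in> B \<Longrightarrow> f \<otimes>\<^bsub>P\<^esub> g \<in> B"
  and B_add: "f \<in> B \<Longrightarrow> g \<in> B \<Longrightarrow> f \<oplus>\<^bsub>P\<^esub> g \<in> B" and B_neg: "f \<in> B \<Longrightarrow> \<ominus>\<^bsub>P\<^esub> f \<in> B"
  using subringE[OF sub_subring] by auto

lemma const_B: "x \<in> R0 \<Longrightarrow> mon x 0 \<in> B"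
  using sub_smult[OF _ one_B] by (simp add: const_eq R0_carrier)

definition unitsV where "unitsV i = {s \<in> R0. s \<noteq> \<zero> \<and> inv s \<in> V i}"

text \<open>The localization of \<open>B\<close> at \<open>i\<close>, as a subring of \<open>K[T]\<close>.\<close>

definition BV where "BV i = {f \<in> carrier P. \<exists>s\<in>unitsV i. s \<odot>\<^bsub>P\<^esub> f \<in> B}"

lemma BV_carrier: "f \<in> BV i \<Longrightarrow> f \<in> carrier P"
  by (simp add: BV_def)

lemma unitsVD: "s \<in> unitsV i \<Longrightarrow> s \<in> R0 \<and> s \<in> carrier R \<and> s \<noteq> \<zero> \<and> inv s \<in> V i"
  by (auto simp: unitsV_def R0_carrier)

lemma unitsV_mult: "i \<in> I \<Longrightarrow> s \<in> unitsV i \<Longrightarrow> t \<in> unitsV i \<Longrightarrow> s \<otimes> t \<in> unitsV i"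
  unfolding unitsV_def using subringE(6)[OF base_subring] subringE(6)[OF valuation_subring]
  by (auto simp: inv_mult R0_carrier mult_nz)

lemma BV_B: "f \<in> B \<Longrightarrow> i \<in> I \<Longrightarrow> f \<in> BV i"
proof -
  assume f: "f \<in> B" "i \<in> I"
  have "\<one> \<in> unitsV i"
    using subringE(3)[OF base_subring] subringE(3)[OF valuation_subring[OF f(2)]]
    by (simp add: unitsV_def)
  then show ?thesis using f by (auto simp: BV_def B_carrier intro!: bexI[of _ "\<one>"])
qed

lemma BV_add:
  assumes i: "i \<in> I" and "f \<in> BV i" "g \<in> BV i" shows "f \<oplus>\<^bsub>P\<^esub> g \<in> BV i"
proof -
  obtain s t where st: "s \<in> unitsV i" "t \<in> unitsV i" "s \<odot>\<^bsub>P\<^esub> f \<in> B" "t \<odot>\<^bsub>P\<^esub> g \<in> B"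
      and c: "f \<in> carrier P" "g \<in> carrier P"
    using assms by (auto simp: BV_def)
  note u = unitsVD[OF st(1)] unitsVD[OF st(2)]
  have "(s \<otimes> t) \<odot>\<^bsub>P\<^esub> (f \<oplus>\<^bsub>P\<^esub> g) = t \<odot>\<^bsub>P\<^esub> (s \<odot>\<^bsub>P\<^esub> f) \<oplus>\<^bsub>P\<^esub> s \<odot>\<^bsub>P\<^esub> (t \<odot>\<^bsub>P\<^esub> g)"
    using u c smult_left_comm[of s t f] by (simp add: UP_smult_assoc1 UP_smult_r_distr)
  also have "\<dots> \<in> B" using u B_add[OF sub_smult[OF _ st(3), of t] sub_smult[OF _ st(4), of s]] by simp
  finally show ?thesis
    using c unitsV_mult[OF i st(1,2)] by (auto simp: BV_def intro!: bexI[of _ "s \<otimes> t"])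
qed

lemma BV_smult:
  assumes i: "i \<in> I" and v: "v \<in> V i" and f: "f \<in> BV i" shows "v \<odot>\<^bsub>P\<^esub> f \<in> BV i"
proof -
  obtain s where s: "s \<in> unitsV i" "s \<otimes> v \<in> R0"
    using valuation_fraction[OF i v] by (auto simp: unitsV_def)
  obtain t where t: "t \<in> unitsV i" "t \<odot>\<^bsub>P\<^esub> f \<in> B" and c: "f \<in> carrier P"
    using f by (auto simp: BV_def)
  note u = unitsVD[OF s(1)] unitsVD[OF t(1)] V_carrier[OF i v]
  have "(s \<otimes> t) \<odot>\<^bsub>P\<^esub> (v \<odot>\<^bsub>P\<^esub> f) = (s \<otimes> v) \<odot>\<^bsub>P\<^esub> (t \<odot>\<^bsub>P\<^esub> f)"
    using u c by (simp add: UP_smult_assoc1 smult_left_comm[of t v])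
  then show ?thesis
    using sub_smult[OF s(2) t(2)] u c unitsV_mult[OF i s(1) t(1)]
    by (auto simp: BV_def intro!: bexI[of _ "s \<otimes> t"])
qed

lemma BV_neg: "i \<in> I \<Longrightarrow> f \<in> BV i \<Longrightarrow> \<ominus>\<^bsub>P\<^esub> f \<in> BV i"
proof -
  assume i: "i \<in> I" "f \<in> BV i"
  have "\<ominus> \<one> \<in> V i" using subringE(3,5)[OF valuation_subring[OF i(1)]] by blast
  from BV_smult[OF i(1) this i(2)] show ?thesis
    using BV_carrier[OF i(2)] smult_l_minus[of \<one> f] by simp
qed

lemma BV_const:
  assumes i: "i \<in> I" and f: "f \<in> BV i" shows "cf f 0 \<in> V i"
proof -
  obtain s where s: "s \<in> unitsV i" "s \<odot>\<^bsub>P\<^esub> f \<in> B" and c: "f \<in> carrier P"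
    using f by (auto simp: BV_def)
  note u = unitsVD[OF s(1)]
  have "s \<otimes> cf f 0 \<in> V i" using sub_const[OF s(2)] R0_V[OF i] u c by simp
  then have "inv s \<otimes> (s \<otimes> cf f 0) \<in> V i"
    using u subringE(6)[OF valuation_subring[OF i]] by blast
  then show ?thesis using u c by (simp add: cancel_inv)
qed

lemma pi_carrier: "i \<in> I \<Longrightarrow> \<pi> i \<in> carrier R"
  using uniformizer(1) R0_carrier by blast

lemma pi_pow:
  assumes "i \<in> I"
  shows "\<pi> i [^] (n::nat) \<in> R0" "\<pi> i [^] n \<in> V i" "\<pi> i [^] n \<in> carrier R" "\<pi> i [^] n \<noteq> \<zero>"
proof -
  show 1: "\<pi> i [^] n \<in> R0"
    using subringE(3,6)[OF base_subring] uniformizer(1)[OF assms] by (induction n) auto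
  then show "\<pi> i [^] n \<in> V i" "\<pi> i [^] n \<in> carrier R"
    using R0_V[OF assms] R0_carrier by auto
  show "\<pi> i [^] n \<noteq> \<zero>"
    using uniformizer(2) pi_carrier assms by (induction n) (auto simp: mult_nz)
qed

text \<open>A denominator of \<open>f\<close> is a unit of \<open>V i\<close> times a power of \<open>\<pi> i\<close>, or the inverse of such a power.\<close>

lemma BV_power:
  assumes i: "i \<in> I" and f: "f \<in> carrier P" shows "\<exists>n::nat. \<pi> i [^] n \<odot>\<^bsub>P\<^esub> f \<in> BV i"
proof -
  obtain r where r: "r \<in> R0" "r \<noteq> \<zero>" "r \<odot>\<^bsub>P\<^esub> f \<in> B" using sub_denom[OF f] by blast
  obtain n u where u: "u \<in> V i" "u \<noteq> \<zero>" "inv u \<in> V i" "r = u \<otimes> \<pi> i [^] n \<or> r \<otimes> \<pi> i [^] (n::nat) = u"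
    using discrete[OF i R0_carrier[OF r(1)] r(2)] by blast
  note c = V_carrier[OF i u(1)] R0_carrier[OF r(1)] pi_pow[OF i, of n] V_carrier[OF i u(3)] f
  from u(4) show ?thesis
  proof
    assume e: "r = u \<otimes> \<pi> i [^] n"
    have "\<pi> i [^] n \<odot>\<^bsub>P\<^esub> f = inv u \<odot>\<^bsub>P\<^esub> (r \<odot>\<^bsub>P\<^esub> f)"
      using c u(2) by (simp add: e UP_smult_assoc1[symmetric] cancel_inv)
    then show ?thesis using BV_smult[OF i u(3) BV_B[OF r(3) i]] by (intro exI[of _ n]) simp
  next
    assume e: "r \<otimes> \<pi> i [^] n = u"
    have "(inv u \<otimes> \<pi> i [^] n) \<otimes> r = \<one>"
    proof -
      have "(inv u \<otimes> \<pi> i [^] n) \<otimes> r = inv u \<otimes> (r \<otimes> \<pi> i [^] n)"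
        using c by (simp add: R.m_ac)
      then show ?thesis using inv_nz[OF c(1) u(2)] e by simp
    qed
    then have "f = (inv u \<otimes> \<pi> i [^] n) \<odot>\<^bsub>P\<^esub> (r \<odot>\<^bsub>P\<^esub> f)"
      using c by (simp add: UP_smult_assoc1[symmetric])
    moreover have "inv u \<otimes> \<pi> i [^] n \<in> V i"
      using u(3) c(4) subringE(6)[OF valuation_subring[OF i]] by blast
    ultimately have "f \<in> BV i" using BV_smult[OF i _ BV_B[OF r(3) i]] by metis
    then show ?thesis using f by (intro exI[of _ 0]) simp
  qed
qed

text \<open>Units of \<open>V i\<close> clear the denominators, so \<open>\<pi> i\<close> inherits primality from the assumption on \<open>B\<close>.\<close>

lemma BV_prime:
  assumes i: "i \<in> I" and f: "f \<in> BV i" and g: "g \<in> BV i" and h: "h \<in> BV i"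
    and e: "f \<otimes>\<^bsub>P\<^esub> g = \<pi> i \<odot>\<^bsub>P\<^esub> h"
  shows "\<exists>e\<in>BV i. f = \<pi> i \<odot>\<^bsub>P\<^esub> e \<or> g = \<pi> i \<odot>\<^bsub>P\<^esub> e"
proof -
  obtain s t w where st: "s \<in> unitsV i" "t \<in> unitsV i" "w \<in> unitsV i" "s \<odot>\<^bsub>P\<^esub> f \<in> B" "t \<odot>\<^bsub>P\<^esub> g \<in> B"
      "w \<odot>\<^bsub>P\<^esub> h \<in> B" and c: "f \<in> carrier P" "g \<in> carrier P" "h \<in> carrier P"
    using assms by (auto simp: BV_def)
  note u = unitsVD[OF st(1)] unitsVD[OF st(2)] unitsVD[OF st(3)] pi_carrier[OF i]
  have "w \<odot>\<^bsub>P\<^esub> ((s \<odot>\<^bsub>P\<^esub> f) \<otimes>\<^bsub>P\<^esub> (t \<odot>\<^bsub>P\<^esub> g)) = w \<odot>\<^bsub>P\<^esub> (s \<odot>\<^bsub>P\<^esub> (t \<odot>\<^bsub>P\<^esub> (f \<otimes>\<^bsub>P\<^esub> g)))"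
    using u c by (simp add: UP_smult_assoc2 mult_smult smult_left_comm[of s t])
  also have "\<dots> = \<pi> i \<odot>\<^bsub>P\<^esub> (s \<odot>\<^bsub>P\<^esub> (t \<odot>\<^bsub>P\<^esub> (w \<odot>\<^bsub>P\<^esub> h)))"
    unfolding e using u c by (simp add: smult_left_comm[of _ "\<pi> i"] smult_left_comm[of w])
  finally have eq: "w \<odot>\<^bsub>P\<^esub> ((s \<odot>\<^bsub>P\<^esub> f) \<otimes>\<^bsub>P\<^esub> (t \<odot>\<^bsub>P\<^esub> g)) = \<pi> i \<odot>\<^bsub>P\<^esub> (s \<odot>\<^bsub>P\<^esub> (t \<odot>\<^bsub>P\<^esub> (w \<odot>\<^bsub>P\<^esub> h)))" .
  have "s \<odot>\<^bsub>P\<^esub> (t \<odot>\<^bsub>P\<^esub> (w \<odot>\<^bsub>P\<^esub> h)) \<in> B" using u sub_smult[OF _ sub_smult[OF _ st(6), of t], of s] by simp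
  from prime_fibre[OF i st(4,5) this _ _ _ eq] u
  obtain v q where v: "v \<in> R0" "v \<noteq> \<zero>" "inv v \<in> V i" "q \<in> B"
     "v \<odot>\<^bsub>P\<^esub> (s \<odot>\<^bsub>P\<^esub> f) = \<pi> i \<odot>\<^bsub>P\<^esub> q \<or> v \<odot>\<^bsub>P\<^esub> (t \<odot>\<^bsub>P\<^esub> g) = \<pi> i \<odot>\<^bsub>P\<^esub> q"
    by blast
  \<comment> \<open>dividing by the units \<open>v\<close> and \<open>s\<close> (or \<open>t\<close>) of \<open>V i\<close>\<close>
  have div: "\<exists>e\<in>BV i. x = \<pi> i \<odot>\<^bsub>P\<^esub> e"
    if z: "z \<in> unitsV i" "x \<in> carrier P" "v \<odot>\<^bsub>P\<^esub> (z \<odot>\<^bsub>P\<^esub> x) = \<pi> i \<odot>\<^bsub>P\<^esub> q" for z x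
  proof -
    note z' = unitsVD[OF z(1)] R0_carrier[OF v(1)] inv_nz[of z] inv_nz[of v]
    have "x = inv z \<odot>\<^bsub>P\<^esub> (inv v \<odot>\<^bsub>P\<^esub> (v \<odot>\<^bsub>P\<^esub> (z \<odot>\<^bsub>P\<^esub> x)))"
      using z' z(2) v(2) by (simp add: smult_cancel_inv)
    also have "\<dots> = \<pi> i \<odot>\<^bsub>P\<^esub> (inv z \<odot>\<^bsub>P\<^esub> (inv v \<odot>\<^bsub>P\<^esub> q))"
      unfolding z(3) using z' v u B_carrier[OF v(4)] by (simp add: smult_left_comm[of _ "\<pi> i"])
    finally show ?thesis
      using BV_smult[OF i _ BV_smult[OF i v(3) BV_B[OF v(4) i]], of "inv z"] z' by blast
  qed
  from v(5) show ?thesis using div[OF st(1) c(1)] div[OF st(2) c(2)] by blast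
qed

text \<open>A factor that is not divisible by the uniformizer can be cancelled inside \<open>BV i\<close>: if
  \<open>\<pi>\<^sup>k x\<close> is the first multiple of \<open>x\<close> in \<open>BV i\<close> and \<open>k > 0\<close>, then \<open>\<pi>\<close> divides \<open>h (\<pi>\<^sup>k x)\<close>, hence
  \<open>\<pi>\<^sup>k x\<close>, which contradicts the choice of \<open>k\<close>.\<close>

lemma BV_cancel:
  assumes i: "i \<in> I" and h: "h \<in> BV i" and ndvd: "\<not> (\<exists>e\<in>BV i. h = \<pi> i \<odot>\<^bsub>P\<^esub> e)"
    and x: "x \<in> carrier P" and hx: "h \<otimes>\<^bsub>P\<^esub> x \<in> BV i"
  shows "x \<in> BV i"
proof -
  define k where "k = (LEAST n::nat. \<pi> i [^] n \<odot>\<^bsub>P\<^esub> x \<in> BV i)"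
  have k: "\<pi> i [^] k \<odot>\<^bsub>P\<^esub> x \<in> BV i"
    unfolding k_def using BV_power[OF i x] by (rule LeastI_ex)
  note c = pi_carrier[OF i] pi_pow[OF i] BV_carrier[OF h] x BV_carrier[OF hx]
  show ?thesis
  proof (cases k)
    case 0
    then show ?thesis using k x by simp
  next
    case (Suc m)
    have "h \<otimes>\<^bsub>P\<^esub> (\<pi> i [^] k \<odot>\<^bsub>P\<^esub> x) = \<pi> i \<odot>\<^bsub>P\<^esub> (\<pi> i [^] m \<odot>\<^bsub>P\<^esub> (h \<otimes>\<^bsub>P\<^esub> x))"
      using c by (simp add: Suc mult_smult UP_smult_assoc1 smult_left_comm[of "\<pi> i"])
    moreover have "\<pi> i [^] m \<odot>\<^bsub>P\<^esub> (h \<otimes>\<^bsub>P\<^esub> x) \<in> BV i"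
      using BV_smult[OF i _ hx] c by blast
    ultimately obtain e where e: "e \<in> BV i" "\<pi> i [^] k \<odot>\<^bsub>P\<^esub> x = \<pi> i \<odot>\<^bsub>P\<^esub> e"
      using BV_prime[OF i h k] ndvd by blast
    have "\<pi> i \<odot>\<^bsub>P\<^esub> (\<pi> i [^] m \<odot>\<^bsub>P\<^esub> x) = \<pi> i \<odot>\<^bsub>P\<^esub> e"
      using e(2) c by (simp add: Suc UP_smult_assoc1 smult_left_comm[of "\<pi> i"])
    then have "inv (\<pi> i) \<odot>\<^bsub>P\<^esub> (\<pi> i \<odot>\<^bsub>P\<^esub> (\<pi> i [^] m \<odot>\<^bsub>P\<^esub> x)) = inv (\<pi> i) \<odot>\<^bsub>P\<^esub> (\<pi> i \<odot>\<^bsub>P\<^esub> e)"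
      by simp
    then have "\<pi> i [^] m \<odot>\<^bsub>P\<^esub> x = e"
      using c BV_carrier[OF e(1)] uniformizer(2)[OF i] by (simp add: smult_cancel_inv)
    then have "m \<ge> k" unfolding k_def using e(1) by (intro Least_le) simp
    then show ?thesis using Suc by simp
  qed
qed

lemma L_zero: "\<zero> \<in> L"
  unfolding L_def using subringE(2)[OF sub_subring] by (force intro: exI[of _ "\<zero>\<^bsub>P\<^esub>"])

lemma L_add: "x \<in> L \<Longrightarrow> y \<in> L \<Longrightarrow> x \<oplus> y \<in> L"
  unfolding L_def
proof clarify
  fix f g assume "f \<in> B" "g \<in> B" "cf f 0 = \<zero>" "cf g 0 = \<zero>"
  then show "\<exists>h. cf f 1 \<oplus> cf g 1 = cf h 1 \<and> h \<in> B \<and> cf h 0 = \<zero>"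
    by (intro exI[of _ "f \<oplus>\<^bsub>P\<^esub> g"]) (auto simp: B_add B_carrier)
qed

lemma L_smult: "r \<in> R0 \<Longrightarrow> x \<in> L \<Longrightarrow> r \<otimes> x \<in> L"
  unfolding L_def
proof clarify
  fix f assume "r \<in> R0" "f \<in> B" "cf f 0 = \<zero>"
  then show "\<exists>h. r \<otimes> cf f 1 = cf h 1 \<and> h \<in> B \<and> cf h 0 = \<zero>"
    by (intro exI[of _ "r \<odot>\<^bsub>P\<^esub> f"]) (auto simp: sub_smult B_carrier R0_carrier)
qed

lemma L_neg: "x \<in> L \<Longrightarrow> \<ominus> x \<in> L"
  using L_smult[of "\<ominus> \<one>" x] subringE(3,5)[OF base_subring] L_carrier[of x] by (simp add: R.l_minus)

text \<open>The constant coefficient lies in \<open>R0\<close> and can be subtracted.\<close>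

lemma L_linear_coeff: "f \<in> B \<Longrightarrow> cf f 1 \<in> L"
proof -
  assume f: "f \<in> B"
  let ?g = "f \<oplus>\<^bsub>P\<^esub> \<ominus>\<^bsub>P\<^esub> mon (cf f 0) 0"
  have c: "cf f 0 \<in> carrier R" "f \<in> carrier P" using f B_carrier by auto
  have "?g \<in> B" using f by (intro B_add B_neg const_B sub_const)
  moreover have "cf ?g 0 = \<zero>" "cf ?g 1 = cf f 1" using c by (simp_all add: R.r_neg)
  ultimately show ?thesis unfolding L_def by (auto intro!: exI[of _ ?g])
qed

lemma L_fg:
  obtains C where "finite C" "C \<subseteq> L"
    "\<And>H. \<lbrakk>\<zero> \<in> H; \<And>x y. x \<in> H \<Longrightarrow> y \<in> H \<Longrightarrow> x \<oplus> y \<in> H; \<And>r x. r \<in> R0 \<Longrightarrow> x \<in> H \<Longrightarrow> r \<otimes> x \<in> H; C \<subseteq> H\<rbrakk>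
      \<Longrightarrow> L \<subseteq> H"
  using linear_fg unfolding L_def[symmetric] by metis

lemma L_nonzero: "\<exists>x\<in>L. x \<noteq> \<zero>"
proof -
  have T: "T \<in> carrier P" by simp
  obtain r where r: "r \<in> R0" "r \<noteq> \<zero>" "r \<odot>\<^bsub>P\<^esub> T \<in> B" using sub_denom[OF T] by blast
  have "cf (r \<odot>\<^bsub>P\<^esub> T) 1 = r" using R0_carrier[OF r(1)] by simp
  then show ?thesis using L_linear_coeff[OF r(3)] r(2) by auto
qed

text \<open>The quotient of two elements is a unit of \<open>V i\<close> times a power of \<open>\<pi> i\<close>, or the inverse of such an element.\<close>

lemma valuation_total:
  assumes i: "i \<in> I" and xy: "x \<in> carrier R" "x \<noteq> \<zero>" "y \<in> carrier R" "y \<noteq> \<zero>"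
  shows "x \<otimes> inv y \<in> V i \<or> y \<otimes> inv x \<in> V i"
proof -
  note iv = inv_nz[OF xy(1,2)] inv_nz[OF xy(3,4)]
  have c: "x \<otimes> inv y \<in> carrier R" "x \<otimes> inv y \<noteq> \<zero>" using xy iv by (auto simp: mult_nz)
  obtain n u where u: "u \<in> V i" "u \<noteq> \<zero>" "inv u \<in> V i"
      "x \<otimes> inv y = u \<otimes> \<pi> i [^] n \<or> x \<otimes> inv y \<otimes> \<pi> i [^] (n::nat) = u"
    using discrete[OF i c] by blast
  note uc = V_carrier[OF i u(1)] pi_pow[OF i, of n] V_carrier[OF i u(3)]
  note Vm = subringE(6)[OF valuation_subring[OF i]]
  from u(4) show ?thesis
  proof
    assume "x \<otimes> inv y = u \<otimes> \<pi> i [^] n"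
    then show ?thesis using Vm[OF u(1) uc(3)] by simp
  next
    assume e: "x \<otimes> inv y \<otimes> \<pi> i [^] n = u"
    have "y \<otimes> inv x = (y \<otimes> inv x) \<otimes> (inv u \<otimes> (x \<otimes> inv y \<otimes> \<pi> i [^] n))"
      unfolding e using inv_nz[OF uc(1) u(2)] xy iv by simp
    also have "\<dots> = inv u \<otimes> \<pi> i [^] n \<otimes> (x \<otimes> inv x) \<otimes> (y \<otimes> inv y)"
      using xy iv(1,6) uc by (simp add: R.m_ac)
    also have "\<dots> = inv u \<otimes> \<pi> i [^] n" using iv uc by simp
    finally show ?thesis using Vm[OF u(3) uc(3)] by simp
  qed
qed

text \<open>By \<open>valuation_total\<close>, one of finitely many generators of \<open>L\<close> divides all the others.\<close>

lemma L_locally_principal: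
  assumes i: "i \<in> I"
  obtains \<delta> where "\<delta> \<in> L" "\<delta> \<noteq> \<zero>" "\<And>c. c \<in> L \<Longrightarrow> c \<otimes> inv \<delta> \<in> V i"
proof -
  note Vm = subringE(6)[OF valuation_subring[OF i]] and Va = subringE(7)[OF valuation_subring[OF i]]
    and V0 = subringE(2)[OF valuation_subring[OF i]] and V1 = subringE(3)[OF valuation_subring[OF i]]
  obtain C where C: "finite C" "C \<subseteq> L" and gen: "\<And>H. \<lbrakk>\<zero> \<in> H; \<And>x y. x \<in> H \<Longrightarrow> y \<in> H \<Longrightarrow> x \<oplus> y \<in> H;
      \<And>r x. r \<in> R0 \<Longrightarrow> x \<in> H \<Longrightarrow> r \<otimes> x \<in> H; C \<subseteq> H\<rbrakk> \<Longrightarrow> L \<subseteq> H"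
    by (rule L_fg) blast
  have "C - {\<zero>} \<noteq> {}"
  proof
    assume "C - {\<zero>} = {}"
    then have "L \<subseteq> {\<zero>}" using R0_carrier by (intro gen) auto
    then show False using L_nonzero by blast
  qed
  moreover have "\<exists>\<delta>\<in>D. \<forall>c\<in>D. c \<otimes> inv \<delta> \<in> V i"
    if "finite D" "D \<noteq> {}" "D \<subseteq> carrier R - {\<zero>}" for D
    using that
  proof (induction D rule: finite_ne_induct)
    case (singleton x)
    then show ?case using inv_nz[of x] V1 by simp
  next
    case (insert x D)
    then obtain \<delta> where d: "\<delta> \<in> D" "\<forall>c\<in>D. c \<otimes> inv \<delta> \<in> V i" by auto
    have xd: "x \<in> carrier R" "x \<noteq> \<zero>" "\<delta> \<in> carrier R" "\<delta> \<noteq> \<zero>" using insert d by auto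
    note iv = inv_nz[OF xd(1,2)] inv_nz[OF xd(3,4)]
    show ?case
    proof (cases "x \<otimes> inv \<delta> \<in> V i")
      case True
      then show ?thesis using d by auto
    next
      case False
      then have dx: "\<delta> \<otimes> inv x \<in> V i" using valuation_total[OF i xd] by blast
      have "c \<otimes> inv x \<in> V i" if c: "c \<in> D" for c
      proof -
        have cc: "c \<in> carrier R" using c insert by auto
        have "c \<otimes> inv x = (c \<otimes> inv x) \<otimes> (\<delta> \<otimes> inv \<delta>)" using cc iv by simp
        also have "\<dots> = (c \<otimes> inv \<delta>) \<otimes> (\<delta> \<otimes> inv x)" using cc iv(1,6) xd by (simp add: R.m_ac)
        finally show ?thesis using Vm[OF d(2)[rule_format, OF c] dx] by simp
      qed
      moreover have "x \<otimes> inv x \<in> V i" using iv V1 by simp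
      ultimately have "\<forall>c\<in>insert x D. c \<otimes> inv x \<in> V i" by blast
      then show ?thesis by blast
    qed
  qed
  moreover have "finite (C - {\<zero>})" "C - {\<zero>} \<subseteq> carrier R - {\<zero>}" using C L_carrier by auto
  ultimately obtain \<delta> where d: "\<delta> \<in> C - {\<zero>}" "\<forall>c\<in>C - {\<zero>}. c \<otimes> inv \<delta> \<in> V i"
    by blast
  have dc: "\<delta> \<in> L" "\<delta> \<noteq> \<zero>" "\<delta> \<in> carrier R" using d C L_carrier by auto
  note iv = inv_nz[OF dc(3,2)]
  have "L \<subseteq> {x \<in> carrier R. x \<otimes> inv \<delta> \<in> V i}"
  proof (rule gen)
    show "\<zero> \<in> {x \<in> carrier R. x \<otimes> inv \<delta> \<in> V i}" using iv V0 by simp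
    show "C \<subseteq> {x \<in> carrier R. x \<otimes> inv \<delta> \<in> V i}"
    proof
      fix c assume "c \<in> C"
      then show "c \<in> {x \<in> carrier R. x \<otimes> inv \<delta> \<in> V i}"
        using d(2) C L_carrier iv V0 by (cases "c = \<zero>") auto
    qed
  next
    fix x y assume "x \<in> {x \<in> carrier R. x \<otimes> inv \<delta> \<in> V i}" "y \<in> {x \<in> carrier R. x \<otimes> inv \<delta> \<in> V i}"
    then show "x \<oplus> y \<in> {x \<in> carrier R. x \<otimes> inv \<delta> \<in> V i}"
      using iv Va by (simp add: R.l_distr)
  next
    fix r x assume "r \<in> R0" "x \<in> {x \<in> carrier R. x \<otimes> inv \<delta> \<in> V i}"
    then show "r \<otimes> x \<in> {x \<in> carrier R. x \<otimes> inv \<delta> \<in> V i}"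
      using iv Vm[OF R0_V[OF i]] by (simp add: R.m_assoc R0_carrier)
  qed
  with dc show thesis by (intro that) auto
qed

text \<open>Locally, \<open>B\<close> is the polynomial ring over \<open>V i\<close> in the variable \<open>\<delta> T\<close>. That
  \<open>\<delta> T\<close> belongs to it rests on \<open>BV_cancel\<close>: with \<open>g = \<delta> T u \<in> B\<close> and \<open>u(0) = 1\<close>, if \<open>h = \<pi>\<^sup>n \<delta> T\<close> is the first multiple of \<open>\<delta> T\<close> in
  \<open>BV i\<close> and \<open>n > 0\<close>, then \<open>h u = \<pi>\<^sup>n g\<close>, so \<open>u \<in> BV i\<close> and \<open>\<pi>\<close> divides \<open>u\<close>, which contradicts
  \<open>u(0) = 1\<close>.\<close>

lemma BV_variable:
  assumes i: "i \<in> I" and d: "\<delta> \<in> L" "\<delta> \<noteq> \<zero>"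
  shows "\<delta> \<odot>\<^bsub>P\<^esub> T \<in> BV i"
proof -
  have dc: "\<delta> \<in> carrier R" using L_carrier[OF d(1)] .
  note iv = inv_nz[OF dc d(2)]
  obtain g where g: "g \<in> B" "cf g 0 = \<zero>" "cf g 1 = \<delta>" using d(1) by (auto simp: L_def)
  note gc = B_carrier[OF g(1)]
  obtain w where w: "w \<in> carrier P" "g = T \<otimes>\<^bsub>P\<^esub> w" "\<And>n. cf w n = cf g (Suc n)"
    using shift_exists[OF gc g(2)] by blast
  define u where "u = inv \<delta> \<odot>\<^bsub>P\<^esub> w"
  have u: "u \<in> carrier P" "cf u 0 = \<one>" using w(1) w(3)[of 0] iv dc g(3) by (simp_all add: u_def)
  have gu: "g = (\<delta> \<odot>\<^bsub>P\<^esub> T) \<otimes>\<^bsub>P\<^esub> u"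
    unfolding u_def using w(1) iv dc by (simp add: UP_smult_assoc2 mult_smult smult_cancel_inv[OF dc d(2)] w(2))
  define n where "n = (LEAST n::nat. \<pi> i [^] n \<odot>\<^bsub>P\<^esub> (\<delta> \<odot>\<^bsub>P\<^esub> T) \<in> BV i)"
  have Tc: "\<delta> \<odot>\<^bsub>P\<^esub> T \<in> carrier P" using dc by simp
  have n: "\<pi> i [^] n \<odot>\<^bsub>P\<^esub> (\<delta> \<odot>\<^bsub>P\<^esub> T) \<in> BV i"
    unfolding n_def using BV_power[OF i Tc] by (rule LeastI_ex)
  note c = pi_carrier[OF i] pi_pow[OF i] Tc u(1) gc
  show ?thesis
  proof (cases n)
    case 0
    then show ?thesis using n Tc by simp
  next
    case (Suc m)
    define h where "h = \<pi> i [^] n \<odot>\<^bsub>P\<^esub> (\<delta> \<odot>\<^bsub>P\<^esub> T)"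
    have split: "\<pi> i [^] n \<odot>\<^bsub>P\<^esub> x = \<pi> i \<odot>\<^bsub>P\<^esub> (\<pi> i [^] m \<odot>\<^bsub>P\<^esub> x)" if "x \<in> carrier P" for x
      using that c by (simp add: Suc UP_smult_assoc1 smult_left_comm[of "\<pi> i"])
    have ndvd: "\<not> (\<exists>e\<in>BV i. h = \<pi> i \<odot>\<^bsub>P\<^esub> e)"
    proof
      assume "\<exists>e\<in>BV i. h = \<pi> i \<odot>\<^bsub>P\<^esub> e"
      then obtain e where e: "e \<in> BV i" "\<pi> i \<odot>\<^bsub>P\<^esub> (\<pi> i [^] m \<odot>\<^bsub>P\<^esub> (\<delta> \<odot>\<^bsub>P\<^esub> T)) = \<pi> i \<odot>\<^bsub>P\<^esub> e"
        unfolding h_def split[OF Tc] by blast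
      have "inv (\<pi> i) \<odot>\<^bsub>P\<^esub> (\<pi> i \<odot>\<^bsub>P\<^esub> (\<pi> i [^] m \<odot>\<^bsub>P\<^esub> (\<delta> \<odot>\<^bsub>P\<^esub> T))) = inv (\<pi> i) \<odot>\<^bsub>P\<^esub> (\<pi> i \<odot>\<^bsub>P\<^esub> e)"
        by (simp only: e(2))
      then have "\<pi> i [^] m \<odot>\<^bsub>P\<^esub> (\<delta> \<odot>\<^bsub>P\<^esub> T) = e"
        by (simp only: smult_cancel_inv[OF c(1) uniformizer(2)[OF i]] BV_carrier[OF e(1)] UP_smult_closed c(4) Tc)
      then have "n \<le> m" unfolding n_def using e(1) by (intro Least_le) simp
      then show False using Suc by simp
    qed
    have hu: "h \<otimes>\<^bsub>P\<^esub> u = \<pi> i \<odot>\<^bsub>P\<^esub> (\<pi> i [^] m \<odot>\<^bsub>P\<^esub> g)"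
    proof -
      have "h \<otimes>\<^bsub>P\<^esub> u = \<pi> i [^] n \<odot>\<^bsub>P\<^esub> ((\<delta> \<odot>\<^bsub>P\<^esub> T) \<otimes>\<^bsub>P\<^esub> u)"
        unfolding h_def by (rule UP_smult_assoc2[OF c(4) Tc u(1)])
      then show ?thesis by (simp only: gu[symmetric] split[OF gc])
    qed
    have mg: "\<pi> i [^] m \<odot>\<^bsub>P\<^esub> g \<in> BV i" by (rule BV_smult[OF i c(3) BV_B[OF g(1) i]])
    have "h \<otimes>\<^bsub>P\<^esub> u \<in> BV i"
      unfolding hu using BV_smult[OF i R0_V[OF i uniformizer(1)[OF i]] mg] .
    then have uB: "u \<in> BV i"
      using BV_cancel[OF i _ ndvd u(1)] n by (simp add: h_def)
    obtain e where e: "e \<in> BV i" "u = \<pi> i \<odot>\<^bsub>P\<^esub> e"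
      using BV_prime[OF i n[folded h_def] uB mg hu] ndvd by blast
    have "\<one> = \<pi> i \<otimes> cf e 0" using u(2) e BV_carrier[OF e(1)] c(1) by simp
    then have "inv (\<pi> i) = cf e 0"
      using c(1) BV_carrier[OF e(1)] by (intro R.comm_inv_char) auto
    then show ?thesis using BV_const[OF i e(1)] uniformizer(3)[OF i] by simp
  qed
qed

text \<open>Subtract \<open>f(0)\<close>, divide by \<open>\<delta> T\<close> and induct on \<open>n\<close>. The quotient stays in \<open>BV i\<close> by \<open>BV_cancel\<close>: if
  \<open>\<delta> T = \<pi> e\<close> with \<open>e \<in> BV i\<close>, then the linear coefficient of \<open>e\<close> lies in \<open>\<delta> V i\<close>, and \<open>\<pi>\<close> would be a unit.\<close>

lemma BV_coeff:
  assumes i: "i \<in> I" and d: "\<delta> \<in> L" "\<delta> \<noteq> \<zero>" "\<And>c. c \<in> L \<Longrightarrow> c \<otimes> inv \<delta> \<in> V i"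
    and f: "f \<in> BV i"
  shows "cf f n \<otimes> inv \<delta> [^] n \<in> V i"
  using f
proof (induction n arbitrary: f)
  case 0
  then show ?case using BV_const[OF i 0] BV_carrier[OF 0] by simp
next
  case (Suc n)
  have dc: "\<delta> \<in> carrier R" using L_carrier[OF d(1)] .
  note iv = inv_nz[OF dc d(2)] and fc = BV_carrier[OF Suc.prems] and pc = pi_carrier[OF i]
  let ?g = "f \<oplus>\<^bsub>P\<^esub> \<ominus>\<^bsub>P\<^esub> mon (cf f 0) 0"
  have "mon (cf f 0) 0 \<in> BV i"
    unfolding const_eq[OF coeff_closed[OF fc]]
    by (intro BV_smult[OF i] BV_const[OF i] BV_B one_B i Suc.prems)
  then have g: "?g \<in> BV i" by (intro BV_add[OF i] BV_neg[OF i] Suc.prems)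
  have gc: "?g \<in> carrier P" "cf ?g 0 = \<zero>" "\<And>n. cf ?g (Suc n) = cf f (Suc n)"
    using fc by (simp_all add: R.r_neg)
  obtain w where w: "w \<in> carrier P" "?g = T \<otimes>\<^bsub>P\<^esub> w" "\<And>n. cf w n = cf ?g (Suc n)"
    using shift_exists[OF gc(1,2)] by blast
  have Tc: "\<delta> \<odot>\<^bsub>P\<^esub> T \<in> carrier P" using dc by simp
  have "?g = (\<delta> \<odot>\<^bsub>P\<^esub> T) \<otimes>\<^bsub>P\<^esub> (inv \<delta> \<odot>\<^bsub>P\<^esub> w)"
    unfolding w(2) using w(1) iv dc by (simp add: UP_smult_assoc2 mult_smult smult_cancel_inv[OF dc d(2)])
  moreover have "\<not> (\<exists>e\<in>BV i. \<delta> \<odot>\<^bsub>P\<^esub> T = \<pi> i \<odot>\<^bsub>P\<^esub> e)"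
  proof
    assume "\<exists>e\<in>BV i. \<delta> \<odot>\<^bsub>P\<^esub> T = \<pi> i \<odot>\<^bsub>P\<^esub> e"
    then obtain e where e: "e \<in> BV i" "\<delta> \<odot>\<^bsub>P\<^esub> T = \<pi> i \<odot>\<^bsub>P\<^esub> e" by blast
    note ec = BV_carrier[OF e(1)]
    have "cf (\<delta> \<odot>\<^bsub>P\<^esub> T) 1 = cf (\<pi> i \<odot>\<^bsub>P\<^esub> e) 1" by (simp only: e(2))
    then have de: "\<delta> = \<pi> i \<otimes> cf e 1" using dc ec pc by simp
    obtain s where s: "s \<in> unitsV i" "s \<odot>\<^bsub>P\<^esub> e \<in> B" using e(1) by (auto simp: BV_def)
    note u = unitsVD[OF s(1)]
    have "cf (s \<odot>\<^bsub>P\<^esub> e) 1 \<otimes> inv \<delta> \<in> V i" by (intro d(3) L_linear_coeff s)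
    then have "inv s \<otimes> ((s \<otimes> cf e 1) \<otimes> inv \<delta>) \<in> V i"
      using subringE(6)[OF valuation_subring[OF i]] u ec by simp
    then have "cf e 1 \<otimes> inv \<delta> \<in> V i"
      using u ec iv by (simp add: R.m_assoc cancel_inv)
    moreover have "inv (\<pi> i) = cf e 1 \<otimes> inv \<delta>"
    proof (rule R.comm_inv_char)
      show "\<pi> i \<otimes> (cf e 1 \<otimes> inv \<delta>) = \<one>"
        using de iv pc ec by (simp add: R.m_assoc[symmetric])
    qed (use pc ec iv in auto)
    ultimately show False using uniformizer(3)[OF i] by simp
  qed
  ultimately have "inv \<delta> \<odot>\<^bsub>P\<^esub> w \<in> BV i"
    using BV_cancel[OF i BV_variable[OF i d(1,2)]] g w(1) iv by (metis UP_smult_closed)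
  from Suc.IH[OF this] show ?case
    using w(1) w(3)[of n] gc(3)[of n] iv fc by (simp add: R.m_ac)
qed

text \<open>\<open>B\<close> is the intersection of its localizations. For \<open>m = r f \<in> B\<close>, flatness applies to one
  equation \<open>s\<^sub>i m \<in> r B\<close> for each of the finitely many \<open>i\<close> at which \<open>r\<close> is not a unit: the colon ideal
  \<open>(r : s\<^sub>i)\<close> is contained in \<open>r R0\<close>, because \<open>R0\<close> is an intersection as well.\<close>

lemma B_Int:
  assumes f: "f \<in> carrier P" and loc: "\<And>i. i \<in> I \<Longrightarrow> f \<in> BV i"
  shows "f \<in> B"
proof -
  obtain r where r: "r \<in> R0" "r \<noteq> \<zero>" "r \<odot>\<^bsub>P\<^esub> f \<in> B" using sub_denom[OF f] by blast
  have rc: "r \<in> carrier R" using R0_carrier[OF r(1)] .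
  note iv = inv_nz[OF rc r(2)]
  define bad where "bad = {i \<in> I. inv r \<notin> V i}"
  obtain js where js: "set js = bad"
    using finite_list[OF finite_character[OF r(1,2)]] unfolding bad_def by blast
  define s where "s j = (if j < length js then SOME s. s \<in> unitsV (js ! j) \<and> s \<odot>\<^bsub>P\<^esub> f \<in> B else \<zero>)" for j
  have s: "s j \<in> unitsV (js ! j) \<and> s j \<odot>\<^bsub>P\<^esub> f \<in> B" if "j < length js" for j
  proof -
    have "js ! j \<in> I" using that js by (auto simp: bad_def dest: nth_mem)
    then have "\<exists>s. s \<in> unitsV (js ! j) \<and> s \<odot>\<^bsub>P\<^esub> f \<in> B" using loc by (auto simp: BV_def)
    from someI_ex[OF this] show ?thesis using that by (simp add: s_def)
  qed
  have sR: "s j \<in> R0" for j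
    using s[of j] subringE(2)[OF base_subring] by (cases "j < length js") (auto simp: s_def unitsV_def)
  define H where "H = {r \<odot>\<^bsub>P\<^esub> b | b. b \<in> B}"
  have "r \<odot>\<^bsub>P\<^esub> f \<in> H"
  proof (rule sub_flat[OF r(1,2) sR r(3)])
    show "\<exists>g\<in>B. s j \<odot>\<^bsub>P\<^esub> (r \<odot>\<^bsub>P\<^esub> f) = r \<odot>\<^bsub>P\<^esub> g" if "j < length js" for j
      using s[OF that] rc f R0_carrier[OF sR] by (intro bexI[of _ "s j \<odot>\<^bsub>P\<^esub> f"]) (auto simp: smult_left_comm)
  next
    show "subgroup H (add_monoid P)"
    proof (rule P.add.subgroupI)
      show "H \<subseteq> carrier P" using rc B_carrier by (auto simp: H_def)
      show "H \<noteq> {}" using one_B by (auto simp: H_def)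
    next
      fix x assume "x \<in> H"
      then obtain b where b: "b \<in> B" "x = r \<odot>\<^bsub>P\<^esub> b" by (auto simp: H_def)
      have "\<ominus>\<^bsub>P\<^esub> x = r \<odot>\<^bsub>P\<^esub> (\<ominus>\<^bsub>P\<^esub> b)"
        using b rc B_carrier smult_r_minus[of r b] by simp
      then show "\<ominus>\<^bsub>P\<^esub> x \<in> H" using B_neg[OF b(1)] by (auto simp: H_def)
    next
      fix x y assume "x \<in> H" "y \<in> H"
      then obtain b c where b: "b \<in> B" "x = r \<odot>\<^bsub>P\<^esub> b" "c \<in> B" "y = r \<odot>\<^bsub>P\<^esub> c" by (auto simp: H_def)
      then have "x \<oplus>\<^bsub>P\<^esub> y = r \<odot>\<^bsub>P\<^esub> (b \<oplus>\<^bsub>P\<^esub> c)"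
        using rc B_carrier by (simp add: UP_smult_r_distr)
      then show "x \<oplus>\<^bsub>P\<^esub> y \<in> H" using B_add[OF b(1,3)] by (auto simp: H_def)
    qed
  next
    fix a g assume a: "a \<in> R0" "g \<in> B" and col: "\<And>j. j < length js \<Longrightarrow> \<exists>b\<in>R0. s j \<otimes> a = r \<otimes> b"
    have ac: "a \<in> carrier R" using R0_carrier[OF a(1)] .
    have "a \<otimes> inv r \<in> V i" if i: "i \<in> I" for i
    proof (cases "i \<in> bad")
      case False
      then have "inv r \<in> V i" using i by (simp add: bad_def)
      then show ?thesis using R0_V[OF i a(1)] subringE(6)[OF valuation_subring[OF i]] by blast
    next
      case True
      then obtain j where j: "j < length js" "js ! j = i" using js by (metis in_set_conv_nth)
      obtain b where b: "b \<in> R0" "s j \<otimes> a = r \<otimes> b" using col[OF j(1)] by blast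
      have u: "s j \<in> R0 \<and> s j \<in> carrier R \<and> s j \<noteq> \<zero> \<and> inv (s j) \<in> V i"
        using s[OF j(1)] unitsVD j(2) by blast
      have bc: "b \<in> carrier R" using R0_carrier[OF b(1)] .
      have ic: "inv (s j) \<in> carrier R" using inv_nz u by blast
      have "a \<otimes> inv r = inv (s j) \<otimes> (s j \<otimes> a) \<otimes> inv r"
        using u ac by (simp add: cancel_inv)
      also have "\<dots> = inv (s j) \<otimes> b \<otimes> (r \<otimes> inv r)"
        unfolding b(2) using ic bc rc iv(1) by (simp add: R.m_ac)
      also have "\<dots> = inv (s j) \<otimes> b" using ic bc iv by simp
      finally show ?thesis
        using u R0_V[OF i b(1)] subringE(6)[OF valuation_subring[OF i]] by simp
    qed
    then have q: "a \<otimes> inv r \<in> R0" using ac iv by (subst base_Int) auto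
    have "a \<odot>\<^bsub>P\<^esub> g = r \<odot>\<^bsub>P\<^esub> ((a \<otimes> inv r) \<odot>\<^bsub>P\<^esub> g)"
      using ac rc iv B_carrier[OF a(2)] by (simp add: UP_smult_assoc1[symmetric] cancel_inv R.m_lcomm[of r a])
    then show "a \<odot>\<^bsub>P\<^esub> g \<in> H" using sub_smult[OF q a(2)] by (auto simp: H_def)
  qed
  then obtain b where b: "b \<in> B" "r \<odot>\<^bsub>P\<^esub> f = r \<odot>\<^bsub>P\<^esub> b" by (auto simp: H_def)
  have "inv r \<odot>\<^bsub>P\<^esub> (r \<odot>\<^bsub>P\<^esub> f) = inv r \<odot>\<^bsub>P\<^esub> (r \<odot>\<^bsub>P\<^esub> b)" by (simp only: b(2))
  then have "f = b" by (simp only: smult_cancel_inv[OF rc r(2)] f B_carrier[OF b(1)])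
  with b show ?thesis by simp
qed

text \<open>Locally \<open>c T = (c / \<delta>) (\<delta> T)\<close> with \<open>c / \<delta> \<in> V i\<close>; then \<open>B_Int\<close> globalizes.\<close>

lemma L_variable: "c \<in> L \<Longrightarrow> c \<odot>\<^bsub>P\<^esub> T \<in> B"
proof (rule B_Int)
  assume c: "c \<in> L"
  then have cc: "c \<in> carrier R" by (rule L_carrier)
  then show "c \<odot>\<^bsub>P\<^esub> T \<in> carrier P" by simp
  fix i assume i: "i \<in> I"
  obtain \<delta> where d: "\<delta> \<in> L" "\<delta> \<noteq> \<zero>" "\<And>c. c \<in> L \<Longrightarrow> c \<otimes> inv \<delta> \<in> V i"
    using L_locally_principal[OF i] by blast
  have dc: "\<delta> \<in> carrier R" using L_carrier[OF d(1)] .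
  note iv = inv_nz[OF dc d(2)]
  have "c \<odot>\<^bsub>P\<^esub> T = (c \<otimes> inv \<delta>) \<odot>\<^bsub>P\<^esub> (\<delta> \<odot>\<^bsub>P\<^esub> T)"
    using cc dc iv by (simp add: UP_smult_assoc1[symmetric] R.m_assoc)
  then show "c \<odot>\<^bsub>P\<^esub> T \<in> BV i"
    using BV_smult[OF i d(3)[OF c] BV_variable[OF i d(1,2)]] by simp
qed

end

section \<open>Invertibility of the module of slopes\<close>

context krull_subalgebra
begin

text \<open>The fractional inverse \<open>(R0 : L)\<close>.\<close>

definition M where "M = {y \<in> carrier R. \<forall>c\<in>L. c \<otimes> y \<in> R0}"

lemma M_carrier: "y \<in> M \<Longrightarrow> y \<in> carrier R"
  by (simp add: M_def)

lemma M_smult: "r \<in> R0 \<Longrightarrow> y \<in> M \<Longrightarrow> r \<otimes> y \<in> M"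
  using subringE(6)[OF base_subring] L_carrier
  by (auto simp: M_def R0_carrier R.m_lcomm[of _ r])

lemma common_denom:
  assumes "finite C" "C \<subseteq> carrier R"
  shows "\<exists>d\<in>R0. d \<noteq> \<zero> \<and> (\<forall>c\<in>C. d \<otimes> c \<in> R0)"
  using assms
proof (induction C rule: finite_induct)
  case empty
  show ?case using subringE(3)[OF base_subring] by (intro bexI[of _ "\<one>"]) auto
next
  case (insert x C)
  then obtain d where d: "d \<in> R0" "d \<noteq> \<zero>" "\<forall>c\<in>C. d \<otimes> c \<in> R0" by auto
  obtain s where s: "s \<in> R0" "s \<noteq> \<zero>" "s \<otimes> x \<in> R0" using base_fraction insert.prems by auto
  note c = R0_carrier[OF d(1)] R0_carrier[OF s(1)] and Rm = subringE(6)[OF base_subring]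
  have "(d \<otimes> s) \<otimes> y \<in> R0" if y: "y \<in> insert x C" for y
  proof -
    have yc: "y \<in> carrier R" using y insert.prems by auto
    have "(d \<otimes> s) \<otimes> y = d \<otimes> (s \<otimes> y)" "(d \<otimes> s) \<otimes> y = s \<otimes> (d \<otimes> y)"
      using c yc by (simp_all add: R.m_ac)
    moreover have "d \<otimes> (s \<otimes> y) \<in> R0 \<or> s \<otimes> (d \<otimes> y) \<in> R0"
      using y Rm[OF d(1) s(3)] Rm[OF s(1)] d(3) by auto
    ultimately show ?thesis by auto
  qed
  then show ?case using Rm[OF d(1) s(1)] c d(2) s(2) mult_nz by blast
qed

lemma L_denom: obtains d where "d \<in> R0" "d \<noteq> \<zero>" "\<And>c. c \<in> L \<Longrightarrow> d \<otimes> c \<in> R0"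
proof -
  obtain C where C: "finite C" "C \<subseteq> L" and gen: "\<And>H. \<lbrakk>\<zero> \<in> H; \<And>x y. x \<in> H \<Longrightarrow> y \<in> H \<Longrightarrow> x \<oplus> y \<in> H;
      \<And>r x. r \<in> R0 \<Longrightarrow> x \<in> H \<Longrightarrow> r \<otimes> x \<in> H; C \<subseteq> H\<rbrakk> \<Longrightarrow> L \<subseteq> H"
    by (rule L_fg) blast
  obtain d where d: "d \<in> R0" "d \<noteq> \<zero>" "\<forall>c\<in>C. d \<otimes> c \<in> R0"
    using common_denom[of C] C L_carrier by blast
  note dc = R0_carrier[OF d(1)]
  have "L \<subseteq> {x \<in> carrier R. d \<otimes> x \<in> R0}"
    using subringE[OF base_subring] d dc C L_carrier R0_carrier
    by (intro gen) (auto simp: R.r_distr R.m_lcomm[of d])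
  with d show thesis by (intro that[of d]) auto
qed

text \<open>\<open>L\<close> is invertible. For \<open>c\<^sub>0 \<in> L\<close>, the element \<open>f = c\<^sub>0 T\<close> satisfies \<open>c f = c\<^sub>0 (c T) \<in> c\<^sub>0 B\<close> for every
  \<open>c \<in> L\<close>. By flatness \<open>f\<close> lies in \<open>(c\<^sub>0 : L) B = c\<^sub>0 M B\<close>, and comparing linear coefficients gives
  \<open>c\<^sub>0 \<in> c\<^sub>0 M L\<close>.\<close>

lemma one_in_LM:
  obtains ps where "set ps \<subseteq> L \<times> M" "lsum ps = \<one>"
proof -
  obtain c0 where c0: "c0 \<in> L" "c0 \<noteq> \<zero>" using L_nonzero by blast
  have c0c: "c0 \<in> carrier R" using L_carrier[OF c0(1)] .
  note iv = inv_nz[OF c0c c0(2)]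
  obtain d where d: "d \<in> R0" "d \<noteq> \<zero>" "\<And>c. c \<in> L \<Longrightarrow> d \<otimes> c \<in> R0" by (rule L_denom) blast
  note dc = R0_carrier[OF d(1)]
  obtain C where C: "finite C" "C \<subseteq> L" and gen: "\<And>H. \<lbrakk>\<zero> \<in> H; \<And>x y. x \<in> H \<Longrightarrow> y \<in> H \<Longrightarrow> x \<oplus> y \<in> H;
      \<And>r x. r \<in> R0 \<Longrightarrow> x \<in> H \<Longrightarrow> r \<otimes> x \<in> H; C \<subseteq> H\<rbrakk> \<Longrightarrow> L \<subseteq> H"
    by (rule L_fg) blast
  obtain cs where cs: "set cs = C" using finite_list[OF C(1)] by blast
  define s where "s j = (if j < length cs then d \<otimes> (cs ! j) else \<zero>)" for j
  have csL: "cs ! j \<in> L" if "j < length cs" for j using that cs C(2) nth_mem by blast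
  have sR: "s j \<in> R0" for j
    using d(3) csL subringE(2)[OF base_subring] by (simp add: s_def)
  define f where "f = c0 \<odot>\<^bsub>P\<^esub> T"
  have Tc: "T \<in> carrier P" by simp
  have pc: "set ps \<subseteq> carrier R \<times> carrier R" if "set ps \<subseteq> L \<times> M" for ps
    using that L_carrier M_carrier by blast
  define H where "H = {g \<in> carrier P. \<exists>ps. set ps \<subseteq> L \<times> M \<and> cf g 1 = c0 \<otimes> lsum ps}"
  have "f \<in> H"
  proof (rule sub_flat[where r = "d \<otimes> c0" and s = s and k = "length cs"])
    show "d \<otimes> c0 \<in> R0" by (rule d(3)[OF c0(1)])
    show "d \<otimes> c0 \<noteq> \<zero>" using dc d(2) c0c c0(2) by (intro mult_nz)
    show "s j \<in> R0" for j by (rule sR)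
    show "f \<in> B" unfolding f_def by (rule L_variable[OF c0(1)])
  next
    fix j assume j: "j < length cs"
    have cj: "cs ! j \<in> carrier R" using csL[OF j] L_carrier by blast
    have "s j \<odot>\<^bsub>P\<^esub> f = (d \<otimes> c0) \<odot>\<^bsub>P\<^esub> ((cs ! j) \<odot>\<^bsub>P\<^esub> T)"
      using j cj dc c0c Tc by (simp add: s_def f_def UP_smult_assoc1[symmetric] R.m_ac del: monom_closed)
    then show "\<exists>g\<in>B. s j \<odot>\<^bsub>P\<^esub> f = (d \<otimes> c0) \<odot>\<^bsub>P\<^esub> g" using L_variable[OF csL[OF j]] by blast
  next
    show "subgroup H (add_monoid P)"
    proof (rule P.add.subgroupI)
      show "H \<subseteq> carrier P" by (auto simp: H_def)
      have "cf \<zero>\<^bsub>P\<^esub> 1 = c0 \<otimes> lsum []" using c0c by (simp add: lsum_def)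
      then have "\<zero>\<^bsub>P\<^esub> \<in> H" unfolding H_def by (intro CollectI conjI exI[of _ "[]"]) simp_all
      then show "H \<noteq> {}" by blast
    next
      fix g assume "g \<in> H"
      then obtain ps where ps: "g \<in> carrier P" "set ps \<subseteq> L \<times> M" "cf g 1 = c0 \<otimes> lsum ps" by (auto simp: H_def)
      have m: "\<ominus> \<one> \<in> R0" using subringE(3,5)[OF base_subring] by blast
      have "set (map (\<lambda>(x, y). (x, \<ominus> \<one> \<otimes> y)) ps) \<subseteq> L \<times> M"
        using ps(2) M_smult[OF m] by auto
      moreover have "cf (\<ominus>\<^bsub>P\<^esub> g) 1 = c0 \<otimes> lsum (map (\<lambda>(x, y). (x, \<ominus> \<one> \<otimes> y)) ps)"
        using ps(1,3) c0c lsum_closed[OF pc[OF ps(2)]]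
        by (simp add: lsum_smult[OF pc[OF ps(2)]] R.l_minus R.r_minus)
      ultimately show "\<ominus>\<^bsub>P\<^esub> g \<in> H" using ps(1) unfolding H_def by blast
    next
      fix g h assume "g \<in> H" "h \<in> H"
      then obtain ps qs where ps: "g \<in> carrier P" "set ps \<subseteq> L \<times> M" "cf g 1 = c0 \<otimes> lsum ps"
        and qs: "h \<in> carrier P" "set qs \<subseteq> L \<times> M" "cf h 1 = c0 \<otimes> lsum qs" by (auto simp: H_def)
      have "cf (g \<oplus>\<^bsub>P\<^esub> h) 1 = c0 \<otimes> lsum (ps @ qs)"
        using ps(1,3) qs(1,3) c0c lsum_closed[OF pc[OF ps(2)]] lsum_closed[OF pc[OF qs(2)]]
        by (simp add: lsum_append[OF pc[OF ps(2)] pc[OF qs(2)]] R.r_distr)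
      moreover have "set (ps @ qs) \<subseteq> L \<times> M" using ps qs by simp
      ultimately show "g \<oplus>\<^bsub>P\<^esub> h \<in> H" using ps(1) qs(1) unfolding H_def by blast
    qed
  next
    fix a g assume a: "a \<in> R0" "g \<in> B"
      and col: "\<And>j. j < length cs \<Longrightarrow> \<exists>b\<in>R0. s j \<otimes> a = (d \<otimes> c0) \<otimes> b"
    have ac: "a \<in> carrier R" using R0_carrier[OF a(1)] .
    define y where "y = inv c0 \<otimes> a"
    have yc: "y \<in> carrier R" using iv ac by (simp add: y_def)
    have "c \<otimes> y \<in> R0" if c: "c \<in> C" for c
    proof -
      obtain j where j: "j < length cs" "cs ! j = c" using c cs by (metis in_set_conv_nth)
      obtain b where b: "b \<in> R0" "s j \<otimes> a = (d \<otimes> c0) \<otimes> b" using col[OF j(1)] by blast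
      have cc: "c \<in> carrier R" "b \<in> carrier R" using c C(2) L_carrier R0_carrier b(1) by auto
      have dc0: "d \<otimes> c0 \<in> carrier R" "d \<otimes> c0 \<noteq> \<zero>" using dc d(2) c0c c0(2) mult_nz by auto
      have "(d \<otimes> c0) \<otimes> (c \<otimes> y) = d \<otimes> (c \<otimes> (c0 \<otimes> (inv c0 \<otimes> a)))"
        using dc c0c cc iv(1) ac by (simp add: y_def R.m_ac)
      also have "\<dots> = s j \<otimes> a"
        using j dc cc ac c0c c0(2) by (simp add: cancel_inv s_def R.m_assoc)
      also have "\<dots> = (d \<otimes> c0) \<otimes> b" by (rule b(2))
      finally have "(d \<otimes> c0) \<otimes> (c \<otimes> y) = (d \<otimes> c0) \<otimes> b" .
      then have "c \<otimes> y = b"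
        using R.m_lcancel[OF dc0(2,1), of "c \<otimes> y" b] cc yc by simp
      then show ?thesis using b(1) by simp
    qed
    then have "L \<subseteq> {x \<in> carrier R. x \<otimes> y \<in> R0}"
      using subringE[OF base_subring] C L_carrier R0_carrier yc
      by (intro gen) (auto simp: R.l_distr R.m_assoc)
    then have yM: "y \<in> M" using yc by (auto simp: M_def)
    have l: "cf g 1 \<in> L" by (rule L_linear_coeff[OF a(2)])
    have gc: "g \<in> carrier P" by (rule B_carrier[OF a(2)])
    have "a = c0 \<otimes> y" using ac c0c c0(2) by (simp add: y_def cancel_inv)
    then have "cf (a \<odot>\<^bsub>P\<^esub> g) 1 = c0 \<otimes> lsum [(cf g 1, y)]"
      using gc c0c yc by (simp add: lsum_def R.m_ac)
    moreover have "set [(cf g 1, y)] \<subseteq> L \<times> M" using l yM by simp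
    ultimately show "a \<odot>\<^bsub>P\<^esub> g \<in> H" using ac gc unfolding H_def by blast
  qed
  then obtain ps where ps: "set ps \<subseteq> L \<times> M" "cf f 1 = c0 \<otimes> lsum ps" by (auto simp: H_def)
  have "c0 \<otimes> \<one> = c0 \<otimes> lsum ps" using ps(2) c0c by (simp add: f_def)
  then have "lsum ps = \<one>"
    using R.m_lcancel[OF c0(2) c0c R.one_closed lsum_closed[OF pc[OF ps(1)]]] by simp
  with ps(1) show thesis by (rule that)
qed

text \<open>The coefficients of \<open>T\<^sup>n\<close> in \<open>B\<close> are paired into \<open>R0\<close> by \<open>n\<close>-fold products of elements of \<open>M\<close>. As \<open>M\<close>
  is the inverse of \<open>L\<close>, this bounds the coefficients by \<open>L\<^sup>n\<close>.\<close>

definition dual_degree :: "nat \<Rightarrow> 'a set" where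
  "dual_degree n = {c \<in> carrier R. \<forall>ys. set ys \<subseteq> M \<and> length ys = n \<longrightarrow> c \<otimes> lprod ys \<in> R0}"

text \<open>This can be tested in each \<open>V i\<close>, where the coefficient is \<open>\<delta>\<^sup>n\<close> times an element of \<open>V i\<close> by \<open>BV_coeff\<close>,
  and each of the \<open>n\<close> factors from \<open>M\<close> absorbs one \<open>\<delta>\<close>.\<close>

lemma B_coeff_dual:
  assumes f: "f \<in> B" shows "cf f n \<in> dual_degree n"
proof -
  note fc = B_carrier[OF f]
  have "cf f n \<otimes> lprod ys \<in> V i" if ys: "set ys \<subseteq> M" "length ys = n" and i: "i \<in> I" for ys i
  proof -
    obtain \<delta> where d: "\<delta> \<in> L" "\<delta> \<noteq> \<zero>" "\<And>c. c \<in> L \<Longrightarrow> c \<otimes> inv \<delta> \<in> V i"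
      using L_locally_principal[OF i] by blast
    have dc: "\<delta> \<in> carrier R" using L_carrier[OF d(1)] .
    note iv = inv_nz[OF dc d(2)] and Vm = subringE(6)[OF valuation_subring[OF i]]
    have key: "x \<otimes> lprod ys \<in> V i"
      if "set ys \<subseteq> M" "x \<in> carrier R" "x \<otimes> inv \<delta> [^] length ys \<in> V i" for x ys
      using that
    proof (induction ys arbitrary: x)
      case Nil
      then show ?case by (simp add: lprod_def)
    next
      case (Cons y ys)
      have yc: "y \<in> M" "y \<in> carrier R" using Cons.prems M_carrier by auto
      have dy: "\<delta> \<otimes> y \<in> V i" using yc(1) d(1) R0_V[OF i] by (auto simp: M_def)
      have pc: "inv \<delta> [^] length ys \<in> carrier R" "lprod ys \<in> carrier R"
        using iv Cons.prems M_carrier by (auto intro!: lprod_closed)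
      have "(x \<otimes> y) \<otimes> inv \<delta> [^] length ys = (\<delta> \<otimes> y) \<otimes> (x \<otimes> inv \<delta> [^] length (y # ys))"
      proof -
        have "(\<delta> \<otimes> y) \<otimes> (x \<otimes> inv \<delta> [^] length (y # ys)) = (\<delta> \<otimes> inv \<delta>) \<otimes> ((x \<otimes> y) \<otimes> inv \<delta> [^] length ys)"
          using dc yc(2) Cons.prems(2) iv(1) pc by (simp add: R.m_ac)
        then show ?thesis using iv Cons.prems(2) yc(2) pc by simp
      qed
      then have "(x \<otimes> y) \<otimes> inv \<delta> [^] length ys \<in> V i" using Vm[OF dy Cons.prems(3)] by simp
      then have "(x \<otimes> y) \<otimes> lprod ys \<in> V i" using Cons.prems yc by (intro Cons.IH) auto
      then show ?case using Cons.prems(2) yc(2) pc by (simp add: lprod_def R.m_assoc)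
    qed
    show ?thesis
      using key[OF ys(1) coeff_closed[OF fc]] BV_coeff[OF i d BV_B[OF f i]] ys(2) by simp
  qed
  moreover have "lprod ys \<in> carrier R" if "set ys \<subseteq> M" for ys
    using that M_carrier by (intro lprod_closed) auto
  ultimately show ?thesis
    using fc unfolding dual_degree_def by (subst base_Int) auto
qed

lemma dual_degree_Suc:
  assumes "c \<in> dual_degree (Suc n)" "y \<in> M" shows "y \<otimes> c \<in> dual_degree n"
proof -
  have "y \<otimes> c \<otimes> lprod ys \<in> R0" if "set ys \<subseteq> M" "length ys = n" for ys
  proof -
    have "lprod ys \<in> carrier R" using that M_carrier by (intro lprod_closed) auto
    then have "y \<otimes> c \<otimes> lprod ys = c \<otimes> lprod (y # ys)"
      using assms M_carrier by (simp add: lprod_def dual_degree_def R.m_ac)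
    moreover have "set (y # ys) \<subseteq> M" "length (y # ys) = Suc n" using that assms by auto
    ultimately show ?thesis using assms(1) unfolding dual_degree_def by auto
  qed
  then show ?thesis using assms M_carrier by (simp add: dual_degree_def)
qed

lemma dual_degree_0: "c \<in> dual_degree 0 \<Longrightarrow> c \<in> R0"
  by (auto simp: dual_degree_def lprod_def)

text \<open>Let \<open>\<Sum> x\<^sub>i y\<^sub>i = 1\<close> with \<open>x\<^sub>i \<in> L\<close> and \<open>y\<^sub>i \<in> M\<close>. A coefficient \<open>c\<close> of \<open>T\<^sup>n\<^sup>+\<^sup>1\<close> satisfies
  \<open>c T\<^sup>n\<^sup>+\<^sup>1 = \<Sum> (x\<^sub>i T) (y\<^sub>i c T\<^sup>n)\<close>, where \<open>y\<^sub>i c\<close> is paired into \<open>R0\<close> by \<open>n\<close>-fold products; so \<open>B\<close> is contained in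
  every ring that contains \<open>R0\<close> and \<open>L T\<close>.\<close>

theorem B_generated:
  assumes G: "subring G P" and const: "\<And>r. r \<in> R0 \<Longrightarrow> mon r 0 \<in> G"
    and lin: "\<And>c. c \<in> L \<Longrightarrow> c \<odot>\<^bsub>P\<^esub> T \<in> G"
  shows "B \<subseteq> G"
proof
  obtain ps where ps: "set ps \<subseteq> L \<times> M" "lsum ps = \<one>" by (rule one_in_LM)
  have mono: "mon c n \<in> G" if "c \<in> dual_degree n" for c n
    using that
  proof (induction n arbitrary: c)
    case 0
    then show ?case by (intro const dual_degree_0)
  next
    case (Suc n)
    have cc: "c \<in> carrier R" using Suc.prems by (simp add: dual_degree_def)
    have "mon (lsum qs \<otimes> c) (Suc n) \<in> G" if "set qs \<subseteq> L \<times> M" for qs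
      using that
    proof (induction qs)
      case Nil
      then show ?case using cc subringE(2)[OF G] by (simp add: lsum_def)
    next
      case (Cons q qs)
      obtain x y where q: "q = (x, y)" "x \<in> L" "y \<in> M" using Cons.prems by (cases q) auto
      have xy: "x \<in> carrier R" "y \<in> carrier R" using q L_carrier M_carrier by auto
      have qc: "lsum qs \<in> carrier R" using Cons.prems L_carrier M_carrier by (intro lsum_closed) auto
      have "mon x 1 = x \<odot>\<^bsub>P\<^esub> T" using monom_mult_smult[of x \<one> 1] xy by simp
      then have "mon x 1 \<otimes>\<^bsub>P\<^esub> mon (y \<otimes> c) n \<in> G"
        using lin[OF q(2)] Suc.IH[OF dual_degree_Suc[OF Suc.prems q(3)]] subringE(6)[OF G] by simp
      moreover have "mon x 1 \<otimes>\<^bsub>P\<^esub> mon (y \<otimes> c) n = mon (x \<otimes> y \<otimes> c) (Suc n)"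
        using monom_mult[of x "y \<otimes> c" 1 n] xy cc by (simp add: R.m_assoc)
      ultimately have "mon (x \<otimes> y \<otimes> c) (Suc n) \<oplus>\<^bsub>P\<^esub> mon (lsum qs \<otimes> c) (Suc n) \<in> G"
        using subringE(7)[OF G] Cons by simp
      then show ?case
        using q xy qc cc by (simp add: lsum_def R.l_distr)
    qed
    from this[OF ps(1)] show ?case using ps(2) cc by simp
  qed
  fix f assume f: "f \<in> B"
  have fc: "f \<in> carrier P" by (rule B_carrier[OF f])
  have "(\<Oplus>\<^bsub>P\<^esub>i\<in>{..n}. mon (cf f i) i) \<in> G" for n
  proof (induction n)
    case 0
    then show ?case using mono[OF B_coeff_dual[OF f, of 0]] fc by simp
  next
    case (Suc n)
    then show ?case
      using mono[OF B_coeff_dual[OF f, of "Suc n"]] subringE(7)[OF G] fc by simp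
  qed
  from this[of "deg R f"] show "f \<in> G" using up_repr[OF fc] by simp
qed

end

section \<open>Discrete valuation rings of fractions\<close>

lemma (in primeideal) complement_localized: "localized_ring R (carrier R - I)"
proof unfold_locales
  show "\<one> \<in> carrier R - I" using one_imp_carrier I_notcarr by auto
  show "s \<otimes> t \<in> carrier R - I" if "s \<in> carrier R - I" "t \<in> carrier R - I" for s t
    using that I_prime[of s t] by auto
qed auto

context "domain"
begin

context
  fixes P :: "'a set"
  assumes P: "primeideal P R"
begin

lemma localization_at_eq_iff:
  assumes "a \<in> carrier R" "b \<in> carrier R" "s \<in> carrier R - P" "t \<in> carrier R - P"
  shows "fract R (carrier R - P) a s = fract R (carrier R - P) b t \<longleftrightarrow> a \<otimes> t = b \<otimes> s"
proof -
  interpret P: primeideal P R by (rule P)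
  interpret Q: localized_ring R "carrier R - P" by (rule P.complement_localized)
  have "u \<noteq> \<zero>" if "u \<in> carrier R - P" for u using that additive_subgroup.zero_closed[OF P.is_additive_subgroup] by auto
  then show ?thesis
    using assms m_lcancel[of _ "a \<otimes> t" "b \<otimes> s"] Q.denoms_one by (auto simp: Q.fract_eq_iff)
qed

lemma localization_at_nonunit:
  assumes "a \<in> P" "s \<in> carrier R - P" shows "fract R (carrier R - P) a s \<notin> Units (localization_at R P)"
proof
  interpret P: primeideal P R by (rule P)
  interpret Q: localized_ring R "carrier R - P" by (rule P.complement_localized)
  assume "fract R (carrier R - P) a s \<in> Units (localization_at R P)"
  then obtain y where y: "y \<in> carrier (localization_at R P)"
      "fract R (carrier R - P) a s \<otimes>\<^bsub>localization_at R P\<^esub> y = \<one>\<^bsub>localization_at R P\<^esub>"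
    by (auto simp: Units_def)
  from y(1) obtain b t where bt: "b \<in> carrier R" "t \<in> carrier R - P" "y = fract R (carrier R - P) b t"
    unfolding localization_at_def by (rule Q.fract_cases)
  have ac: "a \<in> carrier R" using assms(1) by (rule P.Icarr)
  have "s \<otimes> t \<in> carrier R - P" using Q.denoms_mult assms bt by blast
  moreover have "a \<otimes> b \<otimes> \<one> = \<one> \<otimes> (s \<otimes> t)"
    using y(2) bt ac assms Q.denoms_one \<open>s \<otimes> t \<in> carrier R - P\<close> unfolding localization_at_def
    by (simp add: Q.fract_mult Q.fract_one localization_at_eq_iff del: r_one l_one)
  then have "a \<otimes> b = s \<otimes> t" using ac bt assms by simp
  moreover have "a \<otimes> b \<in> P" using assms(1) bt(1) by (rule P.I_r_closed)
  ultimately show False by auto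
qed

text \<open>What is used about the discrete valuation ring \<open>R\<^sub>P\<close>, in terms of \<open>R\<close>: a uniformizer \<open>\<pi>\<close> can be
  taken in \<open>P\<close>, and every nonzero element is a power of \<open>\<pi>\<close> up to factors outside \<open>P\<close>.\<close>

lemma dvr_uniformizer:
  assumes dvr: "discrete_valuation_ring (localization_at R P)"
  obtains \<pi> where "\<pi> \<in> P" "\<pi> \<noteq> \<zero>"
    "\<And>x. x \<in> P \<Longrightarrow> \<exists>s\<in>carrier R - P. \<exists>r\<in>carrier R. s \<otimes> x = r \<otimes> \<pi>"
    "\<And>x. x \<in> carrier R \<Longrightarrow> x \<noteq> \<zero> \<Longrightarrow>
       \<exists>n::nat. \<exists>s\<in>carrier R - P. \<exists>t\<in>carrier R - P. s \<otimes> x = t \<otimes> \<pi> [^] n"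
proof -
  interpret P: primeideal P R by (rule P)
  interpret Q: localized_ring R "carrier R - P" by (rule P.complement_localized)
  define D where "D = localization_at R P"
  define e where "e a s = fract R (carrier R - P) a s" for a s
  interpret D: principal_domain D using dvr by (simp add: discrete_valuation_ring_def D_def)
  have ec: "e a s \<in> carrier D" if "a \<in> carrier R" "s \<in> carrier R - P" for a s
    using that unfolding e_def D_def localization_at_def by (rule Q.fract_closed)
  have em: "e a s \<otimes>\<^bsub>D\<^esub> e b t = e (a \<otimes> b) (s \<otimes> t)"
    if "a \<in> carrier R" "s \<in> carrier R - P" "b \<in> carrier R" "t \<in> carrier R - P" for a b s t
    using that unfolding e_def D_def localization_at_def by (intro Q.fract_mult)
  have e1: "\<one>\<^bsub>D\<^esub> = e \<one> \<one>" and e0: "\<zero>\<^bsub>D\<^esub> = e \<zero> \<one>"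
    unfolding e_def D_def localization_at_def by (rule Q.fract_one Q.fract_zero)+
  have eq: "e a s = e b t \<longleftrightarrow> a \<otimes> t = b \<otimes> s"
    if "a \<in> carrier R" "b \<in> carrier R" "s \<in> carrier R - P" "t \<in> carrier R - P" for a b s t
    using that unfolding e_def by (rule localization_at_eq_iff)
  have nu: "e a s \<notin> Units D" if "a \<in> P" "s \<in> carrier R - P" for a s
    using that unfolding e_def D_def by (rule localization_at_nonunit)
  have un: "e s t \<in> Units D" if st: "s \<in> carrier R - P" "t \<in> carrier R - P" for s t
  proof -
    have "e s t \<otimes>\<^bsub>D\<^esub> e t s = \<one>\<^bsub>D\<^esub>"
      using st Q.denoms_mult Q.denoms_one by (subst em) (auto simp: e1 eq m_comm)
    moreover have "e t s \<otimes>\<^bsub>D\<^esub> e s t = \<one>\<^bsub>D\<^esub>"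
      using st Q.denoms_mult Q.denoms_one by (subst em) (auto simp: e1 eq m_comm)
    ultimately show ?thesis using st ec unfolding Units_def by blast
  qed
  have ca: "\<exists>a s. a \<in> carrier R \<and> s \<in> carrier R - P \<and> x = e a s" if "x \<in> carrier D" for x
    using that unfolding e_def D_def localization_at_def by (metis Q.fract_cases)
  obtain m0 where m0: "maximalideal m0 D" and uniq: "\<And>m. maximalideal m D \<Longrightarrow> m = m0"
    using dvr unfolding discrete_valuation_ring_def D_def by blast
  obtain m where m: "m \<in> carrier D" "m0 = PIdl\<^bsub>D\<^esub> m"
    using D.exists_gen[OF maximalideal.axioms(1)[OF m0]] by blast
  obtain \<pi> t0 where \<pi>: "\<pi> \<in> carrier R" "t0 \<in> carrier R - P" "m = e \<pi> t0"
    using ca[OF m(1)] by blast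
  have nonunit: "y \<in> m0" if y: "y \<in> carrier D" "y \<notin> Units D" "y \<noteq> \<zero>\<^bsub>D\<^esub>" for y
  proof -
    have y0: "y \<in> carrier D - {\<zero>\<^bsub>D\<^esub>}" using y by simp
    obtain p where p: "p \<in> carrier D" "ring_irreducible\<^bsub>D\<^esub> p" "p divides\<^bsub>D\<^esub> y"
      by (rule D.exists_irreducible_divisor[OF y0 y(2)])
    have "PIdl\<^bsub>D\<^esub> p = m0" using D.irreducible_imp_maximalideal[OF p(1,2)] by (rule uniq)
    moreover obtain c where "c \<in> carrier D" "y = p \<otimes>\<^bsub>D\<^esub> c" using p(3) by (auto simp: factor_def)
    ultimately show ?thesis using p(1) D.m_comm[of p c] by (auto simp: cgenideal_def)
  qed
  have piP: "\<pi> \<in> P"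
  proof (rule ccontr)
    assume "\<pi> \<notin> P"
    then have "m \<in> Units D" using \<pi> by (auto intro: un)
    then have "m0 = carrier D" using m D.ideal_eq_carrier_iff[OF m(1)] by simp
    then show False using maximalideal.I_notcarr[OF m0] by simp
  qed
  obtain y where y: "y \<in> carrier D" "y \<notin> Units D" "y \<noteq> \<zero>\<^bsub>D\<^esub>"
  proof -
    have "\<not> field D" using dvr by (simp add: discrete_valuation_ring_def D_def)
    then have "Units D \<noteq> carrier D - {\<zero>\<^bsub>D\<^esub>}"
      using D.domain_axioms by (auto simp: field_def field_axioms_def)
    moreover have "Units D \<subseteq> carrier D - {\<zero>\<^bsub>D\<^esub>}"
      using D.Units_closed D.zero_not_one D.Units_r_inv by (auto simp: Units_def)
    ultimately show thesis using that by blast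
  qed
  have dvd: "\<exists>s\<in>carrier R - P. \<exists>r\<in>carrier R. s \<otimes> x = r \<otimes> \<pi>" if x: "x \<in> P" for x
  proof (cases "x = \<zero>")
    case True
    then show ?thesis using \<pi>(1) Q.denoms_one by (intro bexI[of _ \<one>] bexI[of _ \<zero>]) auto
  next
    case False
    have xc: "x \<in> carrier R" using x by (rule P.Icarr)
    have "e x \<one> \<in> m0"
      using xc x False nu[OF x Q.denoms_one] Q.denoms_one by (intro nonunit ec) (auto simp: e0 eq)
    then obtain c where c: "c \<in> carrier D" "e x \<one> = c \<otimes>\<^bsub>D\<^esub> m" unfolding m(2) by (auto simp: cgenideal_def)
    obtain b v where b: "b \<in> carrier R" "v \<in> carrier R - P" "c = e b v" using ca[OF c(1)] by blast
    have vt: "v \<otimes> t0 \<in> carrier R - P" using b(2) \<pi>(2) by (rule Q.denoms_mult)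
    have "e x \<one> = e (b \<otimes> \<pi>) (v \<otimes> t0)" using c(2) b \<pi> em by simp
    then have "x \<otimes> (v \<otimes> t0) = b \<otimes> \<pi> \<otimes> \<one>"
      using eq[of x "b \<otimes> \<pi>" \<one> "v \<otimes> t0"] xc b(1) \<pi>(1) Q.denoms_one vt by blast
    then have "(v \<otimes> t0) \<otimes> x = b \<otimes> \<pi>" using xc vt b(1) \<pi>(1) by (simp add: m_comm[of x])
    then show ?thesis using vt b(1) by blast
  qed
  have pi0: "\<pi> \<noteq> \<zero>"
  proof
    assume z: "\<pi> = \<zero>"
    obtain c where "c \<in> carrier D" "y = c \<otimes>\<^bsub>D\<^esub> m" using nonunit[OF y] unfolding m(2) by (auto simp: cgenideal_def)
    moreover have "m = \<zero>\<^bsub>D\<^esub>" using \<pi> z Q.denoms_one by (simp add: e0 eq)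
    ultimately show False using y(3) by simp
  qed
  have "\<exists>n::nat. \<exists>s\<in>carrier R - P. \<exists>t\<in>carrier R - P. s \<otimes> x = t \<otimes> \<pi> [^] n"
    if "x \<in> carrier R" "x \<noteq> \<zero>" for x
    using D.mult_of.division_wellfounded that
  proof (induction "e x \<one>" arbitrary: x rule: wf_induct_rule)
    case (less x)
    show ?case
    proof (cases "x \<in> P")
      case False
      then show ?thesis using less(2) Q.denoms_one
        by (intro exI[of _ 0] bexI[of _ \<one>] bexI[of _ x]) auto
    next
      case True
      obtain s r where sr: "s \<in> carrier R - P" "r \<in> carrier R" "s \<otimes> x = r \<otimes> \<pi>" using dvd[OF True] by blast
      have s0: "s \<noteq> \<zero>" using sr(1) additive_subgroup.zero_closed[OF P.is_additive_subgroup] by auto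
      have r0: "r \<noteq> \<zero>" using sr s0 less(2,3) \<pi>(1) integral[of s x] by auto
      note cl = ec[OF less(2) Q.denoms_one] ec[OF sr(2) Q.denoms_one] ec[OF \<pi>(1) Q.denoms_one]
        ec[OF one_closed sr(1)]
      have nz: "e x \<one> \<noteq> \<zero>\<^bsub>D\<^esub>" "e r \<one> \<noteq> \<zero>\<^bsub>D\<^esub>" using less(2,3) sr(2) r0 Q.denoms_one by (auto simp: e0 eq)
      have "e x \<one> = e (r \<otimes> (\<pi> \<otimes> \<one>)) (\<one> \<otimes> (\<one> \<otimes> s))"
        using sr less(2) \<pi>(1) Q.denoms_one by (subst eq) (auto simp: m_comm)
      then have ex: "e x \<one> = e r \<one> \<otimes>\<^bsub>D\<^esub> (e \<pi> \<one> \<otimes>\<^bsub>D\<^esub> e \<one> s)"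
        using sr \<pi>(1) Q.denoms_one by (simp add: em)
      have ps: "e \<pi> \<one> \<otimes>\<^bsub>D\<^esub> e \<one> s = e \<pi> s" using sr(1) \<pi>(1) Q.denoms_one by (simp add: em)
      have c1: "e \<pi> s \<in> carrier D" using \<pi>(1) sr(1) by (rule ec)
      have c1n: "e \<pi> s \<noteq> \<zero>\<^bsub>D\<^esub>" using ex ps nz cl by auto
      have "\<not> e x \<one> divides\<^bsub>mult_of D\<^esub> e r \<one>"
      proof
        assume "e x \<one> divides\<^bsub>mult_of D\<^esub> e r \<one>"
        then obtain d where d: "d \<in> carrier D" "e r \<one> = e x \<one> \<otimes>\<^bsub>D\<^esub> d" by (auto simp: factor_def)
        have "e r \<one> \<otimes>\<^bsub>D\<^esub> \<one>\<^bsub>D\<^esub> = e r \<one> \<otimes>\<^bsub>D\<^esub> (e \<pi> s \<otimes>\<^bsub>D\<^esub> d)"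
          using d(2) ex ps cl(2) c1 d(1) by (simp add: D.m_assoc)
        then have "\<one>\<^bsub>D\<^esub> = e \<pi> s \<otimes>\<^bsub>D\<^esub> d"
          using D.m_lcancel[OF nz(2) cl(2), of "\<one>\<^bsub>D\<^esub>" "e \<pi> s \<otimes>\<^bsub>D\<^esub> d"] c1 d(1) by simp
        then have "e \<pi> s \<otimes>\<^bsub>D\<^esub> d = \<one>\<^bsub>D\<^esub>" "d \<otimes>\<^bsub>D\<^esub> e \<pi> s = \<one>\<^bsub>D\<^esub>"
          using D.m_comm[OF d(1) c1] by simp_all
        then have "e \<pi> s \<in> Units D" using c1 d(1) unfolding Units_def by blast
        then show False using nu[OF piP sr(1)] by simp
      qed
      moreover have "e r \<one> divides\<^bsub>mult_of D\<^esub> e x \<one>"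
        using ex ps c1 c1n by (auto simp: factor_def)
      ultimately have "properfactor (mult_of D) (e r \<one>) (e x \<one>)" by (simp add: properfactor_def)
      then have "(e r \<one>, e x \<one>) \<in> {(x, y). x \<in> carrier (mult_of D) \<and> y \<in> carrier (mult_of D) \<and>
          properfactor (mult_of D) x y}"
        using cl nz by simp
      from less(1)[OF this sr(2) r0] obtain n s' t' where
        n: "s' \<in> carrier R - P" "t' \<in> carrier R - P" "s' \<otimes> r = t' \<otimes> \<pi> [^] (n::nat)" by blast
      have c: "s \<in> carrier R" "s' \<in> carrier R" "t' \<in> carrier R" using n sr by auto
      have "(s' \<otimes> s) \<otimes> x = (s' \<otimes> r) \<otimes> \<pi>" using c sr(2,3) less(2) \<pi>(1) by (simp add: m_assoc)
      also have "\<dots> = t' \<otimes> \<pi> [^] Suc n" unfolding n(3) using c \<pi>(1) by (simp add: m_assoc)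
      finally show ?thesis using Q.denoms_mult[OF n(1) sr(1)] n(2) by blast
    qed
  qed
  with piP pi0 dvd show thesis by (rule that)
qed

end

end

section \<open>The generic fibre\<close>

context localized_ring
begin

lemma localization_smult:
  assumes "r \<in> carrier R" "x \<in> carrier (localization R S)"
  shows "r \<odot>\<^bsub>localization R S\<^esub> x = fract R S r \<one> \<otimes>\<^bsub>localization R S\<^esub> x"
  using assms by (auto elim!: fract_cases simp: fract_smult fract_mult)

lemma localization_algebra: "algebra R (localization R S)"
proof -
  interpret L: cring "localization R S" by (rule localization_cring)
  note h = fract_surj_hom
  show ?thesis
  proof (rule algebraI)
    fix a b x assume "a \<in> carrier R" "b \<in> carrier R" "x \<in> carrier (localization R S)"
    then show "(a \<oplus> b) \<odot>\<^bsub>localization R S\<^esub> x = a \<odot>\<^bsub>localization R S\<^esub> x \<oplus>\<^bsub>localization R S\<^esub> b \<odot>\<^bsub>localization R S\<^esub> x"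
      and "(a \<otimes> b) \<odot>\<^bsub>localization R S\<^esub> x = a \<odot>\<^bsub>localization R S\<^esub> (b \<odot>\<^bsub>localization R S\<^esub> x)"
      using ring_hom_add[OF h, of a b] ring_hom_mult[OF h, of a b]
      by (simp_all add: localization_smult L.l_distr L.m_assoc)
  next
    fix a x y assume "a \<in> carrier R" "x \<in> carrier (localization R S)" "y \<in> carrier (localization R S)"
    then show "a \<odot>\<^bsub>localization R S\<^esub> x \<otimes>\<^bsub>localization R S\<^esub> y = a \<odot>\<^bsub>localization R S\<^esub> (x \<otimes>\<^bsub>localization R S\<^esub> y)"
      and "a \<odot>\<^bsub>localization R S\<^esub> (x \<oplus>\<^bsub>localization R S\<^esub> y) = a \<odot>\<^bsub>localization R S\<^esub> x \<oplus>\<^bsub>localization R S\<^esub> a \<odot>\<^bsub>localization R S\<^esub> y"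
      and "a \<odot>\<^bsub>localization R S\<^esub> x \<in> carrier (localization R S)"
      by (simp_all add: localization_smult L.r_distr L.m_assoc)
  next
    fix x assume "x \<in> carrier (localization R S)"
    then show "\<one> \<odot>\<^bsub>localization R S\<^esub> x = x" by (simp add: localization_smult fract_one[symmetric])
  qed (rule is_cring localization_cring)+
qed

end

lemma algebra_algebra_via:
  fixes R :: "('r, 'k) ring_scheme" (structure) and C :: "('c, 'n) ring_scheme"
  assumes R: "cring R" and C: "cring C" and h: "h \<in> ring_hom R C"
  shows "algebra R (algebra_via C h)"
proof -
  interpret R: cring R by fact
  interpret C: cring C by fact
  have cl: "h a \<in> carrier C" if "a \<in> carrier R" for a using h that by (rule ring_hom_closed)
  have cC: "cring (algebra_via C h)"
    using ring_algebra_via[OF C.ring_axioms]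
    by (intro cring.intro comm_monoid.intro comm_monoid_axioms.intro ring.is_monoid) (auto simp: C.m_comm)
  show ?thesis
    by (rule algebraI[OF R cC])
      (simp_all add: cl ring_hom_add[OF h] ring_hom_mult[OF h] ring_hom_one[OF h] C.l_distr C.r_distr C.m_assoc)
qed

context "domain"
begin

text \<open>Multiplication by \<open>r \<noteq> 0\<close> is injective on \<open>R\<close>, hence on a flat module.\<close>

lemma flat_torsion_free:
  fixes A :: "('a, 'c, 'p) module_scheme"
  assumes flat: "flat_module R A" and r: "r \<in> carrier R" "r \<noteq> \<zero>"
    and x: "x \<in> carrier A" "r \<odot>\<^bsub>A\<^esub> x = \<zero>\<^bsub>A\<^esub>"
  shows "x = \<zero>\<^bsub>A\<^esub>"
proof -
  interpret A: module R A using flat by (simp add: flat_module_def)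
  have "x \<in> {\<zero>\<^bsub>A\<^esub>}"
  proof (rule flat_colon[OF flat zero_closed, where s = "\<lambda>_. r" and k = 1])
    show "subgroup {\<zero>\<^bsub>A\<^esub>} (add_monoid A)"
      using A.M.add.triv_subgroup by simp
    show "\<exists>y\<in>carrier A. r \<odot>\<^bsub>A\<^esub> x = \<zero> \<odot>\<^bsub>A\<^esub> y"
      using x by (intro bexI[of _ x]) (simp_all)
  next
    fix a y assume a: "a \<in> carrier R" "y \<in> carrier A" "\<And>j. j < (1::nat) \<Longrightarrow> \<exists>b\<in>carrier R. r \<otimes> a = \<zero> \<otimes> b"
    from a(3)[of 0] have "r \<otimes> a = \<zero>" by auto
    then have "a = \<zero>" using a r integral by blast
    then show "a \<odot>\<^bsub>A\<^esub> y \<in> {\<zero>\<^bsub>A\<^esub>}" using a by simp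
  qed (use r x in auto)
  then show ?thesis by simp
qed

lemma quotient_field_algebra: "algebra R (quotient_field R)"
  unfolding quotient_field_def by (rule localized_ring.localization_algebra[OF nonzero_localized])

text \<open>A torsion-free algebra embeds into its generic fibre: \<open>A \<otimes> K\<close> maps to the localization of
  \<open>A\<close> at the nonzero elements of \<open>R\<close>.\<close>

lemma generic_fibre_embedding:
  fixes A :: "('a, 'c, 'p) module_scheme"
  assumes A: "algebra R A"
    and tf: "\<And>r x. \<lbrakk>r \<in> carrier R; r \<noteq> \<zero>; x \<in> carrier A; r \<odot>\<^bsub>A\<^esub> x = \<zero>\<^bsub>A\<^esub>\<rbrakk> \<Longrightarrow> x = \<zero>\<^bsub>A\<^esub>"
    and x: "x \<in> carrier A"
    and z: "pure_tensor R A (quotient_field R) x \<one>\<^bsub>quotient_field R\<^esub> = \<zero>\<^bsub>tensor R A (quotient_field R)\<^esub>"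
  shows "x = \<zero>\<^bsub>A\<^esub>"
proof -
  interpret A: algebra R A by fact
  interpret AK: algebra_pair R A "quotient_field R"
    by (intro algebra_pair.intro A quotient_field_algebra)
  interpret Q: localized_ring R "carrier R - {\<zero>}" by (rule nonzero_localized)
  define S where "S = {r \<odot>\<^bsub>A\<^esub> \<one>\<^bsub>A\<^esub> | r. r \<in> carrier R \<and> r \<noteq> \<zero>}"
  interpret S: localized_ring A S
  proof unfold_locales
    show "S \<subseteq> carrier A" by (auto simp: S_def)
    show "\<one>\<^bsub>A\<^esub> \<in> S" unfolding S_def by (intro CollectI exI[of _ "\<one>"]) simp
    fix s t assume "s \<in> S" "t \<in> S"
    then obtain r q where rq: "r \<in> carrier R" "r \<noteq> \<zero>" "s = r \<odot>\<^bsub>A\<^esub> \<one>\<^bsub>A\<^esub>" "q \<in> carrier R" "q \<noteq> \<zero>" "t = q \<odot>\<^bsub>A\<^esub> \<one>\<^bsub>A\<^esub>"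
      by (auto simp: S_def)
    then have "s \<otimes>\<^bsub>A\<^esub> t = (r \<otimes> q) \<odot>\<^bsub>A\<^esub> \<one>\<^bsub>A\<^esub>" by (simp add: A.smult_assoc2 A.smult_assoc1)
    moreover have "r \<otimes> q \<noteq> \<zero>" using rq integral by blast
    ultimately show "s \<otimes>\<^bsub>A\<^esub> t \<in> S" using rq by (auto simp: S_def)
  qed
  let ?L = "localization A S"
  interpret L: cring ?L by (rule S.localization_cring)
  define \<phi> where "\<phi> r = fract A S (r \<odot>\<^bsub>A\<^esub> \<one>\<^bsub>A\<^esub>) \<one>\<^bsub>A\<^esub>" for r
  have sm: "(r \<odot>\<^bsub>A\<^esub> \<one>\<^bsub>A\<^esub>) \<otimes>\<^bsub>A\<^esub> y = r \<odot>\<^bsub>A\<^esub> y" if "r \<in> carrier R" "y \<in> carrier A" for r y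
    using that by (simp add: A.smult_assoc2)
  have ph: "\<phi> \<in> ring_hom R ?L"
  proof (rule ring_hom_memI)
    fix r q assume "r \<in> carrier R" "q \<in> carrier R"
    then show "\<phi> (r \<otimes> q) = \<phi> r \<otimes>\<^bsub>?L\<^esub> \<phi> q" "\<phi> (r \<oplus> q) = \<phi> r \<oplus>\<^bsub>?L\<^esub> \<phi> q"
      using ring_hom_mult[OF S.fract_surj_hom, of "r \<odot>\<^bsub>A\<^esub> \<one>\<^bsub>A\<^esub>" "q \<odot>\<^bsub>A\<^esub> \<one>\<^bsub>A\<^esub>"]
        ring_hom_add[OF S.fract_surj_hom, of "r \<odot>\<^bsub>A\<^esub> \<one>\<^bsub>A\<^esub>" "q \<odot>\<^bsub>A\<^esub> \<one>\<^bsub>A\<^esub>"]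
      by (simp_all add: \<phi>_def sm A.smult_assoc1 A.smult_l_distr)
  qed (simp_all add: \<phi>_def S.fract_one)
  have un: "\<phi> s \<in> Units ?L" if "s \<in> carrier R - {\<zero>}" for s
  proof -
    have sS: "s \<odot>\<^bsub>A\<^esub> \<one>\<^bsub>A\<^esub> \<in> S" using that by (auto simp: S_def)
    have c: "\<phi> s \<in> carrier ?L" "fract A S \<one>\<^bsub>A\<^esub> (s \<odot>\<^bsub>A\<^esub> \<one>\<^bsub>A\<^esub>) \<in> carrier ?L" using sS that by (auto simp: \<phi>_def)
    have "\<phi> s \<otimes>\<^bsub>?L\<^esub> fract A S \<one>\<^bsub>A\<^esub> (s \<odot>\<^bsub>A\<^esub> \<one>\<^bsub>A\<^esub>) = \<one>\<^bsub>?L\<^esub>"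
      using sS that by (simp add: \<phi>_def S.fract_mult S.fract_one) (intro S.fract_eqI; simp)
    then show ?thesis using c L.m_comm[OF c] unfolding Units_def by auto
  qed
  obtain ext where ext: "ext \<in> ring_hom (localization R (carrier R - {\<zero>})) ?L"
      and exf: "\<And>a s. a \<in> carrier R \<Longrightarrow> s \<in> carrier R - {\<zero>} \<Longrightarrow>
        ext (fract R (carrier R - {\<zero>}) a s) = \<phi> a \<otimes>\<^bsub>?L\<^esub> inv\<^bsub>?L\<^esub> \<phi> s"
    using Q.localization_lift[OF S.localization_cring ph un] by blast
  have ext: "ext \<in> ring_hom (quotient_field R) ?L" using ext by (simp add: quotient_field_def)
  have exr: "ext (r \<odot>\<^bsub>quotient_field R\<^esub> k) = \<phi> r \<otimes>\<^bsub>?L\<^esub> ext k"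
    if "r \<in> carrier R" "k \<in> carrier (quotient_field R)" for r k
  proof -
    have "ext (to_quotient_field R r) = \<phi> r"
      using exf[of r \<one>] that ring_hom_one[OF ph] ring_hom_closed[OF ph that(1)] by (simp add: to_quotient_field_def)
    then show ?thesis
      using that ring_hom_mult[OF ext ring_hom_closed[OF to_quotient_field_hom that(1)] that(2)]
      by (simp add: quotient_field_smult)
  qed
  note fh = S.fract_surj_hom
  have "fract A S x \<one>\<^bsub>A\<^esub> \<otimes>\<^bsub>?L\<^esub> ext \<one>\<^bsub>quotient_field R\<^esub> \<in> {\<zero>\<^bsub>?L\<^esub>}"
  proof (rule AK.pure_tensor_zero_detect[OF L.abelian_group_axioms, where \<beta> = "\<lambda>y k. fract A S y \<one>\<^bsub>A\<^esub> \<otimes>\<^bsub>?L\<^esub> ext k"])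
    show "subgroup {\<zero>\<^bsub>?L\<^esub>} (add_monoid ?L)" using L.add.triv_subgroup by simp
    show "x \<in> carrier A" by (rule x)
    show "\<one>\<^bsub>quotient_field R\<^esub> \<in> carrier (quotient_field R)"
      using field.is_ring[OF quotient_field_is_field] by (simp add: ring.ring_simprules)
    show "frag_of (x, \<one>\<^bsub>quotient_field R\<^esub>) \<in> AK.rels" using z AK.pure_eq_zero_iff by simp
  next
    fix y k assume "y \<in> carrier A" "k \<in> carrier (quotient_field R)"
    then show "fract A S y \<one>\<^bsub>A\<^esub> \<otimes>\<^bsub>?L\<^esub> ext k \<in> carrier ?L" using ring_hom_closed[OF ext] by simp
  next
    fix y y' k assume c: "y \<in> carrier A" "y' \<in> carrier A" "k \<in> carrier (quotient_field R)"
    then show "fract A S (y \<oplus>\<^bsub>A\<^esub> y') \<one>\<^bsub>A\<^esub> \<otimes>\<^bsub>?L\<^esub> ext k \<ominus>\<^bsub>?L\<^esub> fract A S y \<one>\<^bsub>A\<^esub> \<otimes>\<^bsub>?L\<^esub> ext k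
        \<ominus>\<^bsub>?L\<^esub> fract A S y' \<one>\<^bsub>A\<^esub> \<otimes>\<^bsub>?L\<^esub> ext k \<in> {\<zero>\<^bsub>?L\<^esub>}"
      using ring_hom_add[OF fh c(1,2)] ring_hom_closed[OF ext c(3)]
      by (simp add: L.l_distr L.minus_eq L.a_ac L.r_neg L.r_neg1 L.r_neg2)
  next
    fix y k k' assume c: "y \<in> carrier A" "k \<in> carrier (quotient_field R)" "k' \<in> carrier (quotient_field R)"
    then show "fract A S y \<one>\<^bsub>A\<^esub> \<otimes>\<^bsub>?L\<^esub> ext (k \<oplus>\<^bsub>quotient_field R\<^esub> k') \<ominus>\<^bsub>?L\<^esub> fract A S y \<one>\<^bsub>A\<^esub> \<otimes>\<^bsub>?L\<^esub> ext k
        \<ominus>\<^bsub>?L\<^esub> fract A S y \<one>\<^bsub>A\<^esub> \<otimes>\<^bsub>?L\<^esub> ext k' \<in> {\<zero>\<^bsub>?L\<^esub>}"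
      using ring_hom_add[OF ext c(2,3)] ring_hom_closed[OF ext c(3)] ring_hom_closed[OF ext c(2)]
      by (simp add: L.r_distr L.minus_eq L.a_ac L.r_neg L.r_neg1 L.r_neg2)
  next
    fix r y k assume c: "r \<in> carrier R" "y \<in> carrier A" "k \<in> carrier (quotient_field R)"
    have "fract A S (r \<odot>\<^bsub>A\<^esub> y) \<one>\<^bsub>A\<^esub> = \<phi> r \<otimes>\<^bsub>?L\<^esub> fract A S y \<one>\<^bsub>A\<^esub>"
      using c by (simp add: \<phi>_def S.fract_mult sm)
    then have "fract A S (r \<odot>\<^bsub>A\<^esub> y) \<one>\<^bsub>A\<^esub> \<otimes>\<^bsub>?L\<^esub> ext k = fract A S y \<one>\<^bsub>A\<^esub> \<otimes>\<^bsub>?L\<^esub> ext (r \<odot>\<^bsub>quotient_field R\<^esub> k)"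
      using c ring_hom_closed[OF ext c(3)] ring_hom_closed[OF ph c(1)] by (simp add: exr L.m_ac)
    then show "fract A S (r \<odot>\<^bsub>A\<^esub> y) \<one>\<^bsub>A\<^esub> \<otimes>\<^bsub>?L\<^esub> ext k \<ominus>\<^bsub>?L\<^esub> fract A S y \<one>\<^bsub>A\<^esub> \<otimes>\<^bsub>?L\<^esub> ext (r \<odot>\<^bsub>quotient_field R\<^esub> k) \<in> {\<zero>\<^bsub>?L\<^esub>}"
      using c ring_hom_closed[OF ext module.smult_closed[OF AK.right_module c(1,3)]] by (simp add: L.minus_eq L.r_neg)
  qed
  then have "fract A S x \<one>\<^bsub>A\<^esub> = fract A S \<zero>\<^bsub>A\<^esub> \<one>\<^bsub>A\<^esub>"
    using x ring_hom_one[OF ext] by (simp add: S.fract_zero)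
  then obtain u where u: "u \<in> S" "u \<otimes>\<^bsub>A\<^esub> x = \<zero>\<^bsub>A\<^esub>"
    using x by (auto simp: S.fract_eq_iff)
  then obtain r where "r \<in> carrier R" "r \<noteq> \<zero>" "r \<odot>\<^bsub>A\<^esub> x = \<zero>\<^bsub>A\<^esub>" using x by (auto simp: S_def sm)
  then show ?thesis using tf x by blast
qed

end

lemma field_poly_UP: "field K \<Longrightarrow> field_poly K"
  by (rule field_poly.intro)

context field_poly
begin

text \<open>The substitutions \<open>T + c\<close> and \<open>T - c\<close> are inverse to each other.\<close>

lemma translation:
  assumes c: "c \<in> carrier R"
  obtains \<theta> where "\<theta> \<in> ring_hom P P" "\<And>k. k \<in> carrier R \<Longrightarrow> \<theta> (mon k 0) = mon k 0"
    "\<theta> T = T \<oplus>\<^bsub>P\<^esub> mon c 0" "bij_betw \<theta> (carrier P) (carrier P)"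
proof -
  have con: "(\<lambda>k. mon k 0) \<in> ring_hom R P" by (rule const_ring_hom)
  have pre: "UP_pre_univ_prop R P (\<lambda>k. mon k 0)"
    by (intro UP_pre_univ_prop.intro ring_hom_cring.intro ring_hom_cring_axioms.intro con
        UP_cring.intro R.is_cring UP_cring)
  have univ: "\<exists>h\<in>ring_hom P P. (\<forall>k\<in>carrier R. h (mon k 0) = mon k 0) \<and> h T = s"
    if s: "s \<in> carrier P" for s
  proof -
    from UP_pre_univ_prop.UP_universal_property[OF pre s, folded P_def]
    show ?thesis by auto
  qed
  define s where "s = T \<oplus>\<^bsub>P\<^esub> mon c 0"
  define s' where "s' = T \<oplus>\<^bsub>P\<^esub> mon (\<ominus> c) 0"
  have sc: "s \<in> carrier P" "s' \<in> carrier P" using c by (auto simp: s_def s'_def)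
  obtain h where h: "h \<in> ring_hom P P" "\<And>k. k \<in> carrier R \<Longrightarrow> h (mon k 0) = mon k 0" "h T = s"
    using univ[OF sc(1)] by blast
  obtain g where g: "g \<in> ring_hom P P" "\<And>k. k \<in> carrier R \<Longrightarrow> g (mon k 0) = mon k 0" "g T = s'"
    using univ[OF sc(2)] by blast
  have T: "T \<in> carrier P" by simp
  have "s' \<oplus>\<^bsub>P\<^esub> mon c 0 = T" "s \<oplus>\<^bsub>P\<^esub> mon (\<ominus> c) 0 = T"
    unfolding s_def s'_def using c
    by (simp_all add: P.a_assoc monom_add[symmetric] R.l_neg R.r_neg del: monom_add monom_a_inv)
  note inv_T = this
  have cc: "mon c 0 \<in> carrier P" "mon (\<ominus> c) 0 \<in> carrier P" "\<ominus> c \<in> carrier R" using c by auto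
  have "g (h T) = s' \<oplus>\<^bsub>P\<^esub> mon c 0"
    by (simp only: h(3) s_def ring_hom_add[OF g(1) T cc(1)] g(3) g(2)[OF c])
  moreover have "h (g T) = s \<oplus>\<^bsub>P\<^esub> mon (\<ominus> c) 0"
    by (simp only: g(3) s'_def ring_hom_add[OF h(1) T cc(2)] h(3) h(2)[OF cc(3)])
  ultimately have ghT: "g (h T) = T" "h (g T) = T" by (simp_all only: inv_T)
  have comp: "g (h p) = p" "h (g p) = p" if p: "p \<in> carrier P" for p
  proof -
    have gh: "g \<circ> h \<in> ring_hom P P" "h \<circ> g \<in> ring_hom P P" using g(1) h(1) by (auto intro: ring_hom_trans)
    note cr = ring_hom_cringI[OF UP_cring UP_cring]
    have idP: "ring_hom_cring P P id" by (rule cr) simp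
    note uniq = UP_pre_univ_prop.UP_hom_unique[OF pre, folded P_def, where s = T and Psi = id, OF cr _ _ idP]
    have "(g \<circ> h) p = id p"
      by (rule uniq[OF gh(1)]) (use ghT g(2) h(2) p in simp_all)
    then show "g (h p) = p" by simp
    have "(h \<circ> g) p = id p"
      by (rule uniq[OF gh(2)]) (use ghT g(2) h(2) p in simp_all)
    then show "h (g p) = p" by simp
  qed
  have "bij_betw h (carrier P) (carrier P)"
    by (rule bij_betw_byWitness[where f' = g])
       (use comp ring_hom_closed[OF h(1)] ring_hom_closed[OF g(1)] in auto)
  with h show thesis by (intro that) (auto simp: s_def)
qed

end

context "domain"
begin

text \<open>Restrict the isomorphism \<open>A \<otimes> K = K[T]\<close> to \<open>A\<close>. A common denominator of the second factors brings
  any element of \<open>A \<otimes> K\<close> into \<open>A\<close>.\<close>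

lemma generic_embedding:
  fixes A :: "('a, 'c, 'p) module_scheme"
  defines "K \<equiv> quotient_field R"
  assumes A: "algebra R A"
    and tf: "\<And>r x. \<lbrakk>r \<in> carrier R; r \<noteq> \<zero>; x \<in> carrier A; r \<odot>\<^bsub>A\<^esub> x = \<zero>\<^bsub>A\<^esub>\<rbrakk> \<Longrightarrow> x = \<zero>\<^bsub>A\<^esub>"
    and iso: "algebra_isomorphic K (base_change R A K) (UP K)"
  obtains \<eta> where "\<eta> \<in> ring_hom A (UP K)" "inj_on \<eta> (carrier A)"
    "\<And>r x. r \<in> carrier R \<Longrightarrow> x \<in> carrier A \<Longrightarrow> \<eta> (r \<odot>\<^bsub>A\<^esub> x) = to_quotient_field R r \<odot>\<^bsub>UP K\<^esub> \<eta> x"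
    "\<And>f. f \<in> carrier (UP K) \<Longrightarrow> \<exists>r\<in>carrier R. r \<noteq> \<zero> \<and> (\<exists>x\<in>carrier A. to_quotient_field R r \<odot>\<^bsub>UP K\<^esub> f = \<eta> x)"
proof -
  interpret A: algebra R A by fact
  interpret K: field K unfolding K_def by (rule quotient_field_is_field)
  interpret U: field_poly K "UP K" by (rule field_poly_UP) (rule K.field_axioms)
  have pair: "algebra_pair R A K"
    unfolding K_def by (intro algebra_pair.intro A quotient_field_algebra)
  let ?T = "tensor R A K" and ?p = "pure_tensor R A K" and ?q = "to_quotient_field R"
  note Tc = algebra_pair.tensor_cring[OF pair] and pc = algebra_pair.pure_closed[OF pair]
    and pm = algebra_pair.pure_mult[OF pair] and pa = algebra_pair.pure_add_left[OF pair]
    and p1 = algebra_pair.pure_one[OF pair] and pb = algebra_pair.pure_balance[OF pair]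
  have Tr: "ring ?T" using Tc by (rule cring.axioms)
  have qh: "?q \<in> ring_hom R K" unfolding K_def by (rule to_quotient_field_hom)
  obtain f where f: "f \<in> algebra_hom K (base_change R A K) (UP K)"
      and bij: "bij_betw f (carrier (base_change R A K)) (carrier (UP K))"
    using iso by (auto simp: algebra_isomorphic_def)
  have fh: "f \<in> ring_hom ?T (UP K)" using f by (simp add: algebra_hom_def base_change_def)
  have fs: "f (?p \<one>\<^bsub>A\<^esub> k \<otimes>\<^bsub>?T\<^esub> x) = k \<odot>\<^bsub>UP K\<^esub> f x" if "k \<in> carrier K" "x \<in> carrier ?T" for k x
    using f that by (simp add: algebra_hom_def base_change_def)
  have bij: "bij_betw f (carrier ?T) (carrier (UP K))" using bij by (simp add: base_change_def)
  define \<eta> where "\<eta> x = f (?p x \<one>\<^bsub>K\<^esub>)" for x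
  have pr: "?p (r \<odot>\<^bsub>A\<^esub> x) \<one>\<^bsub>K\<^esub> = ?p \<one>\<^bsub>A\<^esub> (?q r) \<otimes>\<^bsub>?T\<^esub> ?p x \<one>\<^bsub>K\<^esub>"
    if "r \<in> carrier R" "x \<in> carrier A" for r x
  proof -
    have "?q r \<in> carrier K" using qh that(1) by (rule ring_hom_closed)
    moreover have "r \<odot>\<^bsub>K\<^esub> \<one>\<^bsub>K\<^esub> = ?q r"
      using quotient_field_smult[OF that(1), folded K_def, OF K.one_closed] calculation by simp
    ultimately show ?thesis
      using that pb[OF that K.one_closed] pm[of "\<one>\<^bsub>A\<^esub>" "?q r" x "\<one>\<^bsub>K\<^esub>"] by simp
  qed
  have eh: "\<eta> \<in> ring_hom A (UP K)"
  proof (rule ring_hom_memI)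
    fix x y assume xy: "x \<in> carrier A" "y \<in> carrier A"
    note c = pc[OF xy(1) K.one_closed] pc[OF xy(2) K.one_closed]
    show "\<eta> x \<in> carrier (UP K)" unfolding \<eta>_def by (rule ring_hom_closed[OF fh c(1)])
    show "\<eta> (x \<otimes>\<^bsub>A\<^esub> y) = \<eta> x \<otimes>\<^bsub>UP K\<^esub> \<eta> y"
      unfolding \<eta>_def ring_hom_mult[OF fh c, symmetric] pm[OF xy(1) K.one_closed xy(2) K.one_closed] by simp
    show "\<eta> (x \<oplus>\<^bsub>A\<^esub> y) = \<eta> x \<oplus>\<^bsub>UP K\<^esub> \<eta> y"
      unfolding \<eta>_def ring_hom_add[OF fh c, symmetric] pa[OF xy K.one_closed] by simp
  next
    show "\<eta> \<one>\<^bsub>A\<^esub> = \<one>\<^bsub>UP K\<^esub>" unfolding \<eta>_def p1 by (rule ring_hom_one[OF fh])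
  qed
  have es: "\<eta> (r \<odot>\<^bsub>A\<^esub> x) = ?q r \<odot>\<^bsub>UP K\<^esub> \<eta> x" if "r \<in> carrier R" "x \<in> carrier A" for r x
    unfolding \<eta>_def pr[OF that]
    by (rule fs[OF ring_hom_closed[OF qh that(1)] pc[OF that(2) K.one_closed]])
  have inj: "inj_on \<eta> (carrier A)"
  proof (rule inj_onI)
    fix x y assume xy: "x \<in> carrier A" "y \<in> carrier A" "\<eta> x = \<eta> y"
    have d: "x \<ominus>\<^bsub>A\<^esub> y \<in> carrier A" using xy by simp
    have "\<eta> (x \<ominus>\<^bsub>A\<^esub> y) = \<zero>\<^bsub>UP K\<^esub>"
      using ring_hom_minus[OF cring.axioms(1)[OF A.M_cring] U.UP_ring eh xy(1,2)] xy(3)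
        ring_hom_closed[OF eh xy(2)] by (simp add: U.P.minus_eq U.P.r_neg)
    also have "\<dots> = f \<zero>\<^bsub>?T\<^esub>" using ring_hom_zero[OF fh Tr U.UP_ring] by simp
    finally have fz: "f (?p (x \<ominus>\<^bsub>A\<^esub> y) \<one>\<^bsub>K\<^esub>) = f \<zero>\<^bsub>?T\<^esub>" unfolding \<eta>_def .
    have "?p (x \<ominus>\<^bsub>A\<^esub> y) \<one>\<^bsub>K\<^esub> = \<zero>\<^bsub>?T\<^esub>"
      by (rule inj_onD[OF bij_betw_imp_inj_on[OF bij] fz pc[OF d K.one_closed] ring.ring_simprules(2)[OF Tr]])
    then have pz: "pure_tensor R A (quotient_field R) (x \<ominus>\<^bsub>A\<^esub> y) \<one>\<^bsub>quotient_field R\<^esub>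
        = \<zero>\<^bsub>tensor R A (quotient_field R)\<^esub>" unfolding K_def .
    have "x \<ominus>\<^bsub>A\<^esub> y = \<zero>\<^bsub>A\<^esub>"
      by (rule generic_fibre_embedding[OF A _ d pz]) (rule tf)
    then show "x = y" by (simp only: A.r_right_minus_eq[OF xy(1,2)])
  qed
  have den: "\<exists>r\<in>carrier R. r \<noteq> \<zero> \<and> (\<exists>x\<in>carrier A. ?q r \<odot>\<^bsub>UP K\<^esub> f z = \<eta> x)" if "z \<in> carrier ?T" for z
    using that
  proof (induction rule: algebra_pair.tensor_induct[OF pair, consumes 1, case_names pure minus])
    case (pure x k)
    obtain b s where bs: "b \<in> carrier R" "s \<in> carrier R" "s \<noteq> \<zero>" "k = ?q b \<otimes>\<^bsub>K\<^esub> inv\<^bsub>K\<^esub> ?q s"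
      using quotient_field_cases[OF pure(2)[unfolded K_def], folded K_def] by blast
    have c: "?q b \<in> carrier K" "?q s \<in> carrier K" using bs ring_hom_closed[OF qh] by auto
    have qs: "?q s \<noteq> \<zero>\<^bsub>K\<^esub>"
      using bs(2,3) ring_hom_zero[OF qh ring_axioms K.ring_axioms] inj_onD[OF to_quotient_field_inj, of s \<zero>] by auto
    then have "?q s \<otimes>\<^bsub>K\<^esub> k = ?q b"
      unfolding bs(4) using c K.m_lcomm[of "?q s" "?q b" "inv\<^bsub>K\<^esub> ?q s"] U.inv_nz[OF c(2) qs] by simp
    then have "?p \<one>\<^bsub>A\<^esub> (?q s) \<otimes>\<^bsub>?T\<^esub> ?p x k = ?p \<one>\<^bsub>A\<^esub> (?q b) \<otimes>\<^bsub>?T\<^esub> ?p x \<one>\<^bsub>K\<^esub>"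
      using pure c pm[of "\<one>\<^bsub>A\<^esub>" "?q s" x k] pm[of "\<one>\<^bsub>A\<^esub>" "?q b" x "\<one>\<^bsub>K\<^esub>"] by simp
    then have "?q s \<odot>\<^bsub>UP K\<^esub> f (?p x k) = \<eta> (b \<odot>\<^bsub>A\<^esub> x)"
      using fs[OF c(2) pc[OF pure]] by (simp add: \<eta>_def pr[OF bs(1) pure(1)])
    then show ?case using bs pure by blast
  next
    case (minus z w)
    then obtain r x q y where h: "r \<in> carrier R" "r \<noteq> \<zero>" "x \<in> carrier A" "?q r \<odot>\<^bsub>UP K\<^esub> f z = \<eta> x"
       "q \<in> carrier R" "q \<noteq> \<zero>" "y \<in> carrier A" "?q q \<odot>\<^bsub>UP K\<^esub> f w = \<eta> y" by blast
    have c: "?q r \<in> carrier K" "?q q \<in> carrier K" "f z \<in> carrier (UP K)" "f w \<in> carrier (UP K)"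
      using h minus ring_hom_closed[OF qh] ring_hom_closed[OF fh] by auto
    have "?q (r \<otimes> q) \<odot>\<^bsub>UP K\<^esub> f (z \<ominus>\<^bsub>?T\<^esub> w)
        = ?q q \<odot>\<^bsub>UP K\<^esub> (?q r \<odot>\<^bsub>UP K\<^esub> f z) \<ominus>\<^bsub>UP K\<^esub> ?q r \<odot>\<^bsub>UP K\<^esub> (?q q \<odot>\<^bsub>UP K\<^esub> f w)"
      using c h minus ring_hom_mult[OF qh h(1,5)] ring_hom_minus[OF Tr U.UP_ring fh minus(1,2)]
        U.smult_left_comm[OF c(1,2,3)]
      by (simp add: U.UP_smult_assoc1 U.P.minus_eq U.UP_smult_r_distr U.smult_r_minus)
    also have "\<dots> = \<eta> (q \<odot>\<^bsub>A\<^esub> x \<ominus>\<^bsub>A\<^esub> r \<odot>\<^bsub>A\<^esub> y)"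
      unfolding h(4,8) using h ring_hom_minus[OF cring.axioms(1)[OF A.M_cring] U.UP_ring eh] by (simp add: es)
    finally show ?case
      using h integral by (intro bexI[of _ "r \<otimes> q"]) auto
  qed
  have "\<exists>r\<in>carrier R. r \<noteq> \<zero> \<and> (\<exists>x\<in>carrier A. ?q r \<odot>\<^bsub>UP K\<^esub> g = \<eta> x)" if "g \<in> carrier (UP K)" for g
  proof -
    have "g \<in> f ` carrier ?T" using that bij_betw_imp_surj_on[OF bij] by simp
    then obtain z where "z \<in> carrier ?T" "g = f z" by blast
    then show ?thesis using den by blast
  qed
  with eh inj es show thesis by (rule that)
qed

end

context "domain"
begin

text \<open>After a translation of the variable, the retraction becomes evaluation at \<open>0\<close>: extended to
  the generic fibre it sends \<open>T\<close> to some \<open>c\<close>, and one substitutes \<open>T + c\<close> for \<open>T\<close>.\<close>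

lemma retraction_embedding:
  fixes A :: "('a, 'c, 'p) module_scheme"
  defines "K \<equiv> quotient_field R" and "\<rho> \<equiv> to_quotient_field R"
  assumes A: "algebra R A"
    and eh: "\<eta> \<in> ring_hom A (UP K)" and inj: "inj_on \<eta> (carrier A)"
    and es: "\<And>r x. r \<in> carrier R \<Longrightarrow> x \<in> carrier A \<Longrightarrow> \<eta> (r \<odot>\<^bsub>A\<^esub> x) = \<rho> r \<odot>\<^bsub>UP K\<^esub> \<eta> x"
    and den: "\<And>f. f \<in> carrier (UP K) \<Longrightarrow> \<exists>r\<in>carrier R. r \<noteq> \<zero> \<and> (\<exists>x\<in>carrier A. \<rho> r \<odot>\<^bsub>UP K\<^esub> f = \<eta> x)"
    and Phi: "\<Phi> \<in> ring_hom A R" and Phis: "\<And>r x. r \<in> carrier R \<Longrightarrow> x \<in> carrier A \<Longrightarrow> \<Phi> (r \<odot>\<^bsub>A\<^esub> x) = r \<otimes> \<Phi> x"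
  obtains \<phi> where "\<phi> \<in> ring_hom A (UP K)" "inj_on \<phi> (carrier A)"
    "\<And>r x. r \<in> carrier R \<Longrightarrow> x \<in> carrier A \<Longrightarrow> \<phi> (r \<odot>\<^bsub>A\<^esub> x) = \<rho> r \<odot>\<^bsub>UP K\<^esub> \<phi> x"
    "\<And>f. f \<in> carrier (UP K) \<Longrightarrow> \<exists>r\<in>carrier R. r \<noteq> \<zero> \<and> (\<exists>x\<in>carrier A. \<rho> r \<odot>\<^bsub>UP K\<^esub> f = \<phi> x)"
    "\<And>x. x \<in> carrier A \<Longrightarrow> up_ring.coeff (UP K) (\<phi> x) 0 = \<rho> (\<Phi> x)"
proof -
  interpret A: algebra R A by fact
  interpret K: field K unfolding K_def by (rule quotient_field_is_field)
  interpret U: field_poly K "UP K" by (rule field_poly_UP) (rule K.field_axioms)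
  let ?D = "UP K"
  have qh: "\<rho> \<in> ring_hom R K" unfolding K_def \<rho>_def by (rule to_quotient_field_hom)
  have qc: "\<rho> r \<in> carrier K" if "r \<in> carrier R" for r using qh that by (rule ring_hom_closed)
  have qnz: "\<rho> r \<noteq> \<zero>\<^bsub>K\<^esub>" if "r \<in> carrier R" "r \<noteq> \<zero>" for r
    using that ring_hom_zero[OF qh ring_axioms K.ring_axioms]
      inj_onD[OF to_quotient_field_inj, folded \<rho>_def, of r \<zero>] by auto
  have ec: "\<eta> x \<in> carrier ?D" if "x \<in> carrier A" for x using eh that by (rule ring_hom_closed)
  have Pc: "\<Phi> x \<in> carrier R" if "x \<in> carrier A" for x using Phi that by (rule ring_hom_closed)
  obtain r t where r: "r \<in> carrier R" "r \<noteq> \<zero>" "t \<in> carrier A" "\<rho> r \<odot>\<^bsub>?D\<^esub> U.T = \<eta> t"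
    using den[of U.T] by auto
  note iv = U.inv_nz[OF qc[OF r(1)] qnz[OF r(1,2)]]
  define c where "c = \<rho> (\<Phi> t) \<otimes>\<^bsub>K\<^esub> inv\<^bsub>K\<^esub> \<rho> r"
  have c: "c \<in> carrier K" unfolding c_def using iv qc[OF Pc[OF r(3)]] by simp
  have cr: "\<rho> r \<otimes>\<^bsub>K\<^esub> c = \<rho> (\<Phi> t)"
    unfolding c_def using iv qc[OF Pc[OF r(3)]] qc[OF r(1)] K.m_lcomm[of "\<rho> r"] by simp
  obtain \<theta> where th: "\<theta> \<in> ring_hom ?D ?D" "\<And>k. k \<in> carrier K \<Longrightarrow> \<theta> (U.mon k 0) = U.mon k 0"
      "\<theta> U.T = U.T \<oplus>\<^bsub>?D\<^esub> U.mon c 0" "bij_betw \<theta> (carrier ?D) (carrier ?D)"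
    using U.translation[OF c] by blast
  have ths: "\<theta> (k \<odot>\<^bsub>?D\<^esub> f) = k \<odot>\<^bsub>?D\<^esub> \<theta> f" if kf: "k \<in> carrier K" "f \<in> carrier ?D" for k f
    using ring_hom_mult[OF th(1), of "U.mon k 0" f] kf th(2)[OF kf(1)] ring_hom_closed[OF th(1) kf(2)]
    by (simp add: U.monom_mult_is_smult)
  define ev where "ev f = U.cf (\<theta> f) 0" for f
  have thc: "\<theta> f \<in> carrier ?D" if "f \<in> carrier ?D" for f using th(1) that by (rule ring_hom_closed)
  have evc: "ev f \<in> carrier K" if "f \<in> carrier ?D" for f unfolding ev_def using thc[OF that] by simp
  have eva: "ev (f \<oplus>\<^bsub>?D\<^esub> g) = ev f \<oplus>\<^bsub>K\<^esub> ev g" and evm: "ev (f \<otimes>\<^bsub>?D\<^esub> g) = ev f \<otimes>\<^bsub>K\<^esub> ev g"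
    if "f \<in> carrier ?D" "g \<in> carrier ?D" for f g
    using that thc ring_hom_add[OF th(1) that] ring_hom_mult[OF th(1) that] by (simp_all add: ev_def)
  have evs: "ev (k \<odot>\<^bsub>?D\<^esub> f) = k \<otimes>\<^bsub>K\<^esub> ev f" if "k \<in> carrier K" "f \<in> carrier ?D" for k f
    using that thc by (simp add: ev_def ths)
  have evk: "ev (U.mon k 0) = k" if "k \<in> carrier K" for k using that by (simp add: ev_def th(2))
  have evT: "ev U.T = c" unfolding ev_def th(3) using c by simp
  \<comment> \<open>Induction on a bound \<open>n\<close> for the degree, using \<open>f = f(0) + T g\<close>.\<close>
  have main: "ev (\<eta> x) = \<rho> (\<Phi> x)" if "x \<in> carrier A" "\<And>k. k \<ge> n \<Longrightarrow> U.cf (\<eta> x) k = \<zero>\<^bsub>K\<^esub>" for n x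
    using that
  proof (induction n arbitrary: x)
    case 0
    have "\<eta> x = \<zero>\<^bsub>?D\<^esub>" using 0 ec by (intro U.up_eqI) auto
    also have "\<dots> = \<eta> \<zero>\<^bsub>A\<^esub>"
      using ring_hom_zero[OF eh cring.axioms(1)[OF A.M_cring] U.UP_ring] by simp
    finally have x0: "x = \<zero>\<^bsub>A\<^esub>" using inj_onD[OF inj] 0(1) by blast
    have "ev \<zero>\<^bsub>?D\<^esub> = \<zero>\<^bsub>K\<^esub>" using evk[of "\<zero>\<^bsub>K\<^esub>"] by simp
    then show ?case
      unfolding x0 ring_hom_zero[OF eh cring.axioms(1)[OF A.M_cring] U.UP_ring]
        ring_hom_zero[OF Phi cring.axioms(1)[OF A.M_cring] ring_axioms] ring_hom_zero[OF qh ring_axioms K.ring_axioms] .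
  next
    case (Suc n)
    define f where "f = \<eta> x"
    have fc: "f \<in> carrier ?D" unfolding f_def by (rule ec[OF Suc(2)])
    define f0 where "f0 = U.cf f 0"
    have f0: "f0 \<in> carrier K" unfolding f0_def using fc by simp
    define h where "h = f \<oplus>\<^bsub>?D\<^esub> \<ominus>\<^bsub>?D\<^esub> U.mon f0 0"
    have hc: "h \<in> carrier ?D" "U.cf h 0 = \<zero>\<^bsub>K\<^esub>" "\<And>k. U.cf h (Suc k) = U.cf f (Suc k)"
      using fc f0 by (simp_all add: h_def f0_def K.r_neg)
    obtain g where g: "g \<in> carrier ?D" "h = U.T \<otimes>\<^bsub>?D\<^esub> g" "\<And>k. U.cf g k = U.cf h (Suc k)"
      using U.shift_exists[OF hc(1,2)] by blast
    have feq: "f = U.mon f0 0 \<oplus>\<^bsub>?D\<^esub> U.T \<otimes>\<^bsub>?D\<^esub> g"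
      unfolding g(2)[symmetric] h_def using fc f0 by (simp add: U.P.a_ac U.P.r_neg2 U.P.r_neg)
    obtain s y where s: "s \<in> carrier R" "s \<noteq> \<zero>" "y \<in> carrier A" "\<rho> s \<odot>\<^bsub>?D\<^esub> g = \<eta> y" using den[OF g(1)] by blast
    obtain u v where uv: "u \<in> carrier R" "v \<in> carrier R" "v \<noteq> \<zero>" "f0 = \<rho> u \<otimes>\<^bsub>K\<^esub> inv\<^bsub>K\<^esub> \<rho> v"
      using quotient_field_cases[OF f0[unfolded K_def], folded K_def \<rho>_def] by blast
    note ivv = U.inv_nz[OF qc[OF uv(2)] qnz[OF uv(2,3)]]
    have vf0: "\<rho> v \<otimes>\<^bsub>K\<^esub> f0 = \<rho> u"
      unfolding uv(4) using ivv qc[OF uv(1)] qc[OF uv(2)] K.m_lcomm[of "\<rho> v" "\<rho> u"] by simp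
    have cs: "\<rho> r \<in> carrier K" "\<rho> s \<in> carrier K" "\<rho> v \<in> carrier K" "\<rho> u \<in> carrier K" using qc r s uv by auto
    have gn: "U.cf (\<eta> y) k = \<zero>\<^bsub>K\<^esub>" if "k \<ge> n" for k
      using Suc(3)[of "Suc k"] that hc(3) g(3) g(1) cs unfolding s(4)[symmetric] by (simp add: f_def)
    have IH: "ev (\<eta> y) = \<rho> (\<Phi> y)" by (rule Suc.IH[OF s(3) gn])
    define w where "w = r \<otimes> s \<otimes> v"
    have w: "w \<in> carrier R" "w \<noteq> \<zero>" unfolding w_def using r s uv integral by auto
    have rw: "\<rho> w = \<rho> r \<otimes>\<^bsub>K\<^esub> \<rho> s \<otimes>\<^bsub>K\<^esub> \<rho> v"
      unfolding w_def using ring_hom_mult[OF qh] r s uv by simp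
    have "\<eta> (w \<odot>\<^bsub>A\<^esub> x) = \<eta> ((r \<otimes> s \<otimes> u) \<odot>\<^bsub>A\<^esub> \<one>\<^bsub>A\<^esub> \<oplus>\<^bsub>A\<^esub> v \<odot>\<^bsub>A\<^esub> (t \<otimes>\<^bsub>A\<^esub> y))"
    proof -
      have "\<eta> (w \<odot>\<^bsub>A\<^esub> x) = \<rho> w \<odot>\<^bsub>?D\<^esub> U.mon f0 0 \<oplus>\<^bsub>?D\<^esub> \<rho> w \<odot>\<^bsub>?D\<^esub> (U.T \<otimes>\<^bsub>?D\<^esub> g)"
        unfolding es[OF w(1) Suc(2)] f_def[symmetric] feq using w qc f0 g(1) by (simp add: U.UP_smult_r_distr)
      moreover have "\<rho> w \<odot>\<^bsub>?D\<^esub> U.mon f0 0 = \<eta> ((r \<otimes> s \<otimes> u) \<odot>\<^bsub>A\<^esub> \<one>\<^bsub>A\<^esub>)"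
      proof -
        have "\<rho> w \<otimes>\<^bsub>K\<^esub> f0 = \<rho> (r \<otimes> s \<otimes> u)"
          unfolding rw using cs f0 vf0 ring_hom_mult[OF qh] r s uv by (simp add: K.m_assoc)
        then show ?thesis
          using es[of "r \<otimes> s \<otimes> u" "\<one>\<^bsub>A\<^esub>"] ring_hom_one[OF eh] r s uv w qc f0
            U.monom_mult_smult[of "\<rho> w" f0 0] U.const_eq[of "\<rho> (r \<otimes> s \<otimes> u)"] by simp
      qed
      moreover have "\<rho> w \<odot>\<^bsub>?D\<^esub> (U.T \<otimes>\<^bsub>?D\<^esub> g) = \<eta> (v \<odot>\<^bsub>A\<^esub> (t \<otimes>\<^bsub>A\<^esub> y))"
      proof -
        have Tc: "U.T \<in> carrier ?D" by simp
        have "\<rho> w \<odot>\<^bsub>?D\<^esub> (U.T \<otimes>\<^bsub>?D\<^esub> g) = \<rho> v \<odot>\<^bsub>?D\<^esub> ((\<rho> r \<odot>\<^bsub>?D\<^esub> U.T) \<otimes>\<^bsub>?D\<^esub> (\<rho> s \<odot>\<^bsub>?D\<^esub> g))"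
          unfolding rw using cs g(1) Tc
          by (simp add: U.UP_smult_assoc2 U.mult_smult U.UP_smult_assoc1[symmetric] K.m_ac del: U.monom_closed)
        then show ?thesis
          unfolding r(4) s(4) using es[OF uv(2) A.m_closed[OF r(3) s(3)]] ring_hom_mult[OF eh r(3) s(3)] by simp
      qed
      ultimately show ?thesis
        using ring_hom_add[OF eh] r s uv by simp
    qed
    then have eq: "w \<odot>\<^bsub>A\<^esub> x = (r \<otimes> s \<otimes> u) \<odot>\<^bsub>A\<^esub> \<one>\<^bsub>A\<^esub> \<oplus>\<^bsub>A\<^esub> v \<odot>\<^bsub>A\<^esub> (t \<otimes>\<^bsub>A\<^esub> y)"
      by (rule inj_onD[OF inj]) (use w Suc(2) r s uv in auto)
    have "w \<otimes> \<Phi> x = r \<otimes> s \<otimes> u \<oplus> v \<otimes> (\<Phi> t \<otimes> \<Phi> y)"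
    proof -
      have "\<Phi> (w \<odot>\<^bsub>A\<^esub> x) = \<Phi> ((r \<otimes> s \<otimes> u) \<odot>\<^bsub>A\<^esub> \<one>\<^bsub>A\<^esub>) \<oplus> \<Phi> (v \<odot>\<^bsub>A\<^esub> (t \<otimes>\<^bsub>A\<^esub> y))"
        unfolding eq by (rule ring_hom_add[OF Phi]) (use r s uv in auto)
      then show ?thesis
        using Phis[OF w(1) Suc(2)] Phis[of "r \<otimes> s \<otimes> u" "\<one>\<^bsub>A\<^esub>"] Phis[OF uv(2) A.m_closed[OF r(3) s(3)]]
          ring_hom_mult[OF Phi r(3) s(3)] ring_hom_one[OF Phi] r s uv by simp
    qed
    then have "\<rho> (w \<otimes> \<Phi> x) = \<rho> (r \<otimes> s \<otimes> u \<oplus> v \<otimes> (\<Phi> t \<otimes> \<Phi> y))" by simp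
    then have 1: "\<rho> w \<otimes>\<^bsub>K\<^esub> \<rho> (\<Phi> x) = \<rho> r \<otimes>\<^bsub>K\<^esub> \<rho> s \<otimes>\<^bsub>K\<^esub> \<rho> u \<oplus>\<^bsub>K\<^esub> \<rho> v \<otimes>\<^bsub>K\<^esub> (\<rho> (\<Phi> t) \<otimes>\<^bsub>K\<^esub> \<rho> (\<Phi> y))"
      using ring_hom_mult[OF qh] ring_hom_add[OF qh] r s uv w Pc Suc(2) by simp
    have 2: "\<rho> (\<Phi> y) = \<rho> s \<otimes>\<^bsub>K\<^esub> ev g" using IH evs[OF cs(2) g(1)] by (simp add: s(4))
    have evg: "ev g \<in> carrier K" using evc[OF g(1)] .
    have 3: "ev f = f0 \<oplus>\<^bsub>K\<^esub> c \<otimes>\<^bsub>K\<^esub> ev g"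
    proof -
      have "ev f = ev (U.mon f0 0) \<oplus>\<^bsub>K\<^esub> ev U.T \<otimes>\<^bsub>K\<^esub> ev g"
        using eva[of "U.mon f0 0" "U.T \<otimes>\<^bsub>?D\<^esub> g"] evm[of U.T g] f0 g(1) by (simp add: feq)
      then show ?thesis by (simp only: evk[OF f0] evT)
    qed
    have "\<rho> w \<otimes>\<^bsub>K\<^esub> ev f = \<rho> r \<otimes>\<^bsub>K\<^esub> \<rho> s \<otimes>\<^bsub>K\<^esub> (\<rho> v \<otimes>\<^bsub>K\<^esub> f0) \<oplus>\<^bsub>K\<^esub> \<rho> v \<otimes>\<^bsub>K\<^esub> ((\<rho> r \<otimes>\<^bsub>K\<^esub> c) \<otimes>\<^bsub>K\<^esub> (\<rho> s \<otimes>\<^bsub>K\<^esub> ev g))"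
      unfolding 3 rw using cs f0 c evg by (simp add: K.r_distr K.m_ac)
    then have "\<rho> w \<otimes>\<^bsub>K\<^esub> ev f = \<rho> w \<otimes>\<^bsub>K\<^esub> \<rho> (\<Phi> x)"
      unfolding 1 2 vf0 cr .
    then show ?case
      using K.m_lcancel[OF qnz[OF w] qc[OF w(1)]] evc[OF fc] qc[OF Pc[OF Suc(2)]] by (simp add: f_def)
  qed
  define \<phi> where "\<phi> = \<theta> \<circ> \<eta>"
  show thesis
  proof (rule that[of \<phi>])
    show "\<phi> \<in> ring_hom A ?D" unfolding \<phi>_def using eh th(1) by (rule ring_hom_trans)
    show "inj_on \<phi> (carrier A)"
      unfolding \<phi>_def
    proof (rule comp_inj_on[OF inj])
      have "\<eta> ` carrier A \<subseteq> carrier ?D" using ec by blast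
      then show "inj_on \<theta> (\<eta> ` carrier A)" using bij_betw_imp_inj_on[OF th(4)] by (rule inj_on_subset[rotated])
    qed
    show "\<phi> (r \<odot>\<^bsub>A\<^esub> x) = \<rho> r \<odot>\<^bsub>?D\<^esub> \<phi> x" if "r \<in> carrier R" "x \<in> carrier A" for r x
      unfolding \<phi>_def comp_def es[OF that] by (rule ths[OF qc[OF that(1)] ec[OF that(2)]])
    show "\<exists>r\<in>carrier R. r \<noteq> \<zero> \<and> (\<exists>x\<in>carrier A. \<rho> r \<odot>\<^bsub>?D\<^esub> f = \<phi> x)" if f: "f \<in> carrier ?D" for f
    proof -
      have "f \<in> \<theta> ` carrier ?D" using f bij_betw_imp_surj_on[OF th(4)] by simp
      then obtain g where g: "g \<in> carrier ?D" "f = \<theta> g" by blast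
      obtain q x where q: "q \<in> carrier R" "q \<noteq> \<zero>" "x \<in> carrier A" "\<rho> q \<odot>\<^bsub>?D\<^esub> g = \<eta> x" using den[OF g(1)] by blast
      have "\<rho> q \<odot>\<^bsub>?D\<^esub> f = \<phi> x"
        unfolding g(2) \<phi>_def comp_def q(4)[symmetric] by (rule ths[OF qc[OF q(1)] g(1), symmetric])
      then show ?thesis using q by blast
    qed
    show "U.cf (\<phi> x) 0 = \<rho> (\<Phi> x)" if x: "x \<in> carrier A" for x
    proof -
      have "ev (\<eta> x) = \<rho> (\<Phi> x)"
        by (rule main[OF x, of "Suc (deg K (\<eta> x))"]) (use U.deg_aboveD ec[OF x] in auto)
      then show ?thesis by (simp add: ev_def \<phi>_def)
    qed
  qed
qed

end

section \<open>Fibres over primes of height one\<close>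

context "domain"
begin

text \<open>In \<open>A \<otimes> k(P)\<close> the image of \<open>\<pi>\<close> is zero and that of \<open>s\<close> is a unit, so one of the factors \<open>a \<otimes> 1\<close> and
  \<open>b \<otimes> 1\<close> vanishes. It remains to see that \<open>x \<otimes> 1 = 0\<close> implies \<open>x \<in> \<pi> A\<^sub>P\<close>. For this, \<open>x \<otimes> u\<close> is sent to
  \<open>u x\<close> for a representative \<open>u \<in> R\<^sub>P\<close>; the result is well defined modulo \<open>P A\<^sub>P = \<pi> A\<^sub>P\<close>, and everything
  takes place inside \<open>K[T]\<close>.\<close>

lemma special_fibre_prime:
  fixes A :: "('a, 'c, 'p) module_scheme"
  defines "K \<equiv> quotient_field R" and "\<rho> \<equiv> to_quotient_field R"
  assumes A: "algebra R A"
    and eh: "\<eta> \<in> ring_hom A (UP K)" and inj: "inj_on \<eta> (carrier A)"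
    and es: "\<And>r x. r \<in> carrier R \<Longrightarrow> x \<in> carrier A \<Longrightarrow> \<eta> (r \<odot>\<^bsub>A\<^esub> x) = \<rho> r \<odot>\<^bsub>UP K\<^esub> \<eta> x"
    and P: "primeideal P R" and dom: "domain (tensor R A (residue_field R P))"
    and pi: "\<pi> \<in> P" and gen: "\<And>x. x \<in> P \<Longrightarrow> \<exists>s\<in>carrier R - P. \<exists>r\<in>carrier R. s \<otimes> x = r \<otimes> \<pi>"
    and abe: "a \<in> carrier A" "b \<in> carrier A" "e \<in> carrier A" "s \<in> carrier R - P"
      "s \<odot>\<^bsub>A\<^esub> (a \<otimes>\<^bsub>A\<^esub> b) = \<pi> \<odot>\<^bsub>A\<^esub> e"
  shows "\<exists>t\<in>carrier R - P. \<exists>e\<in>carrier A. t \<odot>\<^bsub>A\<^esub> a = \<pi> \<odot>\<^bsub>A\<^esub> e \<or> t \<odot>\<^bsub>A\<^esub> b = \<pi> \<odot>\<^bsub>A\<^esub> e"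
proof -
  interpret A: algebra R A by fact
  interpret K: field K unfolding K_def by (rule quotient_field_is_field)
  interpret U: field_poly K "UP K" by (rule field_poly_UP) (rule K.field_axioms)
  interpret P: primeideal P R by (rule P)
  interpret Q: localized_ring R "carrier R - P" by (rule P.complement_localized)
  let ?D = "UP K"
  have qh: "\<rho> \<in> ring_hom R K" unfolding K_def \<rho>_def by (rule to_quotient_field_hom)
  have qc: "\<rho> r \<in> carrier K" if "r \<in> carrier R" for r using qh that by (rule ring_hom_closed)
  have qnz: "\<rho> r \<noteq> \<zero>\<^bsub>K\<^esub>" if "r \<in> carrier R" "r \<noteq> \<zero>" for r
    using that ring_hom_zero[OF qh ring_axioms K.ring_axioms]
      inj_onD[OF to_quotient_field_inj, folded \<rho>_def, of r \<zero>] by auto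
  have ec: "\<eta> x \<in> carrier ?D" if "x \<in> carrier A" for x using eh that by (rule ring_hom_closed)
  have zP: "\<zero> \<in> P" by (rule additive_subgroup.zero_closed[OF P.is_additive_subgroup])
  have sP: "s \<noteq> \<zero>" if "s \<in> carrier R - P" for s using that zP by auto
  have pic: "\<pi> \<in> carrier R" using pi by (rule P.Icarr)
  define Loc where "Loc = localization_at R P"
  define E where "E = extended_prime R P"
  define fr where "fr a s = fract R (carrier R - P) a s" for a s
  have Lc: "cring Loc" unfolding Loc_def localization_at_def by (rule Q.localization_cring)
  interpret L: cring Loc by (rule Lc)
  have frc: "fr a s \<in> carrier Loc" if "a \<in> carrier R" "s \<in> carrier R - P" for a s
    using that unfolding fr_def Loc_def localization_at_def by (rule Q.fract_closed)
  have frh: "(\<lambda>a. fr a \<one>) \<in> ring_hom R Loc"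
    unfolding fr_def Loc_def localization_at_def by (rule Q.fract_surj_hom)
  have Eeq: "E = Idl\<^bsub>Loc\<^esub> ((\<lambda>p. fr p \<one>) ` P)" by (simp add: E_def extended_prime_def Loc_def fr_def)
  have genc: "(\<lambda>p. fr p \<one>) ` P \<subseteq> carrier Loc"
    using P.Icarr Q.denoms_one by (auto intro: frc)
  have Eid: "ideal E Loc" unfolding Eeq by (rule L.genideal_ideal[OF genc])
  interpret E: ideal E Loc by (rule Eid)
  define \<kappa> where "\<kappa> = Loc Quot E"
  define \<sigma> where "\<sigma> r = E +>\<^bsub>Loc\<^esub> fr r \<one>" for r
  define k where "k = residue_field R P"
  have kdef: "k = algebra_via \<kappa> \<sigma>"
    by (simp add: k_def residue_field_def \<kappa>_def \<sigma>_def[abs_def] E_def Loc_def fr_def)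
  have kc: "cring \<kappa>" unfolding \<kappa>_def by (rule E.quotient_is_cring[OF Lc])
  have ph: "(+>\<^bsub>Loc\<^esub>) E \<in> ring_hom Loc \<kappa>" unfolding \<kappa>_def by (rule E.rcos_ring_hom)
  have sh: "\<sigma> \<in> ring_hom R \<kappa>"
    using ring_hom_trans[OF frh ph] by (simp add: comp_def \<sigma>_def[abs_def])
  have kalg: "algebra R k" unfolding kdef by (rule algebra_algebra_via[OF is_cring kc sh])
  have pair: "algebra_pair R A k" by (intro algebra_pair.intro A kalg)
  note ksimps = algebra_via_simps[of \<kappa> \<sigma>, folded kdef]
  let ?T = "tensor R A k" and ?p = "pure_tensor R A k"
  interpret T: "domain" ?T using dom by (simp add: k_def)
  note pc = algebra_pair.pure_closed[OF pair]
    and pm = algebra_pair.pure_mult[OF pair]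
    and p1 = algebra_pair.pure_one[OF pair] and pb = algebra_pair.pure_balance[OF pair]
    and pz = algebra_pair.pure_eq_zero_iff[OF pair]
  have k1: "\<one>\<^bsub>k\<^esub> \<in> carrier k" using cring.cring_simprules(6)[OF kc] by (simp add: ksimps)
  have sc: "\<sigma> r \<in> carrier k" if "r \<in> carrier R" for r using ring_hom_closed[OF sh that] by (simp add: ksimps)
  have sm1: "r \<odot>\<^bsub>k\<^esub> \<one>\<^bsub>k\<^esub> = \<sigma> r" if "r \<in> carrier R" for r
    using ring_hom_closed[OF sh that]
    by (simp add: ksimps monoid.r_one[OF ring.is_monoid[OF cring.axioms(1)[OF kc]]])
  have pr: "?p (r \<odot>\<^bsub>A\<^esub> x) \<one>\<^bsub>k\<^esub> = ?p \<one>\<^bsub>A\<^esub> (\<sigma> r) \<otimes>\<^bsub>?T\<^esub> ?p x \<one>\<^bsub>k\<^esub>" if "r \<in> carrier R" "x \<in> carrier A" for r x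
  proof -
    have "?p (r \<odot>\<^bsub>A\<^esub> x) \<one>\<^bsub>k\<^esub> = ?p x (\<sigma> r)" using pb[OF that k1] by (simp add: sm1[OF that(1)])
    moreover have "\<sigma> r \<otimes>\<^bsub>k\<^esub> \<one>\<^bsub>k\<^esub> = \<sigma> r"
      using ring_hom_closed[OF sh that(1)] monoid.r_one[OF ring.is_monoid[OF cring.axioms(1)[OF kc]]] by (simp add: ksimps)
    ultimately show ?thesis using pm[OF A.one_closed sc[OF that(1)] that(2) k1] that by simp
  qed
  \<comment> \<open>elements outside \<open>P\<close> become units, \<open>\<pi>\<close> becomes zero\<close>
  have unit: "?p \<one>\<^bsub>A\<^esub> (\<sigma> s) \<noteq> \<zero>\<^bsub>?T\<^esub>" if s: "s \<in> carrier R - P" for s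
  proof
    assume z: "?p \<one>\<^bsub>A\<^esub> (\<sigma> s) = \<zero>\<^bsub>?T\<^esub>"
    define i where "i = E +>\<^bsub>Loc\<^esub> fr \<one> s"
    have fc: "fr \<one> s \<in> carrier Loc" "fr s \<one> \<in> carrier Loc" using s Q.denoms_one by (auto intro: frc)
    have ic: "i \<in> carrier k" using ring_hom_closed[OF ph fc(1)] by (simp add: i_def ksimps)
    have "fr s \<one> \<otimes>\<^bsub>Loc\<^esub> fr \<one> s = \<one>\<^bsub>Loc\<^esub>"
      using s Q.denoms_one unfolding fr_def Loc_def localization_at_def
      by (simp add: Q.fract_mult Q.fract_one localization_at_eq_iff[OF P])
    then have "\<sigma> s \<otimes>\<^bsub>k\<^esub> i = \<one>\<^bsub>k\<^esub>"
      using ring_hom_mult[OF ph fc(2,1)] ring_hom_one[OF ph] by (simp add: ksimps \<sigma>_def i_def)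
    then have "?p \<one>\<^bsub>A\<^esub> (\<sigma> s) \<otimes>\<^bsub>?T\<^esub> ?p \<one>\<^bsub>A\<^esub> i = \<one>\<^bsub>?T\<^esub>"
      using pm[OF A.one_closed sc A.one_closed ic, of s] s by (simp add: p1)
    then show False using z pc[OF A.one_closed ic] T.zero_not_one by simp
  qed
  have sigpi: "\<sigma> \<pi> = \<zero>\<^bsub>k\<^esub>"
  proof -
    have "fr \<pi> \<one> \<in> E" unfolding Eeq using L.genideal_self[OF genc] pi by blast
    then have "E +>\<^bsub>Loc\<^esub> fr \<pi> \<one> = E"
      using L.a_coset_join2[OF _ E.a_subgroup] frc[OF pic Q.denoms_one] by blast
    then show ?thesis by (simp add: \<sigma>_def ksimps \<kappa>_def FactRing_def)
  qed
  have vanish: "?p x \<one>\<^bsub>k\<^esub> = \<zero>\<^bsub>?T\<^esub>" if x: "x \<in> carrier A" "s \<in> carrier R - P" "y \<in> carrier A" "s \<odot>\<^bsub>A\<^esub> x = \<pi> \<odot>\<^bsub>A\<^esub> y" for x s y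
  proof -
    have kz: "\<zero>\<^bsub>k\<^esub> \<in> carrier k" using sc[OF pic] sigpi by simp
    have "?p \<one>\<^bsub>A\<^esub> \<zero>\<^bsub>k\<^esub> \<oplus>\<^bsub>?T\<^esub> ?p \<one>\<^bsub>A\<^esub> \<zero>\<^bsub>k\<^esub> = ?p \<one>\<^bsub>A\<^esub> \<zero>\<^bsub>k\<^esub>"
      using algebra_pair.pure_add_right[OF pair A.one_closed kz kz] kc by (simp add: ksimps cring.cring_simprules(2,8))
    then have "?p \<one>\<^bsub>A\<^esub> \<zero>\<^bsub>k\<^esub> = \<zero>\<^bsub>?T\<^esub>"
      using T.add.l_cancel_one[OF pc[OF A.one_closed kz] pc[OF A.one_closed kz]] by simp
    then have "?p \<one>\<^bsub>A\<^esub> (\<sigma> s) \<otimes>\<^bsub>?T\<^esub> ?p x \<one>\<^bsub>k\<^esub> = \<zero>\<^bsub>?T\<^esub>"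
      using pr[of s x] pr[OF pic x(3)] x sigpi pc[OF x(3) k1] by simp
    then show ?thesis using unit[OF x(2)] T.integral pc[OF A.one_closed sc, of s] pc[OF x(1) k1] x(2) by blast
  qed
  \<comment> \<open>the kernel: \<open>A \<otimes> k(P)\<close> maps to \<open>K[T]\<close> modulo \<open>\<pi> A\<^sub>P\<close>\<close>
  obtain ext where ext0: "ext \<in> ring_hom (localization R (carrier R - P)) K"
      and exf: "\<And>a s. a \<in> carrier R \<Longrightarrow> s \<in> carrier R - P \<Longrightarrow>
        ext (fract R (carrier R - P) a s) = \<rho> a \<otimes>\<^bsub>K\<^esub> inv\<^bsub>K\<^esub> \<rho> s"
  proof (rule Q.localization_lift[OF K.is_cring qh])
    show "\<rho> s \<in> Units K" if "s \<in> carrier R - P" for s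
      using qnz[of s] sP[OF that] qc[of s] that K.field_Units by auto
  qed blast
  have ext: "ext \<in> ring_hom Loc K" using ext0 by (simp add: Loc_def localization_at_def)
  have exc: "ext u \<in> carrier K" if "u \<in> carrier Loc" for u using ext that by (rule ring_hom_closed)
  have lcases: "\<exists>a s. a \<in> carrier R \<and> s \<in> carrier R - P \<and> u = fr a s" if "u \<in> carrier Loc" for u
    using that unfolding fr_def Loc_def localization_at_def by (metis Q.fract_cases)
  define H where "H = {f \<in> carrier ?D. \<exists>s\<in>carrier R - P. \<exists>y\<in>carrier A. \<rho> s \<odot>\<^bsub>?D\<^esub> f = \<rho> \<pi> \<odot>\<^bsub>?D\<^esub> \<eta> y}"
  have Hsub: "subgroup H (add_monoid ?D)"
  proof (rule U.P.add.subgroupI)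
    show "H \<subseteq> carrier ?D" by (auto simp: H_def)
    have "\<rho> \<one> \<odot>\<^bsub>?D\<^esub> \<zero>\<^bsub>?D\<^esub> = \<rho> \<pi> \<odot>\<^bsub>?D\<^esub> \<eta> \<zero>\<^bsub>A\<^esub>"
      using qc[OF pic] qc[OF one_closed] ring_hom_zero[OF eh cring.axioms(1)[OF A.M_cring] U.UP_ring]
      by (simp add: U.smult_r_null)
    then show "H \<noteq> {}" using Q.denoms_one unfolding H_def by blast
  next
    fix f assume "f \<in> H"
    then obtain s y where h: "f \<in> carrier ?D" "s \<in> carrier R - P" "y \<in> carrier A" "\<rho> s \<odot>\<^bsub>?D\<^esub> f = \<rho> \<pi> \<odot>\<^bsub>?D\<^esub> \<eta> y"
      by (auto simp: H_def)
    have "\<rho> s \<odot>\<^bsub>?D\<^esub> (\<ominus>\<^bsub>?D\<^esub> f) = \<ominus>\<^bsub>?D\<^esub> (\<rho> s \<odot>\<^bsub>?D\<^esub> f)"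
      using h qc[of s] U.smult_r_minus[of "\<rho> s" f] by simp
    also have "\<dots> = \<rho> \<pi> \<odot>\<^bsub>?D\<^esub> (\<ominus>\<^bsub>?D\<^esub> \<eta> y)"
      unfolding h(4) using h(3) qc[OF pic] ec U.smult_r_minus[of "\<rho> \<pi>" "\<eta> y"] by simp
    also have "\<ominus>\<^bsub>?D\<^esub> \<eta> y = \<eta> (\<ominus>\<^bsub>A\<^esub> y)"
      using ring_hom_cring.hom_a_inv[OF ring_hom_cringI[OF A.M_cring U.UP_cring eh] h(3)] by simp
    finally show "\<ominus>\<^bsub>?D\<^esub> f \<in> H" using h(1-3) unfolding H_def by blast
  next
    fix f g assume "f \<in> H" "g \<in> H"
    then obtain s y t z where h: "f \<in> carrier ?D" "s \<in> carrier R - P" "y \<in> carrier A" "\<rho> s \<odot>\<^bsub>?D\<^esub> f = \<rho> \<pi> \<odot>\<^bsub>?D\<^esub> \<eta> y"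
       "g \<in> carrier ?D" "t \<in> carrier R - P" "z \<in> carrier A" "\<rho> t \<odot>\<^bsub>?D\<^esub> g = \<rho> \<pi> \<odot>\<^bsub>?D\<^esub> \<eta> z"
      by (auto simp: H_def)
    have st: "s \<in> carrier R" "t \<in> carrier R" "\<rho> s \<in> carrier K" "\<rho> t \<in> carrier K" using h qc by auto
    have "\<rho> (s \<otimes> t) \<odot>\<^bsub>?D\<^esub> (f \<oplus>\<^bsub>?D\<^esub> g) = \<rho> t \<odot>\<^bsub>?D\<^esub> (\<rho> s \<odot>\<^bsub>?D\<^esub> f) \<oplus>\<^bsub>?D\<^esub> \<rho> s \<odot>\<^bsub>?D\<^esub> (\<rho> t \<odot>\<^bsub>?D\<^esub> g)"
      using st h(1,5) ring_hom_mult[OF qh st(1,2)] U.smult_left_comm[OF st(3,4) h(1)]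
      by (simp add: U.UP_smult_assoc1 U.UP_smult_r_distr)
    also have "\<dots> = \<rho> \<pi> \<odot>\<^bsub>?D\<^esub> \<eta> (t \<odot>\<^bsub>A\<^esub> y \<oplus>\<^bsub>A\<^esub> s \<odot>\<^bsub>A\<^esub> z)"
      unfolding h(4,8) using st h(3,7) qc[OF pic] ec ring_hom_add[OF eh] es
        U.smult_left_comm[of _ "\<rho> \<pi>"] by (simp add: U.UP_smult_r_distr)
    finally have "\<rho> (s \<otimes> t) \<odot>\<^bsub>?D\<^esub> (f \<oplus>\<^bsub>?D\<^esub> g) = \<rho> \<pi> \<odot>\<^bsub>?D\<^esub> \<eta> (t \<odot>\<^bsub>A\<^esub> y \<oplus>\<^bsub>A\<^esub> s \<odot>\<^bsub>A\<^esub> z)" .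
    moreover have "s \<otimes> t \<in> carrier R - P" using h(2,6) by (rule Q.denoms_mult)
    moreover have "t \<odot>\<^bsub>A\<^esub> y \<oplus>\<^bsub>A\<^esub> s \<odot>\<^bsub>A\<^esub> z \<in> carrier A" using st h by simp
    ultimately show "f \<oplus>\<^bsub>?D\<^esub> g \<in> H" using h(1,5) unfolding H_def by blast
  qed
  \<comment> \<open>the valuation ideal of \<open>R\<^sub>P\<close> times \<open>A\<close> lies in \<open>H\<close>\<close>
  have EH: "ext u \<odot>\<^bsub>?D\<^esub> \<eta> x \<in> H" if u: "u \<in> E" and x: "x \<in> carrier A" for u x
  proof -
    define W where "W = {u \<in> carrier Loc. \<exists>v\<in>carrier Loc. ext u = \<rho> \<pi> \<otimes>\<^bsub>K\<^esub> ext v}"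
    have "ideal W Loc"
    proof (rule idealI[OF L.ring_axioms])
      show "subgroup W (add_monoid Loc)"
      proof (rule L.add.subgroupI)
        show "W \<subseteq> carrier Loc" by (auto simp: W_def)
        have "ext \<zero>\<^bsub>Loc\<^esub> = \<rho> \<pi> \<otimes>\<^bsub>K\<^esub> ext \<zero>\<^bsub>Loc\<^esub>"
          using ring_hom_zero[OF ext L.ring_axioms K.ring_axioms] qc[OF pic] by simp
        then show "W \<noteq> {}" unfolding W_def using L.zero_closed by blast
      next
        fix u assume "u \<in> W"
        then obtain v where v: "u \<in> carrier Loc" "v \<in> carrier Loc" "ext u = \<rho> \<pi> \<otimes>\<^bsub>K\<^esub> ext v" by (auto simp: W_def)
        have i: "ext (\<ominus>\<^bsub>Loc\<^esub> z) = \<ominus>\<^bsub>K\<^esub> ext z" if "z \<in> carrier Loc" for z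
          using ring_hom_cring.hom_a_inv[OF ring_hom_cringI[OF Lc K.is_cring ext] that] .
        have "ext (\<ominus>\<^bsub>Loc\<^esub> u) = \<rho> \<pi> \<otimes>\<^bsub>K\<^esub> ext (\<ominus>\<^bsub>Loc\<^esub> v)"
          using v(3) exc[OF v(2)] qc[OF pic] by (simp add: i[OF v(1)] i[OF v(2)] K.r_minus)
        then show "\<ominus>\<^bsub>Loc\<^esub> u \<in> W" unfolding W_def using v(1,2) by blast
      next
        fix u u' assume "u \<in> W" "u' \<in> W"
        then obtain v v' where v: "u \<in> carrier Loc" "v \<in> carrier Loc" "ext u = \<rho> \<pi> \<otimes>\<^bsub>K\<^esub> ext v"
          "u' \<in> carrier Loc" "v' \<in> carrier Loc" "ext u' = \<rho> \<pi> \<otimes>\<^bsub>K\<^esub> ext v'" by (auto simp: W_def)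
        have "ext (u \<oplus>\<^bsub>Loc\<^esub> u') = \<rho> \<pi> \<otimes>\<^bsub>K\<^esub> ext (v \<oplus>\<^bsub>Loc\<^esub> v')"
          using v exc qc[OF pic] ring_hom_add[OF ext v(1,4)] ring_hom_add[OF ext v(2,5)] by (simp add: K.r_distr)
        then show "u \<oplus>\<^bsub>Loc\<^esub> u' \<in> W" unfolding W_def using v(1,2,4,5) L.a_closed by blast
      qed
    next
      fix u z assume "u \<in> W" and z: "z \<in> carrier Loc"
      then obtain v where v: "u \<in> carrier Loc" "v \<in> carrier Loc" "ext u = \<rho> \<pi> \<otimes>\<^bsub>K\<^esub> ext v" by (auto simp: W_def)
      have "ext (z \<otimes>\<^bsub>Loc\<^esub> u) = \<rho> \<pi> \<otimes>\<^bsub>K\<^esub> ext (z \<otimes>\<^bsub>Loc\<^esub> v)"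
        using v(3) exc[OF v(2)] exc[OF z] qc[OF pic] ring_hom_mult[OF ext z v(1)] ring_hom_mult[OF ext z v(2)]
        by (simp add: K.m_lcomm)
      then show "z \<otimes>\<^bsub>Loc\<^esub> u \<in> W" unfolding W_def using v(1,2) z L.m_closed by blast
      then show "u \<otimes>\<^bsub>Loc\<^esub> z \<in> W" using L.m_comm[OF v(1) z] by simp
    qed
    moreover have "(\<lambda>p. fr p \<one>) ` P \<subseteq> W"
    proof (rule image_subsetI)
      fix p assume p: "p \<in> P"
      have pcR: "p \<in> carrier R" using p by (rule P.Icarr)
      obtain s r where sr: "s \<in> carrier R - P" "r \<in> carrier R" "s \<otimes> p = r \<otimes> \<pi>" using gen[OF p] by blast
      have sK: "\<rho> s \<in> carrier K" "\<rho> s \<noteq> \<zero>\<^bsub>K\<^esub>" using qc qnz sP sr(1) by auto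
      note iv = U.inv_nz[OF sK]
      have e: "\<rho> s \<otimes>\<^bsub>K\<^esub> \<rho> p = \<rho> r \<otimes>\<^bsub>K\<^esub> \<rho> \<pi>"
        using ring_hom_mult[OF qh _ pcR, of s] ring_hom_mult[OF qh sr(2) pic] sr by simp
      have "\<rho> p = inv\<^bsub>K\<^esub> \<rho> s \<otimes>\<^bsub>K\<^esub> (\<rho> s \<otimes>\<^bsub>K\<^esub> \<rho> p)" using U.cancel_inv(2)[OF sK qc[OF pcR]] by simp
      also have "\<dots> = \<rho> \<pi> \<otimes>\<^bsub>K\<^esub> (\<rho> r \<otimes>\<^bsub>K\<^esub> inv\<^bsub>K\<^esub> \<rho> s)"
        unfolding e using iv(1) qc[OF sr(2)] qc[OF pic] by (simp add: K.m_ac)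
      finally have "ext (fr p \<one>) = \<rho> \<pi> \<otimes>\<^bsub>K\<^esub> ext (fr r s)"
        using exf[OF pcR Q.denoms_one] exf[OF sr(2,1)] ring_hom_one[OF qh] qc[OF pcR] by (simp add: fr_def)
      then show "fr p \<one> \<in> W" unfolding W_def using frc[OF pcR Q.denoms_one] frc[OF sr(2,1)] by blast
    qed
    ultimately have "E \<subseteq> W" unfolding Eeq by (rule L.genideal_minimal)
    then obtain v where v: "v \<in> carrier Loc" "ext u = \<rho> \<pi> \<otimes>\<^bsub>K\<^esub> ext v" using u by (auto simp: W_def)
    obtain r s where rs: "r \<in> carrier R" "s \<in> carrier R - P" "v = fr r s" using lcases[OF v(1)] by blast
    have sK: "\<rho> s \<in> carrier K" "\<rho> s \<noteq> \<zero>\<^bsub>K\<^esub>" using qc qnz sP rs(2) by auto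
    note iv = U.inv_nz[OF sK]
    have "\<rho> s \<otimes>\<^bsub>K\<^esub> ext u = \<rho> \<pi> \<otimes>\<^bsub>K\<^esub> \<rho> r"
      unfolding v(2) rs(3) fr_def exf[OF rs(1,2)] using iv sK qc[OF rs(1)] qc[OF pic]
        U.cancel_inv(1)[OF sK, of "\<rho> \<pi> \<otimes>\<^bsub>K\<^esub> \<rho> r"] by (simp add: K.m_ac)
    moreover have uc: "ext u \<in> carrier K" using u E.Icarr by (intro exc)
    ultimately have "\<rho> s \<odot>\<^bsub>?D\<^esub> (ext u \<odot>\<^bsub>?D\<^esub> \<eta> x) = \<rho> \<pi> \<odot>\<^bsub>?D\<^esub> \<eta> (r \<odot>\<^bsub>A\<^esub> x)"
      using sK(1) qc[OF rs(1)] qc[OF pic] ec[OF x]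
      by (simp add: es[OF rs(1) x] U.UP_smult_assoc1[symmetric])
    then show ?thesis unfolding H_def using rs(1,2) x uc ec[OF x] by blast
  qed
  define rep where "rep V = (SOME u. u \<in> carrier Loc \<and> V = E +>\<^bsub>Loc\<^esub> u)" for V
  have rep: "rep V \<in> carrier Loc" "V = E +>\<^bsub>Loc\<^esub> rep V" if "V \<in> carrier k" for V
  proof -
    have "\<exists>u. u \<in> carrier Loc \<and> V = E +>\<^bsub>Loc\<^esub> u"
      using that by (auto simp: ksimps \<kappa>_def FactRing_def A_RCOSETS_def')
    from someI_ex[OF this] show "rep V \<in> carrier Loc" "V = E +>\<^bsub>Loc\<^esub> rep V" unfolding rep_def by auto
  qed
  have repX: "ext (rep V) \<odot>\<^bsub>?D\<^esub> \<eta> x \<ominus>\<^bsub>?D\<^esub> ext u \<odot>\<^bsub>?D\<^esub> \<eta> x \<in> H"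
    if V: "V \<in> carrier k" "u \<in> carrier Loc" "V = E +>\<^bsub>Loc\<^esub> u" "x \<in> carrier A" for V u x
  proof -
    have "E +>\<^bsub>Loc\<^esub> rep V = E +>\<^bsub>Loc\<^esub> u" using rep(2)[OF V(1)] V(3) by simp
    then have d: "rep V \<ominus>\<^bsub>Loc\<^esub> u \<in> E"
      using L.quotient_eq_iff_same_a_r_cos[OF Eid rep(1)[OF V(1)] V(2)] by simp
    have "ext (rep V \<ominus>\<^bsub>Loc\<^esub> u) = ext (rep V) \<ominus>\<^bsub>K\<^esub> ext u"
      by (rule ring_hom_minus[OF L.ring_axioms K.ring_axioms ext rep(1)[OF V(1)] V(2)])
    then have "ext (rep V \<ominus>\<^bsub>Loc\<^esub> u) \<odot>\<^bsub>?D\<^esub> \<eta> x = ext (rep V) \<odot>\<^bsub>?D\<^esub> \<eta> x \<ominus>\<^bsub>?D\<^esub> ext u \<odot>\<^bsub>?D\<^esub> \<eta> x"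
      using exc[OF rep(1)[OF V(1)]] exc[OF V(2)] ec[OF V(4)]
      by (simp add: K.minus_eq U.P.minus_eq U.UP_smult_l_distr U.smult_l_minus)
    with EH[OF d V(4)] show ?thesis by simp
  qed
  have kernel: "\<exists>t\<in>carrier R - P. \<exists>y\<in>carrier A. t \<odot>\<^bsub>A\<^esub> x = \<pi> \<odot>\<^bsub>A\<^esub> y"
    if x: "x \<in> carrier A" and z: "?p x \<one>\<^bsub>k\<^esub> = \<zero>\<^bsub>?T\<^esub>" for x
  proof -
    have "ext (rep \<one>\<^bsub>k\<^esub>) \<odot>\<^bsub>?D\<^esub> \<eta> x \<in> H"
    proof (rule module_pair.pure_tensor_zero_detect[OF module_pair.intro U.P.abelian_group_axioms Hsub,
          where \<beta> = "\<lambda>x V. ext (rep V) \<odot>\<^bsub>?D\<^esub> \<eta> x" and R = R and M = A and N = k])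
      show "module R A" "module R k" by (rule A.module algebra.module[OF kalg])+
      show "frag_of (x, \<one>\<^bsub>k\<^esub>) \<in> tensor_relations R A k" using z pz by simp
    next
      fix y V assume "y \<in> carrier A" "V \<in> carrier k"
      then show "ext (rep V) \<odot>\<^bsub>?D\<^esub> \<eta> y \<in> carrier ?D" using exc rep(1) ec by simp
    next
      fix y y' V assume c: "y \<in> carrier A" "y' \<in> carrier A" "V \<in> carrier k"
      have "ext (rep V) \<odot>\<^bsub>?D\<^esub> \<eta> (y \<oplus>\<^bsub>A\<^esub> y') \<ominus>\<^bsub>?D\<^esub> ext (rep V) \<odot>\<^bsub>?D\<^esub> \<eta> y \<ominus>\<^bsub>?D\<^esub> ext (rep V) \<odot>\<^bsub>?D\<^esub> \<eta> y' = \<zero>\<^bsub>?D\<^esub>"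
        using ring_hom_add[OF eh c(1,2)] exc[OF rep(1)[OF c(3)]] ec[OF c(1)] ec[OF c(2)]
        by (simp add: U.UP_smult_r_distr U.P.minus_eq U.P.a_ac U.P.r_neg U.P.r_neg1 U.P.r_neg2)
      then show "ext (rep V) \<odot>\<^bsub>?D\<^esub> \<eta> (y \<oplus>\<^bsub>A\<^esub> y') \<ominus>\<^bsub>?D\<^esub> ext (rep V) \<odot>\<^bsub>?D\<^esub> \<eta> y \<ominus>\<^bsub>?D\<^esub> ext (rep V) \<odot>\<^bsub>?D\<^esub> \<eta> y' \<in> H"
        using subgroup.one_closed[OF Hsub] by simp
    next
      fix y V V' assume c: "y \<in> carrier A" "V \<in> carrier k" "V' \<in> carrier k"
      note r = rep(1)[OF c(2)] rep(1)[OF c(3)]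
      have e: "V \<oplus>\<^bsub>k\<^esub> V' = E +>\<^bsub>Loc\<^esub> (rep V \<oplus>\<^bsub>Loc\<^esub> rep V')"
        using ring_hom_add[OF ph r] rep(2)[OF c(2)] rep(2)[OF c(3)] by (simp add: ksimps)
      have "V \<oplus>\<^bsub>k\<^esub> V' \<in> carrier k" using kc c(2,3) by (simp add: ksimps cring.cring_simprules(1))
      from repX[OF this L.a_closed[OF r] e c(1)]
      show "ext (rep (V \<oplus>\<^bsub>k\<^esub> V')) \<odot>\<^bsub>?D\<^esub> \<eta> y \<ominus>\<^bsub>?D\<^esub> ext (rep V) \<odot>\<^bsub>?D\<^esub> \<eta> y \<ominus>\<^bsub>?D\<^esub> ext (rep V') \<odot>\<^bsub>?D\<^esub> \<eta> y \<in> H"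
        using ring_hom_add[OF ext r] exc[OF r(1)] exc[OF r(2)] ec[OF c(1)]
          exc[OF rep(1)[OF \<open>V \<oplus>\<^bsub>k\<^esub> V' \<in> carrier k\<close>]]
        by (simp add: U.UP_smult_l_distr U.P.minus_eq U.P.minus_add U.P.a_assoc)
    next
      fix r y V assume c: "r \<in> carrier R" "y \<in> carrier A" "V \<in> carrier k"
      note rv = rep(1)[OF c(3)] and fc = frc[OF c(1) Q.denoms_one]
      have e: "r \<odot>\<^bsub>k\<^esub> V = E +>\<^bsub>Loc\<^esub> (fr r \<one> \<otimes>\<^bsub>Loc\<^esub> rep V)"
        using ring_hom_mult[OF ph fc rv] rep(2)[OF c(3)] by (simp add: ksimps \<sigma>_def)
      have rV: "r \<odot>\<^bsub>k\<^esub> V \<in> carrier k" using module.smult_closed[OF algebra.module[OF kalg] c(1,3)] .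
      have "ext (fr r \<one>) = \<rho> r"
        using exf[OF c(1) Q.denoms_one] ring_hom_one[OF qh] qc[OF c(1)] by (simp add: fr_def)
      then have "ext (fr r \<one> \<otimes>\<^bsub>Loc\<^esub> rep V) \<odot>\<^bsub>?D\<^esub> \<eta> y = ext (rep V) \<odot>\<^bsub>?D\<^esub> \<eta> (r \<odot>\<^bsub>A\<^esub> y)"
        using ring_hom_mult[OF ext fc rv] exc[OF rv] ec[OF c(2)] qc[OF c(1)] es[OF c(1,2)]
        by (simp add: U.UP_smult_assoc1 U.smult_left_comm[of "\<rho> r"])
      with repX[OF rV L.m_closed[OF fc rv] e c(2)]
      have "ext (rep (r \<odot>\<^bsub>k\<^esub> V)) \<odot>\<^bsub>?D\<^esub> \<eta> y \<ominus>\<^bsub>?D\<^esub> ext (rep V) \<odot>\<^bsub>?D\<^esub> \<eta> (r \<odot>\<^bsub>A\<^esub> y) \<in> H" by simp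
      then have "\<ominus>\<^bsub>?D\<^esub> (ext (rep (r \<odot>\<^bsub>k\<^esub> V)) \<odot>\<^bsub>?D\<^esub> \<eta> y \<ominus>\<^bsub>?D\<^esub> ext (rep V) \<odot>\<^bsub>?D\<^esub> \<eta> (r \<odot>\<^bsub>A\<^esub> y)) \<in> H"
        using subgroup.m_inv_closed[OF Hsub] by (simp add: a_inv_def)
      then show "ext (rep V) \<odot>\<^bsub>?D\<^esub> \<eta> (r \<odot>\<^bsub>A\<^esub> y) \<ominus>\<^bsub>?D\<^esub> ext (rep (r \<odot>\<^bsub>k\<^esub> V)) \<odot>\<^bsub>?D\<^esub> \<eta> y \<in> H"
        using exc[OF rv] exc[OF rep(1)[OF rV]] ec[OF c(2)] ec[of "r \<odot>\<^bsub>A\<^esub> y"] c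
        by (simp add: U.P.minus_eq U.P.minus_add U.P.a_comm)
    qed (use x k1 in auto)
    moreover have "ext (rep \<one>\<^bsub>k\<^esub>) \<odot>\<^bsub>?D\<^esub> \<eta> x \<ominus>\<^bsub>?D\<^esub> ext \<one>\<^bsub>Loc\<^esub> \<odot>\<^bsub>?D\<^esub> \<eta> x \<in> H"
      by (rule repX[OF k1 L.one_closed _ x]) (simp add: ksimps ring_hom_one[OF ph])
    ultimately have "ext (rep \<one>\<^bsub>k\<^esub>) \<odot>\<^bsub>?D\<^esub> \<eta> x \<oplus>\<^bsub>?D\<^esub>
        \<ominus>\<^bsub>?D\<^esub> (ext (rep \<one>\<^bsub>k\<^esub>) \<odot>\<^bsub>?D\<^esub> \<eta> x \<ominus>\<^bsub>?D\<^esub> \<eta> x) \<in> H"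
      using subgroup.m_closed[OF Hsub] subgroup.m_inv_closed[OF Hsub] ring_hom_one[OF ext] ec[OF x]
      by (simp add: a_inv_def)
    then have "\<eta> x \<in> H"
      using exc[OF rep(1)[OF k1]] ec[OF x]
      by (simp add: U.P.minus_eq U.P.minus_add U.P.a_assoc[symmetric] U.P.r_neg)
    then obtain t y where t: "t \<in> carrier R - P" "y \<in> carrier A" "\<rho> t \<odot>\<^bsub>?D\<^esub> \<eta> x = \<rho> \<pi> \<odot>\<^bsub>?D\<^esub> \<eta> y"
      by (auto simp: H_def)
    have "\<eta> (t \<odot>\<^bsub>A\<^esub> x) = \<eta> (\<pi> \<odot>\<^bsub>A\<^esub> y)" using t x pic by (simp add: es)
    then have "t \<odot>\<^bsub>A\<^esub> x = \<pi> \<odot>\<^bsub>A\<^esub> y" by (rule inj_onD[OF inj]) (use t x pic in auto)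
    then show ?thesis using t by blast
  qed
  have "?p a \<one>\<^bsub>k\<^esub> \<otimes>\<^bsub>?T\<^esub> ?p b \<one>\<^bsub>k\<^esub> = \<zero>\<^bsub>?T\<^esub>"
  proof -
    have "\<one>\<^bsub>k\<^esub> \<otimes>\<^bsub>k\<^esub> \<one>\<^bsub>k\<^esub> = \<one>\<^bsub>k\<^esub>"
      using monoid.r_one[OF ring.is_monoid[OF cring.axioms(1)[OF kc]]] k1 by (simp add: ksimps)
    then show ?thesis
      using pm[OF abe(1) k1 abe(2) k1] vanish[OF A.m_closed[OF abe(1,2)] abe(4,3,5)] by simp
  qed
  then have "?p a \<one>\<^bsub>k\<^esub> = \<zero>\<^bsub>?T\<^esub> \<or> ?p b \<one>\<^bsub>k\<^esub> = \<zero>\<^bsub>?T\<^esub>"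
    using T.integral pc[OF abe(1) k1] pc[OF abe(2) k1] by blast
  then show ?thesis using kernel[OF abe(1)] kernel[OF abe(2)] by blast
qed

end

section \<open>Polynomials with coefficients in powers of an invertible module\<close>

lemma ideal_module_simps [simp]:
  "carrier (ideal_module S I) = I" "ring.add (ideal_module S I) = ring.add S"
  "ring.zero (ideal_module S I) = ring.zero S" "smult (ideal_module S I) r x = r \<otimes>\<^bsub>S\<^esub> x"
  by (simp_all add: ideal_module_def self_algebra_def algebra_via_def)

lemma ideal_module_module:
  assumes "cring S" "ideal I S" shows "module S (ideal_module S I)"
proof -
  interpret S: cring S by fact
  interpret I: ideal I S by fact
  have ag: "abelian_group (ideal_module S I)"
  proof (rule abelian_groupI)
    fix x assume x: "x \<in> carrier (ideal_module S I)"
    then have "\<ominus>\<^bsub>S\<^esub> x \<in> I" "\<ominus>\<^bsub>S\<^esub> x \<oplus>\<^bsub>S\<^esub> x = \<zero>\<^bsub>S\<^esub>" using I.a_inv_closed I.Icarr by (auto simp: S.l_neg)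
    then show "\<exists>y\<in>carrier (ideal_module S I). y \<oplus>\<^bsub>ideal_module S I\<^esub> x = \<zero>\<^bsub>ideal_module S I\<^esub>" by auto
  qed (auto simp: I.a_closed I.Icarr S.a_ac additive_subgroup.zero_closed[OF I.is_additive_subgroup])
  show ?thesis
    by (rule moduleI[OF S.is_cring ag])
      (auto simp: I.I_l_closed I.Icarr S.l_distr S.r_distr S.m_assoc)
qed

text \<open>The slope module \<open>L\<close> is a fractional ideal of the abstract base ring \<open>S\<close>, embedded by \<open>\<rho>\<close>. A common
  denominator \<open>d\<close> turns it into the ideal \<open>Id\<close> of \<open>S\<close> that corresponds to \<open>d L\<close>.\<close>

locale scaled_line = krull_subalgebra +
  fixes S :: "('s, 'm) ring_scheme" and A :: "('s, 'aa, 'p) module_scheme" and \<rho> and \<phi> and d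
  assumes S: "cring S" and A: "algebra S A"
    and rho_hom: "\<rho> \<in> ring_hom S R" and rho_inj: "inj_on \<rho> (carrier S)" and rho_img: "\<rho> ` carrier S = R0"
    and phi_hom: "\<phi> \<in> ring_hom A P" and phi_inj: "inj_on \<phi> (carrier A)" and phi_img: "\<phi> ` carrier A = B"
    and phi_smult: "\<And>r x. r \<in> carrier S \<Longrightarrow> x \<in> carrier A \<Longrightarrow> \<phi> (r \<odot>\<^bsub>A\<^esub> x) = \<rho> r \<odot>\<^bsub>P\<^esub> \<phi> x"
    and d: "d \<in> R0" "d \<noteq> \<zero>" "\<And>c. c \<in> L \<Longrightarrow> d \<otimes> c \<in> R0"
begin

definition Id where "Id = {x \<in> carrier S. \<exists>c\<in>L. \<rho> x = d \<otimes> c}"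

text \<open>The isomorphism from \<open>Id\<close> to \<open>L\<close>.\<close>

definition lc where "lc x = inv d \<otimes> \<rho> x"

definition rr where "rr = inv_into (carrier S) \<rho>"

lemma d_carrier: "d \<in> carrier R" using d(1) by (rule R0_carrier)

lemma S_ring: "ring S" using S by (rule cring.axioms)

lemma rho_closed: "x \<in> carrier S \<Longrightarrow> \<rho> x \<in> R0" "x \<in> carrier S \<Longrightarrow> \<rho> x \<in> carrier R"
  using rho_img rho_hom ring_hom_closed by auto

lemma rr_props: "x \<in> R0 \<Longrightarrow> rr x \<in> carrier S" "x \<in> R0 \<Longrightarrow> \<rho> (rr x) = x" "y \<in> carrier S \<Longrightarrow> rr (\<rho> y) = y"
  unfolding rr_def using rho_img rho_inj inv_into_into[of _ \<rho>] f_inv_into_f[of _ \<rho>] inv_into_f_f by fastforce+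

lemma rho_eqD: "\<rho> x = \<rho> y \<Longrightarrow> x \<in> carrier S \<Longrightarrow> y \<in> carrier S \<Longrightarrow> x = y"
  using rho_inj by (rule inj_onD)

lemma rr_add: "x \<in> R0 \<Longrightarrow> y \<in> R0 \<Longrightarrow> rr (x \<oplus> y) = rr x \<oplus>\<^bsub>S\<^esub> rr y"
proof -
  assume xy: "x \<in> R0" "y \<in> R0"
  interpret S: cring S by (rule S)
  have "x \<oplus> y = \<rho> (rr x \<oplus>\<^bsub>S\<^esub> rr y)"
    using ring_hom_add[OF rho_hom rr_props(1)[OF xy(1)] rr_props(1)[OF xy(2)]] xy by (simp add: rr_props(2))
  then show ?thesis using rr_props(3)[of "rr x \<oplus>\<^bsub>S\<^esub> rr y"] rr_props(1) xy by simp
qed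

lemma rr_mult: "x \<in> R0 \<Longrightarrow> y \<in> R0 \<Longrightarrow> rr (x \<otimes> y) = rr x \<otimes>\<^bsub>S\<^esub> rr y"
proof -
  assume xy: "x \<in> R0" "y \<in> R0"
  interpret S: cring S by (rule S)
  have "x \<otimes> y = \<rho> (rr x \<otimes>\<^bsub>S\<^esub> rr y)"
    using ring_hom_mult[OF rho_hom rr_props(1)[OF xy(1)] rr_props(1)[OF xy(2)]] xy by (simp add: rr_props(2))
  then show ?thesis using rr_props(3)[of "rr x \<otimes>\<^bsub>S\<^esub> rr y"] rr_props(1) xy by simp
qed

lemma lc_L: "x \<in> Id \<Longrightarrow> lc x \<in> L" and lc_eq: "x \<in> Id \<Longrightarrow> \<rho> x = d \<otimes> lc x"
proof -
  assume "x \<in> Id"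
  then obtain c where c: "c \<in> L" "\<rho> x = d \<otimes> c" by (auto simp: Id_def)
  then have "lc x = c" using cancel_inv[OF d_carrier d(2) L_carrier[OF c(1)]] by (simp add: lc_def)
  with c show "lc x \<in> L" "\<rho> x = d \<otimes> lc x" by auto
qed

lemma lc_carrier: "x \<in> Id \<Longrightarrow> lc x \<in> carrier R"
  using lc_L L_carrier by blast

lemma Id_carrier: "x \<in> Id \<Longrightarrow> x \<in> carrier S" by (simp add: Id_def)

lemma Id_back: "c \<in> L \<Longrightarrow> rr (d \<otimes> c) \<in> Id" "c \<in> L \<Longrightarrow> lc (rr (d \<otimes> c)) = c" "x \<in> Id \<Longrightarrow> rr (d \<otimes> lc x) = x"
proof -
  show "rr (d \<otimes> c) \<in> Id" if c: "c \<in> L"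
    using rr_props(1,2)[OF d(3)[OF c]] c unfolding Id_def by blast
  show "lc (rr (d \<otimes> c)) = c" if c: "c \<in> L"
    unfolding lc_def rr_props(2)[OF d(3)[OF c]] by (rule cancel_inv(2)[OF d_carrier d(2) L_carrier[OF c]])
  show "rr (d \<otimes> lc x) = x" if x: "x \<in> Id"
    unfolding lc_eq[OF x, symmetric] by (rule rr_props(3)[OF Id_carrier[OF x]])
qed

lemma Id_ideal: "ideal Id S"
proof (rule idealI[OF S_ring])
  interpret S: cring S by (rule S)
  show "subgroup Id (add_monoid S)"
  proof (rule S.add.subgroupI)
    show "Id \<subseteq> carrier S" by (auto simp: Id_def)
    show "Id \<noteq> {}" using Id_back(1)[OF L_zero] by blast
  next
    fix x assume x: "x \<in> Id"
    have "\<rho> (\<ominus>\<^bsub>S\<^esub> x) = d \<otimes> \<ominus> lc x"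
      using ring_hom_cring.hom_a_inv[OF ring_hom_cringI[OF S R.is_cring rho_hom] Id_carrier[OF x]]
        lc_eq[OF x] d_carrier lc_carrier[OF x] by (simp add: R.r_minus)
    then show "\<ominus>\<^bsub>S\<^esub> x \<in> Id"
      using L_neg[OF lc_L[OF x]] S.a_inv_closed[OF Id_carrier[OF x]] unfolding Id_def by blast
  next
    fix x y assume xy: "x \<in> Id" "y \<in> Id"
    have "\<rho> (x \<oplus>\<^bsub>S\<^esub> y) = d \<otimes> (lc x \<oplus> lc y)"
      using ring_hom_add[OF rho_hom Id_carrier[OF xy(1)] Id_carrier[OF xy(2)]]
        lc_eq xy d_carrier lc_carrier by (simp add: R.r_distr)
    then show "x \<oplus>\<^bsub>S\<^esub> y \<in> Id"
      using L_add[OF lc_L[OF xy(1)] lc_L[OF xy(2)]] S.a_closed[OF Id_carrier[OF xy(1)] Id_carrier[OF xy(2)]]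
      unfolding Id_def by blast
  qed
next
  interpret S: cring S by (rule S)
  fix x r assume x: "x \<in> Id" and r: "r \<in> carrier S"
  have "\<rho> (r \<otimes>\<^bsub>S\<^esub> x) = d \<otimes> (\<rho> r \<otimes> lc x)"
    using ring_hom_mult[OF rho_hom r Id_carrier[OF x]] lc_eq[OF x] d_carrier lc_carrier[OF x] rho_closed[OF r]
    by (simp add: R.m_lcomm)
  then show *: "r \<otimes>\<^bsub>S\<^esub> x \<in> Id"
    using L_smult[OF rho_closed(1)[OF r] lc_L[OF x]] S.m_closed[OF r Id_carrier[OF x]] unfolding Id_def by blast
  then show "x \<otimes>\<^bsub>S\<^esub> r \<in> Id" using S.m_comm[OF r Id_carrier[OF x]] by simp
qed

lemma lc_add: "x \<in> Id \<Longrightarrow> y \<in> Id \<Longrightarrow> lc (x \<oplus>\<^bsub>S\<^esub> y) = lc x \<oplus> lc y"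
  using ring_hom_add[OF rho_hom, of x y] Id_carrier rho_closed inv_nz(1)[OF d_carrier d(2)]
  by (simp add: lc_def R.r_distr)

lemma lc_smult: "r \<in> carrier S \<Longrightarrow> x \<in> Id \<Longrightarrow> lc (r \<otimes>\<^bsub>S\<^esub> x) = \<rho> r \<otimes> lc x"
  using ring_hom_mult[OF rho_hom, of r x] Id_carrier rho_closed inv_nz(1)[OF d_carrier d(2)]
  by (simp add: lc_def R.m_lcomm)

abbreviation IM where "IM \<equiv> ideal_module S Id"
abbreviation Sy where "Sy \<equiv> symmetric_algebra S IM"
abbreviation FI where "FI \<equiv> free_algebra S Id"

lemma IM_module: "module S IM" by (rule ideal_module_module[OF S Id_ideal])

definition q where "q = sym_proj S IM"

lemma q_hom: "q \<in> ring_hom FI Sy"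
  using module.sym_proj_hom[OF IM_module] by (simp add: q_def)

lemma SM_ring: "ring Sy" by (rule module.symmetric_algebra_ring[OF IM_module])

lemma word_FI: "r \<in> carrier S \<Longrightarrow> set v \<subseteq> Id \<Longrightarrow> word S r v \<in> carrier FI"
  using module.word_closed_FM[OF IM_module, of r v] by simp

lemma q_closed: "p \<in> carrier FI \<Longrightarrow> q p \<in> carrier Sy"
  using q_hom by (rule ring_hom_closed)

text \<open>Scalars and generators of the symmetric algebra.\<close>

definition cst where "cst r = q (word S r [])"
definition gen where "gen x = q (word S \<one>\<^bsub>S\<^esub> [x])"

lemma cst_closed: "r \<in> carrier S \<Longrightarrow> cst r \<in> carrier Sy"
  unfolding cst_def by (intro q_closed word_FI) auto

lemma S_one: "\<one>\<^bsub>S\<^esub> \<in> carrier S" using S_ring by (rule ring.ring_simprules)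

lemma gen_closed: "x \<in> Id \<Longrightarrow> gen x \<in> carrier Sy"
  unfolding gen_def by (intro q_closed word_FI S_one) auto

lemma FI_mult: "p \<otimes>\<^bsub>FI\<^esub> p' = conv S p p'" by (rule cring.F_simps(2)[OF S])

lemma q_word_append:
  "r \<in> carrier S \<Longrightarrow> s \<in> carrier S \<Longrightarrow> set v \<subseteq> Id \<Longrightarrow> set w \<subseteq> Id \<Longrightarrow>
    q (word S (r \<otimes>\<^bsub>S\<^esub> s) (v @ w)) = q (word S r v) \<otimes>\<^bsub>Sy\<^esub> q (word S s w)"
  using ring_hom_mult[OF q_hom word_FI word_FI, of r v s w] cring.conv_word[OF S, of r s v w]
  by (simp add: FI_mult)

lemma cst_mult: "r \<in> carrier S \<Longrightarrow> s \<in> carrier S \<Longrightarrow> cst (r \<otimes>\<^bsub>S\<^esub> s) = cst r \<otimes>\<^bsub>Sy\<^esub> cst s"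
  using q_word_append[of r s "[]" "[]"] by (simp add: cst_def)

lemma cst_add: "r \<in> carrier S \<Longrightarrow> s \<in> carrier S \<Longrightarrow> cst (r \<oplus>\<^bsub>S\<^esub> s) = cst r \<oplus>\<^bsub>Sy\<^esub> cst s"
proof -
  assume rs: "r \<in> carrier S" "s \<in> carrier S"
  interpret S: cring S by (rule S)
  have "word S r [] \<oplus>\<^bsub>FI\<^esub> word S s [] = word S (r \<oplus>\<^bsub>S\<^esub> s) []"
    unfolding cring.F_simps(1)[OF S] by (auto simp: word_def rs)
  then show ?thesis
    unfolding cst_def using ring_hom_add[OF q_hom word_FI word_FI, of r "[]" s "[]"] rs by simp
qed

lemma cst_central: "r \<in> carrier S \<Longrightarrow> z \<in> carrier Sy \<Longrightarrow> cst r \<otimes>\<^bsub>Sy\<^esub> z = z \<otimes>\<^bsub>Sy\<^esub> cst r"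
proof -
  assume r: "r \<in> carrier S" and z: "z \<in> carrier Sy"
  obtain p where p: "p \<in> carrier FI" "z = q p"
    using module.sym_proj_surj[OF IM_module z] by (auto simp: q_def)
  have pc: "\<And>w. p w \<in> carrier S" using p(1) by (simp add: cring.F_carrier[OF S])
  have "word S r [] \<otimes>\<^bsub>FI\<^esub> p = p \<otimes>\<^bsub>FI\<^esub> word S r []"
    unfolding FI_mult using pc r
    by (auto simp: cring.conv_scalar_left[OF S] cring.conv_scalar_right[OF S])
  then show ?thesis
    unfolding cst_def p(2) using ring_hom_mult[OF q_hom word_FI p(1), of r "[]"]
      ring_hom_mult[OF q_hom p(1) word_FI, of r "[]"] r by simp
qed

lemma gen_add: "x \<in> Id \<Longrightarrow> y \<in> Id \<Longrightarrow> gen (x \<oplus>\<^bsub>S\<^esub> y) = gen x \<oplus>\<^bsub>Sy\<^esub> gen y"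
  using module.sym_gen_add[OF IM_module, of x y] by (simp add: gen_def q_def)

lemma gen_smult: "r \<in> carrier S \<Longrightarrow> x \<in> Id \<Longrightarrow> gen (r \<otimes>\<^bsub>S\<^esub> x) = cst r \<otimes>\<^bsub>Sy\<^esub> gen x"
proof -
  assume r: "r \<in> carrier S" and x: "x \<in> Id"
  interpret S: cring S by (rule S)
  show ?thesis
    using module.sym_gen_smult[OF IM_module, of r x] q_word_append[OF r S_one, of "[]" "[x]"] r x
    by (simp add: gen_def cst_def q_def)
qed

text \<open>Choose \<open>x\<^sub>i \<in> L\<close> and \<open>y\<^sub>i \<in> M\<close> with \<open>\<Sum> x\<^sub>i y\<^sub>i = 1\<close>. The map \<open>lift n\<close>, defined on the coefficients of
  \<open>T\<^sup>n\<close> by \<open>c \<mapsto> \<Sum> x\<^bsub>i\<^sub>1\<^esub> \<cdots> x\<^bsub>i\<^sub>n\<^esub> (y\<^bsub>i\<^sub>1\<^esub> \<cdots> y\<^bsub>i\<^sub>n\<^esub> c)\<close>, is inverse to multiplication \<open>Sym\<^sup>n(L) \<rightarrow> L\<^sup>n\<close>.\<close>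

definition pairs where "pairs = (SOME ps. set ps \<subseteq> L \<times> M \<and> lsum ps = \<one>)"

lemma pairs: "set pairs \<subseteq> L \<times> M" "lsum pairs = \<one>"
proof -
  have "\<exists>ps. set ps \<subseteq> L \<times> M \<and> lsum ps = \<one>" using one_in_LM by metis
  from someI_ex[OF this] show "set pairs \<subseteq> L \<times> M" "lsum pairs = \<one>" unfolding pairs_def by auto
qed

text \<open>The sum \<open>\<Sum> x \<cdot> h(y)\<close> over the pairs \<open>(x, y)\<close> of the list, where \<open>x \<in> L\<close> acts as the generator \<open>d x\<close>.\<close>

definition psum where "psum ps h = foldr (\<lambda>(x, y) z. gen (rr (d \<otimes> x)) \<otimes>\<^bsub>Sy\<^esub> h y \<oplus>\<^bsub>Sy\<^esub> z) ps \<zero>\<^bsub>Sy\<^esub>"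

fun lift :: "nat \<Rightarrow> 'a \<Rightarrow> ('s list \<Rightarrow> 's) set set" where
  "lift 0 c = cst (rr c)"
| "lift (Suc n) c = psum pairs (\<lambda>y. lift n (y \<otimes> c))"

lemma psum_closed:
  assumes "set ps \<subseteq> L \<times> M" "\<And>y. y \<in> M \<Longrightarrow> h y \<in> carrier Sy"
  shows "psum ps h \<in> carrier Sy"
proof -
  interpret Sy: ring Sy by (rule SM_ring)
  show ?thesis using assms(1)
    by (induction ps) (auto simp: psum_def gen_closed Id_back assms(2))
qed

lemma psum_add:
  assumes "set ps \<subseteq> L \<times> M" "\<And>y. y \<in> M \<Longrightarrow> h y \<in> carrier Sy" "\<And>y. y \<in> M \<Longrightarrow> h' y \<in> carrier Sy"
    "\<And>y. y \<in> M \<Longrightarrow> g y = h y \<oplus>\<^bsub>Sy\<^esub> h' y"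
  shows "psum ps g = psum ps h \<oplus>\<^bsub>Sy\<^esub> psum ps h'"
proof -
  interpret Sy: ring Sy by (rule SM_ring)
  show ?thesis using assms(1)
  proof (induction ps)
    case Nil
    then show ?case by (simp add: psum_def)
  next
    case (Cons p ps)
    obtain x y where p: "p = (x, y)" "x \<in> L" "y \<in> M" using Cons.prems by (cases p) auto
    have c: "psum ps h \<in> carrier Sy" "psum ps h' \<in> carrier Sy"
      using Cons.prems assms(2,3) by (auto intro!: psum_closed)
    have gc: "gen (rr (d \<otimes> x)) \<in> carrier Sy" using p by (simp add: gen_closed Id_back)
    have e: "psum (p # ps) f = gen (rr (d \<otimes> x)) \<otimes>\<^bsub>Sy\<^esub> f y \<oplus>\<^bsub>Sy\<^esub> psum ps f" for f
      by (simp add: psum_def p)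
    have IH: "psum ps g = psum ps h \<oplus>\<^bsub>Sy\<^esub> psum ps h'" using Cons by simp
    show ?case
      unfolding e IH assms(4)[OF p(3)] using c gc assms(2,3)[OF p(3)] by (simp add: Sy.r_distr Sy.a_ac)
  qed
qed

lemma psum_cst:
  assumes "set ps \<subseteq> L \<times> M" "r \<in> carrier S" "\<And>y. y \<in> M \<Longrightarrow> h y \<in> carrier Sy"
    "\<And>y. y \<in> M \<Longrightarrow> g y = cst r \<otimes>\<^bsub>Sy\<^esub> h y"
  shows "psum ps g = cst r \<otimes>\<^bsub>Sy\<^esub> psum ps h"
proof -
  interpret Sy: ring Sy by (rule SM_ring)
  have rc: "cst r \<in> carrier Sy" by (rule cst_closed[OF assms(2)])
  show ?thesis using assms(1)
  proof (induction ps)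
    case Nil
    then show ?case using rc by (simp add: psum_def)
  next
    case (Cons p ps)
    obtain x y where p: "p = (x, y)" "x \<in> L" "y \<in> M" using Cons.prems by (cases p) auto
    have c: "psum ps h \<in> carrier Sy" using Cons.prems assms(3) by (auto intro!: psum_closed)
    have gc: "gen (rr (d \<otimes> x)) \<in> carrier Sy" using p by (simp add: gen_closed Id_back)
    have e: "psum (p # ps) f = gen (rr (d \<otimes> x)) \<otimes>\<^bsub>Sy\<^esub> f y \<oplus>\<^bsub>Sy\<^esub> psum ps f" for f
      by (simp add: psum_def p)
    have IH: "psum ps g = cst r \<otimes>\<^bsub>Sy\<^esub> psum ps h" using Cons by simp
    have "gen (rr (d \<otimes> x)) \<otimes>\<^bsub>Sy\<^esub> (cst r \<otimes>\<^bsub>Sy\<^esub> h y) = cst r \<otimes>\<^bsub>Sy\<^esub> (gen (rr (d \<otimes> x)) \<otimes>\<^bsub>Sy\<^esub> h y)"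
      using gc rc assms(3)[OF p(3)] cst_central[OF assms(2) gc] by (simp add: Sy.m_assoc[symmetric])
    then show ?case
      unfolding e IH assms(4)[OF p(3)] using c gc rc assms(3)[OF p(3)] by (simp add: Sy.r_distr)
  qed
qed

lemma dual_degree_carrier: "c \<in> dual_degree n \<Longrightarrow> c \<in> carrier R"
  by (simp add: dual_degree_def)

lemma lprod_M: "set ys \<subseteq> M \<Longrightarrow> lprod ys \<in> carrier R"
  using M_carrier by (intro lprod_closed) auto

lemma dual_degree_smult: "r \<in> R0 \<Longrightarrow> c \<in> dual_degree n \<Longrightarrow> r \<otimes> c \<in> dual_degree n"
  using subringE(6)[OF base_subring] lprod_M R0_carrier by (auto simp: dual_degree_def R.m_assoc)

lemma lift_closed: "c \<in> dual_degree n \<Longrightarrow> lift n c \<in> carrier Sy"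
proof (induction n arbitrary: c)
  case 0
  then show ?case using cst_closed rr_props(1) dual_degree_0 by simp
next
  case (Suc n)
  then show ?case using pairs dual_degree_Suc by (simp add: psum_closed)
qed

lemma lift_add: "c \<in> dual_degree n \<Longrightarrow> c' \<in> dual_degree n \<Longrightarrow> lift n (c \<oplus> c') = lift n c \<oplus>\<^bsub>Sy\<^esub> lift n c'"
proof (induction n arbitrary: c c')
  case 0
  then show ?case using dual_degree_0 rr_props(1) by (simp add: rr_add cst_add)
next
  case (Suc n)
  show ?case
    unfolding lift.simps
  proof (rule psum_add[OF pairs(1)])
    fix y assume y: "y \<in> M"
    note c = dual_degree_Suc[OF Suc.prems(1) y] dual_degree_Suc[OF Suc.prems(2) y]
    show "lift n (y \<otimes> c) \<in> carrier Sy" "lift n (y \<otimes> c') \<in> carrier Sy" using c by (auto intro: lift_closed)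
    show "lift n (y \<otimes> (c \<oplus> c')) = lift n (y \<otimes> c) \<oplus>\<^bsub>Sy\<^esub> lift n (y \<otimes> c')"
      using Suc.IH[OF c] M_carrier[OF y] Suc.prems by (simp add: R.r_distr dual_degree_carrier)
  qed
qed

lemma lift_smult: "r \<in> R0 \<Longrightarrow> c \<in> dual_degree n \<Longrightarrow> lift n (r \<otimes> c) = cst (rr r) \<otimes>\<^bsub>Sy\<^esub> lift n c"
proof (induction n arbitrary: c)
  case 0
  then show ?case using dual_degree_0 rr_props(1) by (simp add: rr_mult cst_mult)
next
  case (Suc n)
  show ?case
    unfolding lift.simps
  proof (rule psum_cst[OF pairs(1) rr_props(1)[OF Suc.prems(1)]])
    fix y assume y: "y \<in> M"
    note c = dual_degree_Suc[OF Suc.prems(2) y]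
    show "lift n (y \<otimes> c) \<in> carrier Sy" using c by (rule lift_closed)
    show "lift n (y \<otimes> (r \<otimes> c)) = cst (rr r) \<otimes>\<^bsub>Sy\<^esub> lift n (y \<otimes> c)"
      using Suc.IH[OF Suc.prems(1) c] M_carrier[OF y] R0_carrier[OF Suc.prems(1)] Suc.prems(2)
      by (simp add: R.m_lcomm dual_degree_carrier)
  qed
qed

lemma lprod_lc: "set w \<subseteq> Id \<Longrightarrow> lprod (map lc w) \<in> dual_degree (length w)"
proof (induction w)
  case Nil
  then show ?case using subringE(3)[OF base_subring] by (simp add: dual_degree_def lprod_def)
next
  case (Cons x w)
  have x: "x \<in> Id" "lc x \<in> carrier R" "lprod (map lc w) \<in> dual_degree (length w)" "lprod (map lc w) \<in> carrier R"
    using Cons lc_carrier dual_degree_carrier by auto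
  have e: "lprod (map lc (x # w)) = lc x \<otimes> lprod (map lc w)" by (simp add: lprod_def)
  have "lc x \<otimes> lprod (map lc w) \<otimes> lprod ys \<in> R0" if ys: "set ys \<subseteq> M" "length ys = Suc (length w)" for ys
  proof -
    obtain y ys' where y: "ys = y # ys'" "y \<in> M" "set ys' \<subseteq> M" "length ys' = length w" using ys by (cases ys) auto
    have "lc x \<otimes> lprod (map lc w) \<otimes> lprod ys = (lc x \<otimes> y) \<otimes> (lprod (map lc w) \<otimes> lprod ys')"
      using x(2,4) M_carrier[OF y(2)] lprod_M[OF y(3)] by (simp add: y(1) lprod_def R.m_ac)
    moreover have "lc x \<otimes> y \<in> R0" using y(2) lc_L[OF x(1)] by (auto simp: M_def)
    moreover have "lprod (map lc w) \<otimes> lprod ys' \<in> R0" using x(3) y(3,4) by (auto simp: dual_degree_def)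
    ultimately show ?thesis using subringE(6)[OF base_subring] by simp
  qed
  then show ?case unfolding e using x by (auto simp: dual_degree_def)
qed

text \<open>Scalars move through the symmetric algebra: \<open>x\<^sub>i \<cdot> (y\<^sub>i c) = (x\<^sub>i y\<^sub>i) c\<close> when \<open>c \<in> L\<close>, since \<open>y\<^sub>i c\<close> lies in
  the base ring. If the \<open>x\<^sub>i y\<^sub>i\<close> sum to \<open>1\<close>, the result is the generator \<open>c\<close>. The two membership claims
  keep the induction over the list going.\<close>

lemma psum_gen:
  assumes "set ps \<subseteq> L \<times> M" "x \<in> Id" "z \<in> carrier Sy"
  shows "psum ps (\<lambda>y. cst (rr (y \<otimes> lc x)) \<otimes>\<^bsub>Sy\<^esub> z) = gen (rr (lsum ps \<otimes> \<rho> x)) \<otimes>\<^bsub>Sy\<^esub> z \<and> lsum ps \<otimes> \<rho> x \<in> R0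
    \<and> rr (lsum ps \<otimes> \<rho> x) \<in> Id"
  using assms(1)
proof (induction ps)
  case Nil
  interpret Sy: ring Sy by (rule SM_ring)
  interpret S: cring S by (rule S)
  have z: "rr \<zero> = \<zero>\<^bsub>S\<^esub>" using rr_props(3)[of "\<zero>\<^bsub>S\<^esub>"] ring_hom_zero[OF rho_hom S_ring R.ring_axioms] by simp
  have zI: "\<zero>\<^bsub>S\<^esub> \<in> Id" by (rule additive_subgroup.zero_closed[OF ideal.axioms(1)[OF Id_ideal]])
  have "gen \<zero>\<^bsub>S\<^esub> \<oplus>\<^bsub>Sy\<^esub> gen \<zero>\<^bsub>S\<^esub> = gen \<zero>\<^bsub>S\<^esub>" using gen_add[OF zI zI] by simp
  then have "gen \<zero>\<^bsub>S\<^esub> = \<zero>\<^bsub>Sy\<^esub>" using Sy.add.l_cancel_one[OF gen_closed[OF zI] gen_closed[OF zI]] by simp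
  then show ?case
    using z zI assms(3) rho_closed(2)[OF Id_carrier[OF assms(2)]] subringE(2)[OF base_subring]
    by (simp add: psum_def lsum_def)
next
  case (Cons p ps)
  interpret Sy: ring Sy by (rule SM_ring)
  interpret S: cring S by (rule S)
  obtain u y where p: "p = (u, y)" "u \<in> L" "y \<in> M" using Cons.prems by (cases p) auto
  have IH: "psum ps (\<lambda>y. cst (rr (y \<otimes> lc x)) \<otimes>\<^bsub>Sy\<^esub> z) = gen (rr (lsum ps \<otimes> \<rho> x)) \<otimes>\<^bsub>Sy\<^esub> z"
    "lsum ps \<otimes> \<rho> x \<in> R0" "rr (lsum ps \<otimes> \<rho> x) \<in> Id" using Cons by auto
  have lx: "lc x \<in> L" "lc x \<in> carrier R" "\<rho> x \<in> carrier R" "\<rho> x = d \<otimes> lc x"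
    by (rule lc_L[OF assms(2)] lc_carrier[OF assms(2)] rho_closed(2)[OF Id_carrier[OF assms(2)]] lc_eq[OF assms(2)])+
  have yx: "y \<otimes> lc x \<in> R0"
    using p(3) lx(1) R.m_comm[OF M_carrier[OF p(3)] lx(2)] by (simp add: M_def)
  have uc: "u \<in> carrier R" "y \<in> carrier R" "lsum ps \<in> carrier R"
    using p L_carrier M_carrier Cons.prems by (auto intro!: lsum_closed)
  have du: "d \<otimes> u \<in> R0" by (rule d(3)[OF p(2)])
  have uI: "rr (d \<otimes> u) \<in> Id" by (rule Id_back(1)[OF p(2)])
  have t: "rr (y \<otimes> lc x) \<otimes>\<^bsub>S\<^esub> rr (d \<otimes> u) \<in> Id"
    by (rule ideal.I_l_closed[OF Id_ideal uI rr_props(1)[OF yx]])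
  have "rr ((y \<otimes> lc x) \<otimes> (d \<otimes> u)) = rr (y \<otimes> lc x) \<otimes>\<^bsub>S\<^esub> rr (d \<otimes> u)" by (rule rr_mult[OF yx du])
  moreover have prod: "(y \<otimes> lc x) \<otimes> (d \<otimes> u) = u \<otimes> y \<otimes> \<rho> x"
    unfolding lx(4) using uc lx(2) d_carrier by (simp add: R.m_ac)
  ultimately have r1: "rr (u \<otimes> y \<otimes> \<rho> x) = rr (y \<otimes> lc x) \<otimes>\<^bsub>S\<^esub> rr (d \<otimes> u)" by simp
  have R1: "u \<otimes> y \<otimes> \<rho> x \<in> R0" using subringE(6)[OF base_subring yx du] prod by simp
  have ls: "lsum (p # ps) \<otimes> \<rho> x = u \<otimes> y \<otimes> \<rho> x \<oplus> lsum ps \<otimes> \<rho> x"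
    using uc lx(3) by (simp add: lsum_def p R.l_distr)
  have r2: "rr (lsum (p # ps) \<otimes> \<rho> x) = rr (y \<otimes> lc x) \<otimes>\<^bsub>S\<^esub> rr (d \<otimes> u) \<oplus>\<^bsub>S\<^esub> rr (lsum ps \<otimes> \<rho> x)"
    unfolding ls rr_add[OF R1 IH(2)] r1 ..
  have cc: "cst (rr (y \<otimes> lc x)) \<in> carrier Sy" "gen (rr (d \<otimes> u)) \<in> carrier Sy" "gen (rr (lsum ps \<otimes> \<rho> x)) \<in> carrier Sy"
    using rr_props(1)[OF yx] uI IH(3) by (auto intro: cst_closed gen_closed)
  have "psum (p # ps) (\<lambda>y. cst (rr (y \<otimes> lc x)) \<otimes>\<^bsub>Sy\<^esub> z)
      = gen (rr (d \<otimes> u)) \<otimes>\<^bsub>Sy\<^esub> (cst (rr (y \<otimes> lc x)) \<otimes>\<^bsub>Sy\<^esub> z) \<oplus>\<^bsub>Sy\<^esub> gen (rr (lsum ps \<otimes> \<rho> x)) \<otimes>\<^bsub>Sy\<^esub> z"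
    using IH(1) by (simp add: psum_def p)
  also have "\<dots> = (cst (rr (y \<otimes> lc x)) \<otimes>\<^bsub>Sy\<^esub> gen (rr (d \<otimes> u)) \<oplus>\<^bsub>Sy\<^esub> gen (rr (lsum ps \<otimes> \<rho> x))) \<otimes>\<^bsub>Sy\<^esub> z"
    using cc assms(3) cst_central[OF rr_props(1)[OF yx] cc(2)]
    by (simp add: Sy.l_distr Sy.m_assoc[symmetric])
  also have "\<dots> = gen (rr (lsum (p # ps) \<otimes> \<rho> x)) \<otimes>\<^bsub>Sy\<^esub> z"
    unfolding r2 gen_add[OF t IH(3)] gen_smult[OF rr_props(1)[OF yx] uI] ..
  finally show ?case
    using subringE(7)[OF base_subring R1 IH(2)] ls r2
      additive_subgroup.a_closed[OF ideal.axioms(1)[OF Id_ideal] t IH(3)] by simp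
qed

text \<open>On products of elements of \<open>L\<close>, \<open>lift\<close> inverts multiplication: \<open>psum_gen\<close> splits off the first factor.\<close>

lemma lift_word: "set w \<subseteq> Id \<Longrightarrow> lift (length w) (lprod (map lc w)) = q (word S \<one>\<^bsub>S\<^esub> w)"
proof (induction w)
  case Nil
  have "rr \<one> = \<one>\<^bsub>S\<^esub>" using rr_props(3)[OF S_one] ring_hom_one[OF rho_hom] by simp
  then show ?case by (simp add: lprod_def cst_def)
next
  case (Cons x w)
  interpret S: cring S by (rule S)
  have x: "x \<in> Id" and w: "set w \<subseteq> Id" using Cons.prems by auto
  have IH: "lift (length w) (lprod (map lc w)) = q (word S \<one>\<^bsub>S\<^esub> w)" using Cons.IH[OF w] .
  have zc: "q (word S \<one>\<^bsub>S\<^esub> w) \<in> carrier Sy" using w by (intro q_closed word_FI S_one)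
  have e: "lprod (map lc (x # w)) = lc x \<otimes> lprod (map lc w)" by (simp add: lprod_def)
  note dw = lprod_lc[OF w]
  have eq: "lift (length w) (y \<otimes> (lc x \<otimes> lprod (map lc w))) = cst (rr (y \<otimes> lc x)) \<otimes>\<^bsub>Sy\<^esub> q (word S \<one>\<^bsub>S\<^esub> w)"
    if y: "y \<in> M" for y
  proof -
    have yx: "y \<otimes> lc x \<in> R0"
      using y lc_L[OF x] R.m_comm[OF M_carrier[OF y] lc_carrier[OF x]] by (simp add: M_def)
    have "y \<otimes> (lc x \<otimes> lprod (map lc w)) = (y \<otimes> lc x) \<otimes> lprod (map lc w)"
      using M_carrier[OF y] lc_carrier[OF x] dual_degree_carrier[OF dw] by (simp add: R.m_assoc)
    then show ?thesis using lift_smult[OF yx dw] by (simp add: IH)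
  qed
  have cong: "psum ps g = psum ps h" if "set ps \<subseteq> L \<times> M" "\<And>y. y \<in> M \<Longrightarrow> g y = h y" for ps g h
    using that by (induction ps) (auto simp: psum_def)
  have "lift (length (x # w)) (lprod (map lc (x # w)))
      = psum pairs (\<lambda>y. cst (rr (y \<otimes> lc x)) \<otimes>\<^bsub>Sy\<^esub> q (word S \<one>\<^bsub>S\<^esub> w))"
    unfolding e by (simp add: cong[OF pairs(1) eq])
  also have "\<dots> = gen (rr (\<one> \<otimes> \<rho> x)) \<otimes>\<^bsub>Sy\<^esub> q (word S \<one>\<^bsub>S\<^esub> w)"
    using psum_gen[OF pairs(1) x zc] by (simp add: pairs(2))
  also have "\<dots> = gen x \<otimes>\<^bsub>Sy\<^esub> q (word S \<one>\<^bsub>S\<^esub> w)"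
    using rho_closed[OF Id_carrier[OF x]] rr_props(3)[OF Id_carrier[OF x]] by simp
  also have "\<dots> = q (word S \<one>\<^bsub>S\<^esub> (x # w))"
    unfolding gen_def using q_word_append[OF S_one S_one, of "[x]" w] x w S_one by simp
  finally show ?case .
qed

end

lemma algebra_isomorphic_symI:
  fixes S :: "('s, 'm) ring_scheme" and A :: "('s, 'a, 'p) module_scheme" and C :: "('s, 'c, 'q) module_scheme"
  assumes C: "ring C" and Csm: "\<And>r z. r \<in> carrier S \<Longrightarrow> z \<in> carrier C \<Longrightarrow> r \<odot>\<^bsub>C\<^esub> z \<in> carrier C"
    and g: "g \<in> algebra_hom S C A" and bij: "bij_betw g (carrier C) (carrier A)"
  shows "algebra_isomorphic S A C"
proof -
  interpret C: ring C by fact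
  define h where "h = inv_into (carrier C) g"
  have gh: "g \<in> ring_hom C A" "\<And>r z. r \<in> carrier S \<Longrightarrow> z \<in> carrier C \<Longrightarrow> g (r \<odot>\<^bsub>C\<^esub> z) = r \<odot>\<^bsub>A\<^esub> g z"
    using g by (auto simp: algebra_hom_def)
  have hb: "bij_betw h (carrier A) (carrier C)" unfolding h_def using bij by (rule bij_betw_inv_into)
  have hc: "h a \<in> carrier C" if "a \<in> carrier A" for a using bij_betwE[OF hb] that by blast
  have hg: "h (g z) = z" if "z \<in> carrier C" for z unfolding h_def using bij that by (rule bij_betw_inv_into_left)
  have gh': "g (h a) = a" if "a \<in> carrier A" for a unfolding h_def using bij that by (rule bij_betw_inv_into_right)
  have "h \<in> ring_hom A C"
  proof (rule ring_hom_memI)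
    fix a b assume ab: "a \<in> carrier A" "b \<in> carrier A"
    note c = hc[OF ab(1)] hc[OF ab(2)]
    show "h a \<in> carrier C" by (rule c)
    show "h (a \<otimes>\<^bsub>A\<^esub> b) = h a \<otimes>\<^bsub>C\<^esub> h b"
      using hg[OF C.m_closed[OF c]] ring_hom_mult[OF gh(1) c] gh' ab by simp
    show "h (a \<oplus>\<^bsub>A\<^esub> b) = h a \<oplus>\<^bsub>C\<^esub> h b"
      using hg[OF C.a_closed[OF c]] ring_hom_add[OF gh(1) c] gh' ab by simp
  next
    show "h \<one>\<^bsub>A\<^esub> = \<one>\<^bsub>C\<^esub>" using hg[OF C.one_closed] ring_hom_one[OF gh(1)] by simp
  qed
  moreover have "h (r \<odot>\<^bsub>A\<^esub> a) = r \<odot>\<^bsub>C\<^esub> h a" if ra: "r \<in> carrier S" "a \<in> carrier A" for r a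
    using hg[OF Csm[OF ra(1) hc[OF ra(2)]]] gh(2)[OF ra(1) hc[OF ra(2)]] gh'[OF ra(2)] by simp
  ultimately have "h \<in> algebra_hom S A C" by (auto simp: algebra_hom_def)
  with hb show ?thesis unfolding algebra_isomorphic_def by blast
qed

context scaled_line
begin

text \<open>The homomorphism \<open>g\<close> from the symmetric algebra to \<open>A\<close> sends a generator \<open>x\<close> to the preimage of \<open>(lc x) T\<close>.
  It is onto because \<open>L T\<close> generates \<open>B\<close>. It is injective because applying \<open>lift n\<close> to the coefficient of
  \<open>T\<^sup>n\<close>, for all \<open>n\<close>, recovers the element.\<close>

theorem symmetric_algebra_iso: "algebra_isomorphic S A Sy"
proof -
  interpret A: algebra S A by (rule A)
  interpret S: cring S by (rule S)
  interpret Sy: ring Sy by (rule SM_ring)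
  have Ar: "ring A" using A.M_cring by (rule cring.axioms)
  have pc: "\<phi> a \<in> carrier P" if "a \<in> carrier A" for a using phi_hom that by (rule ring_hom_closed)
  have pB: "\<phi> a \<in> B" if "a \<in> carrier A" for a using phi_img that by blast
  define j where "j x = inv_into (carrier A) \<phi> (lc x \<odot>\<^bsub>P\<^esub> T)" for x
  have j: "j x \<in> carrier A" "\<phi> (j x) = lc x \<odot>\<^bsub>P\<^esub> T" if "x \<in> Id" for x
  proof -
    have "lc x \<odot>\<^bsub>P\<^esub> T \<in> \<phi> ` carrier A" unfolding phi_img by (rule L_variable[OF lc_L[OF that]])
    then show "j x \<in> carrier A" "\<phi> (j x) = lc x \<odot>\<^bsub>P\<^esub> T"
      unfolding j_def by (rule inv_into_into, rule f_inv_into_f)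
  qed
  have phD: "a = b" if "\<phi> a = \<phi> b" "a \<in> carrier A" "b \<in> carrier A" for a b
    using phi_inj that by (rule inj_onD)
  have Tc: "T \<in> carrier P" by simp
  define ev where "ev = eval_free S A j"
  note jc = j(1)
  have evh: "ev \<in> ring_hom FI A" unfolding ev_def by (rule algebra.eval_free_hom[OF A jc])
  have evw: "ev (word S r v) = r \<odot>\<^bsub>A\<^esub> eval_word A j v" if "r \<in> carrier S" "set v \<subseteq> Id" for r v
    unfolding ev_def by (rule algebra.eval_free_word[OF A jc that])
  have ewc: "eval_word A j v \<in> carrier A" if "set v \<subseteq> Id" for v
    by (rule algebra.eval_word_closed[OF A jc that])
  have ev1: "ev (word S r [x]) = r \<odot>\<^bsub>A\<^esub> j x" if "r \<in> carrier S" "x \<in> Id" for r x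
    using evw[of r "[x]"] that jc by (simp add: eval_word_def)
  obtain g where g: "g \<in> ring_hom Sy A" and gq: "\<And>p. p \<in> carrier FI \<Longrightarrow> g (q p) = ev p"
  proof (rule module.symmetric_algebra_lift[OF IM_module A.M_cring, of ev])
    show "ev \<in> ring_hom (free_algebra S (carrier IM)) A" using evh by simp
  next
    fix x y assume "x \<in> carrier IM" "y \<in> carrier IM"
    then have xy: "x \<in> Id" "y \<in> Id" by simp_all
    have xyI: "x \<oplus>\<^bsub>S\<^esub> y \<in> Id" by (rule additive_subgroup.a_closed[OF ideal.axioms(1)[OF Id_ideal] xy])
    have "\<phi> (j (x \<oplus>\<^bsub>S\<^esub> y)) = \<phi> (j x \<oplus>\<^bsub>A\<^esub> j y)"
      unfolding j(2)[OF xyI] lc_add[OF xy] ring_hom_add[OF phi_hom jc[OF xy(1)] jc[OF xy(2)]] j(2)[OF xy(1)] j(2)[OF xy(2)]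
      by (rule UP_smult_l_distr[OF lc_carrier[OF xy(1)] lc_carrier[OF xy(2)] Tc])
    then have "j (x \<oplus>\<^bsub>S\<^esub> y) = j x \<oplus>\<^bsub>A\<^esub> j y" by (rule phD) (use jc xy xyI in auto)
    then show "ev (word S \<one>\<^bsub>S\<^esub> [x \<oplus>\<^bsub>IM\<^esub> y]) = ev (word S \<one>\<^bsub>S\<^esub> [x]) \<oplus>\<^bsub>A\<^esub> ev (word S \<one>\<^bsub>S\<^esub> [y])"
      using xy xyI jc by (simp add: ev1)
  next
    fix r x assume "r \<in> carrier S" "x \<in> carrier IM"
    then have rx: "r \<in> carrier S" "x \<in> Id" by simp_all
    have rxI: "r \<otimes>\<^bsub>S\<^esub> x \<in> Id" by (rule ideal.I_l_closed[OF Id_ideal rx(2,1)])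
    have "\<phi> (j (r \<otimes>\<^bsub>S\<^esub> x)) = \<phi> (r \<odot>\<^bsub>A\<^esub> j x)"
      unfolding j(2)[OF rxI] lc_smult[OF rx] phi_smult[OF rx(1) jc[OF rx(2)]] j(2)[OF rx(2)]
      by (rule UP_smult_assoc1[OF rho_closed(2)[OF rx(1)] lc_carrier[OF rx(2)] Tc])
    then have "j (r \<otimes>\<^bsub>S\<^esub> x) = r \<odot>\<^bsub>A\<^esub> j x" by (rule phD) (use jc rx rxI in auto)
    then show "ev (word S \<one>\<^bsub>S\<^esub> [r \<odot>\<^bsub>IM\<^esub> x]) = ev (word S r [x])"
      using rx rxI jc by (simp add: ev1)
  qed (auto simp: q_def)
  have gc: "g z \<in> carrier A" if "z \<in> carrier Sy" for z using g that by (rule ring_hom_closed)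
  have smult: "r \<odot>\<^bsub>Sy\<^esub> z = cst r \<otimes>\<^bsub>Sy\<^esub> z" if "r \<in> carrier S" for r z
    using module.sym_smult[OF IM_module that, of z] by (simp add: cst_def q_def)
  have gcst: "g (cst r) = r \<odot>\<^bsub>A\<^esub> \<one>\<^bsub>A\<^esub>" if "r \<in> carrier S" for r
    unfolding cst_def using gq[OF word_FI[OF that], of "[]"] evw[OF that, of "[]"] by (simp add: eval_word_def)
  have gs: "g (r \<odot>\<^bsub>Sy\<^esub> z) = r \<odot>\<^bsub>A\<^esub> g z" if rz: "r \<in> carrier S" "z \<in> carrier Sy" for r z
    unfolding smult[OF rz(1)] ring_hom_mult[OF g cst_closed[OF rz(1)] rz(2)] gcst[OF rz(1)]
    using rz gc by (simp add: A.smult_assoc2)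
  have galg: "g \<in> algebra_hom S Sy A" using g gs by (auto simp: algebra_hom_def)
  \<comment> \<open>The image of \<open>g\<close> in \<open>K[T]\<close> is a ring that contains \<open>R0\<close> and \<open>L T\<close>.\<close>
  define G where "G = (\<lambda>z. \<phi> (g z)) ` carrier Sy"
  have comp: "(\<lambda>z. \<phi> (g z)) \<in> ring_hom Sy P"
    using ring_hom_trans[OF g phi_hom] by (simp add: comp_def)
  have "subring G P"
  proof (rule P.subringI)
    show "G \<subseteq> carrier P" unfolding G_def using pc gc by blast
    have "\<one>\<^bsub>P\<^esub> = \<phi> (g \<one>\<^bsub>Sy\<^esub>)" using ring_hom_one[OF comp] by simp
    then show "\<one>\<^bsub>P\<^esub> \<in> G" unfolding G_def using Sy.one_closed by blast
  next
    fix h assume "h \<in> G"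
    then obtain z where z: "z \<in> carrier Sy" "h = \<phi> (g z)" by (auto simp: G_def)
    have "\<phi> (g (\<zero>\<^bsub>Sy\<^esub> \<ominus>\<^bsub>Sy\<^esub> z)) = \<phi> (g \<zero>\<^bsub>Sy\<^esub>) \<ominus>\<^bsub>P\<^esub> \<phi> (g z)"
      by (rule ring_hom_minus[OF Sy.ring_axioms UP_ring comp Sy.zero_closed z(1)])
    moreover have "\<phi> (g \<zero>\<^bsub>Sy\<^esub>) = \<zero>\<^bsub>P\<^esub>" by (rule ring_hom_zero[OF comp Sy.ring_axioms UP_ring])
    ultimately have "\<ominus>\<^bsub>P\<^esub> h = \<phi> (g (\<zero>\<^bsub>Sy\<^esub> \<ominus>\<^bsub>Sy\<^esub> z))"
      using z pc[OF gc[OF z(1)]] by (simp add: P.minus_eq)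
    moreover have "\<zero>\<^bsub>Sy\<^esub> \<ominus>\<^bsub>Sy\<^esub> z \<in> carrier Sy" using z by simp
    ultimately show "\<ominus>\<^bsub>P\<^esub> h \<in> G" unfolding G_def by blast
  next
    fix h1 h2 assume "h1 \<in> G" "h2 \<in> G"
    then obtain z1 z2 where z: "z1 \<in> carrier Sy" "h1 = \<phi> (g z1)" "z2 \<in> carrier Sy" "h2 = \<phi> (g z2)" by (auto simp: G_def)
    have "h1 \<otimes>\<^bsub>P\<^esub> h2 = \<phi> (g (z1 \<otimes>\<^bsub>Sy\<^esub> z2))" "h1 \<oplus>\<^bsub>P\<^esub> h2 = \<phi> (g (z1 \<oplus>\<^bsub>Sy\<^esub> z2))"
      unfolding z using ring_hom_mult[OF comp z(1,3)] ring_hom_add[OF comp z(1,3)] by simp_all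
    then show "h1 \<otimes>\<^bsub>P\<^esub> h2 \<in> G" "h1 \<oplus>\<^bsub>P\<^esub> h2 \<in> G"
      unfolding G_def using Sy.m_closed[OF z(1,3)] Sy.a_closed[OF z(1,3)] by blast+
  qed
  moreover have "mon r 0 \<in> G" if r: "r \<in> R0" for r
  proof -
    have "\<phi> (g (cst (rr r))) = r \<odot>\<^bsub>P\<^esub> \<one>\<^bsub>P\<^esub>"
      using gcst[OF rr_props(1)[OF r]] phi_smult[OF rr_props(1)[OF r] A.one_closed] rr_props(2)[OF r] ring_hom_one[OF phi_hom] by simp
    then have "mon r 0 = \<phi> (g (cst (rr r)))" using const_eq[OF R0_carrier[OF r]] by simp
    then show ?thesis unfolding G_def using cst_closed[OF rr_props(1)[OF r]] by blast
  qed
  moreover have "c \<odot>\<^bsub>P\<^esub> T \<in> G" if c: "c \<in> L" for c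
  proof -
    have x: "rr (d \<otimes> c) \<in> Id" by (rule Id_back(1)[OF c])
    have "g (gen (rr (d \<otimes> c))) = j (rr (d \<otimes> c))"
      unfolding gen_def using gq[OF word_FI[OF S_one], of "[rr (d \<otimes> c)]"] ev1[OF S_one x] x jc[OF x] by simp
    then have "\<phi> (g (gen (rr (d \<otimes> c)))) = c \<odot>\<^bsub>P\<^esub> T" using j(2)[OF x] Id_back(2)[OF c] by simp
    then show ?thesis unfolding G_def using gen_closed[OF x] by force
  qed
  ultimately have "B \<subseteq> G" by (rule B_generated)
  then have surj: "a \<in> g ` carrier Sy" if a: "a \<in> carrier A" for a
  proof -
    obtain z where z: "z \<in> carrier Sy" "\<phi> a = \<phi> (g z)" using \<open>B \<subseteq> G\<close> pB[OF a] by (auto simp: G_def)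
    then have "a = g z" using phD[OF z(2) a gc[OF z(1)]] by simp
    then show ?thesis using z(1) by blast
  qed
  \<comment> \<open>The maps \<open>lift n\<close> assemble to a left inverse. The truncation at \<open>N\<close> avoids the degree; any bound that
    is large enough gives the same sum.\<close>
  define XX where "XX N f = (\<Oplus>\<^bsub>Sy\<^esub>n\<in>{..N}. lift n (cf f n))" for N :: nat and f
  have lz: "lift n \<zero> = \<zero>\<^bsub>Sy\<^esub>" for n
  proof -
    have "\<zero> \<in> dual_degree n" using subringE(2)[OF base_subring] lprod_M by (auto simp: dual_degree_def)
    from lift_add[OF this this] lift_closed[OF this] show ?thesis
      using Sy.add.l_cancel_one by simp
  qed
  have pw: "\<phi> (eval_word A j v) = mon (lprod (map lc v)) (length v)" if "set v \<subseteq> Id" for v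
    using that
  proof (induction v)
    case Nil
    then show ?case using ring_hom_one[OF phi_hom] by (simp add: eval_word_def lprod_def monom_one)
  next
    case (Cons x v)
    have x: "x \<in> Id" and v: "set v \<subseteq> Id" using Cons.prems by auto
    have lv: "lprod (map lc v) \<in> carrier R" by (rule dual_degree_carrier[OF lprod_lc[OF v]])
    have "\<phi> (eval_word A j (x # v)) = \<phi> (j x) \<otimes>\<^bsub>P\<^esub> \<phi> (eval_word A j v)"
      using ring_hom_mult[OF phi_hom jc[OF x] ewc[OF v]] by (simp add: eval_word_def)
    also have "\<dots> = mon (lc x) 1 \<otimes>\<^bsub>P\<^esub> mon (lprod (map lc v)) (length v)"
      unfolding j(2)[OF x] Cons.IH[OF v] using monom_mult_smult[of "lc x" \<one> 1] lc_carrier[OF x] by simp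
    also have "\<dots> = mon (lc x \<otimes> lprod (map lc v)) (1 + length v)"
      by (rule monom_mult[OF lc_carrier[OF x] lv, symmetric])
    finally show ?case by (simp add: lprod_def)
  qed
  have lift_cf: "lift n (cf (\<phi> a) n) \<in> carrier Sy" if "a \<in> carrier A" for n a
    by (rule lift_closed[OF B_coeff_dual[OF pB[OF that]]])
  have main: "\<exists>N0. \<forall>N\<ge>N0. XX N (\<phi> (ev p)) = q p" if "p \<in> carrier FI" for p
    using that
  proof (induction rule: cring.F_induct[OF S, consumes 1, case_names zero add])
    case zero
    interpret FI: ring FI by (rule cring.free_algebra_ring[OF S])
    have "(\<lambda>_. \<zero>\<^bsub>S\<^esub>) = \<zero>\<^bsub>FI\<^esub>" by (simp add: cring.F_simps[OF S])
    then have "\<phi> (ev (\<lambda>_. \<zero>\<^bsub>S\<^esub>)) = \<zero>\<^bsub>P\<^esub>" "q (\<lambda>_. \<zero>\<^bsub>S\<^esub>) = \<zero>\<^bsub>Sy\<^esub>"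
      using ring_hom_zero[OF evh FI.ring_axioms Ar] ring_hom_zero[OF phi_hom Ar UP_ring]
        ring_hom_zero[OF q_hom FI.ring_axioms Sy.ring_axioms] by simp_all
    then show ?case by (simp add: XX_def lz)
  next
    case (add r v p)
    then obtain N0 where N0: "\<And>N. N \<ge> N0 \<Longrightarrow> XX N (\<phi> (ev p)) = q p" by blast
    have w: "word S r v \<in> carrier FI" using add by (intro word_FI)
    have sum: "(\<lambda>w. word S r v w \<oplus>\<^bsub>S\<^esub> p w) = word S r v \<oplus>\<^bsub>FI\<^esub> p" by (simp add: cring.F_simps[OF S])
    have c: "ev (word S r v) \<in> carrier A" "ev p \<in> carrier A" using ring_hom_closed[OF evh] w add by auto
    have fe: "\<phi> (ev (word S r v \<oplus>\<^bsub>FI\<^esub> p)) = \<phi> (ev (word S r v)) \<oplus>\<^bsub>P\<^esub> \<phi> (ev p)"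
      using ring_hom_add[OF evh w add(3)] ring_hom_add[OF phi_hom c] by simp
    have pwv: "\<phi> (ev (word S r v)) = \<rho> r \<odot>\<^bsub>P\<^esub> mon (lprod (map lc v)) (length v)"
      unfolding evw[OF add(1,2)] phi_smult[OF add(1) ewc[OF add(2)]] pw[OF add(2)] ..
    have lv: "lprod (map lc v) \<in> dual_degree (length v)" by (rule lprod_lc[OF add(2)])
    have lvc: "lprod (map lc v) \<in> carrier R" by (rule dual_degree_carrier[OF lv])
    have Xw: "XX N (\<phi> (ev (word S r v))) = q (word S r v)" if N: "N \<ge> length v" for N
    proof -
      have "lift n (cf (\<phi> (ev (word S r v))) n) = (if length v = n then lift (length v) (\<rho> r \<otimes> lprod (map lc v)) else \<zero>\<^bsub>Sy\<^esub>)" for n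
        unfolding pwv using rho_closed[OF add(1)] lvc lz by simp
      then have "XX N (\<phi> (ev (word S r v))) = (\<Oplus>\<^bsub>Sy\<^esub>n\<in>{..N}. if length v = n then lift (length v) (\<rho> r \<otimes> lprod (map lc v)) else \<zero>\<^bsub>Sy\<^esub>)"
        by (simp add: XX_def)
      also have "\<dots> = lift (length v) (\<rho> r \<otimes> lprod (map lc v))"
        using N lift_closed[OF dual_degree_smult[OF rho_closed(1)[OF add(1)] lv]]
        by (intro Sy.add.finprod_singleton) auto
      also have "\<dots> = cst r \<otimes>\<^bsub>Sy\<^esub> q (word S \<one>\<^bsub>S\<^esub> v)"
        unfolding lift_smult[OF rho_closed(1)[OF add(1)] lv] lift_word[OF add(2)] rr_props(3)[OF add(1)] ..
      also have "\<dots> = q (word S r v)"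
        using q_word_append[OF add(1) S_one, of "[]" v] add(1,2) by (simp add: cst_def)
      finally show ?thesis .
    qed
    have "XX N (\<phi> (ev (word S r v \<oplus>\<^bsub>FI\<^esub> p))) = q (word S r v \<oplus>\<^bsub>FI\<^esub> p)" if N: "N \<ge> max N0 (length v)" for N
    proof -
      have "lift n (cf (\<phi> (ev (word S r v)) \<oplus>\<^bsub>P\<^esub> \<phi> (ev p)) n) = lift n (cf (\<phi> (ev (word S r v))) n) \<oplus>\<^bsub>Sy\<^esub> lift n (cf (\<phi> (ev p)) n)" for n
        using lift_add[OF B_coeff_dual[OF pB[OF c(1)]] B_coeff_dual[OF pB[OF c(2)]], of n] pc[OF c(1)] pc[OF c(2)] by simp
      then have "XX N (\<phi> (ev (word S r v \<oplus>\<^bsub>FI\<^esub> p))) = XX N (\<phi> (ev (word S r v))) \<oplus>\<^bsub>Sy\<^esub> XX N (\<phi> (ev p))"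
        unfolding fe XX_def using lift_cf[OF c(1)] lift_cf[OF c(2)] by (simp add: Sy.finsum_addf)
      also have "\<dots> = q (word S r v \<oplus>\<^bsub>FI\<^esub> p)"
        using Xw N0 N ring_hom_add[OF q_hom w add(3)] by simp
      finally show ?thesis .
    qed
    then show ?case unfolding sum by blast
  qed
  have inj: "inj_on g (carrier Sy)"
  proof (rule inj_onI)
    fix y z assume yz: "y \<in> carrier Sy" "z \<in> carrier Sy" "g y = g z"
    obtain p where p: "p \<in> carrier FI" "y = q p" using module.sym_proj_surj[OF IM_module yz(1)] by (auto simp: q_def)
    obtain p' where p': "p' \<in> carrier FI" "z = q p'" using module.sym_proj_surj[OF IM_module yz(2)] by (auto simp: q_def)
    obtain N N' where N: "\<And>n. n \<ge> N \<Longrightarrow> XX n (\<phi> (ev p)) = q p" "\<And>n. n \<ge> N' \<Longrightarrow> XX n (\<phi> (ev p')) = q p'"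
      using main[OF p(1)] main[OF p'(1)] by blast
    have "ev p = ev p'" using yz(3) gq p p' by simp
    then show "y = z" using N(1)[of "max N N'"] N(2)[of "max N N'"] p p' by simp
  qed
  have bij: "bij_betw g (carrier Sy) (carrier A)" unfolding bij_betw_def using inj surj gc by blast
  show ?thesis
    by (rule algebra_isomorphic_symI[OF Sy.ring_axioms _ galg bij]) (simp add: smult cst_closed)
qed

end

section \<open>Flat algebras over a Krull domain with a retraction\<close>

locale krull_retract =
  fixes R :: "('r, 'k) ring_scheme" (structure) and A :: "('r, 'a, 'p) module_scheme" and \<Phi> :: "'a \<Rightarrow> 'r"
  assumes krull: "krull_domain R"
    and alg: "algebra R A"
    and flat: "flat_module R A"
    and retr: "retraction R A \<Phi>"
    and fg: "finitely_generated_ideal A (a_kernel A R \<Phi>)"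
    and generic: "algebra_isomorphic (quotient_field R) (base_change R A (quotient_field R)) (UP (quotient_field R))"
    and special: "\<And>P. P \<in> height_one_primes R \<Longrightarrow> domain (tensor R A (residue_field R P))"

sublocale krull_retract \<subseteq> "domain" R
  using krull by (simp add: krull_domain_def)

sublocale krull_retract \<subseteq> K: field "quotient_field R"
  by (rule quotient_field_is_field)

context krull_retract
begin

abbreviation K where "K \<equiv> quotient_field R"
abbreviation \<rho> where "\<rho> \<equiv> to_quotient_field R"

text \<open>The local ring \<open>R\<^sub>P\<close> as a subring of \<open>K\<close>.\<close>

definition val where "val P = {fract R (carrier R - {\<zero>}) a s | a s. a \<in> carrier R \<and> s \<in> carrier R - P}"

lemma field_poly: "field_poly K" by (rule field_poly_UP) (rule K.field_axioms)

lemma rho_closed: "r \<in> carrier R \<Longrightarrow> \<rho> r \<in> carrier K"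
  using to_quotient_field_hom by (rule ring_hom_closed)

lemma rho_mult: "r \<in> carrier R \<Longrightarrow> q \<in> carrier R \<Longrightarrow> \<rho> (r \<otimes> q) = \<rho> r \<otimes>\<^bsub>K\<^esub> \<rho> q"
  using to_quotient_field_hom by (rule ring_hom_mult)

lemma rho_add: "r \<in> carrier R \<Longrightarrow> q \<in> carrier R \<Longrightarrow> \<rho> (r \<oplus> q) = \<rho> r \<oplus>\<^bsub>K\<^esub> \<rho> q"
  using to_quotient_field_hom by (rule ring_hom_add)

lemma rho_one: "\<rho> \<one> = \<one>\<^bsub>K\<^esub>" using to_quotient_field_hom by (rule ring_hom_one)

lemma rho_zero: "\<rho> \<zero> = \<zero>\<^bsub>K\<^esub>" by (rule ring_hom_zero[OF to_quotient_field_hom ring_axioms K.ring_axioms])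

lemma rho_neg: "r \<in> carrier R \<Longrightarrow> \<rho> (\<ominus> r) = \<ominus>\<^bsub>K\<^esub> \<rho> r"
  using ring_hom_cring.hom_a_inv[OF ring_hom_cringI[OF is_cring K.is_cring to_quotient_field_hom]] .

lemma rho_eqD: "\<rho> r = \<rho> q \<Longrightarrow> r \<in> carrier R \<Longrightarrow> q \<in> carrier R \<Longrightarrow> r = q"
  using to_quotient_field_inj by (rule inj_onD)

lemma rho_nz: "r \<in> carrier R \<Longrightarrow> r \<noteq> \<zero> \<Longrightarrow> \<rho> r \<noteq> \<zero>\<^bsub>K\<^esub>"
  using rho_eqD[of r \<zero>] rho_zero by auto

lemma rho_inv:
  assumes "r \<in> carrier R" "r \<noteq> \<zero>"
  shows "inv\<^bsub>K\<^esub> \<rho> r \<in> carrier K" "\<rho> r \<otimes>\<^bsub>K\<^esub> inv\<^bsub>K\<^esub> \<rho> r = \<one>\<^bsub>K\<^esub>" "inv\<^bsub>K\<^esub> \<rho> r \<noteq> \<zero>\<^bsub>K\<^esub>"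
  using field_poly.inv_nz[OF field_poly rho_closed[OF assms(1)] rho_nz[OF assms]] by auto

lemma rho_subring: "subring (\<rho> ` carrier R) K"
proof (rule K.subringI)
  show "\<one>\<^bsub>K\<^esub> \<in> \<rho> ` carrier R" using rho_one one_closed by (metis imageI)
next
  fix x assume "x \<in> \<rho> ` carrier R"
  then show "\<ominus>\<^bsub>K\<^esub> x \<in> \<rho> ` carrier R" using rho_neg[symmetric] by (auto intro!: imageI)
next
  fix x y assume "x \<in> \<rho> ` carrier R" "y \<in> \<rho> ` carrier R"
  then show "x \<otimes>\<^bsub>K\<^esub> y \<in> \<rho> ` carrier R" "x \<oplus>\<^bsub>K\<^esub> y \<in> \<rho> ` carrier R"
    using rho_mult[symmetric] rho_add[symmetric] by (auto intro!: imageI)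
qed (use rho_closed in blast)

lemma h1_prime: "P \<in> height_one_primes R \<Longrightarrow> primeideal P R"
  by (simp add: height_one_primes_def)

lemma h1_zero: "P \<in> height_one_primes R \<Longrightarrow> \<zero> \<in> P"
  using h1_prime additive_subgroup.zero_closed ideal.axioms(1) primeideal.axioms(1) by blast

lemma val_iff:
  assumes "P \<in> height_one_primes R"
  shows "x \<in> val P \<longleftrightarrow> (\<exists>a\<in>carrier R. \<exists>s\<in>carrier R - P. x = \<rho> a \<otimes>\<^bsub>K\<^esub> inv\<^bsub>K\<^esub> \<rho> s)"
proof -
  have "fract R (carrier R - {\<zero>}) a s = \<rho> a \<otimes>\<^bsub>K\<^esub> inv\<^bsub>K\<^esub> \<rho> s" if "a \<in> carrier R" "s \<in> carrier R - P" for a s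
    using that h1_zero[OF assms] by (intro fract_eq_quotient) auto
  then show ?thesis unfolding val_def by blast
qed

lemma val_unit_iff:
  assumes P: "P \<in> height_one_primes R" and s: "s \<in> carrier R" "s \<noteq> \<zero>"
  shows "inv\<^bsub>K\<^esub> \<rho> s \<in> val P \<longleftrightarrow> s \<notin> P"
proof
  interpret P: primeideal P R by (rule h1_prime[OF P])
  assume "inv\<^bsub>K\<^esub> \<rho> s \<in> val P"
  then obtain a t where at: "a \<in> carrier R" "t \<in> carrier R - P" "inv\<^bsub>K\<^esub> \<rho> s = \<rho> a \<otimes>\<^bsub>K\<^esub> inv\<^bsub>K\<^esub> \<rho> t"
    using val_iff[OF P] by blast
  have t0: "t \<in> carrier R" "t \<noteq> \<zero>" using at(2) h1_zero[OF P] by auto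
  note c = rho_closed[OF s(1)] rho_closed[OF t0(1)] rho_closed[OF at(1)] rho_inv[OF s] rho_inv[OF t0]
  have "\<rho> t = \<rho> t \<otimes>\<^bsub>K\<^esub> (\<rho> s \<otimes>\<^bsub>K\<^esub> inv\<^bsub>K\<^esub> \<rho> s)" using c by simp
  also have "\<dots> = (\<rho> a \<otimes>\<^bsub>K\<^esub> \<rho> s) \<otimes>\<^bsub>K\<^esub> (\<rho> t \<otimes>\<^bsub>K\<^esub> inv\<^bsub>K\<^esub> \<rho> t)"
    unfolding at(3) using c(1-3,7) by (simp add: K.m_ac)
  also have "\<dots> = \<rho> (a \<otimes> s)" using c rho_mult[OF at(1) s(1)] by simp
  finally have "t = a \<otimes> s" using rho_eqD[of t "a \<otimes> s"] t0 at(1) s by simp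
  then show "s \<notin> P" using P.I_l_closed[of s a] at by auto
next
  assume "s \<notin> P"
  moreover have "inv\<^bsub>K\<^esub> \<rho> s = \<rho> \<one> \<otimes>\<^bsub>K\<^esub> inv\<^bsub>K\<^esub> \<rho> s" using rho_inv(1)[OF s] rho_one by simp
  ultimately show "inv\<^bsub>K\<^esub> \<rho> s \<in> val P" using s(1) val_iff[OF P] one_closed by blast
qed

lemma val_subring:
  assumes P: "P \<in> height_one_primes R" shows "subring (val P) K"
proof (rule K.subringI)
  interpret P: primeideal P R by (rule h1_prime[OF P])
  note Q = nonzero_localized and QP = P.complement_localized
  have sub: "s \<in> carrier R - {\<zero>}" if "s \<in> carrier R - P" for s using that h1_zero[OF P] by auto
  show "val P \<subseteq> carrier K"
  proof
    fix x assume "x \<in> val P"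
    then obtain a s where x: "a \<in> carrier R" "s \<in> carrier R - P" "x = \<rho> a \<otimes>\<^bsub>K\<^esub> inv\<^bsub>K\<^esub> \<rho> s"
      using val_iff[OF P] by blast
    have "s \<in> carrier R" "s \<noteq> \<zero>" using sub[OF x(2)] by auto
    then show "x \<in> carrier K" unfolding x(3) by (intro K.m_closed rho_closed rho_inv x(1))
  qed
  show "\<one>\<^bsub>K\<^esub> \<in> val P"
    unfolding val_def quotient_field_def localized_ring.fract_one[OF Q] using localized_ring.denoms_one[OF QP] by blast
  fix x assume "x \<in> val P"
  then obtain a s where x: "a \<in> carrier R" "s \<in> carrier R - P" "x = fract R (carrier R - {\<zero>}) a s"
    by (auto simp: val_def)
  have "x = \<rho> a \<otimes>\<^bsub>K\<^esub> inv\<^bsub>K\<^esub> \<rho> s" unfolding x(3) by (rule fract_eq_quotient[OF x(1) sub[OF x(2)]])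
  then have "\<ominus>\<^bsub>K\<^esub> x = \<rho> (\<ominus> a) \<otimes>\<^bsub>K\<^esub> inv\<^bsub>K\<^esub> \<rho> s"
    using rho_closed[OF x(1)] rho_inv[of s] sub[OF x(2)] rho_neg[OF x(1)] by (simp add: K.l_minus)
  then show "\<ominus>\<^bsub>K\<^esub> x \<in> val P" using val_iff[OF P] x(1,2) by blast
  fix y assume "y \<in> val P"
  then obtain b t where y: "b \<in> carrier R" "t \<in> carrier R - P" "y = fract R (carrier R - {\<zero>}) b t"
    by (auto simp: val_def)
  have st: "s \<otimes> t \<in> carrier R - P" using x(2) y(2) by (rule localized_ring.denoms_mult[OF QP])
  have "x \<otimes>\<^bsub>K\<^esub> y = fract R (carrier R - {\<zero>}) (a \<otimes> b) (s \<otimes> t)"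
    "x \<oplus>\<^bsub>K\<^esub> y = fract R (carrier R - {\<zero>}) (a \<otimes> t \<oplus> b \<otimes> s) (s \<otimes> t)"
    unfolding x(3) y(3) quotient_field_def
    by (rule localized_ring.fract_mult[OF Q x(1) y(1) sub[OF x(2)] sub[OF y(2)]], rule localized_ring.fract_add[OF Q x(1) y(1) sub[OF x(2)] sub[OF y(2)]])
  then show "x \<otimes>\<^bsub>K\<^esub> y \<in> val P" "x \<oplus>\<^bsub>K\<^esub> y \<in> val P"
    unfolding val_def using x(1,2) y(1,2) st by blast+
qed

text \<open>The image of \<open>A\<close> in \<open>K[T]\<close> satisfies the assumptions of \<^locale>\<open>krull_subalgebra\<close>. The valuation rings
  and their finite character come from the definition of a Krull domain, the colon property from
  \<open>flat_colon\<close>, primality of the uniformizers from the fibres over height one primes, and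
  finite generation from the generators of the kernel of \<open>\<Phi>\<close>.\<close>

lemma krull_subalgebra_exists:
  obtains \<phi> \<pi> where "\<phi> \<in> ring_hom A (UP K)" "inj_on \<phi> (carrier A)"
    "\<And>r x. r \<in> carrier R \<Longrightarrow> x \<in> carrier A \<Longrightarrow> \<phi> (r \<odot>\<^bsub>A\<^esub> x) = \<rho> r \<odot>\<^bsub>UP K\<^esub> \<phi> x"
    "krull_subalgebra K (\<rho> ` carrier R) (height_one_primes R) val \<pi> (\<phi> ` carrier A)"
proof -
  interpret A: algebra R A by (rule alg)
  interpret U: field_poly K "UP K" by (rule field_poly)
  let ?D = "UP K" and ?HP = "height_one_primes R"
  have Ar: "ring A" using A.M_cring by (rule cring.axioms)
  have tf: "\<And>r x. \<lbrakk>r \<in> carrier R; r \<noteq> \<zero>; x \<in> carrier A; r \<odot>\<^bsub>A\<^esub> x = \<zero>\<^bsub>A\<^esub>\<rbrakk> \<Longrightarrow> x = \<zero>\<^bsub>A\<^esub>"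
    using flat_torsion_free[OF flat] by blast
  have Phi: "\<Phi> \<in> ring_hom A R" "\<And>r x. r \<in> carrier R \<Longrightarrow> x \<in> carrier A \<Longrightarrow> \<Phi> (r \<odot>\<^bsub>A\<^esub> x) = r \<otimes> \<Phi> x"
    using retr by (auto simp: retraction_def algebra_hom_def self_algebra_def)
  obtain \<eta> where eta: "\<eta> \<in> ring_hom A ?D" "inj_on \<eta> (carrier A)"
    "\<And>r x. r \<in> carrier R \<Longrightarrow> x \<in> carrier A \<Longrightarrow> \<eta> (r \<odot>\<^bsub>A\<^esub> x) = \<rho> r \<odot>\<^bsub>?D\<^esub> \<eta> x"
    "\<And>f. f \<in> carrier ?D \<Longrightarrow> \<exists>r\<in>carrier R. r \<noteq> \<zero> \<and> (\<exists>x\<in>carrier A. \<rho> r \<odot>\<^bsub>?D\<^esub> f = \<eta> x)"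
    by (rule generic_embedding[OF alg tf generic]) blast+
  obtain \<phi> where phi: "\<phi> \<in> ring_hom A ?D" "inj_on \<phi> (carrier A)"
    "\<And>r x. r \<in> carrier R \<Longrightarrow> x \<in> carrier A \<Longrightarrow> \<phi> (r \<odot>\<^bsub>A\<^esub> x) = \<rho> r \<odot>\<^bsub>?D\<^esub> \<phi> x"
    "\<And>f. f \<in> carrier ?D \<Longrightarrow> \<exists>r\<in>carrier R. r \<noteq> \<zero> \<and> (\<exists>x\<in>carrier A. \<rho> r \<odot>\<^bsub>?D\<^esub> f = \<phi> x)"
    "\<And>x. x \<in> carrier A \<Longrightarrow> U.cf (\<phi> x) 0 = \<rho> (\<Phi> x)"
    by (rule retraction_embedding[OF alg eta Phi]) blast+
  have pc: "\<phi> x \<in> carrier ?D" if "x \<in> carrier A" for x using phi(1) that by (rule ring_hom_closed)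
  have Pc: "\<Phi> x \<in> carrier R" if "x \<in> carrier A" for x using Phi(1) that by (rule ring_hom_closed)
  have phD: "x = y" if "\<phi> x = \<phi> y" "x \<in> carrier A" "y \<in> carrier A" for x y using phi(2) that by (rule inj_onD)
  have pneg: "\<phi> (\<ominus>\<^bsub>A\<^esub> x) = \<ominus>\<^bsub>?D\<^esub> \<phi> x" if "x \<in> carrier A" for x
    using ring_hom_cring.hom_a_inv[OF ring_hom_cringI[OF A.M_cring U.UP_cring phi(1)] that] .
  have Pneg: "\<Phi> (\<ominus>\<^bsub>A\<^esub> x) = \<ominus> \<Phi> x" if "x \<in> carrier A" for x
    using ring_hom_cring.hom_a_inv[OF ring_hom_cringI[OF A.M_cring is_cring Phi(1)] that] .
  note pm = ring_hom_mult[OF phi(1)] and pa = ring_hom_add[OF phi(1)]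
  have "\<forall>P\<in>?HP. \<exists>\<pi>. \<pi> \<in> P \<and> \<pi> \<noteq> \<zero> \<and> (\<forall>x\<in>P. \<exists>s\<in>carrier R - P. \<exists>r\<in>carrier R. s \<otimes> x = r \<otimes> \<pi>) \<and>
     (\<forall>x\<in>carrier R. x \<noteq> \<zero> \<longrightarrow> (\<exists>n::nat. \<exists>s\<in>carrier R - P. \<exists>t\<in>carrier R - P. s \<otimes> x = t \<otimes> \<pi> [^] n))"
  proof
    fix P assume P: "P \<in> ?HP"
    then have "discrete_valuation_ring (localization_at R P)" using krull by (simp add: krull_domain_def)
    then show "\<exists>\<pi>. \<pi> \<in> P \<and> \<pi> \<noteq> \<zero> \<and> (\<forall>x\<in>P. \<exists>s\<in>carrier R - P. \<exists>r\<in>carrier R. s \<otimes> x = r \<otimes> \<pi>) \<and>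
     (\<forall>x\<in>carrier R. x \<noteq> \<zero> \<longrightarrow> (\<exists>n::nat. \<exists>s\<in>carrier R - P. \<exists>t\<in>carrier R - P. s \<otimes> x = t \<otimes> \<pi> [^] n))"
      by (rule dvr_uniformizer[OF h1_prime[OF P]]) blast
  qed
  from bchoice[OF this] obtain p where p: "\<forall>P\<in>?HP. p P \<in> P \<and> p P \<noteq> \<zero> \<and>
     (\<forall>x\<in>P. \<exists>s\<in>carrier R - P. \<exists>r\<in>carrier R. s \<otimes> x = r \<otimes> p P) \<and>
     (\<forall>x\<in>carrier R. x \<noteq> \<zero> \<longrightarrow> (\<exists>n::nat. \<exists>s\<in>carrier R - P. \<exists>t\<in>carrier R - P. s \<otimes> x = t \<otimes> p P [^] n))"
    by blast
  have pcar: "p P \<in> carrier R" if "P \<in> ?HP" for P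
    using p that ideal.Icarr[OF primeideal.axioms(1)[OF h1_prime[OF that]]] by blast
  have rpow: "\<rho> (r [^] (n::nat)) = \<rho> r [^]\<^bsub>K\<^esub> n" if "r \<in> carrier R" for r n
    by (induction n) (simp_all add: that rho_one rho_mult)
  have Psub: "s \<noteq> \<zero>" if "P \<in> ?HP" "s \<in> carrier R - P" for P s using h1_zero[OF that(1)] that(2) by auto
  have "krull_subalgebra K (\<rho> ` carrier R) ?HP val (\<lambda>P. \<rho> (p P)) (\<phi> ` carrier A)"
  proof (rule krull_subalgebra.intro[OF field_poly], rule krull_subalgebra_axioms.intro)
    show "subring (\<rho> ` carrier R) K" by (rule rho_subring)
    show "subring (val P) K" if "P \<in> ?HP" for P using that by (rule val_subring)
    show "\<rho> ` carrier R = {x \<in> carrier K. \<forall>P\<in>?HP. x \<in> val P}"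
    proof -
      have "\<rho> ` carrier R = {x \<in> carrier K. \<forall>P\<in>?HP. \<exists>a\<in>carrier R. \<exists>s\<in>carrier R - P. x = fract R (carrier R - {\<zero>}) a s}"
        using krull by (simp add: krull_domain_def)
      moreover have "x \<in> val P \<longleftrightarrow> (\<exists>a\<in>carrier R. \<exists>s\<in>carrier R - P. x = fract R (carrier R - {\<zero>}) a s)" for x P
        unfolding val_def by blast
      ultimately show ?thesis by (simp only:)
    qed
    show "\<exists>s\<in>\<rho> ` carrier R. s \<noteq> \<zero>\<^bsub>K\<^esub> \<and> s \<otimes>\<^bsub>K\<^esub> x \<in> \<rho> ` carrier R" if xc: "x \<in> carrier K" for x
    proof -
      obtain a s where x: "a \<in> carrier R" "s \<in> carrier R" "s \<noteq> \<zero>" "x = \<rho> a \<otimes>\<^bsub>K\<^esub> inv\<^bsub>K\<^esub> \<rho> s"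
        using quotient_field_cases[OF xc] by blast
      have "\<rho> s \<otimes>\<^bsub>K\<^esub> x = \<rho> a"
        unfolding x(4) using rho_closed x(1,2) rho_inv[OF x(2,3)] K.m_lcomm[of "\<rho> s" "\<rho> a" "inv\<^bsub>K\<^esub> \<rho> s"] by simp
      then show ?thesis using x(1-3) rho_nz by (intro bexI[of _ "\<rho> s"]) auto
    qed
    show "\<exists>s\<in>\<rho> ` carrier R. s \<noteq> \<zero>\<^bsub>K\<^esub> \<and> inv\<^bsub>K\<^esub> s \<in> val P \<and> s \<otimes>\<^bsub>K\<^esub> x \<in> \<rho> ` carrier R"
      if P: "P \<in> ?HP" and xV: "x \<in> val P" for P x
    proof -
      obtain a s where x: "a \<in> carrier R" "s \<in> carrier R - P" "x = \<rho> a \<otimes>\<^bsub>K\<^esub> inv\<^bsub>K\<^esub> \<rho> s"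
        using xV val_iff[OF P] by blast
      have s: "s \<in> carrier R" "s \<noteq> \<zero>" using Psub[OF P x(2)] x(2) by auto
      have "\<rho> s \<otimes>\<^bsub>K\<^esub> x = \<rho> a"
        unfolding x(3) using rho_closed x(1) s rho_inv[OF s] K.m_lcomm[of "\<rho> s" "\<rho> a" "inv\<^bsub>K\<^esub> \<rho> s"] by simp
      moreover have "inv\<^bsub>K\<^esub> \<rho> s \<in> val P" using val_unit_iff[OF P s] x(2) by blast
      ultimately show ?thesis using x(1) s rho_nz by (intro bexI[of _ "\<rho> s"]) auto
    qed
    show "\<rho> (p P) \<in> \<rho> ` carrier R" if "P \<in> ?HP" for P using pcar[OF that] by blast
    show "\<rho> (p P) \<noteq> \<zero>\<^bsub>K\<^esub>" if "P \<in> ?HP" for P using pcar[OF that] p that by (intro rho_nz) auto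
    show "inv\<^bsub>K\<^esub> \<rho> (p P) \<notin> val P" if "P \<in> ?HP" for P
      using val_unit_iff[OF that pcar[OF that]] p that by blast
    show "\<exists>n::nat. \<exists>u\<in>val P. u \<noteq> \<zero>\<^bsub>K\<^esub> \<and> inv\<^bsub>K\<^esub> u \<in> val P \<and>
      (x = u \<otimes>\<^bsub>K\<^esub> \<rho> (p P) [^]\<^bsub>K\<^esub> n \<or> x \<otimes>\<^bsub>K\<^esub> \<rho> (p P) [^]\<^bsub>K\<^esub> n = u)"
      if P: "P \<in> ?HP" and x: "x \<in> carrier K" "x \<noteq> \<zero>\<^bsub>K\<^esub>" for P x
    proof -
      note mult = localized_ring.denoms_mult[OF primeideal.complement_localized[OF h1_prime[OF P]]]
      obtain a b where ab: "a \<in> carrier R" "b \<in> carrier R" "b \<noteq> \<zero>" "x = \<rho> a \<otimes>\<^bsub>K\<^esub> inv\<^bsub>K\<^esub> \<rho> b"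
        using quotient_field_cases[OF x(1)] by blast
      have "\<rho> \<zero> \<otimes>\<^bsub>K\<^esub> inv\<^bsub>K\<^esub> \<rho> b = \<zero>\<^bsub>K\<^esub>" unfolding rho_zero by (rule K.l_null[OF rho_inv(1)[OF ab(2,3)]])
      then have a0: "a \<noteq> \<zero>" using x(2) ab(4) by metis
      have unif: "\<exists>n::nat. \<exists>s\<in>carrier R - P. \<exists>t\<in>carrier R - P. s \<otimes> y = t \<otimes> p P [^] n"
        if "y \<in> carrier R" "y \<noteq> \<zero>" for y using p P that by blast
      obtain n s t where 1: "s \<in> carrier R - P" "t \<in> carrier R - P" "s \<otimes> a = t \<otimes> p P [^] (n::nat)"
        using unif[OF ab(1) a0] by blast
      obtain m s' t' where 2: "s' \<in> carrier R - P" "t' \<in> carrier R - P" "s' \<otimes> b = t' \<otimes> p P [^] (m::nat)"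
        using unif[OF ab(2,3)] by blast
      define w where "w = p P"
      have w: "w \<in> carrier R" "w \<noteq> \<zero>" unfolding w_def using pcar[OF P] p P by blast+
      have c: "s \<in> carrier R" "t \<in> carrier R" "s' \<in> carrier R" "t' \<in> carrier R"
          "s \<noteq> \<zero>" "t \<noteq> \<zero>" "s' \<noteq> \<zero>" "t' \<noteq> \<zero>" using 1(1,2) 2(1,2) Psub[OF P] by auto
      define N where "N = t \<otimes> s'"
      define E where "E = s \<otimes> t'"
      have NE: "N \<in> carrier R - P" "E \<in> carrier R - P"
        unfolding N_def E_def using 1(1,2) 2(1,2) mult by blast+
      have NE': "N \<in> carrier R" "E \<in> carrier R" "N \<noteq> \<zero>" "E \<noteq> \<zero>" using NE Psub[OF P] by auto
      define u where "u = \<rho> N \<otimes>\<^bsub>K\<^esub> inv\<^bsub>K\<^esub> \<rho> E"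
      have uV: "u \<in> val P" unfolding u_def using val_iff[OF P] NE by blast
      note k = rho_closed[OF NE'(1)] rho_closed[OF NE'(2)] rho_inv[OF NE'(1,3)] rho_inv[OF NE'(2,4)]
        rho_nz[OF NE'(1,3)] rho_nz[OF NE'(2,4)]
      have iu: "inv\<^bsub>K\<^esub> u = \<rho> E \<otimes>\<^bsub>K\<^esub> inv\<^bsub>K\<^esub> \<rho> N"
      proof -
        have "inv\<^bsub>K\<^esub> u = inv\<^bsub>K\<^esub> \<rho> N \<otimes>\<^bsub>K\<^esub> inv\<^bsub>K\<^esub> (inv\<^bsub>K\<^esub> \<rho> E)"
          unfolding u_def by (rule U.inv_mult[OF k(1,9,6,8)])
        then show ?thesis using U.inv_nz(5)[OF k(2,10)] k by (simp add: K.m_comm)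
      qed
      have iuV: "inv\<^bsub>K\<^esub> u \<in> val P" unfolding iu using val_iff[OF P] NE by blast
      have u0: "u \<noteq> \<zero>\<^bsub>K\<^esub>" unfolding u_def by (rule U.mult_nz[OF k(1,6,9,8)])
      have uc: "u \<in> carrier K" unfolding u_def using k by simp
      have eqR: "a \<otimes> E \<otimes> w [^] m = N \<otimes> w [^] n \<otimes> b"
      proof -
        have "a \<otimes> E \<otimes> w [^] m = (s \<otimes> a) \<otimes> (t' \<otimes> w [^] m)"
          using ab c w by (simp add: E_def m_ac)
        also have "\<dots> = (t \<otimes> w [^] n) \<otimes> (s' \<otimes> b)"
          unfolding 1(3) 2(3) w_def ..
        also have "\<dots> = N \<otimes> w [^] n \<otimes> b"
          using ab c w by (simp add: N_def m_ac)
        finally show ?thesis .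
      qed
      note kb = rho_closed[OF ab(1)] rho_closed[OF ab(2)] rho_inv[OF ab(2,3)] rho_nz[OF ab(2,3)]
      have wc: "\<rho> w \<in> carrier K" "\<And>i::nat. \<rho> w [^]\<^bsub>K\<^esub> i \<in> carrier K" using rho_closed[OF w(1)] by auto
      have wn: "\<rho> w [^]\<^bsub>K\<^esub> (i::nat) \<noteq> \<zero>\<^bsub>K\<^esub>" for i
      proof (induction i)
        case (Suc i)
        show ?case unfolding K.nat_pow_Suc by (rule U.mult_nz[OF wc(2) wc(1) Suc.IH rho_nz[OF w]])
      qed simp
      have eqK: "\<rho> a \<otimes>\<^bsub>K\<^esub> \<rho> E \<otimes>\<^bsub>K\<^esub> \<rho> w [^]\<^bsub>K\<^esub> m = \<rho> N \<otimes>\<^bsub>K\<^esub> \<rho> w [^]\<^bsub>K\<^esub> n \<otimes>\<^bsub>K\<^esub> \<rho> b"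
        using arg_cong[OF eqR, of \<rho>] ab(1,2) NE'(1,2) w(1) by (simp add: rho_mult rpow)
      \<comment> \<open>For \<open>x = a / b\<close> with \<open>a\<close> and \<open>b\<close> equal to \<open>w\<^sup>n\<close> and \<open>w\<^sup>m\<close> up to units of \<open>R\<^sub>P\<close>.\<close>
      have main: "x \<otimes>\<^bsub>K\<^esub> \<rho> w [^]\<^bsub>K\<^esub> m = u \<otimes>\<^bsub>K\<^esub> \<rho> w [^]\<^bsub>K\<^esub> n"
      proof -
        have "x \<otimes>\<^bsub>K\<^esub> \<rho> w [^]\<^bsub>K\<^esub> m = (x \<otimes>\<^bsub>K\<^esub> \<rho> w [^]\<^bsub>K\<^esub> m) \<otimes>\<^bsub>K\<^esub> (\<rho> E \<otimes>\<^bsub>K\<^esub> inv\<^bsub>K\<^esub> \<rho> E)"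
          using x(1) wc k(7) by simp
        also have "\<dots> = (\<rho> a \<otimes>\<^bsub>K\<^esub> \<rho> E \<otimes>\<^bsub>K\<^esub> \<rho> w [^]\<^bsub>K\<^esub> m) \<otimes>\<^bsub>K\<^esub> (inv\<^bsub>K\<^esub> \<rho> b \<otimes>\<^bsub>K\<^esub> inv\<^bsub>K\<^esub> \<rho> E)"
          unfolding ab(4) using kb(1-3) k(2,6) wc(2)[of m] by (simp add: K.m_ac)
        also have "\<dots> = (\<rho> N \<otimes>\<^bsub>K\<^esub> inv\<^bsub>K\<^esub> \<rho> E \<otimes>\<^bsub>K\<^esub> \<rho> w [^]\<^bsub>K\<^esub> n) \<otimes>\<^bsub>K\<^esub> (\<rho> b \<otimes>\<^bsub>K\<^esub> inv\<^bsub>K\<^esub> \<rho> b)"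
          unfolding eqK using kb(1-3) k(1,2,6) wc(2)[of n] by (simp add: K.m_ac)
        also have "\<dots> = u \<otimes>\<^bsub>K\<^esub> \<rho> w [^]\<^bsub>K\<^esub> n" using kb(4) k(1,6) wc by (simp add: u_def)
        finally show ?thesis .
      qed
      show ?thesis
      proof (cases "m \<le> n")
        case True
        then have "\<rho> w [^]\<^bsub>K\<^esub> n = \<rho> w [^]\<^bsub>K\<^esub> (n - m) \<otimes>\<^bsub>K\<^esub> \<rho> w [^]\<^bsub>K\<^esub> m"
          using K.nat_pow_mult[OF wc(1), of "n - m" m] by simp
        then have "x \<otimes>\<^bsub>K\<^esub> \<rho> w [^]\<^bsub>K\<^esub> m = (u \<otimes>\<^bsub>K\<^esub> \<rho> w [^]\<^bsub>K\<^esub> (n - m)) \<otimes>\<^bsub>K\<^esub> \<rho> w [^]\<^bsub>K\<^esub> m"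
          using main uc wc by (simp add: K.m_assoc)
        then have "x = u \<otimes>\<^bsub>K\<^esub> \<rho> w [^]\<^bsub>K\<^esub> (n - m)"
          using K.m_closed K.m_rcancel[OF wn[of m] wc(2)[of m] x(1), of "u \<otimes>\<^bsub>K\<^esub> \<rho> w [^]\<^bsub>K\<^esub> (n - m)"] uc wc by blast
        then show ?thesis using uV u0 iuV unfolding w_def by blast
      next
        case False
        then have "\<rho> w [^]\<^bsub>K\<^esub> m = \<rho> w [^]\<^bsub>K\<^esub> (m - n) \<otimes>\<^bsub>K\<^esub> \<rho> w [^]\<^bsub>K\<^esub> n"
          using K.nat_pow_mult[OF wc(1), of "m - n" n] by simp
        then have "(x \<otimes>\<^bsub>K\<^esub> \<rho> w [^]\<^bsub>K\<^esub> (m - n)) \<otimes>\<^bsub>K\<^esub> \<rho> w [^]\<^bsub>K\<^esub> n = u \<otimes>\<^bsub>K\<^esub> \<rho> w [^]\<^bsub>K\<^esub> n"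
          using main x(1) wc by (simp add: K.m_assoc)
        then have "x \<otimes>\<^bsub>K\<^esub> \<rho> w [^]\<^bsub>K\<^esub> (m - n) = u"
          using K.m_closed K.m_rcancel[OF wn[of n] wc(2)[of n] _ uc, of "x \<otimes>\<^bsub>K\<^esub> \<rho> w [^]\<^bsub>K\<^esub> (m - n)"] x(1) wc by blast
        then show ?thesis using uV u0 iuV unfolding w_def by blast
      qed
    qed
    show "finite {P \<in> ?HP. inv\<^bsub>K\<^esub> r \<notin> val P}" if r: "r \<in> \<rho> ` carrier R" "r \<noteq> \<zero>\<^bsub>K\<^esub>" for r
    proof -
      obtain q where q: "q \<in> carrier R" "r = \<rho> q" using r by blast
      have q0: "q \<noteq> \<zero>" using r q rho_zero by auto
      have "finite {P \<in> ?HP. q \<in> P}" using krull q(1) q0 by (simp add: krull_domain_def)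
      moreover have "{P \<in> ?HP. inv\<^bsub>K\<^esub> r \<notin> val P} \<subseteq> {P \<in> ?HP. q \<in> P}"
        using val_unit_iff q(1) q0 unfolding q(2) by blast
      ultimately show ?thesis by (rule finite_subset[rotated])
    qed
    show "subring (\<phi> ` carrier A) ?D"
    proof (rule U.P.subringI)
      show "\<phi> ` carrier A \<subseteq> carrier ?D" using pc by blast
      show "\<one>\<^bsub>?D\<^esub> \<in> \<phi> ` carrier A" using ring_hom_one[OF phi(1)] A.one_closed by (metis imageI)
    next
      fix f assume "f \<in> \<phi> ` carrier A"
      then show "\<ominus>\<^bsub>?D\<^esub> f \<in> \<phi> ` carrier A" using pneg[symmetric] by (auto intro!: imageI)
    next
      fix f g assume "f \<in> \<phi> ` carrier A" "g \<in> \<phi> ` carrier A"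
      then show "f \<otimes>\<^bsub>?D\<^esub> g \<in> \<phi> ` carrier A" "f \<oplus>\<^bsub>?D\<^esub> g \<in> \<phi> ` carrier A"
        using pm[symmetric] pa[symmetric] by (auto intro!: imageI)
    qed
    show "r \<odot>\<^bsub>?D\<^esub> f \<in> \<phi> ` carrier A" if "r \<in> \<rho> ` carrier R" "f \<in> \<phi> ` carrier A" for r f
      using that phi(3)[symmetric] by (auto intro!: imageI)
    show "U.cf f 0 \<in> \<rho> ` carrier R" if "f \<in> \<phi> ` carrier A" for f
      using that phi(5) Pc by auto
    show "\<exists>r\<in>\<rho> ` carrier R. r \<noteq> \<zero>\<^bsub>K\<^esub> \<and> r \<odot>\<^bsub>?D\<^esub> f \<in> \<phi> ` carrier A" if f: "f \<in> carrier ?D" for f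
    proof -
      obtain r x where "r \<in> carrier R" "r \<noteq> \<zero>" "x \<in> carrier A" "\<rho> r \<odot>\<^bsub>?D\<^esub> f = \<phi> x" using phi(4)[OF f] by blast
      then show ?thesis using rho_nz by (intro bexI[of _ "\<rho> r"]) auto
    qed
    show "f \<in> H"
      if r: "r \<in> \<rho> ` carrier R" "r \<noteq> \<zero>\<^bsub>K\<^esub>" and s: "\<And>j. s j \<in> \<rho> ` carrier R" and f: "f \<in> \<phi> ` carrier A"
        and sf: "\<And>j. j < k \<Longrightarrow> \<exists>g\<in>\<phi> ` carrier A. s j \<odot>\<^bsub>?D\<^esub> f = r \<odot>\<^bsub>?D\<^esub> g" and H: "subgroup H (add_monoid ?D)"
        and col: "\<And>a g. \<lbrakk>a \<in> \<rho> ` carrier R; \<And>j. j < k \<Longrightarrow> \<exists>b\<in>\<rho> ` carrier R. s j \<otimes>\<^bsub>K\<^esub> a = r \<otimes>\<^bsub>K\<^esub> b;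
          g \<in> \<phi> ` carrier A\<rbrakk> \<Longrightarrow> a \<odot>\<^bsub>?D\<^esub> g \<in> H" for k :: nat and r s f H
    proof -
      obtain r' where r': "r' \<in> carrier R" "r = \<rho> r'" using r by blast
      obtain x where x: "x \<in> carrier A" "f = \<phi> x" using f by blast
      have "\<forall>j. \<exists>q. q \<in> carrier R \<and> s j = \<rho> q" using s by blast
      then obtain s' where s': "\<And>j. s' j \<in> carrier R" "\<And>j. s j = \<rho> (s' j)" by metis
      define H' where "H' = {y \<in> carrier A. \<phi> y \<in> H}"
      have "x \<in> H'"
      proof (rule flat_colon[OF flat r'(1) s'(1) x(1)])
        show "\<exists>y\<in>carrier A. s' j \<odot>\<^bsub>A\<^esub> x = r' \<odot>\<^bsub>A\<^esub> y" if jk: "j < k" for j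
        proof -
          obtain y where y: "y \<in> carrier A" "s j \<odot>\<^bsub>?D\<^esub> f = r \<odot>\<^bsub>?D\<^esub> \<phi> y" using sf[OF jk] by blast
          have "\<phi> (s' j \<odot>\<^bsub>A\<^esub> x) = \<phi> (r' \<odot>\<^bsub>A\<^esub> y)" using y x s' r' by (simp add: phi(3))
          then show ?thesis using phD y x s'(1) r'(1) by blast
        qed
        show "subgroup H' (add_monoid A)"
        proof (rule A.M.add.subgroupI)
          show "H' \<subseteq> carrier A" by (auto simp: H'_def)
          have "\<phi> \<zero>\<^bsub>A\<^esub> = \<zero>\<^bsub>?D\<^esub>" by (rule ring_hom_zero[OF phi(1) Ar U.UP_ring])
          then have "\<zero>\<^bsub>A\<^esub> \<in> H'" using subgroup.one_closed[OF H] by (simp add: H'_def)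
          then show "H' \<noteq> {}" by blast
        next
          fix y assume "y \<in> H'"
          then show "\<ominus>\<^bsub>A\<^esub> y \<in> H'" using subgroup.m_inv_closed[OF H] pneg by (auto simp: H'_def a_inv_def)
        next
          fix y z assume "y \<in> H'" "z \<in> H'"
          then show "y \<oplus>\<^bsub>A\<^esub> z \<in> H'" using subgroup.m_closed[OF H] pa by (auto simp: H'_def)
        qed
      next
        fix a y assume a: "a \<in> carrier R" "\<And>j. j < k \<Longrightarrow> \<exists>b\<in>carrier R. s' j \<otimes> a = r' \<otimes> b" "y \<in> carrier A"
        have "\<rho> a \<odot>\<^bsub>?D\<^esub> \<phi> y \<in> H"
        proof (rule col)
          fix j assume "j < k"
          then obtain b where b: "b \<in> carrier R" "s' j \<otimes> a = r' \<otimes> b" using a(2) by blast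
          then have "s j \<otimes>\<^bsub>K\<^esub> \<rho> a = r \<otimes>\<^bsub>K\<^esub> \<rho> b"
            using rho_mult[OF s'(1) a(1), of j] rho_mult[OF r'(1) b(1)] by (simp add: s'(2) r'(2))
          then show "\<exists>b\<in>\<rho> ` carrier R. s j \<otimes>\<^bsub>K\<^esub> \<rho> a = r \<otimes>\<^bsub>K\<^esub> b" using b(1) by blast
        qed (use a in auto)
        then show "a \<odot>\<^bsub>A\<^esub> y \<in> H'" using a by (simp add: H'_def phi(3))
      qed
      then show ?thesis using x by (simp add: H'_def)
    qed
    show "\<exists>C. finite C \<and> C \<subseteq> {U.cf f 1 | f. f \<in> \<phi> ` carrier A \<and> U.cf f 0 = \<zero>\<^bsub>K\<^esub>} \<and>
       (\<forall>H. \<zero>\<^bsub>K\<^esub> \<in> H \<and> (\<forall>x\<in>H. \<forall>y\<in>H. x \<oplus>\<^bsub>K\<^esub> y \<in> H) \<and> (\<forall>r\<in>\<rho> ` carrier R. \<forall>x\<in>H. r \<otimes>\<^bsub>K\<^esub> x \<in> H) \<and> C \<subseteq> H \<longrightarrow>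
          {U.cf f 1 | f. f \<in> \<phi> ` carrier A \<and> U.cf f 0 = \<zero>\<^bsub>K\<^esub>} \<subseteq> H)"
    proof -
      obtain S where S: "finite S" "S \<subseteq> carrier A" "a_kernel A R \<Phi> = Idl\<^bsub>A\<^esub> S"
        using fg by (auto simp: finitely_generated_ideal_def)
      have ker: "a_kernel A R \<Phi> = {x \<in> carrier A. \<Phi> x = \<zero>}" by (simp add: a_kernel_def')
      have cf0: "U.cf (\<phi> x) 0 = \<zero>\<^bsub>K\<^esub> \<longleftrightarrow> \<Phi> x = \<zero>" if "x \<in> carrier A" for x
        using phi(5)[OF that] rho_nz[OF Pc[OF that]] rho_zero by auto
      have SK: "\<Phi> x = \<zero>" if "x \<in> S" for x
        using ring.genideal_self[OF Ar S(2)] that S(3) ker by blast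
      show ?thesis
      proof (intro exI[of _ "(\<lambda>x. U.cf (\<phi> x) 1) ` S"] conjI allI impI)
        show "finite ((\<lambda>x. U.cf (\<phi> x) 1) ` S)" using S(1) by simp
        show "(\<lambda>x. U.cf (\<phi> x) 1) ` S \<subseteq> {U.cf f 1 | f. f \<in> \<phi> ` carrier A \<and> U.cf f 0 = \<zero>\<^bsub>K\<^esub>}"
          using S(2) SK cf0 by blast
        fix H
        assume H: "\<zero>\<^bsub>K\<^esub> \<in> H \<and> (\<forall>x\<in>H. \<forall>y\<in>H. x \<oplus>\<^bsub>K\<^esub> y \<in> H) \<and> (\<forall>r\<in>\<rho> ` carrier R. \<forall>x\<in>H. r \<otimes>\<^bsub>K\<^esub> x \<in> H)
          \<and> (\<lambda>x. U.cf (\<phi> x) 1) ` S \<subseteq> H"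
        \<comment> \<open>\<open>W\<close> is an ideal since \<open>y x\<close> has linear coefficient \<open>\<Phi>(y)\<close> times that of \<open>x\<close> when \<open>\<Phi>(x) = 0\<close>.\<close>
        define W where "W = {x \<in> carrier A. \<Phi> x = \<zero> \<and> U.cf (\<phi> x) 1 \<in> H}"
        have "ideal W A"
        proof (rule idealI[OF Ar])
          show "subgroup W (add_monoid A)"
          proof (rule A.M.add.subgroupI)
            show "W \<subseteq> carrier A" by (auto simp: W_def)
            have "\<zero>\<^bsub>A\<^esub> \<in> W"
              using ring_hom_zero[OF phi(1) Ar U.UP_ring] ring_hom_zero[OF Phi(1) Ar ring_axioms] H by (simp add: W_def)
            then show "W \<noteq> {}" by blast
          next
            fix x assume "x \<in> W"
            then have x: "x \<in> carrier A" "\<Phi> x = \<zero>" "U.cf (\<phi> x) 1 \<in> H" by (auto simp: W_def)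
            have "\<rho> (\<ominus> \<one>) \<otimes>\<^bsub>K\<^esub> U.cf (\<phi> x) 1 \<in> H" using H x(3) by blast
            moreover have "\<rho> (\<ominus> \<one>) \<otimes>\<^bsub>K\<^esub> U.cf (\<phi> x) 1 = U.cf (\<phi> (\<ominus>\<^bsub>A\<^esub> x)) 1"
              using pc[OF x(1)] by (simp add: rho_neg rho_one pneg[OF x(1)] K.l_minus)
            ultimately show "\<ominus>\<^bsub>A\<^esub> x \<in> W" using x Pneg by (simp add: W_def)
          next
            fix x y assume "x \<in> W" "y \<in> W"
            then have x: "x \<in> carrier A" "\<Phi> x = \<zero>" "U.cf (\<phi> x) 1 \<in> H"
              and y: "y \<in> carrier A" "\<Phi> y = \<zero>" "U.cf (\<phi> y) 1 \<in> H" by (auto simp: W_def)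
            have "U.cf (\<phi> x) 1 \<oplus>\<^bsub>K\<^esub> U.cf (\<phi> y) 1 \<in> H" using H x(3) y(3) by blast
            then show "x \<oplus>\<^bsub>A\<^esub> y \<in> W"
              using x y pc ring_hom_add[OF Phi(1) x(1) y(1)] by (simp add: W_def pa)
          qed
        next
          fix x y assume "x \<in> W" and y: "y \<in> carrier A"
          then have x: "x \<in> carrier A" "\<Phi> x = \<zero>" "U.cf (\<phi> x) 1 \<in> H" by (auto simp: W_def)
          have "U.cf (\<phi> (y \<otimes>\<^bsub>A\<^esub> x)) 1 = \<rho> (\<Phi> y) \<otimes>\<^bsub>K\<^esub> U.cf (\<phi> x) 1"
          proof -
            have "U.cf (\<phi> y \<otimes>\<^bsub>?D\<^esub> \<phi> x) 1 = \<rho> (\<Phi> y) \<otimes>\<^bsub>K\<^esub> U.cf (\<phi> x) 1 \<oplus>\<^bsub>K\<^esub> U.cf (\<phi> y) 1 \<otimes>\<^bsub>K\<^esub> \<zero>\<^bsub>K\<^esub>"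
              unfolding U.coeff_1_mult[OF pc[OF y] pc[OF x(1)]] phi(5)[OF y] phi(5)[OF x(1)] x(2) rho_zero ..
            also have "\<dots> = \<rho> (\<Phi> y) \<otimes>\<^bsub>K\<^esub> U.cf (\<phi> x) 1"
              using U.coeff_closed[OF pc[OF y]] U.coeff_closed[OF pc[OF x(1)]] rho_closed[OF Pc[OF y]] by simp
            finally show ?thesis unfolding pm[OF y x(1)] .
          qed
          moreover have "\<rho> (\<Phi> y) \<otimes>\<^bsub>K\<^esub> U.cf (\<phi> x) 1 \<in> H" using H x(3) Pc[OF y] by blast
          ultimately show yx: "y \<otimes>\<^bsub>A\<^esub> x \<in> W"
            using x y ring_hom_mult[OF Phi(1) y x(1)] Pc[OF y] by (simp add: W_def)
          then show "x \<otimes>\<^bsub>A\<^esub> y \<in> W" using A.m_comm[OF x(1) y] by simp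
        qed
        moreover have "S \<subseteq> W" using S(2) SK H by (auto simp: W_def)
        ultimately have "Idl\<^bsub>A\<^esub> S \<subseteq> W" by (rule ring.genideal_minimal[OF Ar])
        then have "a_kernel A R \<Phi> \<subseteq> W" unfolding S(3) .
        then have "U.cf (\<phi> x) 1 \<in> H" if "x \<in> carrier A" "\<Phi> x = \<zero>" for x
          using that by (auto simp: ker W_def)
        then show "{U.cf f 1 | f. f \<in> \<phi> ` carrier A \<and> U.cf f 0 = \<zero>\<^bsub>K\<^esub>} \<subseteq> H" using cf0 by blast
      qed
    qed
    show "\<exists>t\<in>\<rho> ` carrier R. t \<noteq> \<zero>\<^bsub>K\<^esub> \<and> inv\<^bsub>K\<^esub> t \<in> val P \<and>
        (\<exists>e\<in>\<phi> ` carrier A. t \<odot>\<^bsub>?D\<^esub> f = \<rho> (p P) \<odot>\<^bsub>?D\<^esub> e \<or> t \<odot>\<^bsub>?D\<^esub> g = \<rho> (p P) \<odot>\<^bsub>?D\<^esub> e)"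
      if P: "P \<in> ?HP" and fgh: "f \<in> \<phi> ` carrier A" "g \<in> \<phi> ` carrier A" "h \<in> \<phi> ` carrier A"
        and s: "s \<in> \<rho> ` carrier R" "s \<noteq> \<zero>\<^bsub>K\<^esub>" "inv\<^bsub>K\<^esub> s \<in> val P"
        and eq: "s \<odot>\<^bsub>?D\<^esub> (f \<otimes>\<^bsub>?D\<^esub> g) = \<rho> (p P) \<odot>\<^bsub>?D\<^esub> h" for P f g h s
    proof -
      obtain a b e where a: "a \<in> carrier A" "f = \<phi> a" "b \<in> carrier A" "g = \<phi> b" "e \<in> carrier A" "h = \<phi> e"
        using fgh by blast
      obtain q where q: "q \<in> carrier R" "s = \<rho> q" using s by blast
      have q0: "q \<noteq> \<zero>" using s q rho_zero by auto
      have qP: "q \<in> carrier R - P" using val_unit_iff[OF P q(1) q0] s(3) q by blast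
      have "\<phi> (q \<odot>\<^bsub>A\<^esub> (a \<otimes>\<^bsub>A\<^esub> b)) = \<phi> (p P \<odot>\<^bsub>A\<^esub> e)"
        using eq a q pcar[OF P] by (simp add: phi(3) pm)
      then have E: "q \<odot>\<^bsub>A\<^esub> (a \<otimes>\<^bsub>A\<^esub> b) = p P \<odot>\<^bsub>A\<^esub> e" by (rule phD) (use a q pcar[OF P] in auto)
      have gen: "\<And>x. x \<in> P \<Longrightarrow> \<exists>s\<in>carrier R - P. \<exists>r\<in>carrier R. s \<otimes> x = r \<otimes> p P" and pP: "p P \<in> P"
        using p P by blast+
      obtain t y where t: "t \<in> carrier R - P" "y \<in> carrier A" "t \<odot>\<^bsub>A\<^esub> a = p P \<odot>\<^bsub>A\<^esub> y \<or> t \<odot>\<^bsub>A\<^esub> b = p P \<odot>\<^bsub>A\<^esub> y"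
        using special_fibre_prime[OF alg phi(1-3) h1_prime[OF P] special[OF P] pP gen a(1,3,5) qP E] by blast
      have t': "t \<in> carrier R" "t \<noteq> \<zero>" using t(1) Psub[OF P] by auto
      have "\<rho> t \<odot>\<^bsub>?D\<^esub> f = \<rho> (p P) \<odot>\<^bsub>?D\<^esub> \<phi> y \<or> \<rho> t \<odot>\<^bsub>?D\<^esub> g = \<rho> (p P) \<odot>\<^bsub>?D\<^esub> \<phi> y"
        using t(3) phi(3)[OF t'(1) a(1)] phi(3)[OF t'(1) a(3)] phi(3)[OF pcar[OF P] t(2)] a(2,4) by metis
      moreover have "inv\<^bsub>K\<^esub> \<rho> t \<in> val P" using val_unit_iff[OF P t'] t(1) by blast
      ultimately show ?thesis using t' t(2) rho_nz[OF t'] by blast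
    qed
  qed
  with phi(1-3) show thesis by (rule that)
qed

text \<open>The ideal \<open>I\<close> corresponds to \<open>d L\<close>, and its inverse is \<open>J = d\<^sup>-\<^sup>1 M\<close>, because \<open>L M\<close> contains \<open>1\<close>.\<close>

theorem retract_is_symmetric_algebra:
  "\<exists>I. invertible_ideal R I \<and> algebra_isomorphic R A (symmetric_algebra R (ideal_module R I))"
proof -
  obtain \<phi> \<pi> where phi: "\<phi> \<in> ring_hom A (UP K)" "inj_on \<phi> (carrier A)"
    "\<And>r x. r \<in> carrier R \<Longrightarrow> x \<in> carrier A \<Longrightarrow> \<phi> (r \<odot>\<^bsub>A\<^esub> x) = \<rho> r \<odot>\<^bsub>UP K\<^esub> \<phi> x"
    and ks: "krull_subalgebra K (\<rho> ` carrier R) (height_one_primes R) val \<pi> (\<phi> ` carrier A)"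
    by (rule krull_subalgebra_exists) blast
  interpret B: krull_subalgebra K "UP K" "\<rho> ` carrier R" "height_one_primes R" val \<pi> "\<phi> ` carrier A" by (rule ks)
  obtain d where d: "d \<in> \<rho> ` carrier R" "d \<noteq> \<zero>\<^bsub>K\<^esub>" "\<And>c. c \<in> B.L \<Longrightarrow> d \<otimes>\<^bsub>K\<^esub> c \<in> \<rho> ` carrier R"
    by (rule B.L_denom) blast
  interpret B: scaled_line K "UP K" "\<rho> ` carrier R" "height_one_primes R" val \<pi> "\<phi> ` carrier A" R A \<rho> \<phi> d
    by (rule scaled_line.intro[OF ks], rule scaled_line_axioms.intro)
      (simp_all add: is_cring alg to_quotient_field_hom to_quotient_field_inj phi d)
  interpret KM: module R K by (rule algebra.module[OF quotient_field_algebra])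
  have dc: "d \<in> carrier K" by (rule B.d_carrier)
  note iv = B.inv_nz[OF dc d(2)]
  define J where "J = (\<lambda>y. inv\<^bsub>K\<^esub> d \<otimes>\<^bsub>K\<^esub> y) ` B.M"
  have Mc: "y \<in> carrier K" if "y \<in> B.M" for y using that by (rule B.M_carrier)
  have M_add: "x \<oplus>\<^bsub>K\<^esub> y \<in> B.M" if "x \<in> B.M" "y \<in> B.M" for x y
    using that subringE(7)[OF rho_subring] B.L_carrier by (auto simp: B.M_def K.r_distr)
  have M_zero: "\<zero>\<^bsub>K\<^esub> \<in> B.M"
    using subringE(2)[OF rho_subring] B.L_carrier by (auto simp: B.M_def)
  have M_neg: "\<ominus>\<^bsub>K\<^esub> y \<in> B.M" if "y \<in> B.M" for y
    using that subringE(5)[OF rho_subring] B.L_carrier by (auto simp: B.M_def K.r_minus)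
  have Jsub: "submodule J R K"
  proof (rule KM.submoduleI)
    show "J \<subseteq> carrier K" using iv(1) Mc by (auto simp: J_def)
    have "\<zero>\<^bsub>K\<^esub> = inv\<^bsub>K\<^esub> d \<otimes>\<^bsub>K\<^esub> \<zero>\<^bsub>K\<^esub>" using iv(1) by simp
    then show "\<zero>\<^bsub>K\<^esub> \<in> J" unfolding J_def using M_zero by blast
  next
    fix x assume "x \<in> J"
    then obtain y where y: "y \<in> B.M" "x = inv\<^bsub>K\<^esub> d \<otimes>\<^bsub>K\<^esub> y" by (auto simp: J_def)
    then have "\<ominus>\<^bsub>K\<^esub> x = inv\<^bsub>K\<^esub> d \<otimes>\<^bsub>K\<^esub> (\<ominus>\<^bsub>K\<^esub> y)" using iv(1) Mc by (simp add: K.r_minus)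
    then show "\<ominus>\<^bsub>K\<^esub> x \<in> J" unfolding J_def using M_neg[OF y(1)] by blast
  next
    fix x x' assume "x \<in> J" "x' \<in> J"
    then obtain y y' where y: "y \<in> B.M" "x = inv\<^bsub>K\<^esub> d \<otimes>\<^bsub>K\<^esub> y" "y' \<in> B.M" "x' = inv\<^bsub>K\<^esub> d \<otimes>\<^bsub>K\<^esub> y'" by (auto simp: J_def)
    then have "x \<oplus>\<^bsub>K\<^esub> x' = inv\<^bsub>K\<^esub> d \<otimes>\<^bsub>K\<^esub> (y \<oplus>\<^bsub>K\<^esub> y')" using iv(1) Mc by (simp add: K.r_distr)
    then show "x \<oplus>\<^bsub>K\<^esub> x' \<in> J" unfolding J_def using M_add[OF y(1,3)] by blast
  next
    fix r x assume r: "r \<in> carrier R" and "x \<in> J"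
    then obtain y where y: "y \<in> B.M" "x = inv\<^bsub>K\<^esub> d \<otimes>\<^bsub>K\<^esub> y" by (auto simp: J_def)
    have "r \<odot>\<^bsub>K\<^esub> x = inv\<^bsub>K\<^esub> d \<otimes>\<^bsub>K\<^esub> (\<rho> r \<otimes>\<^bsub>K\<^esub> y)"
      using quotient_field_smult[OF r, of x] y iv(1) Mc rho_closed[OF r] by (simp add: K.m_lcomm)
    then show "r \<odot>\<^bsub>K\<^esub> x \<in> J" unfolding J_def using B.M_smult[OF _ y(1)] r by blast
  qed
  have frac: "fractional_ideal R J"
    unfolding fractional_ideal_def
  proof (rule conjI[OF Jsub])
    obtain c where c: "c \<in> B.L" "c \<noteq> \<zero>\<^bsub>K\<^esub>" using B.L_nonzero by blast
    have cc: "c \<in> carrier K" by (rule B.L_carrier[OF c(1)])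
    obtain e where e: "e \<in> carrier R" "\<rho> e = d \<otimes>\<^bsub>K\<^esub> c" using d(3)[OF c(1)] by force
    have "e \<noteq> \<zero>" using e rho_zero B.mult_nz[OF dc cc d(2) c(2)] by auto
    moreover have "e \<odot>\<^bsub>K\<^esub> x \<in> \<rho> ` carrier R" if xJ: "x \<in> J" for x
    proof -
      obtain y where y: "y \<in> B.M" "x = inv\<^bsub>K\<^esub> d \<otimes>\<^bsub>K\<^esub> y" using xJ by (auto simp: J_def)
      have "e \<odot>\<^bsub>K\<^esub> x = c \<otimes>\<^bsub>K\<^esub> (d \<otimes>\<^bsub>K\<^esub> (inv\<^bsub>K\<^esub> d \<otimes>\<^bsub>K\<^esub> y))"
        using quotient_field_smult[OF e(1), of x] y iv(1) Mc[OF y(1)] e(2) dc cc by (simp add: K.m_ac)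
      also have "\<dots> = c \<otimes>\<^bsub>K\<^esub> y" using B.cancel_inv(1)[OF dc d(2) Mc[OF y(1)]] by simp
      finally show ?thesis using y(1) c(1) by (simp add: B.M_def)
    qed
    ultimately show "\<exists>d\<in>carrier R - {\<zero>}. \<forall>x\<in>J. d \<odot>\<^bsub>K\<^esub> x \<in> \<rho> ` carrier R" using e(1) by blast
  qed
  let ?G = "{x \<otimes>\<^bsub>K\<^esub> y | x y. x \<in> \<rho> ` B.Id \<and> y \<in> J}"
  have GR: "?G \<subseteq> \<rho> ` carrier R"
  proof clarify
    fix x y assume x: "x \<in> B.Id" and "y \<in> J"
    then obtain m where m: "m \<in> B.M" "y = inv\<^bsub>K\<^esub> d \<otimes>\<^bsub>K\<^esub> m" by (auto simp: J_def)
    have "\<rho> x \<otimes>\<^bsub>K\<^esub> y = B.lc x \<otimes>\<^bsub>K\<^esub> (d \<otimes>\<^bsub>K\<^esub> (inv\<^bsub>K\<^esub> d \<otimes>\<^bsub>K\<^esub> m))"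
      unfolding B.lc_eq[OF x] m(2) using dc iv(1) Mc[OF m(1)] B.lc_carrier[OF x] by (simp add: K.m_ac)
    also have "\<dots> = B.lc x \<otimes>\<^bsub>K\<^esub> m" using B.cancel_inv(1)[OF dc d(2) Mc[OF m(1)]] by simp
    finally show "\<rho> x \<otimes>\<^bsub>K\<^esub> y \<in> \<rho> ` carrier R" using m(1) B.lc_L[OF x] by (simp add: B.M_def)
  qed
  have gen_sub: "generate (add_monoid K) ?G \<subseteq> \<rho> ` carrier R"
    by (rule K.add.generate_subgroup_incl[OF GR]) (rule subring.axioms(1)[OF rho_subring])
  have gen_lsum: "B.lsum ps \<in> generate (add_monoid K) ?G" if "set ps \<subseteq> B.L \<times> B.M" for ps
    using that
  proof (induction ps)
    case Nil
    then show ?case using generate.one[of "add_monoid K" ?G] by (simp add: B.lsum_def)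
  next
    case (Cons q ps)
    obtain x y where q: "q = (x, y)" "x \<in> B.L" "y \<in> B.M" using Cons.prems by (cases q) auto
    have xy: "x \<in> carrier K" "y \<in> carrier K" using q B.L_carrier Mc by auto
    have "x \<otimes>\<^bsub>K\<^esub> y = x \<otimes>\<^bsub>K\<^esub> (d \<otimes>\<^bsub>K\<^esub> (inv\<^bsub>K\<^esub> d \<otimes>\<^bsub>K\<^esub> y))" using B.cancel_inv(1)[OF dc d(2) xy(2)] by simp
    also have "\<dots> = (d \<otimes>\<^bsub>K\<^esub> x) \<otimes>\<^bsub>K\<^esub> (inv\<^bsub>K\<^esub> d \<otimes>\<^bsub>K\<^esub> y)" using xy dc iv(1) by (simp add: K.m_ac)
    also have "d \<otimes>\<^bsub>K\<^esub> x = \<rho> (B.rr (d \<otimes>\<^bsub>K\<^esub> x))" using B.rr_props(2)[OF d(3)[OF q(2)]] by simp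
    finally have "x \<otimes>\<^bsub>K\<^esub> y \<in> ?G" using B.Id_back(1)[OF q(2)] q(3) unfolding J_def by blast
    then have "x \<otimes>\<^bsub>K\<^esub> y \<in> generate (add_monoid K) ?G" by (rule generate.incl)
    from generate.eng[OF this Cons.IH] Cons.prems show ?case by (simp add: B.lsum_def q)
  qed
  have "\<rho> ` carrier R \<subseteq> generate (add_monoid K) ?G"
  proof
    fix r assume r: "r \<in> \<rho> ` carrier R"
    have rc: "r \<in> carrier K" using r rho_closed by blast
    have ps: "set B.pairs \<subseteq> B.L \<times> B.M" "B.lsum B.pairs = \<one>\<^bsub>K\<^esub>" by (rule B.pairs)+
    have pc: "set B.pairs \<subseteq> carrier K \<times> carrier K" using ps(1) B.L_carrier Mc by blast
    have eq: "B.lsum (map (\<lambda>(x, y). (x, r \<otimes>\<^bsub>K\<^esub> y)) B.pairs) = r" using B.lsum_smult[OF pc rc] ps(2) rc by simp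
    have "set (map (\<lambda>(x, y). (x, r \<otimes>\<^bsub>K\<^esub> y)) B.pairs) \<subseteq> B.L \<times> B.M"
      using ps(1) B.M_smult[OF r] by auto
    from gen_lsum[OF this] show "r \<in> generate (add_monoid K) ?G" unfolding eq .
  qed
  then have "fractional_ideal_prod R (\<rho> ` B.Id) J = \<rho> ` carrier R"
    unfolding fractional_ideal_prod_def using gen_sub by blast
  then have "invertible_ideal R B.Id"
    unfolding invertible_ideal_def using B.Id_ideal frac by blast
  then show ?thesis using B.symmetric_algebra_iso by blast
qed

end

theorem theorem3p9:
  fixes R :: "('r, 'k) ring_scheme" and A :: "('r, 'a, 'p) module_scheme" and \<Phi> :: "'a \<Rightarrow> 'r"
  assumes "krull_domain R"
    and "algebra R A"
    and "flat_module R A"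
    and "retraction R A \<Phi>"
    and "finitely_generated_ideal A (a_kernel A R \<Phi>)"
    and "algebra_isomorphic (quotient_field R) (base_change R A (quotient_field R))
           (UP (quotient_field R))"
    and "\<And>P. P \<in> height_one_primes R \<Longrightarrow> domain (tensor R A (residue_field R P))"
  shows "\<exists>I. invertible_ideal R I \<and>
           algebra_isomorphic R A (symmetric_algebra R (ideal_module R I))"
  using assms by (intro krull_retract.retract_is_symmetric_algebra krull_retract.intro)

end
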